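(* Let $N\in\{2,3\}$, $\alpha\ge 3/2$, $\gamma>1$, and let $(\rho_0,m_0)$, $m_0=\rho_0u_0$, be initial data on $\mathbb{R}^N$ satisfying $$0\le \rho_0\in L^1(\mathbb{R}^N)\cap L^\gamma(\mathbb{R}^N),\quad \nabla\rho_0^{\alpha-1/2}\in L^2(\mathbb{R}^N),\quad m_0\in L^{2\gamma/(\gamma+1)}(\mathbb{R}^N),$$ $$\rho_0\not\equiv 0,\quad m_0=0 \text{ a.e. on } \{x\in\mathbb{R}^N:\rho_0(x)=0\},\quad \rho_0^{-(1+\eta_0)}|m_0|^{2+\eta_0}\in L^1(\mathbb{R}^N)\ \text{ for some } \eta_0>0.$$ Assume in addition: if $N=2$, that $\gamma>1$ and $\gamma\ge 2\alpha-1$; if $N=3$, that $\gamma\in(1,3)$, $\alpha\in(1,2)$, $\gamma\in[2\alpha-1,3\alpha-1]$ and $\rho_0^{-3}|m_0|^4\in L^1(\mathbb{R}^3)$. Assume moreover that $$u_0+\alpha\rho_0^{\alpha-2}\nabla\rho_0=0.$$ Let $T>0$; for $\varepsilon\in(0,1)$ let $(\rho_\varepsilon,u_\varepsilon)$ be the global weak solution (as described in the context) of the compressible Navier–Stokes system with pressure $\varepsilon\rho_\varepsilon^\gamma$ and initial data $(\rho_0,m_0)$, and let $(\rho,u)$ be the quasi-solution of the pressureless system obtained as the limit of $(\rho_\varepsilon,u_\varepsilon)$ as $\varepsilon\to0$ (as described in the context). Then there is a positive constant $C$, independent of $\varepsilon$ but possibly depending on $T$, such that $$\sup_{0\le t\le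 T}\|(\rho_\varepsilon-\rho)(\cdot,t)\|_{L^2(\mathbb{R}^N)}\le C\varepsilon^{\sigma},$$ where $\sigma$ is any number with $\sigma<\frac{1}{2(2\alpha-1)}$ if $N=2$ (with $C$ allowed to depend on $\sigma$), and $\sigma=\frac{4\alpha-3}{4(2\alpha-1)^2}$ if $N=3$.
   Context: Viscosities: $h(\rho)=\rho^\alpha$ and $g(\rho)=(\alpha-1)\rho^\alpha$; $\varepsilon\in(0,1)$; $\mathbb{I}$ is the identity matrix. The compressible system on $\mathbb{R}^N\times(0,T)$ is $$\partial_t\rho_\varepsilon+\mathrm{div}(\rho_\varepsilon u_\varepsilon)=0,\qquad \partial_t(\rho_\varepsilon u_\varepsilon)+\mathrm{div}(\rho_\varepsilon u_\varepsilon\otimes u_\varepsilon)+\nabla(\varepsilon\rho_\varepsilon^\gamma)-\mathrm{div}\big(h(\rho_\varepsilon)\nabla u_\varepsilon+g(\rho_\varepsilon)\,\mathrm{div}u_\varepsilon\,\mathbb{I}\big)=0,$$ with $\rho_\varepsilon(\cdot,0)=\rho_0\ge0$, $\rho_\varepsilon u_\varepsilon(\cdot,0)=m_0$. For a pair $(\rho,u)$ and $\phi\in C_0^\infty(\mathbb{R}^N\times[0,T))^N$ define $$\langle h(\rho)\nabla u,\nabla\phi\rangle=-\int_0^T\!\!\int_{\mathbb{R}^N}\Big(\rho^{\alpha-1/2}\sqrt\rho\,u\cdot\Delta\phi+\tfrac{2\alpha}{2\alpha-1}\sqrt\rho\,u_j\,\partial_i\rho^{\alpha-1/2}\,\partial_i\phi_j\Big),$$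 $$\langle g(\rho)\mathrm{div}u,\mathrm{div}\phi\rangle=-(\alpha-1)\int_0^T\!\!\int_{\mathbb{R}^N}\Big(\rho^{\alpha-1/2}\sqrt\rho\,u\cdot\nabla\mathrm{div}\phi+\tfrac{2\alpha}{2\alpha-1}\sqrt\rho\,u\cdot\nabla\rho^{\alpha-1/2}\,\mathrm{div}\phi\Big).$$ The quantities $h(\rho)\nabla u$ and $g(\rho)\mathrm{div}u$ are understood as distributions in this sense. Weak solution (fixed $\varepsilon>0$): $(\rho_\varepsilon,u_\varepsilon)$ with $0\le\rho_\varepsilon\in L^\infty(0,T;L^1\cap L^\gamma)$; $\nabla\rho_\varepsilon^{\alpha-1/2},\sqrt{\rho_\varepsilon}u_\varepsilon\in L^\infty(0,T;L^2)$; $\nabla\rho_\varepsilon^{(\gamma+\alpha-1)/2}\in L^2(0,T;L^2)$; $h(\rho_\varepsilon)\nabla u_\varepsilon$ and $g(\rho_\varepsilon)\mathrm{div}u_\varepsilon$ in $L^2(0,T;W^{-1,1}_{loc})$; the continuity equation holds in the distribution sense; and for every $\phi\in C_0^\infty(\mathbb{R}^N\times[0,T))^N$ $$\int_{\mathbb{R}^N}m_0\cdot\phi(x,0)+\int_0^T\!\!\int_{\mathbb{R}^N}\sqrt{\rho_\varepsilon}(\sqrt{\rho_\varepsilon}u_\varepsilon)\cdot\partial_t\phi+\sqrt{\rho_\varepsilon}u_\varepsilon\otimes\sqrt{\rho_\varepsilon}u_\varepsilon:\nabla\phi+\varepsilon\rho_\varepsilon^\gamma\mathrm{div}\phi=\langle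 h(\rho_\varepsilon)\nabla u_\varepsilon,\nabla\phi\rangle+\langle g(\rho_\varepsilon)\mathrm{div}u_\varepsilon,\mathrm{div}\phi\rangle.$$ The solutions considered: under the stated hypotheses on the data, a theorem of Li and Xin (arXiv:1504.06826v2) gives global weak solutions in this sense, and $(\rho_\varepsilon,u_\varepsilon)$ denotes these solutions. They satisfy, for all $T>0$: $\|\rho_\varepsilon(\cdot,t)\|_{L^1}=\|\rho_0\|_{L^1}$; $$\sup_{0\le t\le T}\int(\rho_\varepsilon|u_\varepsilon|^2+\varepsilon\rho_\varepsilon^\gamma)+\int_0^T\!\!\int\rho_\varepsilon^\alpha|\nabla u_\varepsilon|^2+(\alpha-1)\rho_\varepsilon^\alpha(\mathrm{div}u_\varepsilon)^2\le\int\frac{|m_0|^2}{\rho_0}+\varepsilon\int\rho_0^\gamma;$$ $$\sup_{0\le t\le T}\int\big(\rho_\varepsilon|u_\varepsilon+\alpha\rho_\varepsilon^{\alpha-2}\nabla\rho_\varepsilon|^2+\varepsilon\rho_\varepsilon^\gamma\big)+\alpha\gamma\varepsilon\int_0^T\!\!\int\rho_\varepsilon^{\alpha+\gamma-3}|\nabla\rho_\varepsilon|^2\le\int\rho_0|u_0+\alpha\rho_0^{\alpha-2}\nabla\rho_0|^2+\varepsilon\int\rho_0^\gamma;$$ and, for $N=3$, $\rho_\varepsilon|u_\varepsilon|^4\in L^\infty(0,T;L^1(\mathbb{R}^3))$ with a bound independent of (small) $\varepsilon$. Pressureless system: $\partial_t\rho+\mathrm{div}(\rho u)=0$, $\ \partial_t(\rho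 u)+\mathrm{div}(\rho u\otimes u)-\mathrm{div}(h(\rho)\nabla u+g(\rho)\mathrm{div}u\,\mathbb{I})=0$. Quasi-solution: $(\rho,u)$ with $0\le\rho\in L^\infty(0,T;L^1)$; $\nabla\rho^{\alpha-1/2},\sqrt\rho u\in L^\infty(0,T;L^2)$; $h(\rho)\nabla u$ and $g(\rho)\mathrm{div}u$ in $L^2(0,T;W^{-1,1}_{loc})$; the continuity equation holds in the distribution sense; and for every $\phi\in C_0^\infty(\mathbb{R}^N\times[0,T))^N$ $$\int_{\mathbb{R}^N}m_0\cdot\phi(x,0)+\int_0^T\!\!\int_{\mathbb{R}^N}\sqrt\rho(\sqrt\rho u)\cdot\partial_t\phi+\sqrt\rho u\otimes\sqrt\rho u:\nabla\phi=\langle h(\rho)\nabla u,\nabla\phi\rangle+\langle g(\rho)\mathrm{div}u,\mathrm{div}\phi\rangle.$$ The limit $(\rho,u)$: as $\varepsilon\to0$ (along a subsequence), $(\rho_\varepsilon,u_\varepsilon)$ converges to a quasi-solution $(\rho,u)$, with $\rho_\varepsilon\to\rho$ in $C([0,T];L^{q_1}_{loc}(\mathbb{R}^N))$ and $\rho_\varepsilon u_\varepsilon\to\rho u$ in $L^2(0,T;L^{q_2}_{loc}(\mathbb{R}^N))$, for $q_1\in[1,\infty)$, $q_2\in[1,2)$ if $N=2$ and $q_1\in[1,6\alpha-3)$, $q_2\in[1,\frac{12\alpha-6}{6\alpha-1})$ if $N=3$. This $(\rho,u)$ is the one in the claim. *)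

theory Defs
  imports "HOL-Analysis.Analysis"
begin

text \<open>
  Functions of time and space are curried, \<open>f t x\<close>; test functions live on the product
  \<open>real \<times> (real ^ 'n)\<close>. Elements of Lebesgue spaces are represented by Borel functions, and
  spaces such as \<open>L\<^sup>2(0,T;L\<^sup>q)\<close> only see \<open>f t x\<close> for \<open>0 < t < T\<close>. Since \<open>0 powr a = 0\<close> and
  \<open>a / 0 = 0\<close>, quantities such as \<open>\<bar>m\<^sub>0\<bar>\<^sup>2 / \<rho>\<^sub>0\<close> or \<open>\<rho> powr (\<alpha> - 2)\<close> vanish on the vacuum set.
\<close>

section \<open>Test functions\<close>

primrec Ck :: "nat \<Rightarrow> ('a::euclidean_space \<Rightarrow> 'b::real_normed_vector) \<Rightarrow> bool" where
  "Ck 0 f \<longleftrightarrow> continuous_on UNIV f"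
| "Ck (Suc k) f \<longleftrightarrow> (\<forall>x. f differentiable (at x)) \<and>
     (\<forall>b\<in>Basis. Ck k (\<lambda>x. frechet_derivative f (at x) b))"

text \<open>
  The space \<open>C\<^sub>0\<^sup>\<infinity>(\<real>\<^sup>N \<times> [0,T))\<close> is rendered as \<open>test_fun ({..<T} \<times> UNIV)\<close>: its elements are the
  restrictions to nonnegative times of smooth functions compactly supported in
  \<open>(-\<infinity>,T) \<times> \<real>\<^sup>N\<close>.
\<close>

definition test_fun :: "'a set \<Rightarrow> ('a::euclidean_space \<Rightarrow> 'b::real_normed_vector) \<Rightarrow> bool" where
  "test_fun U \<phi> \<longleftrightarrow> (\<forall>k. Ck k \<phi>) \<and> compact (closure {x. \<phi> x \<noteq> 0}) \<and> closure {x. \<phi> x \<noteq> 0} \<subseteq> U"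

definition dt :: "(real \<times> (real ^ 'n) \<Rightarrow> 'b::real_normed_vector) \<Rightarrow> real \<times> (real ^ 'n) \<Rightarrow> 'b" where
  "dt \<phi> p = frechet_derivative \<phi> (at p) (1, 0)"

definition dx :: "'n \<Rightarrow> (real \<times> (real ^ 'n) \<Rightarrow> 'b::real_normed_vector) \<Rightarrow> real \<times> (real ^ 'n) \<Rightarrow> 'b" where
  "dx i \<phi> p = frechet_derivative \<phi> (at p) (0, axis i 1)"

definition grad_scalar :: "(real \<times> (real ^ 'n) \<Rightarrow> real) \<Rightarrow> real \<times> (real ^ 'n) \<Rightarrow> real ^ 'n" where
  "grad_scalar \<phi> p = (\<chi> i. dx i \<phi> p)"

definition grad_vec :: "(real \<times> (real ^ 'n) \<Rightarrow> real ^ 'n) \<Rightarrow> real \<times> (real ^ 'n) \<Rightarrow> real ^ 'n ^ 'n" where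
  "grad_vec \<phi> p = (\<chi> i j. dx i \<phi> p $ j)"

definition div_vec :: "(real \<times> (real ^ 'n) \<Rightarrow> real ^ 'n) \<Rightarrow> real \<times> (real ^ 'n) \<Rightarrow> real" where
  "div_vec \<phi> p = (\<Sum>i\<in>UNIV. dx i \<phi> p $ i)"

definition div_mat :: "(real \<times> (real ^ 'n) \<Rightarrow> real ^ 'n ^ 'n) \<Rightarrow> real \<times> (real ^ 'n) \<Rightarrow> real ^ 'n" where
  "div_mat \<Psi> p = (\<chi> j. \<Sum>i\<in>UNIV. dx i \<Psi> p $ i $ j)"

section \<open>Function spaces\<close>

definition Lq_norm :: "real \<Rightarrow> 'a set \<Rightarrow> ('a::euclidean_space \<Rightarrow> 'b::real_normed_vector) \<Rightarrow> ennreal" where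
  "Lq_norm q A f =
     (let I = (\<integral>\<^sup>+x\<in>A. ennreal (norm (f x) powr q) \<partial>lborel)
      in if I = \<infinity> then \<infinity> else ennreal (enn2real I powr (1 / q)))"

definition in_Lq :: "real \<Rightarrow> 'a set \<Rightarrow> ('a::euclidean_space \<Rightarrow> 'b::real_normed_vector) \<Rightarrow> bool" where
  "in_Lq q A f \<longleftrightarrow> set_borel_measurable lborel A f \<and> Lq_norm q A f < \<infinity>"

definition Linf_Lq :: "real \<Rightarrow> real \<Rightarrow> 'a set \<Rightarrow> (real \<Rightarrow> 'a::euclidean_space \<Rightarrow> 'b::real_normed_vector) \<Rightarrow> bool" where
  "Linf_Lq T q A f \<longleftrightarrow> set_borel_measurable lborel ({0<..<T} \<times> A) (\<lambda>p. f (fst p) (snd p)) \<and>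
     (\<exists>C::real. AE t in lborel. t \<in> {0<..<T} \<longrightarrow> Lq_norm q A (f t) \<le> ennreal C)"

definition L2_Lq :: "real \<Rightarrow> real \<Rightarrow> 'a set \<Rightarrow> (real \<Rightarrow> 'a::euclidean_space \<Rightarrow> 'b::real_normed_vector) \<Rightarrow> bool" where
  "L2_Lq T q A f \<longleftrightarrow> set_borel_measurable lborel ({0<..<T} \<times> A) (\<lambda>p. f (fst p) (snd p)) \<and>
     (\<integral>\<^sup>+t\<in>{0<..<T}. (Lq_norm q A (f t))\<^sup>2 \<partial>lborel) < \<infinity>"

text \<open>The space \<open>C([0,T];L\<^sup>q\<^sub>l\<^sub>o\<^sub>c)\<close>; here \<open>f t\<close> matters for every \<open>t\<close>.\<close>

definition C_Lq_loc :: "real \<Rightarrow> real \<Rightarrow> (real \<Rightarrow> 'a::euclidean_space \<Rightarrow> 'b::real_normed_vector) \<Rightarrow> bool" where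
  "C_Lq_loc T q f \<longleftrightarrow> (\<forall>A. compact A \<longrightarrow>
     (\<forall>t\<in>{0..T}. in_Lq q A (f t) \<and>
        ((\<lambda>s. Lq_norm q A (\<lambda>x. f s x - f t x)) \<longlongrightarrow> 0) (at t within {0..T})))"

definition conv_C_Lq_loc ::
    "real \<Rightarrow> real \<Rightarrow> (nat \<Rightarrow> real \<Rightarrow> 'a::euclidean_space \<Rightarrow> 'b::real_normed_vector) \<Rightarrow> (real \<Rightarrow> 'a \<Rightarrow> 'b) \<Rightarrow> bool" where
  "conv_C_Lq_loc T q F f \<longleftrightarrow> (\<forall>k. C_Lq_loc T q (F k)) \<and> C_Lq_loc T q f \<and>
     (\<forall>A. compact A \<longrightarrow>
        (\<lambda>k. SUP t\<in>{0..T}. Lq_norm q A (\<lambda>x. F k t x - f t x)) \<longlonglongrightarrow> 0)"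

definition conv_L2_Lq_loc ::
    "real \<Rightarrow> real \<Rightarrow> (nat \<Rightarrow> real \<Rightarrow> 'a::euclidean_space \<Rightarrow> 'b::real_normed_vector) \<Rightarrow> (real \<Rightarrow> 'a \<Rightarrow> 'b) \<Rightarrow> bool" where
  "conv_L2_Lq_loc T q F f \<longleftrightarrow> (\<forall>A. compact A \<longrightarrow>
     (\<forall>k. L2_Lq T q A (F k)) \<and> L2_Lq T q A f \<and>
     (\<lambda>k. \<integral>\<^sup>+t\<in>{0<..<T}. (Lq_norm q A (\<lambda>x. F k t x - f t x))\<^sup>2 \<partial>lborel) \<longlonglongrightarrow> 0)"

text \<open>
  The space \<open>L\<^sup>2(0,T;W\<^sup>-\<^sup>1\<^sup>,\<^sup>1\<^sub>l\<^sub>o\<^sub>c)\<close>: a distribution \<open>D\<close> (acting on \<open>'b\<close>-valued test functions)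
  belongs to it if on every ball it is of the form \<open>F\<^sub>0 + \<Sum>\<^sub>k \<partial>\<^sub>k F\<^sub>k\<close> with \<open>L\<^sup>2(0,T;L\<^sup>1)\<close> coefficients.
\<close>

definition L2_Wm11_loc :: "real \<Rightarrow> ((real \<times> (real ^ 'n) \<Rightarrow> 'b::euclidean_space) \<Rightarrow> real) \<Rightarrow> bool" where
  "L2_Wm11_loc T D \<longleftrightarrow> (\<forall>R>0. \<exists>F0 F.
     L2_Lq T 1 (ball 0 R) F0 \<and> (\<forall>k. L2_Lq T 1 (ball 0 R) (F k)) \<and>
     (\<forall>\<Psi>. test_fun ({0<..<T} \<times> ball 0 R) \<Psi> \<longrightarrow>
        D \<Psi> = (LINT t:{0<..<T}|lborel. LINT x:ball 0 R|lborel.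
                 F0 t x \<bullet> \<Psi> (t, x) - (\<Sum>k\<in>UNIV. F k t x \<bullet> dx k \<Psi> (t, x)))))"

section \<open>Weak gradients\<close>

definition loc_integrable :: "'a set \<Rightarrow> ('a::euclidean_space \<Rightarrow> 'b::euclidean_space) \<Rightarrow> bool" where
  "loc_integrable U f \<longleftrightarrow> (\<forall>A. compact A \<and> A \<subseteq> U \<longrightarrow> set_integrable lborel A f)"

definition is_wgrad :: "(real ^ 'n \<Rightarrow> real) \<Rightarrow> (real ^ 'n \<Rightarrow> real ^ 'n) \<Rightarrow> bool" where
  "is_wgrad f G \<longleftrightarrow> loc_integrable UNIV f \<and> loc_integrable UNIV G \<and>
     (\<forall>\<phi>::real ^ 'n \<Rightarrow> real. test_fun UNIV \<phi> \<longrightarrow> (\<forall>i.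
        (LINT x|lborel. f x * frechet_derivative \<phi> (at x) (axis i 1))
        = - (LINT x|lborel. G x $ i * \<phi> x)))"

definition wgrad :: "(real ^ 'n \<Rightarrow> real) \<Rightarrow> real ^ 'n \<Rightarrow> real ^ 'n" where
  "wgrad f = (SOME G. is_wgrad f G)"

text \<open>Spatial gradient in the sense of distributions on \<open>(0,T) \<times> \<real>\<^sup>N\<close>.\<close>

definition is_xgrad :: "real \<Rightarrow> (real \<Rightarrow> real ^ 'n \<Rightarrow> real) \<Rightarrow> (real \<Rightarrow> real ^ 'n \<Rightarrow> real ^ 'n) \<Rightarrow> bool" where
  "is_xgrad T f G \<longleftrightarrow>
     loc_integrable ({0<..<T} \<times> UNIV) (\<lambda>p. f (fst p) (snd p)) \<and>
     loc_integrable ({0<..<T} \<times> UNIV) (\<lambda>p. G (fst p) (snd p)) \<and>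
     (\<forall>\<phi>::real \<times> (real ^ 'n) \<Rightarrow> real. test_fun ({0<..<T} \<times> UNIV) \<phi> \<longrightarrow> (\<forall>i.
        (LINT t:{0<..<T}|lborel. LINT x|lborel. f t x * dx i \<phi> (t, x))
        = - (LINT t:{0<..<T}|lborel. LINT x|lborel. G t x $ i * \<phi> (t, x))))"

definition xgrad :: "real \<Rightarrow> (real \<Rightarrow> real ^ 'n \<Rightarrow> real) \<Rightarrow> real \<Rightarrow> real ^ 'n \<Rightarrow> real ^ 'n" where
  "xgrad T f = (SOME G. is_xgrad T f G)"

text \<open>
  A density is only known to be such that a power \<open>\<rho>\<^sup>r\<close> has a weak gradient. The expression
  \<open>\<nabla>\<rho>\<close>, which only ever enters on \<open>{\<rho> > 0}\<close>, is then given there by the chain rule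
  \<open>\<nabla>\<rho> = (1/r) \<rho>\<^sup>1\<^sup>-\<^sup>r \<nabla>\<rho>\<^sup>r\<close>. It is used with \<open>r = \<alpha> - 1/2\<close>.
\<close>

definition dens_grad :: "real \<Rightarrow> (real ^ 'n \<Rightarrow> real) \<Rightarrow> real ^ 'n \<Rightarrow> real ^ 'n" where
  "dens_grad r \<rho> x = (1 / r * \<rho> x powr (1 - r)) *\<^sub>R wgrad (\<lambda>y. \<rho> y powr r) x"

definition dens_xgrad :: "real \<Rightarrow> real \<Rightarrow> (real \<Rightarrow> real ^ 'n \<Rightarrow> real) \<Rightarrow> real \<Rightarrow> real ^ 'n \<Rightarrow> real ^ 'n" where
  "dens_xgrad T r \<rho> t x = (1 / r * \<rho> t x powr (1 - r)) *\<^sub>R xgrad T (\<lambda>s y. \<rho> s y powr r) t x"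

section \<open>The viscous terms\<close>

text \<open>
  The distribution \<open>h(\<rho>)\<nabla>u\<close>, acting on matrix-valued functions \<open>\<Psi>\<close>, where \<open>\<Psi>\<^sub>i\<^sub>j\<close> is paired with
  \<open>h(\<rho>)\<partial>\<^sub>i u\<^sub>j\<close>. For \<open>\<Psi> = \<nabla>\<phi>\<close> one has \<open>div_mat \<Psi> = \<Delta>\<phi>\<close>.
\<close>

definition h_grad_u ::
    "real \<Rightarrow> real \<Rightarrow> (real \<Rightarrow> real ^ 'n \<Rightarrow> real) \<Rightarrow> (real \<Rightarrow> real ^ 'n \<Rightarrow> real ^ 'n) \<Rightarrow>
     (real \<times> (real ^ 'n) \<Rightarrow> real ^ 'n ^ 'n) \<Rightarrow> real" where
  "h_grad_u T \<alpha> \<rho> u \<Psi> = - (LINT t:{0<..<T}|lborel. LINT x|lborel.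
     \<rho> t x powr (\<alpha> - 1/2) * ((sqrt (\<rho> t x) *\<^sub>R u t x) \<bullet> div_mat \<Psi> (t, x)) +
     2 * \<alpha> / (2 * \<alpha> - 1) * (\<Sum>i\<in>UNIV. \<Sum>j\<in>UNIV.
        sqrt (\<rho> t x) * u t x $ j * xgrad T (\<lambda>s y. \<rho> s y powr (\<alpha> - 1/2)) t x $ i * \<Psi> (t, x) $ i $ j))"

definition g_div_u ::
    "real \<Rightarrow> real \<Rightarrow> (real \<Rightarrow> real ^ 'n \<Rightarrow> real) \<Rightarrow> (real \<Rightarrow> real ^ 'n \<Rightarrow> real ^ 'n) \<Rightarrow>
     (real \<times> (real ^ 'n) \<Rightarrow> real) \<Rightarrow> real" where
  "g_div_u T \<alpha> \<rho> u \<psi> = - (\<alpha> - 1) * (LINT t:{0<..<T}|lborel. LINT x|lborel.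
     \<rho> t x powr (\<alpha> - 1/2) * ((sqrt (\<rho> t x) *\<^sub>R u t x) \<bullet> grad_scalar \<psi> (t, x)) +
     2 * \<alpha> / (2 * \<alpha> - 1) * ((sqrt (\<rho> t x) *\<^sub>R u t x) \<bullet>
        xgrad T (\<lambda>s y. \<rho> s y powr (\<alpha> - 1/2)) t x) * \<psi> (t, x))"

text \<open>
  Because of vacuum \<open>u\<close> need not have a weak gradient. A field \<open>V\<close> plays the role of \<open>\<nabla>u\<close> if the
  distribution \<open>h(\<rho>)\<nabla>u\<close> is the function \<open>\<rho>\<^sup>\<alpha> V\<close>; it is determined a.e. on \<open>{\<rho> > 0}\<close>.
\<close>

definition is_velocity_grad ::
    "real \<Rightarrow> real \<Rightarrow> (real \<Rightarrow> real ^ 'n \<Rightarrow> real) \<Rightarrow> (real \<Rightarrow> real ^ 'n \<Rightarrow> real ^ 'n) \<Rightarrow>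
     (real \<Rightarrow> real ^ 'n \<Rightarrow> real ^ 'n ^ 'n) \<Rightarrow> bool" where
  "is_velocity_grad T \<alpha> \<rho> u V \<longleftrightarrow>
     loc_integrable ({0<..<T} \<times> UNIV) (\<lambda>p. \<rho> (fst p) (snd p) powr \<alpha> *\<^sub>R V (fst p) (snd p)) \<and>
     (\<forall>\<Psi>. test_fun ({0<..<T} \<times> UNIV) \<Psi> \<longrightarrow>
        h_grad_u T \<alpha> \<rho> u \<Psi> =
        (LINT t:{0<..<T}|lborel. LINT x|lborel. (\<rho> t x powr \<alpha> *\<^sub>R V t x) \<bullet> \<Psi> (t, x)))"

section \<open>Weak solutions and quasi-solutions\<close>

definition continuity_eq ::
    "real \<Rightarrow> (real \<Rightarrow> real ^ 'n \<Rightarrow> real) \<Rightarrow> (real \<Rightarrow> real ^ 'n \<Rightarrow> real ^ 'n) \<Rightarrow> bool" where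
  "continuity_eq T \<rho> u \<longleftrightarrow> (\<forall>\<phi>. test_fun ({0<..<T} \<times> UNIV) \<phi> \<longrightarrow>
     (LINT t:{0<..<T}|lborel. LINT x|lborel.
        \<rho> t x * dt \<phi> (t, x) + (\<rho> t x *\<^sub>R u t x) \<bullet> grad_scalar \<phi> (t, x)) = 0)"

definition outer :: "real ^ 'n \<Rightarrow> real ^ 'n \<Rightarrow> real ^ 'n ^ 'n" where
  "outer a b = (\<chi> i j. a $ i * b $ j)"

text \<open>Weak form of the momentum equation with pressure \<open>P\<close>.\<close>

definition momentum_eq ::
    "real \<Rightarrow> real \<Rightarrow> (real ^ 'n \<Rightarrow> real ^ 'n) \<Rightarrow> (real \<Rightarrow> real ^ 'n \<Rightarrow> real) \<Rightarrow>
     (real \<Rightarrow> real ^ 'n \<Rightarrow> real) \<Rightarrow> (real \<Rightarrow> real ^ 'n \<Rightarrow> real ^ 'n) \<Rightarrow> bool" where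
  "momentum_eq T \<alpha> m0 P \<rho> u \<longleftrightarrow> (\<forall>\<phi>. test_fun ({..<T} \<times> UNIV) \<phi> \<longrightarrow>
     (LINT x|lborel. m0 x \<bullet> \<phi> (0, x)) +
     (LINT t:{0<..<T}|lborel. LINT x|lborel.
        sqrt (\<rho> t x) * ((sqrt (\<rho> t x) *\<^sub>R u t x) \<bullet> dt \<phi> (t, x)) +
        outer (sqrt (\<rho> t x) *\<^sub>R u t x) (sqrt (\<rho> t x) *\<^sub>R u t x) \<bullet> grad_vec \<phi> (t, x) +
        P t x * div_vec \<phi> (t, x))
     = h_grad_u T \<alpha> \<rho> u (grad_vec \<phi>) + g_div_u T \<alpha> \<rho> u (div_vec \<phi>))"

definition weak_solution ::
    "real \<Rightarrow> real \<Rightarrow> real \<Rightarrow> real \<Rightarrow> (real ^ 'n \<Rightarrow> real ^ 'n) \<Rightarrow>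
     (real \<Rightarrow> real ^ 'n \<Rightarrow> real) \<Rightarrow> (real \<Rightarrow> real ^ 'n \<Rightarrow> real ^ 'n) \<Rightarrow> bool" where
  "weak_solution T \<alpha> \<gamma> \<epsilon> m0 \<rho> u \<longleftrightarrow>
     (AE p in lborel. fst p \<in> {0<..<T} \<longrightarrow> 0 \<le> \<rho> (fst p) (snd p)) \<and>
     Linf_Lq T 1 UNIV \<rho> \<and> Linf_Lq T \<gamma> UNIV \<rho> \<and>
     Ex (is_xgrad T (\<lambda>t x. \<rho> t x powr (\<alpha> - 1/2))) \<and>
     Linf_Lq T 2 UNIV (xgrad T (\<lambda>t x. \<rho> t x powr (\<alpha> - 1/2))) \<and>
     Linf_Lq T 2 UNIV (\<lambda>t x. sqrt (\<rho> t x) *\<^sub>R u t x) \<and>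
     Ex (is_xgrad T (\<lambda>t x. \<rho> t x powr ((\<gamma> + \<alpha> - 1) / 2))) \<and>
     L2_Lq T 2 UNIV (xgrad T (\<lambda>t x. \<rho> t x powr ((\<gamma> + \<alpha> - 1) / 2))) \<and>
     L2_Wm11_loc T (h_grad_u T \<alpha> \<rho> u) \<and> L2_Wm11_loc T (g_div_u T \<alpha> \<rho> u) \<and>
     continuity_eq T \<rho> u \<and>
     momentum_eq T \<alpha> m0 (\<lambda>t x. \<epsilon> * \<rho> t x powr \<gamma>) \<rho> u"

definition quasi_solution ::
    "real \<Rightarrow> real \<Rightarrow> (real ^ 'n \<Rightarrow> real ^ 'n) \<Rightarrow>
     (real \<Rightarrow> real ^ 'n \<Rightarrow> real) \<Rightarrow> (real \<Rightarrow> real ^ 'n \<Rightarrow> real ^ 'n) \<Rightarrow> bool" where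
  "quasi_solution T \<alpha> m0 \<rho> u \<longleftrightarrow>
     (AE p in lborel. fst p \<in> {0<..<T} \<longrightarrow> 0 \<le> \<rho> (fst p) (snd p)) \<and>
     Linf_Lq T 1 UNIV \<rho> \<and>
     Ex (is_xgrad T (\<lambda>t x. \<rho> t x powr (\<alpha> - 1/2))) \<and>
     Linf_Lq T 2 UNIV (xgrad T (\<lambda>t x. \<rho> t x powr (\<alpha> - 1/2))) \<and>
     Linf_Lq T 2 UNIV (\<lambda>t x. sqrt (\<rho> t x) *\<^sub>R u t x) \<and>
     L2_Wm11_loc T (h_grad_u T \<alpha> \<rho> u) \<and> L2_Wm11_loc T (g_div_u T \<alpha> \<rho> u) \<and>
     continuity_eq T \<rho> u \<and>
     momentum_eq T \<alpha> m0 (\<lambda>t x. 0) \<rho> u"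

section \<open>The approximating family and its limit\<close>

text \<open>
  Energy and entropy bounds. Suprema over time are essential suprema, as \<open>u\<close> and \<open>\<nabla>\<rho>\<close> are only
  defined for a.e. time; integrals are extended-valued, so the bounds include integrability.

  The factor \<open>K\<close> (later required not to depend on \<open>\<epsilon>\<close> and \<open>T\<close>) stands for the normalising factors
  \<open>1/2\<close> and \<open>1/(\<gamma>-1)\<close> of the exact energies, and for the usual abuse of notation in adding the
  supremum to the dissipation on all of \<open>(0,T)\<close>. It cannot simply be put to 1: by lower
  semicontinuity at time 0 the supremum in \<open>entropy_bound\<close> is then at least the right-hand side
  (when \<open>u\<^sub>0 + \<alpha>\<rho>\<^sub>0\<^sup>\<alpha>\<^sup>-\<^sup>2\<nabla>\<rho>\<^sub>0 = 0\<close>), so that the dissipation, and hence \<open>\<rho>\<close>, would vanish.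
\<close>

definition energy_bound ::
    "real \<Rightarrow> real \<Rightarrow> real \<Rightarrow> real \<Rightarrow> real \<Rightarrow> (real ^ 'n \<Rightarrow> real) \<Rightarrow> (real ^ 'n \<Rightarrow> real ^ 'n) \<Rightarrow>
     (real \<Rightarrow> real ^ 'n \<Rightarrow> real) \<Rightarrow> (real \<Rightarrow> real ^ 'n \<Rightarrow> real ^ 'n) \<Rightarrow> bool" where
  "energy_bound K T \<alpha> \<gamma> \<epsilon> \<rho>0 m0 \<rho> u \<longleftrightarrow> (\<exists>V. is_velocity_grad T \<alpha> \<rho> u V \<and>
     (AE t in lborel. t \<in> {0<..<T} \<longrightarrow>
        (\<integral>\<^sup>+x. ennreal (\<rho> t x * (norm (u t x))\<^sup>2 + \<epsilon> * \<rho> t x powr \<gamma>) \<partial>lborel) +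
        (\<integral>\<^sup>+s\<in>{0<..<T}. (\<integral>\<^sup>+x. ennreal (\<rho> s x powr \<alpha> * (norm (V s x))\<^sup>2
             + (\<alpha> - 1) * \<rho> s x powr \<alpha> * (trace (V s x))\<^sup>2) \<partial>lborel) \<partial>lborel)
        \<le> ennreal K * ((\<integral>\<^sup>+x. ennreal ((norm (m0 x))\<^sup>2 / \<rho>0 x) \<partial>lborel) +
             ennreal \<epsilon> * (\<integral>\<^sup>+x. ennreal (\<rho>0 x powr \<gamma>) \<partial>lborel))))"

definition entropy_bound ::
    "real \<Rightarrow> real \<Rightarrow> real \<Rightarrow> real \<Rightarrow> real \<Rightarrow> (real ^ 'n \<Rightarrow> real) \<Rightarrow> (real ^ 'n \<Rightarrow> real ^ 'n) \<Rightarrow>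
     (real \<Rightarrow> real ^ 'n \<Rightarrow> real) \<Rightarrow> (real \<Rightarrow> real ^ 'n \<Rightarrow> real ^ 'n) \<Rightarrow> bool" where
  "entropy_bound K T \<alpha> \<gamma> \<epsilon> \<rho>0 u0 \<rho> u \<longleftrightarrow>
     (AE t in lborel. t \<in> {0<..<T} \<longrightarrow>
        (\<integral>\<^sup>+x. ennreal (\<rho> t x * (norm (u t x
             + (\<alpha> * \<rho> t x powr (\<alpha> - 2)) *\<^sub>R dens_xgrad T (\<alpha> - 1/2) \<rho> t x))\<^sup>2
             + \<epsilon> * \<rho> t x powr \<gamma>) \<partial>lborel) +
        ennreal (\<alpha> * \<gamma> * \<epsilon>) * (\<integral>\<^sup>+s\<in>{0<..<T}. (\<integral>\<^sup>+x. ennreal (\<rho> s x powr (\<alpha> + \<gamma> - 3)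
             * (norm (dens_xgrad T (\<alpha> - 1/2) \<rho> s x))\<^sup>2) \<partial>lborel) \<partial>lborel)
        \<le> ennreal K * ((\<integral>\<^sup>+x. ennreal (\<rho>0 x * (norm (u0 x
             + (\<alpha> * \<rho>0 x powr (\<alpha> - 2)) *\<^sub>R dens_grad (\<alpha> - 1/2) \<rho>0 x))\<^sup>2) \<partial>lborel) +
             ennreal \<epsilon> * (\<integral>\<^sup>+x. ennreal (\<rho>0 x powr \<gamma>) \<partial>lborel)))"

text \<open>
  The density is taken in its representative continuous in time with values in \<open>L\<^sup>1\<^sub>l\<^sub>o\<^sub>c\<close>, which gives
  a meaning to \<open>\<rho>\<^sub>\<epsilon>(\<cdot>,t)\<close> for every \<open>t\<close>, and in particular to the initial condition.
\<close>

definition solution_family ::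
    "real \<Rightarrow> real \<Rightarrow> (real ^ 'n \<Rightarrow> real) \<Rightarrow> (real ^ 'n \<Rightarrow> real ^ 'n) \<Rightarrow> (real ^ 'n \<Rightarrow> real ^ 'n) \<Rightarrow>
     (real \<Rightarrow> real \<Rightarrow> real ^ 'n \<Rightarrow> real) \<Rightarrow> (real \<Rightarrow> real \<Rightarrow> real ^ 'n \<Rightarrow> real ^ 'n) \<Rightarrow> bool" where
  "solution_family \<alpha> \<gamma> \<rho>0 m0 u0 \<rho>e ue \<longleftrightarrow>
     (\<exists>K>0. \<forall>\<epsilon>\<in>{0<..<1}. \<forall>T>0.
        weak_solution T \<alpha> \<gamma> \<epsilon> m0 (\<rho>e \<epsilon>) (ue \<epsilon>) \<and>
        C_Lq_loc T 1 (\<rho>e \<epsilon>) \<and> (AE x in lborel. \<rho>e \<epsilon> 0 x = \<rho>0 x) \<and>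
        (\<forall>t\<in>{0..T}. Lq_norm 1 UNIV (\<rho>e \<epsilon> t) = Lq_norm 1 UNIV \<rho>0) \<and>
        energy_bound K T \<alpha> \<gamma> \<epsilon> \<rho>0 m0 (\<rho>e \<epsilon>) (ue \<epsilon>) \<and>
        entropy_bound K T \<alpha> \<gamma> \<epsilon> \<rho>0 u0 (\<rho>e \<epsilon>) (ue \<epsilon>)) \<and>
     (CARD('n) = 3 \<longrightarrow> (\<forall>T>0.
        (\<forall>\<epsilon>\<in>{0<..<1}. Linf_Lq T 1 UNIV (\<lambda>t x. \<rho>e \<epsilon> t x * norm (ue \<epsilon> t x) ^ 4)) \<and>
        (\<exists>C::real. \<exists>\<epsilon>1>0. \<forall>\<epsilon>\<in>{0<..<1}. \<epsilon> < \<epsilon>1 \<longrightarrow>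
           (AE t in lborel. t \<in> {0<..<T} \<longrightarrow>
              Lq_norm 1 UNIV (\<lambda>x. \<rho>e \<epsilon> t x * norm (ue \<epsilon> t x) ^ 4) \<le> ennreal C))))"

definition quasi_solution_limit ::
    "real \<Rightarrow> real \<Rightarrow> (real ^ 'n \<Rightarrow> real ^ 'n) \<Rightarrow>
     (real \<Rightarrow> real \<Rightarrow> real ^ 'n \<Rightarrow> real) \<Rightarrow> (real \<Rightarrow> real \<Rightarrow> real ^ 'n \<Rightarrow> real ^ 'n) \<Rightarrow>
     (real \<Rightarrow> real ^ 'n \<Rightarrow> real) \<Rightarrow> (real \<Rightarrow> real ^ 'n \<Rightarrow> real ^ 'n) \<Rightarrow> bool" where
  "quasi_solution_limit T \<alpha> m0 \<rho>e ue \<rho> u \<longleftrightarrow>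
     quasi_solution T \<alpha> m0 \<rho> u \<and>
     (\<exists>e::nat \<Rightarrow> real. (\<forall>k. e k \<in> {0<..<1}) \<and> e \<longlonglongrightarrow> 0 \<and>
        (\<forall>q\<ge>1. (CARD('n) = 3 \<longrightarrow> q < 6 * \<alpha> - 3) \<longrightarrow>
           conv_C_Lq_loc T q (\<lambda>k. \<rho>e (e k)) \<rho>) \<and>
        (\<forall>q\<ge>1. (CARD('n) = 2 \<longrightarrow> q < 2) \<and>
           (CARD('n) = 3 \<longrightarrow> q < (12 * \<alpha> - 6) / (6 * \<alpha> - 1)) \<longrightarrow>
           conv_L2_Lq_loc T q (\<lambda>k t x. \<rho>e (e k) t x *\<^sub>R ue (e k) t x) (\<lambda>t x. \<rho> t x *\<^sub>R u t x)))"

end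

theory Submission
  imports Defs
begin

text \<open>
  Let \<open>r = \<alpha> - 1/2\<close>, \<open>f = \<rho>\<^sup>r\<close> and \<open>J = \<surd>\<rho> (\<surd>\<rho> u + (1 + 1/(2r)) \<nabla>f) = \<rho>u + \<nabla>\<rho>\<^sup>\<alpha>\<close>. The initial data make the entropy
  vanish, so that \<open>\<surd>\<rho> u + (1 + 1/(2r)) \<nabla>f\<close> is \<open>O(\<surd>\<epsilon>)\<close> in \<open>L\<^sup>2\<close>, while \<open>\<nabla>f\<close> and \<open>\<surd>\<rho> u\<close> stay bounded. The
  limit is never used directly: \<open>\<rho>\<^sub>\<epsilon>\<close> is compared with \<open>\<rho>\<^sub>\<delta>\<close> for \<open>\<delta> \<le> \<epsilon>\<close>, and \<open>\<delta>\<close> tends to 0 along the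
  subsequence at the end. The difference \<open>w = \<rho>\<^sub>\<epsilon> - \<rho>\<^sub>\<delta>\<close> solves a porous medium equation
  \<open>\<partial>\<^sub>t w = \<Delta>z - div (J\<^sub>\<epsilon> - J\<^sub>\<delta>)\<close> with \<open>z = \<rho>\<^sub>\<epsilon>\<^sup>\<alpha> - \<rho>\<^sub>\<delta>\<^sup>\<alpha>\<close> and small forcing. Instead of \<open>(-\<Delta>)\<^sup>-\<^sup>1 w\<close> one tests
  with the time integral \<open>U\<close> of \<open>\<rho>\<^sub>\<epsilon> u\<^sub>\<epsilon> - \<rho>\<^sub>\<delta> u\<^sub>\<delta>\<close>, for which \<open>w = - div U\<close>, mollified at a scale \<open>h\<close>. By the
  monotonicity of powers the diffusion only contributes a commutator \<open>O(h\<^sup>1\<^sup>+\<^sup>p)\<close>, and a Sobolev bound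
  on \<open>f\<close> gives \<open>\<parallel>J\<^sub>h\<parallel>\<^sup>2 = O(\<epsilon> h\<^sup>-\<^sup>s\<^sup>/\<^sup>r)\<close>. Hence \<open>\<parallel>U\<^sub>h\<parallel> = O(\<kappa>)\<close> if \<open>\<kappa>\<^sup>2\<close> dominates both quantities. Then
  \<open>\<integral> w (f\<^sub>\<epsilon> - f\<^sub>\<delta>) = O(\<kappa>)\<close>, where the integrand is at least \<open>\<bar>w\<bar>\<^sup>r\<^sup>+\<^sup>1\<close>, and interpolation with the bound on
  the mass gives \<open>\<parallel>w\<parallel>\<^sup>2 = O(\<kappa>\<^sup>1\<^sup>/\<^sup>r)\<close>. The rates come from \<open>h = \<surd>\<epsilon>\<close>, \<open>s = 1/2\<close>, \<open>p = 1 - 1/(2r)\<close> in three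
  dimensions, and from \<open>h = \<epsilon>\<close>, \<open>p = 0\<close> and small \<open>s > 0\<close> in two.
\<close>

text \<open>The continuity equation itself supplies an antiderivative of w: both densities start
  from \<open>\<rho>0\<close>, so w = - div U holds exactly. Inverting the Laplacian would meet the
  low frequencies of an integrable function, which in two dimensions need not have a potential with
  square integrable gradient. The obstacle is that U is only integrable in space, being built from
  \<surd>\<rho> times an L2 field; this forces the mollification, whose price is the commutator. The
  exponent p says how much of an increment of w is traded for an increment of f; it is limited by
  the powers of \<rho> that are integrable uniformly in \<epsilon>, those between 1 and 4r, where 4r
  comes from an L4 bound on f. Uniformity rests on the entropy: it is O(\<epsilon>) and contains
  \<epsilon> \<rho>^\<gamma>, so \<epsilon> cancels. The scale h balances \<epsilon> h^(-s/r)
  against h^(1+p); in three dimensions both are \<epsilon>^(1-1/(4r)). In two dimensions s has to be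
  positive, as the dyadic sum behind the Sobolev bound diverges logarithmically at s = 0, and this
  costs the endpoint rate.\<close>

abbreviation lborel_integral :: "('a::euclidean_space \<Rightarrow> 'b::{banach, second_countable_topology}) \<Rightarrow> 'b" (binder "LI " 10)
 where "lborel_integral f \<equiv> integral\<^sup>L lborel f"

abbreviation lborel_nn_integral :: "('a::euclidean_space \<Rightarrow> ennreal) \<Rightarrow> ennreal" (binder "NI " 10)
 where "lborel_nn_integral f \<equiv> integral\<^sup>N lborel f"

section \<open>Affine changes of variables in Lebesgue integrals\<close>

lemma nn_integral_lborel_affine:
 fixes t :: "'a::euclidean_space"
 assumes [measurable]: "f \<in> borel_measurable borel" and c: "c \<noteq> 0"
 shows "(NI x. f x) = ennreal (\<bar>c\<bar> ^ DIM('a)) * (NI x. f (t + c *\<^sub>R x))"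
 by (subst lborel_affine[OF c, of t]) (simp add: nn_integral_density nn_integral_distr nn_integral_cmult)

lemma integrable_lborel_affine:
 fixes t :: "'a::euclidean_space" and f :: "'a \<Rightarrow> 'b::{banach, second_countable_topology}"
 assumes f: "integrable lborel f" and c: "c \<noteq> 0"
 shows "integrable lborel (\<lambda>x. f (t + c *\<^sub>R x))"
proof -
 have [measurable]: "f \<in> borel_measurable borel" using f by auto
 show ?thesis using f c unfolding integrable_iff_bounded
  by (subst (asm) nn_integral_lborel_affine[where c=c and t=t]) (auto simp: ennreal_mult_less_top)
qed

lemma integrable_lborel_affine_iff:
 fixes t :: "'a::euclidean_space" and f :: "'a \<Rightarrow> 'b::{banach, second_countable_topology}"
 assumes c: "c \<noteq> 0"
 shows "integrable lborel (\<lambda>x. f (t + c *\<^sub>R x)) \<longleftrightarrow> integrable lborel f"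
 using integrable_lborel_affine[of f c t]
  integrable_lborel_affine[of "\<lambda>x. f (t + c *\<^sub>R x)" "1/c" "(- 1/c) *\<^sub>R t"] c
 by (auto simp: algebra_simps)

lemma integral_lborel_affine:
 fixes t :: "'a::euclidean_space" and f :: "'a \<Rightarrow> 'b::{banach, second_countable_topology}"
 assumes c: "c \<noteq> 0"
 shows "(LI x. f x) = (\<bar>c\<bar> ^ DIM('a)) *\<^sub>R (LI x. f (t + c *\<^sub>R x))"
proof cases
 assume f: "integrable lborel f"
 then have [measurable]: "f \<in> borel_measurable borel" by auto
 show ?thesis using c f f[THEN integrable_lborel_affine, of c t]
  by (subst lborel_affine[OF c, of t]) (simp add: integral_density integral_distr)
next
 assume "\<not> integrable lborel f" with c show ?thesis
  by (simp add: integrable_lborel_affine_iff not_integrable_integral_eq)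
qed

lemma nn_integral_shift:
 fixes a :: "'a::euclidean_space"
 assumes "f \<in> borel_measurable borel"
 shows "(NI x. f (x + a)) = (NI x. f x)"
 using nn_integral_lborel_affine[OF assms, of 1 a] by (simp add: add.commute)

lemma nn_integral_reflect:
 fixes a :: "'a::euclidean_space"
 assumes "f \<in> borel_measurable borel"
 shows "(NI x. f (a - x)) = (NI x. f x)"
 using nn_integral_lborel_affine[OF assms, of "-1" a] by simp

lemma integral_shift:
 fixes a :: "'a::euclidean_space" and f :: "'a \<Rightarrow> 'b::{banach, second_countable_topology}"
 shows "(LI x. f (x + a)) = (LI x. f x)"
 using integral_lborel_affine[of 1 f a] by (simp add: add.commute)

lemma integral_reflect:
 fixes a :: "'a::euclidean_space" and f :: "'a \<Rightarrow> 'b::{banach, second_countable_topology}"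
 shows "(LI x. f (a - x)) = (LI x. f x)"
 using integral_lborel_affine[of "-1" f a] by simp

lemma integrable_shift:
 fixes a :: "'a::euclidean_space" and f :: "'a \<Rightarrow> 'b::{banach, second_countable_topology}"
 shows "integrable lborel (\<lambda>x. f (x + a)) \<longleftrightarrow> integrable lborel f"
 using integrable_lborel_affine_iff[of 1 f a] by (simp add: add.commute)

lemma integrable_reflect:
 fixes a :: "'a::euclidean_space" and f :: "'a \<Rightarrow> 'b::{banach, second_countable_topology}"
 shows "integrable lborel (\<lambda>x. f (a - x)) \<longleftrightarrow> integrable lborel f"
 using integrable_lborel_affine_iff[of "-1" f a] by simp

section \<open>Smooth bumps\<close>

lemma Ck_add: "Ck k f \<Longrightarrow> Ck k g \<Longrightarrow> Ck k (\<lambda>x. f x + g x :: 'b::real_normed_vector)"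
proof (induction k arbitrary: f g)
 case 0 then show ?case by (auto intro: continuous_on_add)
next
 case (Suc k)
 then have "frechet_derivative (\<lambda>x. f x + g x) (at x)
   = (\<lambda>b. frechet_derivative f (at x) b + frechet_derivative g (at x) b)" for x
  by (intro frechet_derivative_at[symmetric] derivative_intros) (auto simp: frechet_derivative_works[symmetric])
 with Suc show ?case by (auto intro: differentiable_add)
qed

lemma Ck_Suc_D: "Ck (Suc k) f \<Longrightarrow> Ck k f"
proof (induction k arbitrary: f)
 case 0 then show ?case
  by (auto intro!: continuous_at_imp_continuous_on differentiable_imp_continuous_within)
next
 case (Suc k) then show ?case by (metis Ck.simps(2))
qed

lemma Ck_mult:
 fixes f g :: "'a::euclidean_space \<Rightarrow> real"
 shows "Ck k f \<Longrightarrow> Ck k g \<Longrightarrow> Ck k (\<lambda>x. f x * g x)"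
proof (induction k arbitrary: f g)
 case 0 then show ?case by (auto intro: continuous_on_mult)
next
 case (Suc k)
 then have "frechet_derivative (\<lambda>x. f x * g x) (at x)
   = (\<lambda>b. f x * frechet_derivative g (at x) b + frechet_derivative f (at x) b * g x)" for x
  by (intro frechet_derivative_at[symmetric] derivative_intros) (auto simp: frechet_derivative_works[symmetric])
 moreover have "Ck k f" "Ck k g" using Suc.prems by (auto dest: Ck_Suc_D simp del: Ck.simps)
 ultimately show ?case using Suc by (auto intro!: differentiable_mult Ck_add Suc.IH)
qed

lemma Ck_const: "Ck k (\<lambda>_. c)"
 by (induction k arbitrary: c) auto

lemma Ck_prod:
 fixes f :: "'i \<Rightarrow> 'a::euclidean_space \<Rightarrow> real"
 shows "finite I \<Longrightarrow> (\<And>i. i \<in> I \<Longrightarrow> Ck k (f i)) \<Longrightarrow> Ck k (\<lambda>x. \<Prod>i\<in>I. f i x)"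
 by (induction I rule: finite_induct) (auto intro: Ck_const Ck_mult)

text \<open>For \<open>p = 1\<close> this is the classical function exp(-1/x) glued to 0. The
  polynomial in 1/x is carried along because the resulting family is closed under
  differentiation.\<close>

definition flat :: "real poly \<Rightarrow> real \<Rightarrow> real" where
 "flat p x = (if x \<le> 0 then 0 else poly p (1 / x) * exp (- 1 / x))"

lemma poly_exp_tendsto_0: "((\<lambda>y::real. poly p y * exp (- y)) \<longlongrightarrow> 0) at_top"
proof -
 have "((\<lambda>y::real. \<Sum>i\<le>degree p. coeff p i * (y ^ i / exp y)) \<longlongrightarrow> (\<Sum>i\<le>degree p. coeff p i * 0)) at_top"
  by (intro tendsto_intros tendsto_power_div_exp_0)
 moreover have "(\<Sum>i\<le>degree p. coeff p i * (y ^ i / exp y)) = poly p y * exp (- y)" for y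
  by (simp add: poly_altdef exp_minus sum_divide_distrib inverse_eq_divide)
 ultimately show ?thesis by simp
qed

text \<open>With y = 1/x the derivative of p(y) exp(-y) in x is y^2 (p(y) - p'(y)) exp(-y).\<close>

definition flat_step :: "real poly \<Rightarrow> real poly" where
 "flat_step p = [:0,0,1:] * (p - pderiv p)"

lemma poly_flat_step: "poly (flat_step p) y = y\<^sup>2 * (poly p y - poly (pderiv p) y)"
 by (simp add: flat_step_def power2_eq_square)

lemma flat_deriv: "(flat p has_real_derivative flat (flat_step p) x) (at x)"
proof (rule linorder_cases[of x 0])
 assume "x < 0"
 then have "((\<lambda>_. 0) has_real_derivative flat (flat_step p) x) (at x)"
  by (simp add: flat_def)
 then show ?thesis
  by (rule has_field_derivative_transform_within_open[where S = "{..<0}"]) (use \<open>x < 0\<close> in \<open>auto simp: flat_def\<close>)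
next
 assume "x > 0"
 have "((\<lambda>x. poly p (1 / x) * exp (- 1 / x)) has_real_derivative flat (flat_step p) x) (at x)"
 proof -
  have 1: "((\<lambda>x. 1 / x) has_real_derivative - (1 / x\<^sup>2)) (at x)"
   using \<open>x > 0\<close> by (auto intro!: derivative_eq_intros simp: power2_eq_square)
  have 2: "((\<lambda>x. - 1 / x) has_real_derivative (1 / x\<^sup>2)) (at x)"
   using \<open>x > 0\<close> by (auto intro!: derivative_eq_intros simp: power2_eq_square)
  show ?thesis
   by (rule DERIV_cong[OF DERIV_mult[OF DERIV_chain2[OF poly_DERIV 1] DERIV_chain2[OF DERIV_exp 2]]])
     (use \<open>x > 0\<close> in \<open>simp add: flat_def poly_flat_step algebra_simps power2_eq_square\<close>)
 qed
 then show ?thesis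
  by (rule has_field_derivative_transform_within_open[where S = "{0<..}"]) (use \<open>x > 0\<close> in \<open>auto simp: flat_def\<close>)
next
 assume x: "x = 0"
 \<comment> \<open>With y = 1/h the difference quotient at 0 is y p(y) exp(-y), hence the shifted
   polynomial \<open>pCons 0 p\<close>.\<close>
 have "((\<lambda>h. poly (pCons 0 p) (inverse h) * exp (- inverse h)) \<longlongrightarrow> 0) (at_right (0::real))"
  using filterlim_compose[OF poly_exp_tendsto_0 filterlim_inverse_at_top_right] .
 then have "((\<lambda>h. (flat p (0 + h) - flat p 0) / h) \<longlongrightarrow> 0) (at_right 0)"
  by (rule Lim_transform_eventually)
    (auto simp: flat_def field_simps intro!: eventually_at_rightI[of 0 1])
 moreover have "((\<lambda>h. (flat p (0 + h) - flat p 0) / h) \<longlongrightarrow> 0) (at_left 0)"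
  by (rule Lim_transform_eventually[OF tendsto_const])
    (auto simp: flat_def intro!: eventually_at_leftI[of "-1"])
 ultimately have "((\<lambda>h. (flat p (0 + h) - flat p 0) / h) \<longlongrightarrow> 0) (at 0)"
  by (intro filterlim_split_at)
 then show ?thesis unfolding x DERIV_def by (simp add: flat_def)
qed

text \<open>A directional derivative is again of the same form, with \<open>c\<close> multiplied by
  \<open>b \<bullet> v\<close> and \<open>q\<close> replaced by \<open>flat_step q\<close>; this is
  why both are generalised in the induction. Affine arguments cover everything that is built from
  \<open>flat\<close> below.\<close>

lemma Ck_flat: "Ck k (\<lambda>p. c * flat q (a + p \<bullet> v))"
proof (induction k arbitrary: c q)
 case 0
 have "continuous_on UNIV (flat q)"
  by (intro continuous_at_imp_continuous_on ballI DERIV_isCont[OF flat_deriv])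
 then show ?case
  by (auto intro!: continuous_intros continuous_on_compose2[of UNIV "flat q"])
next
 case (Suc k)
 have d: "((\<lambda>p. c * flat q (a + p \<bullet> v)) has_derivative
   (\<lambda>b. c * (flat (flat_step q) (a + x \<bullet> v) * (b \<bullet> v)))) (at x)" for x
 proof -
  have "((\<lambda>p. a + p \<bullet> v) has_derivative (\<lambda>b. b \<bullet> v)) (at x)"
   by (auto intro!: derivative_eq_intros)
  from has_derivative_compose[OF this flat_deriv[of q, unfolded has_field_derivative_def]]
  show ?thesis by (rule has_derivative_mult_right)
 qed
 have "frechet_derivative (\<lambda>p. c * flat q (a + p \<bullet> v)) (at x) =
   (\<lambda>b. c * (flat (flat_step q) (a + x \<bullet> v) * (b \<bullet> v)))" for x
  by (rule frechet_derivative_at[OF d, symmetric])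
 then have e: "(\<lambda>x. frechet_derivative (\<lambda>p. c * flat q (a + p \<bullet> v)) (at x) b)
   = (\<lambda>p. (c * (b \<bullet> v)) * flat (flat_step q) (a + p \<bullet> v))" for b
  by (intro ext) (simp only: mult_ac)
 have df: "(\<lambda>p. c * flat q (a + p \<bullet> v)) differentiable (at x)" for x
  using d unfolding differentiable_def by blast
 show ?case
  unfolding Ck.simps e by (intro conjI allI ballI df Suc.IH)
qed

text \<open>A product of one-dimensional bumps, one for each coordinate, vanishing outside the cube
  with sides [-1,1]. Smoothness then needs only products and affine substitutions, and evenness
  amounts to swapping the two factors of each coordinate.\<close>

definition bump0 :: "'a::euclidean_space \<Rightarrow> real" where
 "bump0 x = (\<Prod>b\<in>Basis. flat 1 (1 + x \<bullet> (- b)) * flat 1 (1 + x \<bullet> b))"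

definition bump :: "'a::euclidean_space \<Rightarrow> real" where
 "bump x = bump0 x / (\<integral>y. bump0 y \<partial>(lborel :: 'a measure))"

definition mol :: "real \<Rightarrow> 'a::euclidean_space \<Rightarrow> real" where
 "mol h x = bump ((1 / h) *\<^sub>R x) / h ^ DIM('a)"

definition dmol :: "real \<Rightarrow> 'a::euclidean_space \<Rightarrow> 'a \<Rightarrow> real" where
 "dmol h b x = frechet_derivative (mol h) (at x) b"

lemma flat_nonneg: "0 \<le> flat 1 x" by (simp add: flat_def)

lemma flat_le_1: "flat 1 x \<le> 1" by (simp add: flat_def)

lemma bump0_nonneg: "0 \<le> bump0 x"
 by (auto simp: bump0_def intro!: prod_nonneg flat_nonneg mult_nonneg_nonneg)

lemma bump0_le_1: "bump0 x \<le> 1"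
 by (auto simp: bump0_def intro!: prod_le_1 flat_nonneg flat_le_1 mult_nonneg_nonneg mult_le_one)

lemma Ck_flat': "Ck k (\<lambda>p. flat q (a + p \<bullet> v))"
 using Ck_flat[of k 1 q a v] by simp

text \<open>\<open>L\<close> is an affine map given through its coordinates. The cases of interest
  are \<open>t0 - fst p\<close> and \<open>x0 - snd p\<close> on space-time, whose kernels are
  multiplied to form test functions.\<close>

lemma Ck_mol_comp:
 fixes L :: "'b::euclidean_space \<Rightarrow> 'a::euclidean_space"
 assumes "\<And>b p. b \<in> Basis \<Longrightarrow> L p \<bullet> b = a b + p \<bullet> v b"
 shows "Ck k (\<lambda>p. mol h (L p))"
proof -
 define I where "I = (\<integral>y. bump0 y \<partial>(lborel :: 'a measure)) * h ^ DIM('a)"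
 have "(\<lambda>p. mol h (L p)) = (\<lambda>p. (\<Prod>b\<in>Basis. flat 1 ((1 - a b / h) + p \<bullet> (- (1 / h)) *\<^sub>R v b)
    * flat 1 ((1 + a b / h) + p \<bullet> ((1 / h) *\<^sub>R v b))) * (1 / I))"
 proof
  fix p
  have "1 + ((1 / h) *\<^sub>R L p) \<bullet> (- b) = (1 - a b / h) + p \<bullet> (- (1 / h)) *\<^sub>R v b"
   "1 + ((1 / h) *\<^sub>R L p) \<bullet> b = (1 + a b / h) + p \<bullet> ((1 / h) *\<^sub>R v b)" if "b \<in> Basis" for b
   using assms[OF that, of p] by (auto simp: add_divide_distrib)
  then have "bump0 ((1 / h) *\<^sub>R L p) = (\<Prod>b\<in>Basis. flat 1 ((1 - a b / h) + p \<bullet> (- (1 / h)) *\<^sub>R v b)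
    * flat 1 ((1 + a b / h) + p \<bullet> ((1 / h) *\<^sub>R v b)))"
   unfolding bump0_def by (intro prod.cong refl) metis
  then show "mol h (L p) = (\<Prod>b\<in>Basis. flat 1 ((1 - a b / h) + p \<bullet> (- (1 / h)) *\<^sub>R v b)
    * flat 1 ((1 + a b / h) + p \<bullet> ((1 / h) *\<^sub>R v b))) * (1 / I)"
   unfolding mol_def bump_def I_def by simp
 qed
 moreover have "Ck k (\<lambda>p. (\<Prod>b\<in>Basis. flat 1 ((1 - a b / h) + p \<bullet> (- (1 / h)) *\<^sub>R v b)
    * flat 1 ((1 + a b / h) + p \<bullet> ((1 / h) *\<^sub>R v b))) * (1 / I))"
  by (intro Ck_mult Ck_prod Ck_const Ck_flat') auto
 ultimately show ?thesis by simp
qed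

lemma Ck_mol: "Ck k (mol h)"
 using Ck_mol_comp[of "\<lambda>p. p" "\<lambda>_. 0" "\<lambda>b. b" k h] by simp

lemma continuous_bump0: "continuous_on UNIV (bump0 :: 'a::euclidean_space \<Rightarrow> real)"
proof -
 have "Ck 0 (bump0 :: 'a \<Rightarrow> real)"
  unfolding bump0_def[abs_def] by (intro Ck_mult Ck_prod Ck_flat') auto
 then show ?thesis by simp
qed

lemma continuous_mol: "continuous_on UNIV (mol h)"
 using Ck_mol[of 0 h] by simp

lemma mol_measurable [measurable]: "mol h \<in> borel_measurable borel"
 by (rule borel_measurable_continuous_onI[OF continuous_mol])

lemma bump0_supp:
 assumes "bump0 x \<noteq> 0" "b \<in> Basis" shows "\<bar>x \<bullet> b\<bar> < 1"
proof -
 have "flat 1 (1 + x \<bullet> (- b)) * flat 1 (1 + x \<bullet> b) \<noteq> 0"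
  using assms by (auto simp: bump0_def)
 then show ?thesis by (auto simp: flat_def split: if_splits)
qed

text \<open>The cube is enclosed in a ball by means of the l1 norm; this crude radius is the origin
  of the factor \<open>real DIM('a) * h\<close> in all support statements.\<close>

lemma bump0_supp_norm:
 fixes x :: "'a::euclidean_space"
 assumes "bump0 x \<noteq> 0" shows "norm x \<le> DIM('a)"
proof -
 have "norm x \<le> (\<Sum>b\<in>Basis. \<bar>x \<bullet> b\<bar>)" by (rule norm_le_l1)
 also have "... \<le> (\<Sum>b\<in>(Basis::'a set). 1)"
  using bump0_supp[OF assms] by (intro sum_mono) force
 finally show ?thesis by simp
qed

lemma integrable_continuous_compact_supp:
 fixes f :: "'a::euclidean_space \<Rightarrow> 'b::euclidean_space"
 assumes "continuous_on UNIV f" "\<And>x. f x \<noteq> 0 \<Longrightarrow> norm x \<le> r"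
 shows "integrable lborel f"
proof -
 have "set_integrable lborel (cball 0 r) f"
  unfolding set_integrable_def
  by (intro borel_integrable_compact continuous_on_subset[OF assms(1)]) auto
 moreover have "(\<lambda>x. indicator (cball 0 r) x *\<^sub>R f x) = f"
  using assms(2) by (auto simp: fun_eq_iff indicator_def)
 ultimately show ?thesis by (simp add: set_integrable_def)
qed

lemma bump0_integrable: "integrable lborel (bump0 :: 'a::euclidean_space \<Rightarrow> real)"
 by (rule integrable_continuous_compact_supp[OF continuous_bump0 bump0_supp_norm])

lemma bump0_integral_pos: "0 < (\<integral>y. bump0 y \<partial>(lborel :: 'a::euclidean_space measure))"
proof -
 have "(\<integral>y. bump0 y \<partial>(lborel :: 'a measure)) \<noteq> 0"
 proof
  assume "(\<integral>y. bump0 y \<partial>(lborel :: 'a measure)) = 0"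
  then have "AE y in (lborel :: 'a measure). bump0 y = 0"
   using integral_nonneg_eq_0_iff_AE[OF bump0_integrable] bump0_nonneg by auto
  moreover have "open {y::'a. bump0 y \<noteq> 0}"
   using continuous_bump0 by (intro open_Collect_neq) auto
  moreover from calculation have "{y::'a. bump0 y \<noteq> 0} \<in> null_sets lborel"
   by (subst AE_iff_null_sets) (auto simp: borel_open)
  ultimately have "{y::'a. bump0 y \<noteq> 0} = {}"
   using open_not_negligible[of "{y::'a. bump0 y \<noteq> 0}"]
   by (auto simp: negligible_iff_null_sets null_sets_completionI)
  moreover have "bump0 (0::'a) \<noteq> 0" by (simp add: bump0_def flat_def)
  ultimately show False by blast
 qed
 moreover have "0 \<le> (\<integral>y. bump0 y \<partial>(lborel :: 'a measure))"
  by (simp add: bump0_nonneg)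
 ultimately show ?thesis by simp
qed

lemma mol_nonneg: "0 < h \<Longrightarrow> 0 \<le> mol h x"
 using bump0_nonneg bump0_integral_pos by (auto simp: mol_def bump_def intro!: divide_nonneg_nonneg less_imp_le[OF bump0_integral_pos])

lemma mol_even: "mol h (- x) = mol h x"
 by (simp add: mol_def bump_def bump0_def mult.commute cong: prod.cong)

lemma mol_minus_commute: "mol h (x - y) = mol h (y - x)"
 using mol_even[of h "x - y"] by simp

lemma mol_supp:
 fixes x :: "'a::euclidean_space"
 assumes "0 < h" "mol h x \<noteq> 0" shows "norm x \<le> real DIM('a) * h"
proof -
 have "norm ((1 / h) *\<^sub>R x) \<le> DIM('a)"
  using assms by (intro bump0_supp_norm) (auto simp: mol_def bump_def)
 then show ?thesis using assms(1) by (simp add: field_simps)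
qed

lemma mol_integrable: "0 < h \<Longrightarrow> integrable lborel (mol h :: 'a::euclidean_space \<Rightarrow> real)"
 by (rule integrable_continuous_compact_supp[OF continuous_mol mol_supp[of h]])

lemma mol_integral:
 assumes "0 < h" shows "(\<integral>x. mol h x \<partial>(lborel :: 'a::euclidean_space measure)) = 1"
proof -
 have "(\<integral>x. mol h x \<partial>(lborel :: 'a measure)) = \<bar>h\<bar> ^ DIM('a) * (\<integral>x. mol h (0 + h *\<^sub>R x) \<partial>(lborel :: 'a measure))"
  using assms by (subst integral_lborel_affine[where c = h and t = 0]) auto
 also have "... = 1" using assms bump0_integral_pos[where 'a='a] by (simp add: mol_def bump_def)
 finally show ?thesis .
qed

lemma nn_integral_mol: "0 < h \<Longrightarrow> (NI x. ennreal (mol h (x::'a::euclidean_space))) = 1"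
 by (subst nn_integral_eq_integral[OF mol_integrable]) (auto simp: mol_nonneg mol_integral)

text \<open>The maximum of \<open>bump0\<close> is at most 1, so this bounds the normalised bump;
  the type argument selects the space.\<close>

definition molB :: "'a::euclidean_space itself \<Rightarrow> real" where
 "molB _ = 1 / (\<integral>y. bump0 y \<partial>(lborel :: 'a measure))"

lemma molB_pos: "0 < molB TYPE('a::euclidean_space)"
 using bump0_integral_pos[where 'a='a] by (simp add: molB_def)

lemma mol_bound:
 fixes x :: "'a::euclidean_space"
 assumes "0 < h" shows "mol h x \<le> molB TYPE('a) / h ^ DIM('a)"
 using assms bump0_integral_pos[where 'a='a] bump0_le_1
 by (auto simp: mol_def bump_def molB_def intro!: divide_right_mono)

lemma mol_differentiable: "mol h differentiable (at x)"
 using Ck_mol[of "Suc 0" h] by (auto simp only: Ck.simps)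

lemma mol_has_derivative: "(mol h has_derivative (\<lambda>v. dmol h v x)) (at x)"
 using mol_differentiable by (simp add: dmol_def frechet_derivative_works[symmetric])

lemma dmol_continuous: "b \<in> Basis \<Longrightarrow> continuous_on UNIV (dmol h b)"
 using Ck_mol[of "Suc 0" h] by (auto simp only: Ck.simps dmol_def[abs_def])

lemma dmol_measurable [measurable]: "b \<in> Basis \<Longrightarrow> dmol h b \<in> borel_measurable borel"
 by (rule borel_measurable_continuous_onI[OF dmol_continuous])

lemma dmol_sum: "dmol h v x = (\<Sum>b\<in>Basis. (v \<bullet> b) * dmol h b x)"
proof -
 interpret linear "\<lambda>v. dmol h v x"
  using mol_has_derivative by (rule has_derivative_linear)
 have "dmol h v x = dmol h (\<Sum>b\<in>Basis. (v \<bullet> b) *\<^sub>R b) x" by (simp add: euclidean_representation)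
 also have "... = (\<Sum>b\<in>Basis. (v \<bullet> b) * dmol h b x)" by (simp add: sum scaleR)
 finally show ?thesis .
qed

lemma dmol_supp:
 fixes x :: "'a::euclidean_space"
 assumes "0 < h" "dmol h v x \<noteq> 0" shows "norm x \<le> real DIM('a) * h"
proof (rule ccontr)
 assume n: "\<not> ?thesis"
 have "open {y::'a. real DIM('a) * h < norm y}" by (intro open_Collect_less continuous_intros)
 then have "(mol h has_derivative (\<lambda>v. 0)) (at x)"
  using n mol_supp[OF assms(1)]
  by (intro has_derivative_transform_within_open[where f = "\<lambda>_. 0" and s = "{y. real DIM('a) * h < norm y}",
     OF has_derivative_const]) force+
 then have "(\<lambda>v. dmol h v x) = (\<lambda>v. 0)"
  using mol_has_derivative has_derivative_unique by blast
 then show False using assms(2) by metis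
qed

lemma dmol_bounded:
 assumes "0 < h" shows "\<exists>B>0. \<forall>b\<in>Basis. \<forall>x::'a::euclidean_space. \<bar>dmol h b x\<bar> \<le> B"
proof -
 have "\<exists>B. \<forall>x::'a. \<bar>dmol h b x\<bar> \<le> B" if "b \<in> Basis" for b
 proof -
  have "compact (dmol h b ` cball (0::'a) (real DIM('a) * h))"
   by (intro compact_continuous_image continuous_on_subset[OF dmol_continuous[OF that]]) auto
  then have "bounded (dmol h b ` cball (0::'a) (real DIM('a) * h))" by (rule compact_imp_bounded)
  then obtain B where B: "\<And>x::'a. norm x \<le> real DIM('a) * h \<Longrightarrow> \<bar>dmol h b x\<bar> \<le> B"
   unfolding bounded_iff by force
  have "\<bar>dmol h b x\<bar> \<le> \<bar>B\<bar>" for x :: 'a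
   using B[of x] dmol_supp[OF assms, of b x] by fastforce
  then show ?thesis by blast
 qed
 then obtain B where B: "\<And>b x. b \<in> (Basis :: 'a set) \<Longrightarrow> \<bar>dmol h b x\<bar> \<le> B b" by metis
 have "\<bar>dmol h b x\<bar> \<le> (\<Sum>b\<in>Basis. \<bar>B b\<bar>) + 1" if "b \<in> (Basis :: 'a set)" for b x
 proof -
  have "\<bar>dmol h b x\<bar> \<le> \<bar>B b\<bar>" using B[OF that] by (meson abs_ge_self order_trans)
  also have "... \<le> (\<Sum>b\<in>Basis. \<bar>B b\<bar>)" using that by (intro member_le_sum) auto
  finally show ?thesis by simp
 qed
 moreover have "0 < (\<Sum>b\<in>(Basis::'a set). \<bar>B b\<bar>) + 1" by (simp add: add_nonneg_pos sum_nonneg)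
 ultimately show ?thesis by blast
qed

lemma dmol_integrable: "0 < h \<Longrightarrow> b \<in> Basis \<Longrightarrow> integrable lborel (dmol h b)"
 by (rule integrable_continuous_compact_supp[OF dmol_continuous dmol_supp[of h b]])

section \<open>Convolutions\<close>

lemma fst_borel_measurable [measurable]: "fst \<in> borel_measurable (borel :: ('a::topological_space \<times> 'b::topological_space) measure)"
 by (intro borel_measurable_continuous_onI continuous_intros)

lemma snd_borel_measurable [measurable]: "snd \<in> borel_measurable (borel :: ('a::topological_space \<times> 'b::topological_space) measure)"
 by (intro borel_measurable_continuous_onI continuous_intros)

lemma integrable_prodI:
 fixes f :: "'a::euclidean_space \<times> 'b::euclidean_space \<Rightarrow> 'c::{banach, second_countable_topology}"
 assumes "f \<in> borel_measurable borel"
  and "(NI x. (NI y. ennreal (norm (f (x, y))))) < \<infinity>"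
 shows "integrable (lborel \<Otimes>\<^sub>M lborel) f"
proof (rule integrableI_bounded)
 show m: "f \<in> borel_measurable (lborel \<Otimes>\<^sub>M lborel)" using assms(1) by (simp add: lborel_prod)
 show "(\<integral>\<^sup>+p. ennreal (norm (f p)) \<partial>(lborel \<Otimes>\<^sub>M lborel)) < \<infinity>"
  using assms(2) m by (subst lborel.nn_integral_fst[symmetric]) auto
qed

lemma integrable_prodI2:
 fixes f :: "'a::euclidean_space \<times> 'b::euclidean_space \<Rightarrow> 'c::{banach, second_countable_topology}"
 assumes "f \<in> borel_measurable borel"
  and "(NI y. (NI x. ennreal (norm (f (x, y))))) < \<infinity>"
 shows "integrable (lborel \<Otimes>\<^sub>M lborel) f"
proof (rule integrableI_bounded)
 show m: "f \<in> borel_measurable (lborel \<Otimes>\<^sub>M lborel)" using assms(1) by (simp add: lborel_prod)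
 show "(\<integral>\<^sup>+p. ennreal (norm (f p)) \<partial>(lborel \<Otimes>\<^sub>M lborel)) < \<infinity>"
  using assms(2) m by (subst lborel_pair.nn_integral_snd[symmetric]) auto
qed

lemma nn_integral_swap:
 fixes f :: "'a::euclidean_space \<times> 'b::euclidean_space \<Rightarrow> ennreal"
 assumes "f \<in> borel_measurable borel"
 shows "(NI x. (NI y. f (x, y))) = (NI y. (NI x. f (x, y)))"
 by (rule lborel_pair.Fubini'[symmetric]) (use assms in \<open>simp add: lborel_prod\<close>)

lemma measurable_nn_integral_snd [measurable]:
 fixes f :: "'a::euclidean_space \<times> 'b::euclidean_space \<Rightarrow> ennreal"
 assumes "f \<in> borel_measurable borel"
 shows "(\<lambda>x. (NI y. f (x, y))) \<in> borel_measurable borel"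
  "(\<lambda>y. (NI x. f (x, y))) \<in> borel_measurable borel"
proof -
 have m: "f \<in> borel_measurable (lborel \<Otimes>\<^sub>M lborel)" using assms by (simp add: lborel_prod)
 show "(\<lambda>x. (NI y. f (x, y))) \<in> borel_measurable borel"
  using lborel.borel_measurable_nn_integral_fst[OF m] by simp
 have "(\<lambda>p. f (snd p, fst p)) \<in> borel_measurable borel" using assms by measurable
 then have "(\<lambda>p. f (snd p, fst p)) \<in> borel_measurable (lborel \<Otimes>\<^sub>M lborel)" by (simp add: lborel_prod)
 from lborel.borel_measurable_nn_integral_fst[OF this]
 show "(\<lambda>y. (NI x. f (x, y))) \<in> borel_measurable borel" by simp
qed

lemma measurable_integral_snd:
 fixes f :: "'a::euclidean_space \<times> 'b::euclidean_space \<Rightarrow> 'c::{banach, second_countable_topology}"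
 assumes "f \<in> borel_measurable borel"
 shows "(\<lambda>x. (LI y. f (x, y))) \<in> borel_measurable borel"
  "(\<lambda>y. (LI x. f (x, y))) \<in> borel_measurable borel"
proof -
 have "case_prod (\<lambda>x y. f (x, y)) \<in> borel_measurable (lborel \<Otimes>\<^sub>M lborel)" using assms by (simp add: lborel_prod)
 from lborel.borel_measurable_lebesgue_integral[OF this]
 show "(\<lambda>x. (LI y. f (x, y))) \<in> borel_measurable borel" by simp
 have "(\<lambda>p. f (snd p, fst p)) \<in> borel_measurable borel" using assms by measurable
 then have "case_prod (\<lambda>y x. f (x, y)) \<in> borel_measurable (lborel \<Otimes>\<^sub>M lborel)"
  by (simp add: lborel_prod case_prod_beta')
 from lborel.borel_measurable_lebesgue_integral[OF this]
 show "(\<lambda>y. (LI x. f (x, y))) \<in> borel_measurable borel" by simp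
qed

lemma integral_swap:
 fixes f :: "'a::euclidean_space \<times> 'b::euclidean_space \<Rightarrow> 'c::{banach, second_countable_topology}"
 assumes "integrable (lborel \<Otimes>\<^sub>M lborel) f"
 shows "(LI x. (LI y. f (x, y))) = (LI y. (LI x. f (x, y)))"
 by (rule lborel_pair.Fubini_integral[symmetric]) (use assms in simp)

lemma integrable_bounded_scale:
 fixes f :: "'a \<Rightarrow> 'b::{banach, second_countable_topology}" and k :: "'a \<Rightarrow> real"
 assumes "integrable M f" "k \<in> borel_measurable M" "\<And>y. \<bar>k y\<bar> \<le> B"
 shows "integrable M (\<lambda>y. k y *\<^sub>R f y)"
proof (rule Bochner_Integration.integrable_bound)
 show "integrable M (\<lambda>y. B * norm (f y))" using assms(1) by auto
 show "(\<lambda>y. k y *\<^sub>R f y) \<in> borel_measurable M" using assms(1,2) by measurable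
 have "norm (k y *\<^sub>R f y) \<le> norm (B * norm (f y))" for y
  using mult_right_mono[OF order_trans[OF assms(3)[of y] abs_ge_self], of "norm (f y)"] by (auto simp: abs_mult)
 then show "AE y in M. norm (k y *\<^sub>R f y) \<le> norm (B * norm (f y))" by simp
qed

text \<open>Convolution of a scalar kernel with a possibly vector-valued function. As a Bochner
  integral it is 0 at points where the integrand is not integrable.\<close>

definition cv :: "('a::euclidean_space \<Rightarrow> real) \<Rightarrow> ('a \<Rightarrow> 'b::{banach, second_countable_topology}) \<Rightarrow> 'a \<Rightarrow> 'b" where
 "cv k f x = (LI y. k (x - y) *\<^sub>R f y)"

lemma integrable_kernel:
 fixes f :: "'a::euclidean_space \<Rightarrow> 'b::{banach, second_countable_topology}"
 assumes "integrable lborel f" "k \<in> borel_measurable borel" "\<And>y. \<bar>k y\<bar> \<le> B"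
 shows "integrable lborel (\<lambda>y. k (x - y) *\<^sub>R f y)"
 using assms by (intro integrable_bounded_scale[where B = B]) auto

lemma cv_measurable:
 fixes f :: "'a::euclidean_space \<Rightarrow> 'b::{banach, second_countable_topology}"
 assumes [measurable]: "f \<in> borel_measurable borel" "k \<in> borel_measurable borel"
 shows "cv k f \<in> borel_measurable borel"
 unfolding cv_def[abs_def]
 using measurable_integral_snd(1)[of "\<lambda>p. k (fst p - snd p) *\<^sub>R f (snd p)"] by simp

lemma cv_bound:
 fixes f :: "'a::euclidean_space \<Rightarrow> 'b::{banach, second_countable_topology}"
 assumes f: "integrable lborel f" and k: "k \<in> borel_measurable borel" and B: "\<And>y. \<bar>k y\<bar> \<le> B"
 shows "norm (cv k f x) \<le> B * (LI y. norm (f y))"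
proof -
 have "norm (cv k f x) \<le> (LI y. norm (k (x - y) *\<^sub>R f y))"
  unfolding cv_def by (rule integral_norm_bound)
 also have "... \<le> (LI y. B * norm (f y))"
  using integrable_norm[OF integrable_kernel[OF f k B]] f B
  by (intro integral_mono) (auto intro!: mult_right_mono)
 finally show ?thesis by simp
qed

lemma nn_integral_cv_le:
 fixes f :: "'a::euclidean_space \<Rightarrow> 'b::{banach, second_countable_topology}"
 assumes f [measurable]: "f \<in> borel_measurable borel" and k [measurable]: "k \<in> borel_measurable borel"
 shows "(NI x. ennreal (norm (cv k f x)))
   \<le> (NI x. ennreal \<bar>k x\<bar>) * (NI y. ennreal (norm (f y)))"
proof -
 have "(NI x. ennreal (norm (cv k f x)))
   \<le> (NI x. (NI y. ennreal (norm (k (x - y) *\<^sub>R f y))))"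
  unfolding cv_def by (intro nn_integral_mono) (metis integral_norm_bound_ennreal not_integrable_integral_eq norm_zero ennreal_0 zero_le)
 also have "... = (NI y. (NI x. ennreal (norm (k (x - y) *\<^sub>R f y))))"
  using nn_integral_swap[of "\<lambda>p. ennreal (norm (k (fst p - snd p) *\<^sub>R f (snd p)))"] by simp
 also have "... = (NI y. (NI x. ennreal \<bar>k x\<bar>) * ennreal (norm (f y)))"
 proof (intro nn_integral_cong)
  fix y
  have "(NI x. ennreal (norm (k (x - y) *\<^sub>R f y)))
    = (NI x. ennreal \<bar>k (x + - y)\<bar> * ennreal (norm (f y)))"
   by (simp add: ennreal_mult)
  also have "... = (NI x. ennreal \<bar>k (x + - y)\<bar>) * ennreal (norm (f y))"
   by (rule nn_integral_multc) simp
  also have "(NI x. ennreal \<bar>k (x + - y)\<bar>) = (NI x. ennreal \<bar>k x\<bar>)"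
   by (rule nn_integral_shift[of "\<lambda>x. ennreal \<bar>k x\<bar>"]) simp
  finally show "(NI x. ennreal (norm (k (x - y) *\<^sub>R f y)))
    = (NI x. ennreal \<bar>k x\<bar>) * ennreal (norm (f y))" .
 qed
 also have "... = (NI x. ennreal \<bar>k x\<bar>) * (NI y. ennreal (norm (f y)))"
  by (rule nn_integral_cmult) simp
 finally show ?thesis .
qed

lemma cv_integrable:
 fixes f :: "'a::euclidean_space \<Rightarrow> 'b::{banach, second_countable_topology}"
 assumes f: "integrable lborel f" and k: "integrable lborel k"
 shows "integrable lborel (cv k f)"
proof (rule integrableI_bounded)
 show "cv k f \<in> borel_measurable lborel"
  using assms by (auto intro!: cv_measurable)
 have "(NI x. ennreal (norm (cv k f x)))
   \<le> (NI x. ennreal \<bar>k x\<bar>) * (NI y. ennreal (norm (f y)))"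
  using assms by (intro nn_integral_cv_le) auto
 also have "... < \<infinity>"
  using assms by (auto simp: integrable_iff_bounded ennreal_mult_less_top)
 finally show "(NI x. ennreal (norm (cv k f x))) < \<infinity>" .
qed

lemma cv_inner:
 fixes f :: "'a::euclidean_space \<Rightarrow> 'b::euclidean_space"
 assumes "integrable lborel f" "k \<in> borel_measurable borel" "\<And>y. \<bar>k y\<bar> \<le> B"
 shows "cv k f x \<bullet> b = cv k (\<lambda>y. f y \<bullet> b) x"
 using integral_inner_left[OF integrable_kernel[OF assms, where x = x], of b] by (simp add: cv_def)

lemma cv_diff:
 fixes f g :: "'a::euclidean_space \<Rightarrow> 'b::{banach, second_countable_topology}"
 assumes "integrable lborel f" "integrable lborel g" "k \<in> borel_measurable borel" "\<And>y. \<bar>k y\<bar> \<le> B"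
 shows "cv k (\<lambda>y. f y - g y) x = cv k f x - cv k g x"
 using Bochner_Integration.integral_diff[OF integrable_kernel[OF assms(1,3,4), where x = x] integrable_kernel[OF assms(2,3,4), where x = x]]
 by (simp add: cv_def scaleR_diff_right)

lemma mol_abs_bound: "0 < h \<Longrightarrow> \<bar>mol h (x::'a::euclidean_space)\<bar> \<le> molB TYPE('a) / h ^ DIM('a)"
 using mol_bound[of h x] mol_nonneg[of h x] by simp

text \<open>The product of two convolutions is integrated in x first, which leaves a double integral
  of e(y) g(z) against a kernel in y and z. Integration by parts and the symmetrization argument are
  both read off from properties of that kernel.\<close>

lemma cv_cv_product:
 fixes e g :: "'a::euclidean_space \<Rightarrow> real"
 assumes e: "integrable lborel e" and g: "integrable lborel g"
  and k: "integrable lborel k" "\<And>x. \<bar>k x\<bar> \<le> B" and l: "integrable lborel l" "\<And>x. \<bar>l x\<bar> \<le> B"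
 shows "integrable lborel (\<lambda>x. cv k e x * cv l g x)"
  and "(LI x. cv k e x * cv l g x)
   = (\<integral>p. (e (fst p) * g (snd p)) * (LI x. k (x - fst p) * l (x - snd p)) \<partial>(lborel \<Otimes>\<^sub>M lborel))"
proof -
 have [measurable]: "e \<in> borel_measurable borel" "g \<in> borel_measurable borel"
  "k \<in> borel_measurable borel" "l \<in> borel_measurable borel"
  using assms by auto
 define F where "F = (\<lambda>q::'a \<times> 'a \<times> 'a. k (fst q - fst (snd q)) * e (fst (snd q)) * (l (fst q - snd (snd q)) * g (snd (snd q))))"
 have [measurable]: "F \<in> borel_measurable borel" unfolding F_def by measurable
 have eg: "integrable (lborel \<Otimes>\<^sub>M lborel) (\<lambda>p::'a\<times>'a. e (fst p) * g (snd p))"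
 proof (rule integrable_prodI)
  have "(NI x. (NI y. ennreal (norm (e (fst (x, y)) * g (snd (x, y))))))
    = (NI x. ennreal (norm (e x))) * (NI y. ennreal (norm (g y)))"
   by (simp add: abs_mult ennreal_mult nn_integral_cmult nn_integral_multc)
  also have "... < \<infinity>" using e g by (auto simp: integrable_iff_bounded ennreal_mult_less_top)
  finally show "(NI x. (NI y. ennreal (norm (e (fst (x, y)) * g (snd (x, y)))))) < \<infinity>" .
 qed simp
 have B0: "0 \<le> B" using k(2)[of 0] by simp
 \<comment> \<open>The kernel \<open>l\<close> is estimated by its supremum and only
   \<open>k\<close> is integrated in x, so that \<open>e\<close> and \<open>g\<close>
   decouple.\<close>
 have inner: "(NI x. ennreal (norm (F (x, p)))) \<le> ennreal (B * (LI x. \<bar>k x\<bar>)) * ennreal (norm (e (fst p) * g (snd p)))" for p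
 proof -
  have "(NI x. ennreal (norm (F (x, p))))
   \<le> (NI x. ennreal (B * norm (e (fst p) * g (snd p))) * ennreal \<bar>k (x + - fst p)\<bar>)"
  proof (intro nn_integral_mono)
   fix x
   have "norm (F (x, p)) = \<bar>l (x - snd p)\<bar> * (norm (e (fst p) * g (snd p)) * \<bar>k (x - fst p)\<bar>)"
    by (simp add: F_def abs_mult)
   also have "... \<le> B * (norm (e (fst p) * g (snd p)) * \<bar>k (x - fst p)\<bar>)"
    by (intro mult_right_mono l) auto
   finally show "ennreal (norm (F (x, p))) \<le> ennreal (B * norm (e (fst p) * g (snd p))) * ennreal \<bar>k (x + - fst p)\<bar>"
    by (simp add: ennreal_mult[symmetric] B0 mult.assoc ennreal_leI)
  qed
  also have "... = ennreal (B * norm (e (fst p) * g (snd p))) * (NI x. ennreal \<bar>k (x + - fst p)\<bar>)"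
   by (rule nn_integral_cmult) simp
  also have "(NI x. ennreal \<bar>k (x + - fst p)\<bar>) = ennreal (LI x. \<bar>k x\<bar>)"
   using nn_integral_shift[of "\<lambda>x. ennreal \<bar>k x\<bar>" "- fst p"] k(1)
   by (simp add: nn_integral_eq_integral)
  finally show ?thesis by (simp add: ennreal_mult[symmetric] B0 mult_ac)
 qed
 have F: "integrable (lborel \<Otimes>\<^sub>M lborel) F"
 proof (rule integrable_prodI2)
  have "(NI p. (NI x. ennreal (norm (F (x, p)))))
   \<le> (NI p. ennreal (B * (LI x. \<bar>k x\<bar>)) * ennreal (norm (e (fst p) * g (snd p))))"
   by (intro nn_integral_mono inner)
  also have "... = ennreal (B * (LI x. \<bar>k x\<bar>)) * (NI p. ennreal (norm (e (fst p) * g (snd p))))"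
   by (rule nn_integral_cmult) simp
  also have "... < \<infinity>" using eg by (auto simp: integrable_iff_bounded ennreal_mult_less_top lborel_prod)
  finally show "(NI p. (NI x. ennreal (norm (F (x, p))))) < \<infinity>" .
 qed simp
 have prod: "(LI p. F (x, p)) = cv k e x * cv l g x" for x
 proof -
  define a where "a y = k (x - y) * e y" for y
  define b where "b y = l (x - y) * g y" for y
  have ia: "integrable lborel a" and ib: "integrable lborel b"
   using integrable_kernel[where k = k and f = e and x = x and B = B] integrable_kernel[where k = l and f = g and x = x and B = B] e g k l
   by (auto simp: a_def[abs_def] b_def[abs_def])
  then have [measurable]: "a \<in> borel_measurable borel" "b \<in> borel_measurable borel" by auto
  have "integrable (lborel \<Otimes>\<^sub>M lborel) (\<lambda>p::'a\<times>'a. a (fst p) * b (snd p))"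
  proof (rule integrable_prodI)
   have "(NI x. (NI y. ennreal (norm (a (fst (x, y)) * b (snd (x, y))))))
     = (NI x. ennreal (norm (a x))) * (NI y. ennreal (norm (b y)))"
    by (simp add: abs_mult ennreal_mult nn_integral_cmult nn_integral_multc)
   also have "... < \<infinity>" using ia ib by (auto simp: integrable_iff_bounded ennreal_mult_less_top)
   finally show "(NI x. (NI y. ennreal (norm (a (fst (x, y)) * b (snd (x, y)))))) < \<infinity>" .
  qed simp
  from lborel_pair.integral_fst'[OF this, symmetric]
  have "(\<integral>p. a (fst p) * b (snd p) \<partial>(lborel :: ('a \<times> 'a) measure)) = (LI y. a y) * (LI y. b y)"
   by (simp add: lborel_prod)
  moreover have "(\<lambda>p. F (x, p)) = (\<lambda>p. a (fst p) * b (snd p))"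
   by (simp add: F_def a_def b_def fun_eq_iff)
  ultimately show ?thesis by (simp add: cv_def a_def b_def)
 qed
 have "integrable lborel (\<lambda>x. (LI p. F (x, p)))"
  using lborel_pair.integrable_fst'[OF F] .
 then show "integrable lborel (\<lambda>x. cv k e x * cv l g x)" by (simp add: prod)
 have "(LI x. cv k e x * cv l g x) = (LI p. (LI x. F (x, p)))"
  using integral_swap[OF F] by (simp add: prod)
 also have "... = (LI p. (e (fst p) * g (snd p)) * (LI x. k (x - fst p) * l (x - snd p)))"
 proof (intro Bochner_Integration.integral_cong refl)
  fix p :: "'a \<times> 'a"
  have "(LI x. F (x, p)) = (LI x. (e (fst p) * g (snd p)) * (k (x - fst p) * l (x - snd p)))"
   by (intro Bochner_Integration.integral_cong refl) (simp add: F_def mult_ac)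
  then show "(LI x. F (x, p)) = (e (fst p) * g (snd p)) * (LI x. k (x - fst p) * l (x - snd p))"
   by simp
 qed
 finally show "(LI x. cv k e x * cv l g x)
   = (\<integral>p. (e (fst p) * g (snd p)) * (LI x. k (x - fst p) * l (x - snd p)) \<partial>(lborel \<Otimes>\<^sub>M lborel))"
  by (simp add: lborel_prod)
qed

section \<open>Integration by parts between mollified functions\<close>

lemma FTC_segment:
 fixes F :: "'a::euclidean_space \<Rightarrow> real"
 assumes d: "\<And>x. (F has_derivative F' x) (at x)" and c: "continuous_on UNIV (\<lambda>x. F' x v)"
 shows "(LI s. F' (x + s *\<^sub>R v) v * indicator {0..1} s) = F (x + v) - F x"
proof -
 have "((\<lambda>s. F (x + s *\<^sub>R v)) has_real_derivative F' (x + s *\<^sub>R v) v) (at s)" for s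
 proof -
  have "((\<lambda>s. F (x + s *\<^sub>R v)) has_derivative (\<lambda>t. F' (x + s *\<^sub>R v) (t *\<^sub>R v))) (at s)"
   by (rule has_derivative_compose[OF _ d]) (auto intro!: derivative_eq_intros)
  moreover have "F' (x + s *\<^sub>R v) (t *\<^sub>R v) = t * F' (x + s *\<^sub>R v) v" for t
   using linear_scale[OF has_derivative_linear[OF d]] by auto
  ultimately show ?thesis by (simp add: has_field_derivative_def mult.commute[of _ "F' (x + s *\<^sub>R v) v"])
 qed
 moreover have "isCont (\<lambda>s. F' (x + s *\<^sub>R v) v) s" for s
  using continuous_on_compose2[OF c, of UNIV "\<lambda>s. x + s *\<^sub>R v"]
  by (auto intro!: continuous_intros simp: continuous_on_eq_continuous_at)
 ultimately show ?thesis
  using integral_FTC_Icc_real[of 0 1 "\<lambda>s. F (x + s *\<^sub>R v)" "\<lambda>s. F' (x + s *\<^sub>R v) v"] by simp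
qed

text \<open>The integral of F(x + v) - F(x) over x is 0 by translation invariance. Written as a line
  integral and after Fubini, it is the average over s in [0,1] of the integral of F'(x + s v) v, and
  by translation this does not depend on s.\<close>

lemma integral_derivative_zero:
 fixes F :: "'a::euclidean_space \<Rightarrow> real"
 assumes d: "\<And>x. (F has_derivative F' x) (at x)" and c: "continuous_on UNIV (\<lambda>x. F' x v)"
  and F: "integrable lborel F" and F': "integrable lborel (\<lambda>x. F' x v)"
 shows "(LI x. F' x v) = 0"
proof -
 have [measurable]: "(\<lambda>x. F' x v) \<in> borel_measurable borel" using F' by auto
 define H where "H p = F' (fst p + snd p *\<^sub>R v) v * indicator {0..1} (snd p)" for p :: "'a \<times> real"
 have [measurable]: "H \<in> borel_measurable borel"
  unfolding H_def[abs_def] using measurable_compose[OF _ \<open>(\<lambda>x. F' x v) \<in> borel_measurable borel\<close>] by measurable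
 have sl: "(NI x. ennreal \<bar>H (x, s)\<bar>) = ennreal (LI x. \<bar>F' x v\<bar>) * indicator {0..1} s" for s
  using nn_integral_shift[of "\<lambda>x. ennreal \<bar>F' x v\<bar>" "s *\<^sub>R v"] F'
  by (cases "s \<in> {0..1}") (simp_all add: H_def nn_integral_eq_integral)
 have "integrable (lborel \<Otimes>\<^sub>M lborel) H"
  by (rule integrable_prodI2) (auto simp: sl nn_integral_cmult ennreal_mult_less_top)
 then have "(LI x. (LI s. H (x, s))) = (LI s. (LI x. H (x, s)))"
  by (rule integral_swap)
 moreover have "(LI x. (LI s. H (x, s))) = 0"
 proof -
  have "(LI x. (LI s. H (x, s))) = (LI x. F (x + v) - F x)"
   by (simp add: H_def FTC_segment[OF d c])
  also have "... = 0"
   using F integral_shift[of F v] by (subst Bochner_Integration.integral_diff) (auto simp: integrable_shift)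
  finally show ?thesis .
 qed
 moreover have "(LI s. (LI x. H (x, s))) = (LI x. F' x v)"
  using integral_shift[of "\<lambda>x. F' x v"] by (simp add: H_def)
 ultimately show ?thesis by simp
qed

text \<open>The sum of the two integrands is the derivative of a product of two translated
  mollifiers, and a total derivative integrates to 0.\<close>

lemma mol_dmol_antisym:
 fixes y z :: "'a::euclidean_space"
 assumes h: "0 < h" and b: "b \<in> Basis"
 shows "(LI x. mol h (x - y) * dmol h b (x - z)) = - (LI x. dmol h b (x - y) * mol h (x - z))"
proof -
 obtain B where B: "\<And>x::'a. \<bar>dmol h b x\<bar> \<le> B" using dmol_bounded[OF h] b by blast
 have m: "integrable lborel (\<lambda>x. mol h (x - y))" and d: "integrable lborel (\<lambda>x. dmol h b (x - y))"
  using integrable_shift[of "mol h" "- y"] integrable_shift[of "dmol h b" "- y"] mol_integrable[OF h] dmol_integrable[OF h b]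
  by auto
 have i1: "integrable lborel (\<lambda>x. mol h (x - y) * dmol h b (x - z))"
  using integrable_bounded_scale[OF m, of "\<lambda>x. dmol h b (x - z)" B] B b by (simp add: mult.commute)
 have i2: "integrable lborel (\<lambda>x. dmol h b (x - y) * mol h (x - z))"
  using integrable_bounded_scale[OF d, of "\<lambda>x. mol h (x - z)", OF _ mol_abs_bound[OF h]] by (simp add: mult.commute)
 have i3: "integrable lborel (\<lambda>x. mol h (x - y) * mol h (x - z))"
  using integrable_bounded_scale[OF m, of "\<lambda>x. mol h (x - z)", OF _ mol_abs_bound[OF h]] by (simp add: mult.commute)
 have "((\<lambda>x. mol h (x - y) * mol h (x - z)) has_derivative
   (\<lambda>v. mol h (x - y) * dmol h v (x - z) + dmol h v (x - y) * mol h (x - z))) (at x)" for x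
  by (intro has_derivative_mult has_derivative_compose[OF _ mol_has_derivative]) (auto intro!: derivative_eq_intros)
 moreover have "continuous_on UNIV (\<lambda>x. mol h (x - y) * dmol h b (x - z) + dmol h b (x - y) * mol h (x - z))"
  using b by (intro continuous_intros continuous_on_compose2[OF continuous_mol] continuous_on_compose2[OF dmol_continuous]) auto
 ultimately have "(LI x. mol h (x - y) * dmol h b (x - z) + dmol h b (x - y) * mol h (x - z)) = 0"
  using i1 i2 i3 by (intro integral_derivative_zero[where v = b and F = "\<lambda>x. mol h (x - y) * mol h (x - z)"
   and F' = "\<lambda>x v. mol h (x - y) * dmol h v (x - z) + dmol h v (x - y) * mol h (x - z)"]) auto
 then show ?thesis using i1 i2 by simp
qed

text \<open>By \<open>cv_cv_product\<close> both sides are double integrals of \<open>e\<close> and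
  \<open>g\<close>, against kernels that are opposite by \<open>mol_dmol_antisym\<close>. All
  derivatives fall on mollifiers, so \<open>e\<close> and \<open>g\<close> may be arbitrary
  integrable functions.\<close>

lemma cv_by_parts:
 fixes e g :: "'a::euclidean_space \<Rightarrow> real"
 assumes h: "0 < h" and b: "b \<in> Basis" and e: "integrable lborel e" and g: "integrable lborel g"
 shows "(LI x. cv (mol h) e x * cv (dmol h b) g x) = - (LI x. cv (dmol h b) e x * cv (mol h) g x)"
proof -
 obtain B where B: "\<And>x::'a. \<bar>dmol h b x\<bar> \<le> B" using dmol_bounded[OF h] b by blast
 let ?B = "max B (molB TYPE('a) / h ^ DIM('a))"
 have 1: "\<bar>dmol h b x\<bar> \<le> ?B" "\<bar>mol h x\<bar> \<le> ?B" for x :: 'a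
  using B[of x] mol_abs_bound[OF h, of x] by linarith+
 show ?thesis
  unfolding cv_cv_product(2)[OF e g mol_integrable[OF h] 1(2) dmol_integrable[OF h b] 1(1)]
   cv_cv_product(2)[OF e g dmol_integrable[OF h b] 1(1) mol_integrable[OF h] 1(2)]
  by (simp add: mol_dmol_antisym[OF h b])
qed

section \<open>Weak derivatives tested against kernels\<close>

lemma abs_mol: "0 < h \<Longrightarrow> \<bar>mol h x\<bar> = mol h x"
 using mol_nonneg[of h x] by simp

lemma integrable_mol_kernel:
 fixes f :: "'a::euclidean_space \<Rightarrow> 'b::{banach, second_countable_topology}"
 assumes "integrable lborel f" "0 < h"
 shows "integrable lborel (\<lambda>y. mol h (x - y) *\<^sub>R f y)"
 by (rule integrable_kernel[OF assms(1) mol_measurable mol_abs_bound[OF assms(2)]])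

lemma integrable_dmol_kernel:
 fixes f :: "'a::euclidean_space \<Rightarrow> 'b::{banach, second_countable_topology}"
 assumes "integrable lborel f" "0 < h" "b \<in> Basis"
 shows "integrable lborel (\<lambda>y. dmol h b (x - y) *\<^sub>R f y)"
proof -
 obtain B where "\<And>x::'a. \<bar>dmol h b x\<bar> \<le> B" using dmol_bounded[OF assms(2)] assms(3) by blast
 then show ?thesis by (rule integrable_kernel[OF assms(1) dmol_measurable[OF assms(3)]])
qed

text \<open>Open sets are an intersection-stable generator of the Borel sets, so the vanishing of
  the integrals extends to all Borel sets; the sets where \<open>H\<close> is positive and where it
  is negative then settle the claim.\<close>

lemma integrable_zero_of_open:
 fixes H :: "'a::euclidean_space \<Rightarrow> real"
 assumes H: "integrable lborel H"
  and open_zero: "\<And>A. open A \<Longrightarrow> (LI x. indicator A x * H x) = 0"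
 shows "AE x in lborel. H x = 0"
proof -
 have ind: "integrable lborel (\<lambda>x. indicator A x * H x)" if "A \<in> sets borel" for A
  using integrable_mult_indicator[OF _ H, of A] that by simp
 have sigma: "sets (borel :: 'a measure) = sigma_sets UNIV {S. open S}"
  by (simp add: borel_def)
 have all: "(LI x. indicator A x * H x) = 0" if "A \<in> sets borel" for A
 proof -
  have "Int_stable {S :: 'a set. open S}" by (auto simp: Int_stable_def)
  moreover have "{S :: 'a set. open S} \<subseteq> Pow UNIV" by auto
  moreover have "A \<in> sigma_sets UNIV {S. open S}" using that by (simp add: sigma)
  ultimately show ?thesis
  proof (induction rule: sigma_sets_induct_disjoint)
   case (basic A) then show ?case using open_zero by auto
  next
   case empty show ?case by simp
  next
   case (compl A)
   then have A: "A \<in> sets borel" by (simp add: sigma)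
   have "(LI x. indicator (UNIV - A) x * H x) = (LI x. indicator UNIV x * H x - indicator A x * H x)"
    by (intro Bochner_Integration.integral_cong) (auto simp: indicator_def)
   also have "... = 0"
    using compl open_zero[of UNIV] ind[OF A] ind[of UNIV] by (subst Bochner_Integration.integral_diff) auto
   finally show ?case .
  next
   case (union A)
   then have A: "A i \<in> sets borel" for i by (auto simp: sigma)
   have si: "set_integrable lborel (\<Union>i. A i) H"
    unfolding set_integrable_def using ind[of "\<Union>i. A i"] A by auto
   have "(LINT x:(\<Union>i. A i)|lborel. H x) = (\<Sum>i. (LINT x:(A i)|lborel. H x))"
    using union A si by (intro lebesgue_integral_countable_add) (auto simp: disjoint_family_on_def)
   then show ?case using union by (simp add: set_lebesgue_integral_def)
  qed
 qed
 have [measurable]: "H \<in> borel_measurable borel" using H by auto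
 have "AE x in lborel. indicator {x. 0 < H x} x * H x = 0"
  using all[of "{x. 0 < H x}"] ind[of "{x. 0 < H x}"]
  by (subst integral_nonneg_eq_0_iff_AE[symmetric]) (auto split: split_indicator)
 moreover have "AE x in lborel. - (indicator {x. H x < 0} x * H x) = 0"
  using all[of "{x. H x < 0}"] ind[of "{x. H x < 0}"]
  by (subst integral_nonneg_eq_0_iff_AE[symmetric]) (auto split: split_indicator)
 ultimately show ?thesis
  by eventually_elim (auto simp: indicator_def split: if_splits)
qed

lemma cv_mol_tendsto:
 fixes f :: "'a::euclidean_space \<Rightarrow> real"
 assumes h: "\<And>k. 0 < h k" "h \<longlonglongrightarrow> (0::real)" and f: "continuous_on UNIV f" "\<And>x. \<bar>f x\<bar> \<le> B"
 shows "(\<lambda>k. cv (mol (h k)) f x) \<longlonglongrightarrow> f x"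
proof (rule LIMSEQ_I)
 fix e :: real assume e: "0 < e"
 have [measurable]: "f \<in> borel_measurable borel" using f(1) by (rule borel_measurable_continuous_onI)
 have "\<exists>d>0. \<forall>y. dist y x < d \<longrightarrow> dist (f y) (f x) < e / 2"
  using f(1) e unfolding continuous_on_iff by (metis UNIV_I half_gt_zero)
 then obtain d where d: "0 < d" "\<And>y. norm (y - x) < d \<Longrightarrow> \<bar>f y - f x\<bar> < e / 2"
  by (auto simp: dist_norm)
 have "eventually (\<lambda>k. real DIM('a) * h k < d) sequentially"
  using order_tendstoD(2)[OF tendsto_mult_left[OF h(2), of "real DIM('a)"], of d] d(1) by simp
 then obtain N where N: "\<And>k. N \<le> k \<Longrightarrow> real DIM('a) * h k < d" unfolding eventually_sequentially by blast
 show "\<exists>N. \<forall>k\<ge>N. norm (cv (mol (h k)) f x - f x) < e"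
 proof (intro exI allI impI)
  fix k assume k: "N \<le> k"
  have m: "integrable lborel (\<lambda>y. mol (h k) (x - y))"
   using mol_integrable[OF h(1)] by (simp add: integrable_reflect)
  have i1: "integrable lborel (\<lambda>y. mol (h k) (x - y) * f y)"
   using integrable_bounded_scale[OF m _ f(2)] by (simp add: mult.commute)
  have m1: "(LI y. mol (h k) (x - y)) = 1"
   using integral_reflect[of "mol (h k)" x] mol_integral[OF h(1)] by simp
  have "cv (mol (h k)) f x - f x = (LI y. mol (h k) (x - y) * f y - mol (h k) (x - y) * f x)"
   using i1 m m1 by (simp add: cv_def)
  also have "norm ... \<le> (LI y. norm (mol (h k) (x - y) * f y - mol (h k) (x - y) * f x))"
   by (rule integral_norm_bound)
  also have "... \<le> (LI y. mol (h k) (x - y) * (e / 2))"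
  proof (rule integral_mono)
   fix y
   show "norm (mol (h k) (x - y) * f y - mol (h k) (x - y) * f x) \<le> mol (h k) (x - y) * (e / 2)"
   proof (cases "mol (h k) (x - y) = 0")
    case False
    then have "norm (x - y) \<le> real DIM('a) * h k" by (rule mol_supp[OF h(1)])
    then have "\<bar>f y - f x\<bar> < e / 2" using N[OF k] by (intro d) (simp add: norm_minus_commute)
    then show ?thesis
     using mol_nonneg[OF h(1), of k "x - y"]
     by (auto simp: right_diff_distrib[symmetric] abs_mult intro!: mult_left_mono simp del: mult.assoc times_divide_eq_right)
   qed simp
  qed (use i1 m in auto)
  also have "... < e" using e m1 by simp
  finally show "norm (cv (mol (h k)) f x - f x) < e" .
 qed
qed

text \<open>Fubini and the evenness of the mollifier.\<close>

lemma cv_adjoint: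
 fixes H f :: "'a::euclidean_space \<Rightarrow> real"
 assumes h: "0 < h" and H: "integrable lborel H" and f: "f \<in> borel_measurable borel" "\<And>x. \<bar>f x\<bar> \<le> B"
 shows "(LI x. H x * cv (mol h) f x) = (LI x. f x * cv (mol h) H x)"
proof -
 have [measurable]: "f \<in> borel_measurable borel" "H \<in> borel_measurable borel" using f H by auto
 let ?F = "\<lambda>p::'a \<times> 'a. H (fst p) * (mol h (fst p - snd p) * f (snd p))"
 have B: "0 \<le> B" using f(2)[of 0] by simp
 have "(NI y. ennreal (norm (?F (x, y)))) \<le> ennreal B * ennreal \<bar>H x\<bar>" for x
 proof -
  have "(NI y. ennreal (norm (?F (x, y)))) \<le> (NI y. ennreal (B * \<bar>H x\<bar>) * ennreal (mol h (x - y)))"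
  proof (intro nn_integral_mono)
   fix y
   have "norm (?F (x, y)) = \<bar>f y\<bar> * (\<bar>H x\<bar> * mol h (x - y))"
    using h by (simp add: abs_mult mult_ac abs_mol)
   also have "... \<le> B * (\<bar>H x\<bar> * mol h (x - y))"
    using mol_nonneg[OF h, of "x - y"] by (intro mult_right_mono f) auto
   finally show "ennreal (norm (?F (x, y))) \<le> ennreal (B * \<bar>H x\<bar>) * ennreal (mol h (x - y))"
    using mol_nonneg[OF h, of "x - y"] B
    by (subst ennreal_mult[symmetric]) (auto simp only: mult.assoc intro!: ennreal_leI mult_nonneg_nonneg abs_ge_zero)
  qed
  also have "... = ennreal (B * \<bar>H x\<bar>)"
   using nn_integral_reflect[of "\<lambda>y. ennreal (mol h y)" x] nn_integral_mol[OF h, where 'a='a]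
   by (simp add: nn_integral_cmult)
  finally show ?thesis using B by (simp add: ennreal_mult)
 qed
 then have "(NI x. (NI y. ennreal (norm (?F (x, y))))) \<le> (NI x. ennreal B * ennreal \<bar>H x\<bar>)"
  by (intro nn_integral_mono)
 also have "... < \<infinity>" using H by (auto simp: nn_integral_cmult integrable_iff_bounded ennreal_mult_less_top)
 finally have I: "integrable (lborel \<Otimes>\<^sub>M lborel) ?F" by (intro integrable_prodI) auto
 have e1: "(LI y. ?F (x, y)) = H x * cv (mol h) f x" for x
  by (simp add: cv_def)
 have e2: "(LI x. ?F (x, y)) = f y * cv (mol h) H y" for y
 proof -
  have "(LI x. ?F (x, y)) = (LI x. f y * (mol h (y - x) * H x))"
   by (intro Bochner_Integration.integral_cong refl) (subst mol_minus_commute, simp)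
  then show ?thesis by (simp add: cv_def)
 qed
 show ?thesis using integral_swap[OF I] by (simp only: e1 e2)
qed

lemma cv_mol_bounded:
 fixes f :: "'a::euclidean_space \<Rightarrow> real"
 assumes h: "0 < h" and f: "f \<in> borel_measurable borel" "\<And>x. \<bar>f x\<bar> \<le> B"
 shows "\<bar>cv (mol h) f x\<bar> \<le> B"
proof -
 have m: "integrable lborel (\<lambda>y. mol h (x - y))"
  using mol_integrable[OF h] by (simp add: integrable_reflect)
 have i1: "integrable lborel (\<lambda>y. mol h (x - y) * f y)"
  using integrable_bounded_scale[OF m _ f(2)] f by (simp add: mult.commute)
 have "\<bar>cv (mol h) f x\<bar> \<le> (LI y. \<bar>mol h (x - y) * f y\<bar>)"
  using integral_norm_bound[of lborel "\<lambda>y. mol h (x - y) * f y"] by (simp add: cv_def)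
 also have "... \<le> (LI y. mol h (x - y) * B)"
 proof (rule integral_mono)
  show "\<bar>mol h (x - y) * f y\<bar> \<le> mol h (x - y) * B" for y
   using mol_nonneg[OF h, of "x - y"] f(2)[of y] by (auto simp: abs_mult intro!: mult_left_mono)
 qed (use i1 m in auto)
 also have "... = B" using integral_reflect[of "mol h" x] mol_integral[OF h, where 'a='a] by simp
 finally show ?thesis .
qed

lemma open_indicator_approx:
 fixes A :: "'a::euclidean_space set"
 assumes "open A"
 shows "\<exists>f :: nat \<Rightarrow> 'a \<Rightarrow> real. (\<forall>n. continuous_on UNIV (f n)) \<and> (\<forall>n x. \<bar>f n x\<bar> \<le> 1) \<and>
  (\<forall>n x. x \<notin> A \<longrightarrow> f n x = 0) \<and> (\<forall>x. (\<lambda>n. f n x) \<longlonglongrightarrow> indicator A x)"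
proof (cases "A = UNIV")
 \<comment> \<open>The distance to the empty set is 0 by convention, so the construction by
   \<open>infdist\<close> would give the wrong limit here.\<close>
 case True
 then show ?thesis by (intro exI[of _ "\<lambda>_ _. 1"]) auto
next
 case False
 have lim: "(\<lambda>n. min 1 (real n * infdist x (- A))) \<longlonglongrightarrow> indicator A x" for x
 proof (cases "x \<in> A")
  case True
  then have "infdist x (- A) > 0"
   using assms False by (intro infdist_pos_not_in_closed) auto
  then obtain N :: nat where N: "1 < N * infdist x (- A)" using reals_Archimedean3 by blast
  have "eventually (\<lambda>n. 1 = min 1 (real n * infdist x (- A))) sequentially"
   using eventually_ge_at_top[of N]
  proof eventually_elim
   case (elim n)
   have "1 < n * infdist x (- A)"
    using N elim \<open>0 < infdist x (- A)\<close> by (smt (verit) mult_right_mono of_nat_mono)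
   then show ?case by simp
  qed
  then show ?thesis using True by (intro Lim_transform_eventually[OF tendsto_const]) auto
 next
  case False
  then show ?thesis by simp
 qed
 show ?thesis
  by (intro exI[of _ "\<lambda>n x. min 1 (real n * infdist x (- A))"] conjI allI lim)
    (auto intro!: continuous_intros simp: infdist_nonneg)
qed

text \<open>The fundamental lemma of the calculus of variations with mollifiers as the only test
  functions. By \<open>cv_adjoint\<close> the mollifier passes from \<open>H\<close> to a continuous
  function supported well inside \<open>U\<close>; letting the scale tend to 0, \<open>H\<close>
  annihilates such functions, and these approximate indicators of open sets.\<close>

lemma mol_zero:
 fixes H :: "'a::euclidean_space \<Rightarrow> real"
 assumes h: "\<And>k. 0 < h k" "h \<longlonglongrightarrow> (0::real)" and H: "integrable lborel H" and U: "open U"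
  and z: "\<And>k x. cball x (real DIM('a) * h k) \<subseteq> U \<Longrightarrow> cv (mol (h k)) H x = 0"
 shows "AE x in lborel. x \<in> U \<longrightarrow> H x = 0"
proof -
 \<comment> \<open>Centres in \<open>V n\<close> have distance at least 1/(n+1) from the complement
   of \<open>U\<close>, so for small \<open>h k\<close> the kernels around them stay within
   \<open>U\<close>.\<close>
 define V where "V n = interior {x. cball x (1 / real (Suc n)) \<subseteq> U}" for n
 have [measurable]: "H \<in> borel_measurable borel" using H by auto
 have Vn: "AE x in lborel. indicator (V n) x * H x = 0" for n
 proof (rule integrable_zero_of_open)
  show "integrable lborel (\<lambda>x. indicator (V n) x * H x)"
   using integrable_mult_indicator[OF _ H, of "V n"] by (simp add: V_def)
  fix A :: "'a set" assume "open A"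
  then have oAV: "open (A \<inter> V n)" by (auto simp: V_def)
  then have [measurable]: "A \<inter> V n \<in> sets borel" by (rule borel_open)
  from open_indicator_approx[OF oAV] obtain f :: "nat \<Rightarrow> 'a \<Rightarrow> real" where
   f: "\<And>j. continuous_on UNIV (f j)" "\<And>j x. \<bar>f j x\<bar> \<le> 1" "\<And>j x. x \<notin> A \<inter> V n \<Longrightarrow> f j x = 0"
    "\<And>x. (\<lambda>j. f j x) \<longlonglongrightarrow> indicator (A \<inter> V n) x" by blast
  have [measurable]: "f j \<in> borel_measurable borel" for j
   by (rule borel_measurable_continuous_onI[OF f(1)])
  have fz: "(LI x. H x * f j x) = 0" for j
  proof (rule LIMSEQ_unique)
   show "(\<lambda>k. (LI x. H x * cv (mol (h k)) (f j) x)) \<longlonglongrightarrow> (LI x. H x * f j x)"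
   proof (rule integral_dominated_convergence[where w = "\<lambda>x. \<bar>H x\<bar>"])
    show "AE x in lborel. (\<lambda>k. H x * cv (mol (h k)) (f j) x) \<longlonglongrightarrow> H x * f j x"
     by (intro AE_I2 tendsto_intros cv_mol_tendsto[OF h f(1,2)])
    show "AE x in lborel. norm (H x * cv (mol (h k)) (f j) x) \<le> \<bar>H x\<bar>" for k
    proof (rule AE_I2)
     fix x
     have "\<bar>cv (mol (h k)) (f j) x\<bar> \<le> 1" by (rule cv_mol_bounded[OF h(1) _ f(2)]) simp
     then show "norm (H x * cv (mol (h k)) (f j) x) \<le> \<bar>H x\<bar>"
      by (auto simp: abs_mult intro!: mult_left_le)
    qed
   qed (use H in \<open>auto intro!: borel_measurable_times cv_measurable\<close>)
   have "eventually (\<lambda>k. real DIM('a) * h k < 1 / real (Suc n)) sequentially"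
    using order_tendstoD(2)[OF tendsto_mult_left[OF h(2), of "real DIM('a)"], of "1 / real (Suc n)"] by simp
   then have "eventually (\<lambda>k. 0 = (LI x. H x * cv (mol (h k)) (f j) x)) sequentially"
   proof eventually_elim
    case (elim k)
    have "f j x * cv (mol (h k)) H x = 0" for x
    proof (cases "x \<in> V n")
     case True
     then have "cball x (1 / real (Suc n)) \<subseteq> U" using interior_subset by (auto simp: V_def)
     then have "cball x (real DIM('a) * h k) \<subseteq> U" using elim by (meson less_imp_le order_trans subset_cball)
     then show ?thesis using z by simp
    qed (simp add: f(3))
    then have "(\<lambda>x. f j x * cv (mol (h k)) H x) = (\<lambda>x. 0)" by (rule ext)
    then show ?case using cv_adjoint[OF h(1) H, of "f j" 1 k] f(2) by simp
   qed
   then show "(\<lambda>k. (LI x. H x * cv (mol (h k)) (f j) x)) \<longlonglongrightarrow> 0"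
    by (intro Lim_transform_eventually[OF tendsto_const])
  qed
  have "(\<lambda>j. (LI x. H x * f j x)) \<longlonglongrightarrow> (LI x. H x * indicator (A \<inter> V n) x)"
  proof (rule integral_dominated_convergence[where w = "\<lambda>x. \<bar>H x\<bar>"])
   show "AE x in lborel. norm (H x * f k x) \<le> \<bar>H x\<bar>" for k
    using f(2) by (auto simp: abs_mult intro!: mult_left_le)
  qed (use H f(4) \<open>open (A \<inter> V n)\<close> in \<open>auto intro!: tendsto_intros\<close>)
  then have "(LI x. H x * indicator (A \<inter> V n) x) = 0"
   using LIMSEQ_unique by (simp add: fz) blast
  then show "(LI x. indicator A x * (indicator (V n) x * H x)) = 0"
   by (simp add: indicator_inter_arith mult_ac)
 qed
 have "AE x in lborel. \<forall>n. indicator (V n) x * H x = 0" using Vn unfolding AE_all_countable by blast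
 then show ?thesis
 proof eventually_elim
  case (elim x)
  show ?case
  proof
   assume "x \<in> U"
   then obtain r where r: "0 < r" "ball x r \<subseteq> U" using U by (auto simp: open_contains_ball)
   obtain n where n: "1 / real (Suc n) < r / 2" using r(1) nat_approx_posE[of "r / 2"] by auto
   have "ball x (r / 2) \<subseteq> {y. cball y (1 / real (Suc n)) \<subseteq> U}"
   proof clarify
    fix y z assume "y \<in> ball x (r / 2)" "z \<in> cball y (1 / real (Suc n))"
    then have "dist x z < r" using dist_triangle[of x z y] n by auto
    then show "z \<in> U" using r(2) by auto
   qed
   then have "ball x (r / 2) \<subseteq> V n" unfolding V_def by (intro interior_maximal) auto
   then have "x \<in> V n" using r(1) by auto
   then show "H x = 0" using elim[rule_format, of n] by simp
  qed
 qed
qed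

lemma mol_zero_vec:
 fixes H :: "'a::euclidean_space \<Rightarrow> 'b::euclidean_space"
 assumes h: "\<And>k. 0 < h k" "h \<longlonglongrightarrow> (0::real)" and H: "integrable lborel H" and U: "open U"
  and z: "\<And>k x. cball x (real DIM('a) * h k) \<subseteq> U \<Longrightarrow> cv (mol (h k)) H x = 0"
 shows "AE x in lborel. x \<in> U \<longrightarrow> H x = 0"
proof -
 have "AE x in lborel. x \<in> U \<longrightarrow> H x \<bullet> b = 0" if "b \<in> Basis" for b
 proof (rule mol_zero[OF h _ U])
  show "integrable lborel (\<lambda>x. H x \<bullet> b)" using H by simp
  fix k x assume sub: "cball x (real DIM('a) * h k) \<subseteq> U"
  show "cv (mol (h k)) (\<lambda>y. H y \<bullet> b) x = 0"
   using cv_inner[OF H mol_measurable mol_abs_bound[OF h(1)[of k]], where x = x and b = b] z[OF sub] by simp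
 qed
 then have "AE x in lborel. \<forall>b\<in>Basis. x \<in> U \<longrightarrow> H x \<bullet> b = 0"
  by (intro AE_finite_allI) auto
 then show ?thesis by eventually_elim (auto intro: euclidean_eqI)
qed

text \<open>
  Only translates of the kernels \<open>mol (h k)\<close> serve as test functions; with \<open>h k \<longlonglongrightarrow> 0\<close> they already
  determine a distribution.
\<close>

definition wk_grad :: "'a set \<Rightarrow> (nat \<Rightarrow> real) \<Rightarrow> ('a::euclidean_space \<Rightarrow> real) \<Rightarrow> ('a \<Rightarrow> 'a) \<Rightarrow> bool" where
 "wk_grad U h f G \<longleftrightarrow> (\<forall>k x. cball x (real DIM('a) * h k) \<subseteq> U \<longrightarrow>
   (\<forall>b\<in>Basis. (LI y. dmol (h k) b (x - y) * f y) = (LI y. mol (h k) (x - y) * (G y \<bullet> b))))"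

text \<open>Both sides are compared after mollification at x: the increment of the mollified
  function is a line integral of its derivative, for each s the weak gradient moves that derivative
  to \<open>G\<close>, and \<open>mol_zero\<close> removes the mollification. Convexity keeps the
  tube around the segment inside \<open>U\<close>.\<close>

lemma wk_grad_line:
 fixes f :: "'a::euclidean_space \<Rightarrow> real"
 assumes h: "\<And>k. 0 < h k" "h \<longlonglongrightarrow> (0::real)" and f: "integrable lborel f" and G: "integrable lborel G"
  and U: "open U" "convex U" and wk: "wk_grad U h f G"
 shows "AE y in lborel. y \<in> U \<and> y + v \<in> U \<longrightarrow>
  f (y + v) - f y = (LI s. indicator {0..1} s * (G (y + s *\<^sub>R v) \<bullet> v))"
proof -
 have [measurable]: "f \<in> borel_measurable borel" "G \<in> borel_measurable borel" using f G by auto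
 define g where "g y = G y \<bullet> v" for y
 have g: "integrable lborel g" unfolding g_def using G by auto
 then have [measurable]: "g \<in> borel_measurable borel" by auto
 define K where "K p = indicator {0..1} (snd p) * g (fst p + snd p *\<^sub>R v)" for p :: "'a \<times> real"
 have K_meas [measurable]: "K \<in> borel_measurable borel" unfolding K_def[abs_def] by measurable
 have sl: "(NI y. ennreal \<bar>K (y, s)\<bar>) = ennreal (LI x. \<bar>g x\<bar>) * indicator {0..1} s" for s
  using nn_integral_shift[of "\<lambda>x. ennreal \<bar>g x\<bar>" "s *\<^sub>R v"] g
  by (cases "s \<in> {0..1}") (simp_all add: K_def nn_integral_eq_integral)
 have K: "integrable (lborel \<Otimes>\<^sub>M lborel) K"
  by (rule integrable_prodI2) (auto simp: sl nn_integral_cmult ennreal_mult_less_top)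
 define I where "I y = (LI s. K (y, s))" for y
 have I: "integrable lborel I" unfolding I_def by (rule lborel_pair.integrable_fst'[OF K])
 define H where "H y = f (y + v) - f y - I y" for y
 have H: "integrable lborel H" unfolding H_def using f I by (auto simp: integrable_shift)
 let ?W = "U \<inter> (\<lambda>y. y + v) -` U"
 have "AE y in lborel. y \<in> ?W \<longrightarrow> H y = 0"
 proof (rule mol_zero[OF h H])
  show "open ?W" using U by (intro open_Int open_vimage continuous_intros)
  fix k x assume sub: "cball x (real DIM('a) * h k) \<subseteq> ?W"
  let ?m = "mol (h k) :: 'a \<Rightarrow> real"
  note mB = mol_abs_bound[OF h(1)[of k], where 'a='a]
  \<comment> \<open>A point near x + s v is the convex combination, with weights 1 - s and s, of a
    point near x and its translate by v.\<close>
  have seg: "cball (x + s *\<^sub>R v) (real DIM('a) * h k) \<subseteq> U" if s: "s \<in> {0..1}" for s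
  proof
   fix z assume "z \<in> cball (x + s *\<^sub>R v) (real DIM('a) * h k)"
   then have "z - s *\<^sub>R v \<in> cball x (real DIM('a) * h k)" by (simp add: dist_norm algebra_simps)
   then have "z - s *\<^sub>R v \<in> U" "z - s *\<^sub>R v + v \<in> U" using sub by auto
   then have "(1 - s) *\<^sub>R (z - s *\<^sub>R v) + s *\<^sub>R (z - s *\<^sub>R v + v) \<in> U"
    using s U(2) by (intro convexD) auto
   then show "z \<in> U" by (simp add: algebra_simps)
  qed
  have cont: "continuous_on UNIV (\<lambda>x. dmol (h k) v (x :: 'a))"
   unfolding dmol_sum[of _ v] by (intro continuous_intros dmol_continuous) auto
  obtain B where B: "\<And>b x. b \<in> Basis \<Longrightarrow> \<bar>dmol (h k) b (x::'a)\<bar> \<le> B" using dmol_bounded[OF h(1)] by metis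
  define C where "C = (\<Sum>b\<in>Basis. \<bar>v \<bullet> b\<bar> * B)"
  have C: "\<bar>dmol (h k) v x\<bar> \<le> C" for x :: 'a
   unfolding dmol_sum[of _ v] C_def
   by (intro order_trans[OF sum_abs] sum_mono) (auto simp: abs_mult intro!: mult_left_mono B)
  have [measurable]: "(\<lambda>x. dmol (h k) v (x :: 'a)) \<in> borel_measurable borel"
   using cont by (rule borel_measurable_continuous_onI)
  have C0: "0 \<le> C" using C[of 0] by linarith
  define P where "P p = f (fst p) * (dmol (h k) v (x + snd p *\<^sub>R v - fst p) * indicator {0..1} (snd p))" for p :: "'a \<times> real"
  have Pm [measurable]: "P \<in> borel_measurable borel" unfolding P_def[abs_def] by measurable
  have P: "integrable (lborel \<Otimes>\<^sub>M lborel) P"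
  proof (rule integrable_prodI[OF Pm])
   have "(NI s. ennreal (norm (P (y, s)))) \<le> ennreal C * ennreal \<bar>f y\<bar>" for y
   proof -
    have "(NI s. ennreal (norm (P (y, s)))) \<le> (NI s. ennreal (C * \<bar>f y\<bar>) * indicator {0..1::real} s)"
     using C by (intro nn_integral_mono) (auto simp: P_def abs_mult mult.commute[of C] intro!: ennreal_leI mult_left_mono split: split_indicator)
    then show ?thesis using C0 by (simp add: nn_integral_cmult ennreal_mult)
   qed
   then have "(NI y. (NI s. ennreal (norm (P (y, s))))) \<le> (NI y. ennreal C * ennreal \<bar>f y\<bar>)"
    by (intro nn_integral_mono)
   also have "... < \<infinity>" using f by (auto simp: nn_integral_cmult integrable_iff_bounded ennreal_mult_less_top)
   finally show "(NI y. (NI s. ennreal (norm (P (y, s))))) < \<infinity>" .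
  qed
  have "cv ?m f (x + v) - cv ?m f x = (LI y. ?m (x + v - y) * f y - ?m (x - y) * f y)"
   using integrable_mol_kernel[OF f h(1)[of k], of "x + v"] integrable_mol_kernel[OF f h(1)[of k], of x]
   by (simp add: cv_def)
  also have "... = (LI y. (LI s. P (y, s)))"
  proof (rule Bochner_Integration.integral_cong[OF refl])
   fix y
   show "?m (x + v - y) * f y - ?m (x - y) * f y = (LI s. P (y, s))"
   proof -
    have "(LI s. dmol (h k) v (x + s *\<^sub>R v - y) * indicator {0..1} s) = ?m (x + v - y) - ?m (x - y)"
    proof -
     have "x - y + v = x + v - y" "x - y + s *\<^sub>R v = x + s *\<^sub>R v - y" for s by simp_all
     then show ?thesis
      using FTC_segment[of ?m "\<lambda>x v. dmol (h k) v x" v "x - y", OF mol_has_derivative cont]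
      by (simp only:)
    qed
    then show ?thesis by (simp add: P_def left_diff_distrib mult.commute[of "f y"])
   qed
  qed
  also have "... = (LI s. (LI y. P (y, s)))" by (rule integral_swap[OF P])
  \<comment> \<open>For fixed s the weak gradient is used at the centre x + s v; shifting the
    integration variable by s v then moves the offset from the kernel into \<open>K\<close>.\<close>
  also have "... = (LI s. (LI y. ?m (x - y) * K (y, s)))"
  proof (rule Bochner_Integration.integral_cong[OF refl])
   fix s :: real
   show "(LI y. P (y, s)) = (LI y. ?m (x - y) * K (y, s))"
   proof (cases "s \<in> {0..1}")
    case True
    have ib: "integrable lborel (\<lambda>y. dmol (h k) b (x + s *\<^sub>R v - y) * f y)" if "b \<in> Basis" for b
     using integrable_dmol_kernel[OF f h(1)[of k] that, of "x + s *\<^sub>R v"] by simp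
    have ig: "integrable lborel (\<lambda>y. ?m (x + s *\<^sub>R v - y) * (G y \<bullet> b))" for b
     using integrable_mol_kernel[of "\<lambda>y. G y \<bullet> b", OF _ h(1)[of k], of "x + s *\<^sub>R v"] G by simp
    have "(LI y. P (y, s)) = (LI y. (\<Sum>b\<in>Basis. (v \<bullet> b) * (dmol (h k) b (x + s *\<^sub>R v - y) * f y)))"
     using True by (simp add: P_def dmol_sum[of _ v] sum_distrib_left mult_ac)
    also have "... = (\<Sum>b\<in>Basis. (v \<bullet> b) * (LI y. dmol (h k) b (x + s *\<^sub>R v - y) * f y))"
     using ib by (subst Bochner_Integration.integral_sum) auto
    also have "... = (\<Sum>b\<in>Basis. (v \<bullet> b) * (LI y. ?m (x + s *\<^sub>R v - y) * (G y \<bullet> b)))"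
     using wk seg[OF True] by (simp add: wk_grad_def)
    also have "... = (LI y. (\<Sum>b\<in>Basis. (v \<bullet> b) * (?m (x + s *\<^sub>R v - y) * (G y \<bullet> b))))"
     using ig by (subst Bochner_Integration.integral_sum) auto
    also have "... = (LI y. ?m (x + s *\<^sub>R v - y) * g y)"
     by (simp add: g_def euclidean_inner[of _ v] sum_distrib_left mult_ac)
    also have "... = (LI y. ?m (x + s *\<^sub>R v - (y + s *\<^sub>R v)) * g (y + s *\<^sub>R v))"
     using integral_shift[of "\<lambda>y. ?m (x + s *\<^sub>R v - y) * g y" "s *\<^sub>R v"] by simp
    also have "... = (LI y. ?m (x - y) * K (y, s))"
     using True by (simp add: K_def)
    finally show ?thesis .
   qed (simp add: P_def K_def)
  qed
  also have "... = (LI y. (LI s. ?m (x - y) * K (y, s)))"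
  proof -
   have "integrable (lborel \<Otimes>\<^sub>M lborel) (\<lambda>p. ?m (x - fst p) *\<^sub>R K p)"
    by (rule integrable_bounded_scale[OF K _ mB]) (simp add: lborel_prod)
   from integral_swap[OF this] show ?thesis by simp
  qed
  also have "... = cv ?m I x" by (simp add: cv_def I_def)
  finally have "cv ?m f (x + v) - cv ?m f x - cv ?m I x = 0" by simp
  moreover have "cv ?m (\<lambda>y. f (y + v)) x = cv ?m f (x + v)"
   using integral_shift[of "\<lambda>y. ?m (x + v - y) * f y" v] by (simp add: cv_def)
  ultimately show "cv ?m H x = 0"
   unfolding H_def
   using cv_diff[of "\<lambda>y. f (y + v) - f y" I ?m, OF _ I _ mB]
    cv_diff[of "\<lambda>y. f (y + v)" f ?m, OF _ f _ mB] f
   by (simp add: integrable_shift)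
 qed
 then show ?thesis
  by eventually_elim (auto simp: H_def I_def K_def g_def mult.commute)
qed

section \<open>Functions with square integrable gradient\<close>

lemma powr_diff_le:
 fixes a b :: real
 assumes "0 \<le> a" "0 \<le> b" "0 < q" "q \<le> 1"
 shows "\<bar>a powr q - b powr q\<bar> \<le> \<bar>a - b\<bar> powr q"
proof -
 have sub: "(u + v) powr q \<le> u powr q + v powr q" if "0 \<le> u" "0 \<le> v" for u v :: real
 proof (cases "u + v = 0")
  case False
  then have p: "0 < u + v" using that by simp
  have t: "t \<le> t powr q" if "0 \<le> t" "t \<le> 1" for t :: real
   using powr_mono'[of q 1 t] assms that by (cases "t = 0") auto
  have "1 = u / (u + v) + v / (u + v)" using p by (simp add: add_divide_distrib[symmetric])
  also have "... \<le> (u / (u + v)) powr q + (v / (u + v)) powr q"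
   using that p by (intro add_mono t) auto
  also have "... = (u powr q + v powr q) / (u + v) powr q"
   using that p by (simp add: powr_divide add_divide_distrib)
  finally show ?thesis using p by (simp add: field_simps)
 qed (use that in auto)
 show ?thesis
 proof (cases "a \<le> b")
  case True
  then have "a powr q \<le> b powr q" using assms by (intro powr_mono2) auto
  then show ?thesis using sub[of a "b - a"] assms True by simp
 next
  case False
  then have "b powr q \<le> a powr q" using assms by (intro powr_mono2) auto
  then show ?thesis using sub[of b "a - b"] assms False by simp
 qed
qed

text \<open>The intermediate point is located in two ways: its distance to \<open>a\<close> enters
  the Taylor remainder, its bound by the maximum enters the comparison of pressures.\<close>

lemma powr_MVT:
 fixes a b :: real
 assumes "0 \<le> a" "0 \<le> b" "0 < q"
 shows "\<exists>z\<ge>0. \<bar>z - a\<bar> \<le> \<bar>b - a\<bar> \<and> z \<le> max a b \<and> b powr (1 + q) - a powr (1 + q) = (1 + q) * z powr q * (b - a)"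
proof -
 have mv: "\<exists>z. l < z \<and> z < u \<and> u powr (1 + q) - l powr (1 + q) = (1 + q) * z powr q * (u - l)"
  if "0 \<le> l" "l < u" for l u :: real
 proof -
  have c: "continuous_on {l..u} (\<lambda>x. x powr (1 + q))"
   using that assms by (intro continuous_on_powr') auto
  have d: "((\<lambda>x. x powr (1 + q)) has_derivative (\<lambda>h. (1 + q) * x powr q * h)) (at x)" if "l < x" for x
   using has_real_derivative_powr[of x "1 + q"] that \<open>0 \<le> l\<close> by (simp add: has_field_derivative_def)
  show ?thesis by (rule mvt[OF that(2) c d]) auto
 qed
 consider "a < b" | "b < a" | "a = b" by linarith
 then show ?thesis
 proof cases
  case 1
  with mv[of a b] assms obtain z where "a < z" "z < b" "b powr (1 + q) - a powr (1 + q) = (1 + q) * z powr q * (b - a)" by auto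
  then show ?thesis using assms by (intro exI[of _ z]) auto
 next
  case 2
  with mv[of b a] assms obtain z where z: "b < z" "z < a" "a powr (1 + q) - b powr (1 + q) = (1 + q) * z powr q * (a - b)" by auto
  have "b powr (1 + q) - a powr (1 + q) = - (a powr (1 + q) - b powr (1 + q))" by simp
  also have "... = (1 + q) * z powr q * (b - a)" unfolding z(3) by (simp add: algebra_simps)
  finally show ?thesis using z assms by (intro exI[of _ z]) auto
 next
  case 3
  then show ?thesis using assms by (intro exI[of _ a]) auto
 qed
qed

text \<open>The derivative (1 + q) x^q is Hoelder continuous with exponent q on the half line, the
  vacuum x = 0 included.\<close>

lemma powr_Taylor:
 fixes a b :: real
 assumes "0 \<le> a" "0 \<le> b" "0 < q" "q \<le> 1"
 shows "\<bar>b powr (1 + q) - a powr (1 + q) - (1 + q) * a powr q * (b - a)\<bar> \<le> (1 + q) * \<bar>b - a\<bar> powr (1 + q)"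
proof -
 obtain z where z: "0 \<le> z" "\<bar>z - a\<bar> \<le> \<bar>b - a\<bar>"
  "b powr (1 + q) - a powr (1 + q) = (1 + q) * z powr q * (b - a)"
  using powr_MVT[OF assms(1-3)] by blast
 have "\<bar>b powr (1 + q) - a powr (1 + q) - (1 + q) * a powr q * (b - a)\<bar> = (1 + q) * (\<bar>z powr q - a powr q\<bar> * \<bar>b - a\<bar>)"
 proof -
  have "(1 + q) * z powr q * (b - a) - (1 + q) * a powr q * (b - a) = (1 + q) * ((z powr q - a powr q) * (b - a))"
   by (simp add: algebra_simps)
  then show ?thesis unfolding z(3) using assms by (simp add: abs_mult)
 qed
 also have "... \<le> (1 + q) * (\<bar>b - a\<bar> powr q * \<bar>b - a\<bar>)"
 proof (intro mult_left_mono mult_right_mono)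
  have "\<bar>z powr q - a powr q\<bar> \<le> \<bar>z - a\<bar> powr q" using z assms by (intro powr_diff_le) auto
  also have "... \<le> \<bar>b - a\<bar> powr q" using z assms by (intro powr_mono2) auto
  finally show "\<bar>z powr q - a powr q\<bar> \<le> \<bar>b - a\<bar> powr q" .
 qed (use assms in auto)
 also have "\<bar>b - a\<bar> powr q * \<bar>b - a\<bar> = \<bar>b - a\<bar> powr (1 + q)"
  by (cases "b = a") (auto simp: powr_add)
 finally show ?thesis .
qed

lemma norm_integral_le_nn_integral:
 fixes f :: "'a \<Rightarrow> 'b::{banach, second_countable_topology}"
 shows "ennreal (norm (\<integral>x. f x \<partial>M)) \<le> (\<integral>\<^sup>+x. ennreal (norm (f x)) \<partial>M)"
 by (cases "integrable M f") (simp_all add: integral_norm_bound_ennreal not_integrable_integral_eq)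

lemma integrable_nonneg_bound:
 fixes f g :: "'a \<Rightarrow> real"
 assumes "integrable M g" "f \<in> borel_measurable M" "\<And>x. 0 \<le> f x" "\<And>x. f x \<le> g x"
 shows "integrable M f"
proof (rule Bochner_Integration.integrable_bound[OF assms(1,2)])
 show "AE x in M. norm (f x) \<le> norm (g x)"
  using assms(3,4) by (intro AE_I2) (simp add: abs_of_nonneg order_trans[OF assms(3,4)])
qed

lemma abs_mult_le_squares: "\<bar>u * v\<bar> \<le> u\<^sup>2 + (v::real)^2"
proof -
 have "2 * (\<bar>u\<bar> * \<bar>v\<bar>) \<le> u\<^sup>2 + v\<^sup>2" using sum_squares_bound[of "\<bar>u\<bar>" "\<bar>v\<bar>"] by simp
 moreover have "0 \<le> \<bar>u\<bar> * \<bar>v\<bar>" by simp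
 ultimately show ?thesis unfolding abs_mult by linarith
qed

lemma integrable_mult_of_squares:
 fixes u v :: "'a \<Rightarrow> real"
 assumes [measurable]: "u \<in> borel_measurable M" "v \<in> borel_measurable M"
  and "integrable M (\<lambda>x. (u x)^2)" "integrable M (\<lambda>x. (v x)^2)"
 shows "integrable M (\<lambda>x. u x * v x)"
proof (rule Bochner_Integration.integrable_bound)
 show "integrable M (\<lambda>x. (u x)^2 + (v x)^2)" using assms by auto
 have "norm (u x * v x) \<le> norm ((u x)^2 + (v x)^2)" for x
  using abs_mult_le_squares[of "u x" "v x"] by simp
 then show "AE x in M. norm (u x * v x) \<le> norm ((u x)^2 + (v x)^2)" by simp
qed simp

lemma powr_le_one_plus:
 fixes x :: real assumes "0 \<le> x" "0 \<le> q" "q \<le> 1" shows "x powr q \<le> 1 + x"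
proof (cases "x \<le> 1")
 case True
 then have "x powr q \<le> 1" using assms by (intro powr_le1) auto
 then show ?thesis using assms by linarith
next
 case False
 then have "x powr q \<le> x powr 1" using assms by (intro powr_mono) auto
 then show ?thesis using False by simp
qed

text \<open>A nonnegative function in L1 and H1, whose gradient enters through increments along
  lines: translation estimates and the chain rule follow from them directly. One constant
  \<open>A\<close> bounds all norms, so that later constants depend on \<open>A\<close> alone and
  are uniform in time and in \<epsilon>.\<close>

locale sobolev =
 fixes f :: "'a::euclidean_space \<Rightarrow> real" and G :: "'a \<Rightarrow> 'a" and A :: real
 assumes f_nonneg: "\<And>x. 0 \<le> f x"
  and f_int: "integrable lborel f" and f_L1: "(LI x. f x) \<le> A"
  and f_sq: "integrable lborel (\<lambda>x. (f x)^2)" and f_L2: "(LI x. (f x)^2) \<le> A"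
  and G_meas [measurable]: "G \<in> borel_measurable borel"
  and G_sq: "integrable lborel (\<lambda>x. (norm (G x))^2)" and G_L2: "(LI x. (norm (G x))^2) \<le> A"
  and line: "\<And>v. AE y in lborel. f (y + v) - f y = (LI s. indicator {0..1} s * (G (y + s *\<^sub>R v) \<bullet> v))"
begin

lemma f_meas [measurable]: "f \<in> borel_measurable borel" using f_int by auto

lemma A_nonneg: "0 \<le> A"
 using f_L2 Bochner_Integration.integral_nonneg[of lborel "\<lambda>x. (f x)^2"] by (meson order_trans zero_le_power2)

text \<open>Cauchy-Schwarz in the line parameter, then Fubini and the translation invariance of the
  L2 norm of \<open>G\<close>.\<close>

lemma translation:
 shows "integrable lborel (\<lambda>y. (f (y + v) - f y)^2)" and "(LI y. (f (y + v) - f y)^2) \<le> (norm v)^2 * A"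
proof -
 have sl: "(NI y. ennreal ((norm (G (y + s *\<^sub>R v)))^2)) \<le> ennreal A" for s
  using nn_integral_shift[of "\<lambda>y. ennreal ((norm (G y))^2)" "s *\<^sub>R v"] G_sq G_L2
  by (simp add: nn_integral_eq_integral ennreal_leI)
 have "(NI y. ennreal ((f (y + v) - f y)^2))
   \<le> (NI y. (NI s. indicator {0..1::real} s * ennreal ((norm v)^2 * (norm (G (y + s *\<^sub>R v)))^2)))"
 proof (rule nn_integral_mono_AE)
  show "AE y in lborel. ennreal ((f (y + v) - f y)^2)
   \<le> (NI s. indicator {0..1::real} s * ennreal ((norm v)^2 * (norm (G (y + s *\<^sub>R v)))^2))"
   using line[of v]
  proof eventually_elim
   case (elim y)
   let ?k = "\<lambda>s::real. ennreal (norm v * norm (G (y + s *\<^sub>R v)))"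
   have "ennreal \<bar>f (y + v) - f y\<bar> \<le> (NI s. ennreal (norm (indicator {0..1} s * (G (y + s *\<^sub>R v) \<bullet> v))))"
    using norm_integral_le_nn_integral[of lborel "\<lambda>s. indicator {0..1} s * (G (y + s *\<^sub>R v) \<bullet> v)"]
    by (simp add: elim)
   also have "... \<le> (NI s. indicator {0..1::real} s * (indicator {0..1::real} s * ?k s))"
   proof (intro nn_integral_mono)
    fix s :: real
    have "\<bar>G (y + s *\<^sub>R v) \<bullet> v\<bar> \<le> norm v * norm (G (y + s *\<^sub>R v))"
     using Cauchy_Schwarz_ineq2[of "G (y + s *\<^sub>R v)" v] by (simp add: mult.commute)
    then show "ennreal (norm (indicator {0..1} s * (G (y + s *\<^sub>R v) \<bullet> v))) \<le> indicator {0..1::real} s * (indicator {0..1::real} s * ?k s)"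
     by (auto simp: indicator_def intro: ennreal_leI)
   qed
   finally have "ennreal \<bar>f (y + v) - f y\<bar> ^ 2 \<le> (...) ^ 2" by (rule power_mono) simp
   also have "... \<le> (NI s. (indicator {0..1::real} s) ^ 2) * (NI s. (indicator {0..1::real} s * ?k s) ^ 2)"
    by (intro Cauchy_Schwarz_nn_integral) auto
   also have "(NI s. (indicator {0..1::real} s) ^ 2) = (NI s. (indicator {0..1::real} s))"
    by (intro nn_integral_cong) (auto simp: indicator_def)
   also have "(NI s. (indicator {0..1::real} s)) = 1" by simp
   also have "(NI s. (indicator {0..1::real} s * ?k s) ^ 2)
    = (NI s. indicator {0..1::real} s * ennreal ((norm v)^2 * (norm (G (y + s *\<^sub>R v)))^2))"
    by (intro nn_integral_cong) (auto simp: indicator_def ennreal_power power_mult_distrib)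
   finally show ?case by (simp add: ennreal_power)
  qed
 qed
 also have "... = (NI s. (NI y. indicator {0..1::real} s * ennreal ((norm v)^2 * (norm (G (y + s *\<^sub>R v)))^2)))"
  using nn_integral_swap[of "\<lambda>p. indicator {0..1::real} (snd p) * ennreal ((norm v)^2 * (norm (G (fst p + snd p *\<^sub>R v)))^2)"] by simp
 also have "... \<le> (NI s. indicator {0..1::real} s * ennreal ((norm v)^2 * A))"
 proof (intro nn_integral_mono)
  fix s :: real
  have "(NI y. indicator {0..1::real} s * ennreal ((norm v)^2 * (norm (G (y + s *\<^sub>R v)))^2))
    = indicator {0..1::real} s * (ennreal ((norm v)^2) * (NI y. ennreal ((norm (G (y + s *\<^sub>R v)))^2)))"
   by (simp add: nn_integral_cmult ennreal_mult)
  also have "... \<le> indicator {0..1::real} s * (ennreal ((norm v)^2) * ennreal A)"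
   by (intro mult_left_mono sl) auto
  finally show "(NI y. indicator {0..1::real} s * ennreal ((norm v)^2 * (norm (G (y + s *\<^sub>R v)))^2))
    \<le> indicator {0..1::real} s * ennreal ((norm v)^2 * A)"
   using A_nonneg by (simp add: ennreal_mult)
 qed
 also have "... = ennreal ((norm v)^2 * A)" by (simp add: nn_integral_multc)
 finally have b: "(NI y. ennreal ((f (y + v) - f y)^2)) \<le> ennreal ((norm v)^2 * A)" .
 show i: "integrable lborel (\<lambda>y. (f (y + v) - f y)^2)"
  using b by (intro integrableI_bounded) (auto intro: le_less_trans)
 show "(LI y. (f (y + v) - f y)^2) \<le> (norm v)^2 * A"
  using b A_nonneg nn_integral_eq_integral[OF i] by (simp add: ennreal_le_iff)
qed

lemma powr_integrable:
 assumes "0 \<le> q" "q \<le> 1"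
 shows "integrable lborel (\<lambda>y. f y powr (1 + q))"
proof (rule integrable_nonneg_bound)
 show "integrable lborel (\<lambda>y. f y + (f y)^2)" using f_int f_sq by auto
 show "f y powr (1 + q) \<le> f y + (f y)^2" for y
 proof -
  have "f y powr (1 + q) = f y * f y powr q" using f_nonneg[of y] by (cases "f y = 0") (auto simp: powr_add)
  also have "... \<le> f y * (1 + f y)" using f_nonneg[of y] assms by (intro mult_left_mono powr_le_one_plus) auto
  finally show ?thesis by (simp add: algebra_simps power2_eq_square)
 qed
qed auto

lemma weight_sq_integrable:
 assumes "0 < h" "0 \<le> q" "q \<le> 1"
 shows "integrable lborel (\<lambda>y. (mol h (x - y) * f y powr q)^2)"
proof (rule integrable_nonneg_bound)
 let ?M = "molB TYPE('a) / h ^ DIM('a)"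
 show "integrable lborel (\<lambda>y. 2 * ?M * mol h (x - y) + 2 * ?M\<^sup>2 * (f y)^2)"
  using f_sq mol_integrable[OF assms(1), where 'a='a] by (auto simp: integrable_reflect)
 show "(mol h (x - y) * f y powr q)^2 \<le> 2 * ?M * mol h (x - y) + 2 * ?M\<^sup>2 * (f y)^2" for y
 proof -
  have m: "0 \<le> mol h (x - y)" "mol h (x - y) \<le> ?M" using mol_nonneg mol_bound assms by auto
  have "(f y powr q)^2 \<le> (1 + f y)^2"
   using powr_le_one_plus[of "f y" q] f_nonneg[of y] assms by (intro power_mono) auto
  also have "... \<le> 2 + 2 * (f y)^2" using sum_squares_bound[of 1 "f y"] by (simp add: power2_sum)
  finally have "(mol h (x - y) * f y powr q)^2 \<le> (mol h (x - y))^2 * (2 + 2 * (f y)^2)"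
   by (simp add: power_mult_distrib mult_left_mono)
  also have "... = 2 * (mol h (x - y) * mol h (x - y)) + 2 * ((mol h (x - y))^2 * (f y)^2)"
   by (simp add: algebra_simps power2_eq_square)
  also have "... \<le> 2 * (?M * mol h (x - y)) + 2 * (?M\<^sup>2 * (f y)^2)"
   using m by (intro add_mono mult_left_mono mult_right_mono power_mono) auto
  finally show ?thesis by (simp add: mult.assoc)
 qed
qed auto

lemma mol_kernel_translate:
 assumes h: "0 < h" and b: "b \<in> Basis" and B: "\<And>z::'a. \<bar>dmol h b z\<bar> \<le> B"
 shows "\<bar>mol h (z + t *\<^sub>R b) - mol h (z::'a)\<bar> \<le> \<bar>t\<bar> * B"
proof -
 have cont: "continuous_on UNIV (\<lambda>x::'a. dmol h (t *\<^sub>R b) x)"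
  unfolding dmol_sum[of _ "t *\<^sub>R b"] by (intro continuous_intros dmol_continuous) auto
 have lin: "dmol h (t *\<^sub>R b) x = t * dmol h b x" for x :: 'a
  using linear_scale[OF has_derivative_linear[OF mol_has_derivative]] by simp
 have B0: "0 \<le> B" using B[of 0] by linarith
 have "mol h (z + t *\<^sub>R b) - mol h z = (LI s. dmol h (t *\<^sub>R b) (z + s *\<^sub>R t *\<^sub>R b) * indicator {0..1} s)"
  using FTC_segment[of "mol h" "\<lambda>x v. dmol h v x" "t *\<^sub>R b" z, OF mol_has_derivative cont] by simp
 also have "norm ... \<le> (LI s. norm (dmol h (t *\<^sub>R b) (z + s *\<^sub>R t *\<^sub>R b) * indicator {0..1} s))"
  by (rule integral_norm_bound)
 also have "... \<le> (LI s. (\<bar>t\<bar> * B) * indicator {0..1::real} s)"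
 proof (rule integral_mono)
  have "integrable lborel (\<lambda>s::real. indicator {0..1} s *\<^sub>R dmol h (t *\<^sub>R b) (z + s *\<^sub>R t *\<^sub>R b))"
   by (intro borel_integrable_compact continuous_on_compose2[OF cont] continuous_intros) auto
  then show "integrable lborel (\<lambda>s::real. norm (dmol h (t *\<^sub>R b) (z + s *\<^sub>R t *\<^sub>R b) * indicator {0..1} s))"
   by (intro integrable_norm) (simp add: mult.commute)
  show "norm (dmol h (t *\<^sub>R b) (z + s *\<^sub>R t *\<^sub>R b) * indicator {0..1} s) \<le> (\<bar>t\<bar> * B) * indicator {0..1} s" for s
   using B B0 by (auto simp: lin abs_mult indicator_def intro!: mult_left_mono)
 qed auto
 finally show ?thesis by simp
qed

text \<open>
  Since \<open>q < 1\<close> the power is not twice differentiable at the vacuum. Its Taylor remainder is still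
  \<open>O(\<bar>\<delta>f\<bar>\<^sup>1\<^sup>+\<^sup>q)\<close>, which is \<open>o(h)\<close> after integration as difference quotients of \<open>f\<close> are bounded in \<open>L\<^sup>2\<close>.
\<close>

lemma chain_rule:
 fixes h q :: real
 assumes h: "0 < h" and b: "b \<in> Basis" and q: "0 < q" "q \<le> 1 / 2"
 shows "(LI y. dmol h b (x - y) * f y powr (1 + q))
  = (LI y. mol h (x - y) * ((1 + q) * f y powr q * (G y \<bullet> b)))"
proof -
 let ?M = "molB TYPE('a) / h ^ DIM('a)"
 obtain B where B: "0 < B" "\<And>z::'a. \<bar>dmol h b z\<bar> \<le> B" using dmol_bounded[OF h] b by blast
 define psi where "psi y = mol h (x - y)" for y
 define Phi where "Phi y = f y powr (1 + q)" for y
 define s where "s n = 1 / real (Suc n)" for n :: nat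
 define d where "d n y = (f (y + s n *\<^sub>R b) - f y) / s n" for n y
 define W where "W y = psi y * f y powr q" for y
 define g where "g y = G y \<bullet> b" for y
 have s: "0 < s n" "s n \<le> 1" for n by (auto simp: s_def)
 have s0: "s \<longlonglongrightarrow> 0" unfolding s_def[abs_def] by (rule LIMSEQ_Suc[OF lim_1_over_n])
 have psi: "0 \<le> psi y" "psi y \<le> ?M" for y using mol_nonneg[OF h] mol_bound[OF h] by (auto simp: psi_def)
 have M: "0 \<le> ?M" using psi order_trans by blast
 have psi_int: "integrable lborel psi" and psi_1: "(LI y. psi y) = 1"
  using mol_integrable[OF h, where 'a='a] integral_reflect[of "mol h" x] mol_integral[OF h, where 'a='a]
  by (auto simp: psi_def[abs_def] integrable_reflect)
 have psi_diff: "\<bar>psi (y - t *\<^sub>R b) - psi y\<bar> \<le> \<bar>t\<bar> * B" for y t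
  using mol_kernel_translate[OF h b B(2), of "x - y" t] by (simp add: psi_def algebra_simps)
 have [measurable]: "psi \<in> borel_measurable borel" "Phi \<in> borel_measurable borel" "g \<in> borel_measurable borel"
  "W \<in> borel_measurable borel" "d n \<in> borel_measurable borel" for n
  unfolding psi_def[abs_def] Phi_def[abs_def] g_def[abs_def] W_def[abs_def] d_def[abs_def] by measurable
 have Phi: "integrable lborel Phi" using powr_integrable[of q] q by (simp add: Phi_def[abs_def])
 have W2: "integrable lborel (\<lambda>y. (W y)^2)"
  using weight_sq_integrable[OF h, of q x] q by (simp add: W_def[abs_def] psi_def[abs_def])
 have g_le: "(g y)^2 \<le> (norm (G y))^2" for y
  using Basis_le_norm[OF b, of "G y"] by (simp add: g_def abs_le_square_iff[symmetric])
 have g2: "integrable lborel (\<lambda>y. (g y)^2)"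
  by (rule integrable_nonneg_bound[OF G_sq]) (auto simp: g_le)
 have g2A: "(LI y. (g y)^2) \<le> A"
  using integral_mono[OF g2 G_sq g_le] G_L2 by linarith
 have f2A: "(LI y. (f y)^2) \<le> A" by (rule f_L2)
 have e2: "integrable lborel (\<lambda>y. ((f (y + v) - f y) / c)^2)" for v c
  using translation(1)[of v] by (simp add: power_divide)
 have e2A: "(LI y. ((f (y + v) - f y) / c)^2) \<le> A" if "norm v \<le> c" "0 < c" for v c
 proof -
  have "(LI y. ((f (y + v) - f y) / c)^2) = (LI y. (f (y + v) - f y)^2) / c\<^sup>2"
   by (simp add: power_divide)
  also have "... \<le> ((norm v)^2 * A) / c\<^sup>2"
   using translation(2)[of v] by (intro divide_right_mono) auto
  also have "... \<le> (c\<^sup>2 * A) / c\<^sup>2"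
   using that A_nonneg by (intro divide_right_mono mult_right_mono power_mono) auto
  also have "... = A" using that by simp
  finally show ?thesis .
 qed
 have nb: "norm (t *\<^sub>R b) = \<bar>t\<bar>" for t using b by simp
 \<comment> \<open>This is where q \<le> 1/2 enters, through the comparison with
   \<open>sqrt (s n)\<close>. In the application to the pressure q is 1/(2r) with r \<ge> 1.\<close>
 have spq: "0 < s n powr q" "s n \<le> s n powr q" "sqrt (s n) \<le> s n powr q" for n
  using s[of n] q powr_mono'[of q 1 "s n"] powr_mono'[of q "1/2" "s n"] by (auto simp: powr_half_sqrt)
 \<comment> \<open>Discrete integration by parts: a translation moves the difference quotient from
   the kernel to the power of \<open>f\<close>.\<close>
 have step2: "(LI y. Phi y * ((psi (y - s n *\<^sub>R b) - psi y) / s n))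
   = (LI y. psi y * ((Phi (y + s n *\<^sub>R b) - Phi y) / s n))" for n
 proof -
  have i1: "integrable lborel (\<lambda>y. psi y * Phi y)"
   using integrable_mol_kernel[OF Phi h, of x] by (simp add: psi_def)
  have i2: "integrable lborel (\<lambda>y. psi (y - s n *\<^sub>R b) * Phi y)"
   using integrable_mol_kernel[OF Phi h, of "x + s n *\<^sub>R b"] by (simp add: psi_def algebra_simps)
  have i3: "integrable lborel (\<lambda>y. psi y * Phi (y + s n *\<^sub>R b))"
   using integrable_mol_kernel[of "\<lambda>y. Phi (y + s n *\<^sub>R b)" h x] Phi h by (simp add: psi_def integrable_shift)
  have "(LI y. Phi y * ((psi (y - s n *\<^sub>R b) - psi y) / s n))
   = (LI y. (psi (y - s n *\<^sub>R b) * Phi y - psi y * Phi y) / s n)"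
   by (intro Bochner_Integration.integral_cong refl) (simp add: algebra_simps)
  also have "... = ((LI y. psi (y - s n *\<^sub>R b) * Phi y) - (LI y. psi y * Phi y)) / s n"
   using i1 i2 by simp
  also have "(LI y. psi (y - s n *\<^sub>R b) * Phi y) = (LI y. psi y * Phi (y + s n *\<^sub>R b))"
   using integral_shift[of "\<lambda>y. psi (y - s n *\<^sub>R b) * Phi y" "s n *\<^sub>R b"] by simp
  also have "((LI y. psi y * Phi (y + s n *\<^sub>R b)) - (LI y. psi y * Phi y)) / s n
   = (LI y. (psi y * Phi (y + s n *\<^sub>R b) - psi y * Phi y) / s n)"
   using i1 i3 by simp
  also have "... = (LI y. psi y * ((Phi (y + s n *\<^sub>R b) - Phi y) / s n))"
   by (intro Bochner_Integration.integral_cong refl) (simp add: algebra_simps)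
  finally show ?thesis .
 qed
 have lim1: "(\<lambda>n. (LI y. Phi y * ((psi (y - s n *\<^sub>R b) - psi y) / s n))) \<longlonglongrightarrow> (LI y. Phi y * dmol h b (x - y))"
 proof (rule integral_dominated_convergence[where w = "\<lambda>y. B * Phi y"])
  show "AE y in lborel. (\<lambda>n. Phi y * ((psi (y - s n *\<^sub>R b) - psi y) / s n)) \<longlonglongrightarrow> Phi y * dmol h b (x - y)"
  proof (intro AE_I2 tendsto_mult_left)
   fix y
   have "((\<lambda>t. mol h (x - y + t *\<^sub>R b)) has_derivative (\<lambda>t. dmol h (t *\<^sub>R b) (x - y + 0 *\<^sub>R b))) (at 0)"
    by (rule has_derivative_compose[OF _ mol_has_derivative]) (auto intro!: derivative_eq_intros)
   moreover have "dmol h (t *\<^sub>R b) (x - y) = dmol h b (x - y) * t" for t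
    using linear_scale[OF has_derivative_linear[OF mol_has_derivative]] by (simp add: mult.commute)
   ultimately have "((\<lambda>t. mol h (x - y + t *\<^sub>R b)) has_real_derivative dmol h b (x - y)) (at 0)"
    by (simp add: has_field_derivative_def)
   then have "((\<lambda>t. (mol h (x - y + t *\<^sub>R b) - mol h (x - y)) / t) \<longlongrightarrow> dmol h b (x - y)) (at 0)"
    by (simp add: has_field_derivative_iff)
   moreover have "filterlim s (at 0) sequentially"
    using s0 s(1) by (auto simp: filterlim_at less_imp_neq[THEN not_sym] intro!: always_eventually)
   ultimately have "(\<lambda>n. (mol h (x - y + s n *\<^sub>R b) - mol h (x - y)) / s n) \<longlonglongrightarrow> dmol h b (x - y)"
    by (rule filterlim_compose)
   then show "(\<lambda>n. (psi (y - s n *\<^sub>R b) - psi y) / s n) \<longlonglongrightarrow> dmol h b (x - y)"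
    by (simp add: psi_def algebra_simps)
  qed
  show "AE y in lborel. norm (Phi y * ((psi (y - s n *\<^sub>R b) - psi y) / s n)) \<le> B * Phi y" for n
  proof (intro AE_I2)
   fix y
   have "\<bar>psi (y - s n *\<^sub>R b) - psi y\<bar> / s n \<le> B"
    using psi_diff[of y "s n"] s(1)[of n] by (simp add: field_simps)
   moreover have "0 \<le> Phi y" by (simp add: Phi_def)
   ultimately have "Phi y * (\<bar>psi (y - s n *\<^sub>R b) - psi y\<bar> / s n) \<le> Phi y * B" by (rule mult_left_mono)
   then show "norm (Phi y * ((psi (y - s n *\<^sub>R b) - psi y) / s n)) \<le> B * Phi y"
    using s(1)[of n] \<open>0 \<le> Phi y\<close> by (simp add: abs_mult mult.commute[of B])
  qed
 qed (use Phi b in auto)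
 have dd: "integrable lborel (\<lambda>y. (d n y)^2)" "(LI y. (d n y)^2) \<le> A" for n
  using e2[of "s n *\<^sub>R b" "s n"] e2A[of "s n *\<^sub>R b" "s n"] s(1)[of n] nb[of "s n"] by (auto simp: d_def)
 have Wd: "integrable lborel (\<lambda>y. W y * d n y)" for n
  by (rule integrable_mult_of_squares[OF _ _ W2 dd(1)]) auto
 have Wg: "integrable lborel (\<lambda>y. W y * g y)"
  by (rule integrable_mult_of_squares[OF _ _ W2 g2]) auto
 \<comment> \<open>The Taylor remainder has order 1 + q in the step, so after division by
   \<open>s n\<close> the factor \<open>s n powr q\<close> is left, times integrals bounded by the
   L2 norm of the difference quotients.\<close>
 have step3: "\<bar>(LI y. psi y * ((Phi (y + s n *\<^sub>R b) - Phi y) / s n)) - (1 + q) * (LI y. W y * d n y)\<bar>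
   \<le> s n powr q * (2 * (1 + ?M * A))" for n
 proof -
  have iP: "integrable lborel (\<lambda>y. psi y * ((Phi (y + s n *\<^sub>R b) - Phi y) / s n))"
   using integrable_mol_kernel[of "\<lambda>y. (Phi (y + s n *\<^sub>R b) - Phi y) / s n" h x] Phi h
   by (simp add: psi_def integrable_shift)
  have pt: "\<bar>psi y * ((Phi (y + s n *\<^sub>R b) - Phi y) / s n) - (1 + q) * (W y * d n y)\<bar>
    \<le> s n powr q * (2 * (psi y + ?M * (d n y)^2))" for y
  proof -
   let ?a = "f y" and ?b = "f (y + s n *\<^sub>R b)"
   have "psi y * ((Phi (y + s n *\<^sub>R b) - Phi y) / s n) - (1 + q) * (W y * d n y)
    = psi y * ((?b powr (1 + q) - ?a powr (1 + q) - (1 + q) * ?a powr q * (?b - ?a)) / s n)"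
    by (simp add: Phi_def W_def d_def diff_divide_distrib right_diff_distrib mult_ac)
   then have "\<bar>psi y * ((Phi (y + s n *\<^sub>R b) - Phi y) / s n) - (1 + q) * (W y * d n y)\<bar>
    = psi y * (\<bar>?b powr (1 + q) - ?a powr (1 + q) - (1 + q) * ?a powr q * (?b - ?a)\<bar> / s n)"
    using psi(1)[of y] s(1)[of n] by (simp add: abs_mult)
   also have "... \<le> psi y * ((1 + q) * \<bar>?b - ?a\<bar> powr (1 + q) / s n)"
    using psi(1)[of y] s(1)[of n] q f_nonneg by (intro mult_left_mono divide_right_mono powr_Taylor) auto
   also have "\<bar>?b - ?a\<bar> = s n * \<bar>d n y\<bar>" using s(1)[of n] by (simp add: d_def)
   also have "(s n * \<bar>d n y\<bar>) powr (1 + q) = s n * s n powr q * \<bar>d n y\<bar> powr (1 + q)"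
    using s(1)[of n] by (simp add: powr_mult powr_add)
   also have "psi y * ((1 + q) * (s n * s n powr q * \<bar>d n y\<bar> powr (1 + q)) / s n) = s n powr q * (psi y * ((1 + q) * \<bar>d n y\<bar> powr (1 + q)))"
    using s(1)[of n] by simp
   also have "... \<le> s n powr q * (psi y * (2 * (1 + (d n y)^2)))"
   proof (intro mult_left_mono mult_mono)
    show "\<bar>d n y\<bar> powr (1 + q) \<le> 1 + (d n y)^2"
    proof (cases "\<bar>d n y\<bar> \<le> 1")
     case True
     then have "\<bar>d n y\<bar> powr (1 + q) \<le> 1" using q by (intro powr_le1) auto
     then show ?thesis by (smt (verit) zero_le_power2)
    next
     case False
     then have "\<bar>d n y\<bar> powr (1 + q) \<le> \<bar>d n y\<bar> powr 2" using q by (intro powr_mono) auto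
     also have "... = (d n y)^2" using False by (simp add: powr_numeral)
     finally show ?thesis by simp
    qed
   qed (use q psi in auto)
   also have "psi y * (2 * (1 + (d n y)^2)) \<le> 2 * (psi y + ?M * (d n y)^2)"
   proof -
    have "psi y * (2 * (1 + (d n y)^2)) = 2 * (psi y + psi y * (d n y)^2)" by (simp add: algebra_simps)
    also have "... \<le> 2 * (psi y + ?M * (d n y)^2)"
     using psi(2)[of y] by (intro mult_left_mono add_left_mono mult_right_mono) auto
    finally show ?thesis .
   qed
   finally show ?thesis using spq(1)[of n] by (simp add: mult_left_mono)
  qed
  have "\<bar>(LI y. psi y * ((Phi (y + s n *\<^sub>R b) - Phi y) / s n)) - (1 + q) * (LI y. W y * d n y)\<bar>
   = \<bar>(LI y. psi y * ((Phi (y + s n *\<^sub>R b) - Phi y) / s n) - (1 + q) * (W y * d n y))\<bar>"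
   using iP Wd by simp
  also have "... \<le> (LI y. \<bar>psi y * ((Phi (y + s n *\<^sub>R b) - Phi y) / s n) - (1 + q) * (W y * d n y)\<bar>)"
   by (rule integral_abs_bound)
  also have "... \<le> (LI y. s n powr q * (2 * (psi y + ?M * (d n y)^2)))"
   using iP Wd psi_int dd(1) by (intro integral_mono pt integrable_abs) auto
  also have "... = s n powr q * (2 * (1 + ?M * (LI y. (d n y)^2)))"
   using psi_int dd(1) psi_1 by simp
  also have "... \<le> s n powr q * (2 * (1 + ?M * A))"
   using dd(2) M spq(1)[of n] by (intro mult_left_mono add_mono) auto
  finally show ?thesis .
 qed
 define C where "C = 1 + 2 * ?M * A + (2 * B + A) + 2 * B * A"
 have shift_W: "integrable lborel (\<lambda>y. W (y - t *\<^sub>R b) * g y)" for t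
 proof (rule integrable_mult_of_squares[OF _ _ _ g2])
  show "integrable lborel (\<lambda>y. (W (y - t *\<^sub>R b))^2)"
   using W2 integrable_shift[of "\<lambda>y. (W y)^2" "- (t *\<^sub>R b)"] by simp
 qed auto
 \<comment> \<open>The weight \<open>W\<close> is Hoelder continuous under small translations when
   tested with \<open>g\<close>; this is needed because the increment of \<open>f\<close> samples
   \<open>g\<close> along a segment and not at the point itself.\<close>
 have step4: "\<bar>(LI y. W (y - t *\<^sub>R b) * g y) - (LI y. W y * g y)\<bar> \<le> s n powr q * C" if t: "0 \<le> t" "t \<le> s n" for t n
 proof -
  define v where "v = - (t *\<^sub>R b)"
  define e where "e y = (f (y + v) - f y) / s n" for y
  have nv: "norm v \<le> s n" using t b by (simp add: v_def)
  have ee: "integrable lborel (\<lambda>y. (e y)^2)" "(LI y. (e y)^2) \<le> A"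
   using e2[of v "s n"] e2A[OF nv s(1)] by (auto simp: e_def)
  have yv: "y - t *\<^sub>R b = y + v" for y by (simp add: v_def)
  have psi_v: "integrable lborel (\<lambda>y. psi (y + v))" "(LI y. psi (y + v)) = 1"
   using psi_int psi_1 integral_shift[of psi v] by (auto simp: integrable_shift)
  have pd: "\<bar>psi (y + v) - psi y\<bar> \<le> s n * B" for y
  proof -
   have "\<bar>psi (y + v) - psi y\<bar> \<le> t * B" using psi_diff[of y t] t by (simp add: yv)
   also have "... \<le> s n * B" using t B(1) by (intro mult_right_mono) auto
   finally show ?thesis .
  qed
  \<comment> \<open>The three groups are the majorants from \<open>p1\<close>, \<open>p2\<close> and
    \<open>p3\<close> below, the first one after multiplication by the kernel.\<close>
  define R where "R y = (psi (y + v) + ?M * (e y)^2 + ?M * (g y)^2) + (B * (psi (y + v) + psi y) + (g y)^2) + (B * (f y)^2 + B * (g y)^2)" for y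
  have R_int: "integrable lborel R" unfolding R_def[abs_def]
   using psi_v psi_int ee g2 f_sq by auto
  have R_le: "(LI y. R y) \<le> C"
  proof -
   have "(LI y. R y) = (1 + ?M * (LI y. (e y)^2) + ?M * (LI y. (g y)^2))
    + (B * 2 + (LI y. (g y)^2)) + (B * (LI y. (f y)^2) + B * (LI y. (g y)^2))"
    unfolding R_def using psi_v psi_int psi_1 ee g2 f_sq by simp
   also have "... \<le> (1 + ?M * A + ?M * A) + (B * 2 + A) + (B * A + B * A)"
    using ee g2A f2A M B(1) by (intro add_mono mult_left_mono) auto
   finally show ?thesis by (simp add: C_def algebra_simps)
  qed
  have pt: "\<bar>W (y + v) * g y - W y * g y\<bar> \<le> s n powr q * R y" for y
  proof -
   have p1: "\<bar>f (y + v) powr q - f y powr q\<bar> * \<bar>g y\<bar> \<le> s n powr q * (1 + (e y)^2 + (g y)^2)"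
   proof -
    have "\<bar>f (y + v) powr q - f y powr q\<bar> \<le> \<bar>f (y + v) - f y\<bar> powr q"
     using q f_nonneg by (intro powr_diff_le) auto
    also have "\<bar>f (y + v) - f y\<bar> = s n * \<bar>e y\<bar>" using s(1)[of n] by (simp add: e_def)
    also have "(s n * \<bar>e y\<bar>) powr q = s n powr q * \<bar>e y\<bar> powr q" using s(1)[of n] by (simp add: powr_mult)
    also have "... \<le> s n powr q * (1 + \<bar>e y\<bar>)" using q by (intro mult_left_mono powr_le_one_plus) auto
    finally have "\<bar>f (y + v) powr q - f y powr q\<bar> * \<bar>g y\<bar> \<le> s n powr q * ((1 + \<bar>e y\<bar>) * \<bar>g y\<bar>)"
     by (simp add: mult_right_mono mult.assoc[symmetric])
    also have "(1 + \<bar>e y\<bar>) * \<bar>g y\<bar> \<le> 1 + (e y)^2 + (g y)^2"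
    proof -
     have "2 * ((1 + \<bar>e y\<bar>) * \<bar>g y\<bar>) \<le> (1 + \<bar>e y\<bar>)^2 + \<bar>g y\<bar>\<^sup>2"
      using sum_squares_bound[of "1 + \<bar>e y\<bar>" "\<bar>g y\<bar>"] by (simp only: mult.assoc)
     moreover have "(1 + \<bar>e y\<bar>)^2 \<le> 2 + 2 * (e y)^2"
      using sum_squares_bound[of 1 "\<bar>e y\<bar>"] by (simp add: power2_sum)
     ultimately show ?thesis using zero_le_power2[of "g y"] by (simp only: power2_abs)
    qed
    finally show ?thesis using spq(1)[of n] by (simp add: mult_left_mono)
   qed
   \<comment> \<open>Since \<open>g\<close> is only square integrable, the bound
     \<open>s n * B\<close> on the kernel increment would leave a non-integrable majorant. The
     increment is therefore also bounded by the kernels themselves, and the geometric mean of both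
     bounds costs only \<open>sqrt (s n)\<close>.\<close>
   have p2: "\<bar>psi (y + v) - psi y\<bar> * \<bar>g y\<bar> \<le> s n powr q * (B * (psi (y + v) + psi y) + (g y)^2)"
   proof -
    define D where "D = \<bar>psi (y + v) - psi y\<bar>"
    have D: "0 \<le> D" "D \<le> s n * B" "D \<le> psi (y + v) + psi y"
     using pd[of y] psi(1)[of y] psi(1)[of "y + v"] by (auto simp: D_def)
    have rs: "0 < sqrt (s n)" "sqrt (s n) * sqrt (s n) = s n" using s(1)[of n] by auto
    have "D * \<bar>g y\<bar> \<le> sqrt (s n) * (B * (psi (y + v) + psi y) + (g y)^2)"
    proof -
     have "D * D \<le> (s n * B) * (psi (y + v) + psi y)" using D by (intro mult_mono) auto
     then have 1: "(D / sqrt (s n))^2 \<le> B * (psi (y + v) + psi y)"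
      using rs s(1)[of n] by (simp add: power_divide power2_eq_square field_simps)
     have "D * \<bar>g y\<bar> = sqrt (s n) * \<bar>(D / sqrt (s n)) * g y\<bar>" using rs D by (simp add: abs_mult)
     also have "... \<le> sqrt (s n) * ((D / sqrt (s n))^2 + (g y)^2)"
      using rs by (intro mult_left_mono abs_mult_le_squares) auto
     also have "... \<le> sqrt (s n) * (B * (psi (y + v) + psi y) + (g y)^2)"
      using 1 rs by (intro mult_left_mono) auto
     finally show ?thesis .
    qed
    also have "... \<le> s n powr q * (B * (psi (y + v) + psi y) + (g y)^2)"
     using spq(3)[of n] B(1) psi(1)[of y] psi(1)[of "y + v"] by (intro mult_right_mono) auto
    finally show ?thesis by (simp add: D_def)
   qed
   have p3: "\<bar>psi (y + v) - psi y\<bar> * (f y * \<bar>g y\<bar>) \<le> s n powr q * (B * (f y)^2 + B * (g y)^2)"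
   proof -
    have fg: "f y * \<bar>g y\<bar> \<le> (f y)^2 + (g y)^2"
     using abs_mult_le_squares[of "f y" "g y"] f_nonneg[of y] by (simp add: abs_mult)
    have "\<bar>psi (y + v) - psi y\<bar> * (f y * \<bar>g y\<bar>) \<le> (s n powr q * B) * ((f y)^2 + (g y)^2)"
     using pd[of y] spq(2)[of n] B(1) f_nonneg[of y] fg
     by (intro mult_mono) (auto intro: order_trans mult_right_mono)
    then show ?thesis by (simp add: algebra_simps)
   qed
   have "W (y + v) * g y - W y * g y = psi (y + v) * ((f (y + v) powr q - f y powr q) * g y) + (psi (y + v) - psi y) * (f y powr q * g y)"
    by (simp add: W_def algebra_simps)
   then have "\<bar>W (y + v) * g y - W y * g y\<bar> \<le> psi (y + v) * (\<bar>f (y + v) powr q - f y powr q\<bar> * \<bar>g y\<bar>) + \<bar>psi (y + v) - psi y\<bar> * (f y powr q * \<bar>g y\<bar>)"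
    using psi(1)[of "y + v"] abs_triangle_ineq[of "psi (y + v) * ((f (y + v) powr q - f y powr q) * g y)" "(psi (y + v) - psi y) * (f y powr q * g y)"]
    by (simp add: abs_mult)
   also have "... \<le> psi (y + v) * (s n powr q * (1 + (e y)^2 + (g y)^2)) + \<bar>psi (y + v) - psi y\<bar> * ((1 + f y) * \<bar>g y\<bar>)"
    using psi(1)[of "y + v"] q f_nonneg[of y]
    by (intro add_mono mult_left_mono mult_right_mono p1 powr_le_one_plus) auto
   also have "... = s n powr q * (psi (y + v) + psi (y + v) * (e y)^2 + psi (y + v) * (g y)^2)
     + (\<bar>psi (y + v) - psi y\<bar> * \<bar>g y\<bar> + \<bar>psi (y + v) - psi y\<bar> * (f y * \<bar>g y\<bar>))"
    by (simp add: algebra_simps)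
   also have "... \<le> s n powr q * (psi (y + v) + ?M * (e y)^2 + ?M * (g y)^2)
     + (s n powr q * (B * (psi (y + v) + psi y) + (g y)^2) + s n powr q * (B * (f y)^2 + B * (g y)^2))"
    using psi(2)[of "y + v"] spq(1)[of n] by (intro add_mono mult_left_mono mult_right_mono p2 p3) auto
   also have "... = s n powr q * R y" by (simp add: R_def algebra_simps)
   finally show ?thesis .
  qed
  have "\<bar>(LI y. W (y + v) * g y) - (LI y. W y * g y)\<bar> = \<bar>(LI y. W (y + v) * g y - W y * g y)\<bar>"
   using shift_W[of t] Wg by (simp add: yv)
  also have "... \<le> (LI y. \<bar>W (y + v) * g y - W y * g y\<bar>)" by (rule integral_abs_bound)
  also have "... \<le> (LI y. s n powr q * R y)"
   using shift_W[of t] Wg R_int by (intro integral_mono pt integrable_abs) (auto simp: yv)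
  also have "... \<le> s n powr q * C" using R_le spq(1)[of n] by simp
  finally show ?thesis by (simp add: yv)
 qed
 \<comment> \<open>The difference quotient \<open>d n\<close> is the average of \<open>g\<close>
   over the segment, so after Fubini the error is an average of those in
   \<open>step4\<close>.\<close>
 have step5: "\<bar>(LI y. W y * d n y) - (LI y. W y * g y)\<bar> \<le> s n powr q * C" for n
 proof -
  define K where "K p = indicator {0..1} (snd p) * (W (fst p) * g (fst p + (snd p * s n) *\<^sub>R b))" for p :: "'a \<times> real"
  have Km [measurable]: "K \<in> borel_measurable borel" unfolding K_def[abs_def] by measurable
  have gs: "integrable lborel (\<lambda>y. (g (y + v))^2)" for v
   using g2 by (simp add: integrable_shift[of "\<lambda>y. (g y)^2"])
  have K: "integrable (lborel \<Otimes>\<^sub>M lborel) K"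
  proof (rule integrable_prodI2[OF Km])
   let ?Q = "(LI y. (W y)^2) + (LI y. (g y)^2)"
   have "(NI y. ennreal (norm (K (y, t)))) \<le> ennreal ?Q * indicator {0..1} t" for t
   proof (cases "t \<in> {0..1}")
    case True
    have "(NI y. ennreal (norm (K (y, t)))) \<le> (NI y. ennreal ((W y)^2 + (g (y + (t * s n) *\<^sub>R b))^2))"
     using True abs_mult_le_squares by (intro nn_integral_mono ennreal_leI) (simp add: K_def)
    also have "... = ennreal (LI y. (W y)^2 + (g (y + (t * s n) *\<^sub>R b))^2)"
     using W2 gs by (intro nn_integral_eq_integral) auto
    also have "(LI y. (W y)^2 + (g (y + (t * s n) *\<^sub>R b))^2) = ?Q"
     using W2 gs integral_shift[of "\<lambda>y. (g y)^2"] by simp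
    finally show ?thesis using True by simp
   qed (simp add: K_def)
   then have "(NI t. (NI y. ennreal (norm (K (y, t))))) \<le> (NI t. ennreal ?Q * indicator {0..1::real} t)"
    by (intro nn_integral_mono)
   also have "... < \<infinity>" by (simp add: nn_integral_cmult ennreal_mult_less_top)
   finally show "(NI t. (NI y. ennreal (norm (K (y, t))))) < \<infinity>" .
  qed
  have "(LI y. W y * d n y) = (LI y. (LI t. K (y, t)))"
  proof (rule integral_cong_AE)
   show "AE y in lborel. W y * d n y = (LI t. K (y, t))"
    using line[of "s n *\<^sub>R b"]
   proof eventually_elim
    case (elim y)
    have "d n y = (LI t. s n * (indicator {0..1} t * g (y + (t * s n) *\<^sub>R b))) / s n"
     unfolding d_def elim by (intro arg_cong2[where f = "(/)"] Bochner_Integration.integral_cong refl) (simp add: g_def)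
    also have "... = (LI t. indicator {0..1} t * g (y + (t * s n) *\<^sub>R b))"
     using s(1)[of n] by simp
    finally have "W y * d n y = (LI t. W y * (indicator {0..1} t * g (y + (t * s n) *\<^sub>R b)))" by simp
    also have "... = (LI t. K (y, t))"
     by (intro Bochner_Integration.integral_cong refl) (simp add: K_def)
    finally show ?case .
   qed
  qed (use measurable_integral_snd(1)[OF Km] in auto)
  also have "... = (LI t. (LI y. K (y, t)))" by (rule integral_swap[OF K])
  also have "... = (LI t. indicator {0..1} t * (LI y. W (y - (t * s n) *\<^sub>R b) * g y))"
  proof (rule Bochner_Integration.integral_cong[OF refl])
   fix t :: real
   show "(LI y. K (y, t)) = indicator {0..1} t * (LI y. W (y - (t * s n) *\<^sub>R b) * g y)"
    using integral_shift[of "\<lambda>y. W (y - (t * s n) *\<^sub>R b) * g y" "(t * s n) *\<^sub>R b"] by (simp add: K_def)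
  qed
  finally have Wd_eq: "(LI y. W y * d n y) = (LI t. indicator {0..1} t * (LI y. W (y - (t * s n) *\<^sub>R b) * g y))" .
  have "integrable lborel (\<lambda>t. (LI y. K (y, t)))"
   using lborel_pair.integrable_snd[of "\<lambda>y t. K (y, t)"] K by simp
  then have it: "integrable lborel (\<lambda>t. indicator {0..1} t * (LI y. W (y - (t * s n) *\<^sub>R b) * g y))"
  proof (rule Bochner_Integration.integrable_cong[THEN iffD1, OF refl, rotated])
   fix t :: real
   show "(LI y. K (y, t)) = indicator {0..1} t * (LI y. W (y - (t * s n) *\<^sub>R b) * g y)"
    using integral_shift[of "\<lambda>y. W (y - (t * s n) *\<^sub>R b) * g y" "(t * s n) *\<^sub>R b"] by (simp add: K_def)
  qed
  have "(LI y. W y * d n y) - (LI y. W y * g y)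
   = (LI t. indicator {0..1} t * (LI y. W (y - (t * s n) *\<^sub>R b) * g y) - indicator {0..1::real} t * (LI y. W y * g y))"
   unfolding Wd_eq using it by simp
  then have "\<bar>(LI y. W y * d n y) - (LI y. W y * g y)\<bar> \<le> (LI t. \<bar>indicator {0..1} t * (LI y. W (y - (t * s n) *\<^sub>R b) * g y) - indicator {0..1::real} t * (LI y. W y * g y)\<bar>)"
   by (simp only: integral_abs_bound)
  also have "... \<le> (LI t. indicator {0..1::real} t * (s n powr q * C))"
  proof (rule integral_mono)
   fix t :: real
   show "\<bar>indicator {0..1} t * (LI y. W (y - (t * s n) *\<^sub>R b) * g y) - indicator {0..1::real} t * (LI y. W y * g y)\<bar>
    \<le> indicator {0..1::real} t * (s n powr q * C)"
   proof (cases "t \<in> {0..1}")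
    case True
    then have "0 \<le> t * s n" "t * s n \<le> s n"
     using s(1)[of n] mult_right_mono[of t 1 "s n"] by (simp_all add: mult_nonneg_nonneg)
    from step4[OF this] show ?thesis using True by simp
   next
    case False
    then show ?thesis by simp
   qed
   show "integrable lborel (\<lambda>t. \<bar>indicator {0..1} t * (LI y. W (y - (t * s n) *\<^sub>R b) * g y) - indicator {0..1::real} t * (LI y. W y * g y)\<bar>)"
    by (intro integrable_abs Bochner_Integration.integrable_diff it) simp
  qed simp
  finally show ?thesis by simp
 qed
 have spq0: "(\<lambda>n. s n powr q) \<longlonglongrightarrow> 0"
  using s0 q s(1) by (intro tendsto_zero_powrI[OF s0 tendsto_const]) (auto simp: less_imp_le)
 have "(\<lambda>n. (LI y. W y * d n y)) \<longlonglongrightarrow> (LI y. W y * g y)"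
  by (rule LIM_zero_cancel, rule Lim_null_comparison[OF _ tendsto_mult_left_zero[OF spq0, of C]]) (use step5 in auto)
 then have "(\<lambda>n. (1 + q) * (LI y. W y * d n y)) \<longlonglongrightarrow> (1 + q) * (LI y. W y * g y)"
  by (rule tendsto_mult_left)
 moreover have "(\<lambda>n. (LI y. psi y * ((Phi (y + s n *\<^sub>R b) - Phi y) / s n)) - (1 + q) * (LI y. W y * d n y)) \<longlonglongrightarrow> 0"
  by (rule Lim_null_comparison[OF _ tendsto_mult_left_zero[OF spq0, of "2 * (1 + ?M * A)"]]) (use step3 in \<open>simp only: real_norm_def eventually_sequentially, blast\<close>)
 ultimately have "(\<lambda>n. (LI y. psi y * ((Phi (y + s n *\<^sub>R b) - Phi y) / s n))) \<longlonglongrightarrow> (1 + q) * (LI y. W y * g y)"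
  using tendsto_add by fastforce
 then have "(LI y. Phi y * dmol h b (x - y)) = (1 + q) * (LI y. W y * g y)"
  using lim1 unfolding step2 by (rule LIMSEQ_unique[rotated])
 moreover have "(1 + q) * (LI y. W y * g y) = (LI y. mol h (x - y) * ((1 + q) * f y powr q * (G y \<bullet> b)))"
  by (simp add: W_def psi_def g_def mult_ac flip: integral_mult_right_zero)
 ultimately show ?thesis by (simp add: Phi_def mult.commute)
qed

lemma mol_sq_mult_integrable:
 fixes g :: "'a \<Rightarrow> real"
 assumes h: "0 < h" and [measurable]: "g \<in> borel_measurable borel" and g: "integrable lborel (\<lambda>y. (g y)^2)"
 shows "integrable lborel (\<lambda>y. mol h (x - y) * g y)"
proof (rule integrable_mult_of_squares[OF _ _ _ g])
 show "integrable lborel (\<lambda>y. (mol h (x - y))^2)"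
 proof (rule integrable_nonneg_bound)
  show "integrable lborel (\<lambda>y. molB TYPE('a) / h ^ DIM('a) * mol h (x - y))"
   using mol_integrable[OF h, where 'a='a] by (auto simp: integrable_reflect)
  show "(mol h (x - y))^2 \<le> molB TYPE('a) / h ^ DIM('a) * mol h (x - y)" for y
   unfolding power2_eq_square using mol_nonneg[OF h] mol_bound[OF h] by (intro mult_right_mono) auto
 qed auto
qed auto

lemma mol_G_integrable:
 assumes h: "0 < h"
 shows "integrable lborel (\<lambda>y. mol h (x - y) * (G y \<bullet> b))"
proof (rule mol_sq_mult_integrable[OF h])
 show "integrable lborel (\<lambda>y. (G y \<bullet> b)^2)"
 proof (rule integrable_nonneg_bound)
  show "integrable lborel (\<lambda>y. (norm b)^2 * (norm (G y))^2)" using G_sq by auto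
  show "(G y \<bullet> b)^2 \<le> (norm b)^2 * (norm (G y))^2" for y
   using Cauchy_Schwarz_ineq[of "G y" b] by (simp add: power2_norm_eq_inner mult.commute)
 qed auto
qed auto

text \<open>In the chain rule the exponent 1 + q tends to 1. The left side converges to the weak
  gradient of \<open>f\<close>, the right side to \<open>G\<close> restricted to the set where
  \<open>f\<close> is positive, as f^q stays 0 elsewhere. Hence the part of \<open>G\<close> on the
  zero set annihilates every mollifier. This makes the gradient vanish on the vacuum, where the
  entropy says nothing about it.\<close>

lemma grad_zero:
 assumes hs: "\<And>k. 0 < hs k" "hs \<longlonglongrightarrow> (0::real)" and wk: "wk_grad UNIV hs f G"
 shows "AE y in lborel. f y = 0 \<longrightarrow> G y = 0"
proof -
 define Z where "Z y = (if f y = 0 then G y else 0)" for y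
 have [measurable]: "Z \<in> borel_measurable borel" unfolding Z_def[abs_def] by measurable
 have key: "(LI y. mol (hs k) (x - y) * (Z y \<bullet> b)) = 0" if b: "b \<in> Basis" for k x b
 proof -
  let ?h = "hs k"
  \<comment> \<open>Starting at 1/2 keeps all exponents in the range of
    \<open>chain_rule\<close>.\<close>
  define q where "q n = 1 / real (Suc (Suc n))" for n :: nat
  have q: "0 < q n" "q n \<le> 1 / 2" for n by (auto simp: q_def field_simps)
  have q0: "q \<longlonglongrightarrow> 0" unfolding q_def[abs_def] by (intro LIMSEQ_Suc lim_1_over_n)
  obtain B where B: "0 < B" "\<And>z::'a. \<bar>dmol ?h b z\<bar> \<le> B" using dmol_bounded[OF hs(1)] b by blast
  have l1: "(\<lambda>n. (LI y. dmol ?h b (x - y) * f y powr (1 + q n))) \<longlonglongrightarrow> (LI y. dmol ?h b (x - y) * f y)"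
  proof (rule integral_dominated_convergence[where w = "\<lambda>y. B * (f y + (f y)^2)"])
   show "AE y in lborel. (\<lambda>n. dmol ?h b (x - y) * f y powr (1 + q n)) \<longlonglongrightarrow> dmol ?h b (x - y) * f y"
   proof (intro AE_I2 tendsto_mult_left)
    fix y
    show "(\<lambda>n. f y powr (1 + q n)) \<longlonglongrightarrow> f y"
    proof (cases "f y = 0")
     case False
     then have "(\<lambda>n. f y powr (1 + q n)) \<longlonglongrightarrow> f y powr (1 + 0)"
      by (intro tendsto_powr[OF tendsto_const tendsto_add[OF tendsto_const q0]])
     then show ?thesis using f_nonneg[of y] by simp
    qed simp
   qed
   show "AE y in lborel. norm (dmol ?h b (x - y) * f y powr (1 + q n)) \<le> B * (f y + (f y)^2)" for n
   proof (intro AE_I2)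
    fix y
    have "f y powr (1 + q n) = f y * f y powr q n" using f_nonneg[of y] by (cases "f y = 0") (auto simp: powr_add)
    also have "... \<le> f y * (1 + f y)" using f_nonneg[of y] q[of n] by (intro mult_left_mono powr_le_one_plus) auto
    finally have "f y powr (1 + q n) \<le> f y + (f y)^2" by (simp add: algebra_simps power2_eq_square)
    then show "norm (dmol ?h b (x - y) * f y powr (1 + q n)) \<le> B * (f y + (f y)^2)"
     using B by (simp add: abs_mult mult_mono)
   qed
   show "integrable lborel (\<lambda>y. B * (f y + (f y)^2))" using f_int f_sq by auto
  qed (use b in auto)
  \<comment> \<open>Pointwise f^q tends to 1 where \<open>f\<close> is positive and equals 0 where
    \<open>f\<close> is 0, so the part \<open>Z\<close> drops out of the limit.\<close>
  have l2: "(\<lambda>n. (LI y. mol ?h (x - y) * ((1 + q n) * f y powr q n * (G y \<bullet> b))))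
    \<longlonglongrightarrow> (LI y. mol ?h (x - y) * (G y \<bullet> b) - mol ?h (x - y) * (Z y \<bullet> b))"
  proof (rule integral_dominated_convergence[where w = "\<lambda>y. 2 * (\<bar>mol ?h (x - y) * (G y \<bullet> b)\<bar> + molB TYPE('a) / ?h ^ DIM('a) * ((f y)^2 + (norm (G y))^2))"])
   show "integrable lborel (\<lambda>y. 2 * (\<bar>mol ?h (x - y) * (G y \<bullet> b)\<bar> + molB TYPE('a) / ?h ^ DIM('a) * ((f y)^2 + (norm (G y))^2)))"
    using mol_G_integrable[OF hs(1)] f_sq G_sq
    by (intro integrable_mult_right integrable_add integrable_abs Bochner_Integration.integrable_add) auto
   show "AE y in lborel. (\<lambda>n. mol ?h (x - y) * ((1 + q n) * f y powr q n * (G y \<bullet> b)))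
     \<longlonglongrightarrow> mol ?h (x - y) * (G y \<bullet> b) - mol ?h (x - y) * (Z y \<bullet> b)"
   proof (intro AE_I2)
    fix y
    show "(\<lambda>n. mol ?h (x - y) * ((1 + q n) * f y powr q n * (G y \<bullet> b)))
     \<longlonglongrightarrow> mol ?h (x - y) * (G y \<bullet> b) - mol ?h (x - y) * (Z y \<bullet> b)"
    proof (cases "f y = 0")
     case False
     have "(\<lambda>n. mol ?h (x - y) * ((1 + q n) * f y powr q n * (G y \<bullet> b)))
       \<longlonglongrightarrow> mol ?h (x - y) * ((1 + 0) * f y powr 0 * (G y \<bullet> b))"
      using False by (intro tendsto_mult tendsto_const tendsto_add q0 tendsto_powr)
     then show ?thesis using False by (simp add: Z_def)
    qed (simp add: Z_def)
   qed
   show "AE y in lborel. norm (mol ?h (x - y) * ((1 + q n) * f y powr q n * (G y \<bullet> b)))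
     \<le> 2 * (\<bar>mol ?h (x - y) * (G y \<bullet> b)\<bar> + molB TYPE('a) / ?h ^ DIM('a) * ((f y)^2 + (norm (G y))^2))" for n
   proof (intro AE_I2)
    fix y
    let ?M = "molB TYPE('a) / ?h ^ DIM('a)"
    have m: "0 \<le> mol ?h (x - y)" "mol ?h (x - y) \<le> ?M" using mol_nonneg[OF hs(1)] mol_bound[OF hs(1)] by auto
    have Gb: "\<bar>G y \<bullet> b\<bar> \<le> norm (G y)" using Basis_le_norm[OF b] .
    have "norm (mol ?h (x - y) * ((1 + q n) * f y powr q n * (G y \<bullet> b))) = (1 + q n) * (f y powr q n * (mol ?h (x - y) * \<bar>G y \<bullet> b\<bar>))"
     using m q[of n] by (simp add: abs_mult)
    also have "... \<le> 2 * ((1 + f y) * (mol ?h (x - y) * \<bar>G y \<bullet> b\<bar>))"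
     using q[of n] m f_nonneg[of y] by (intro mult_mono powr_le_one_plus) auto
    also have "(1 + f y) * (mol ?h (x - y) * \<bar>G y \<bullet> b\<bar>) = mol ?h (x - y) * \<bar>G y \<bullet> b\<bar> + mol ?h (x - y) * (f y * \<bar>G y \<bullet> b\<bar>)"
     by (simp add: algebra_simps)
    also have "... \<le> mol ?h (x - y) * \<bar>G y \<bullet> b\<bar> + ?M * (f y * norm (G y))"
     using m Gb f_nonneg[of y] by (intro add_left_mono mult_mono) auto
    also have "... \<le> mol ?h (x - y) * \<bar>G y \<bullet> b\<bar> + ?M * ((f y)^2 + (norm (G y))^2)"
     using abs_mult_le_squares[of "f y" "norm (G y)"] f_nonneg[of y] m by (intro add_left_mono mult_left_mono) auto
    finally show "norm (mol ?h (x - y) * ((1 + q n) * f y powr q n * (G y \<bullet> b)))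
     \<le> 2 * (\<bar>mol ?h (x - y) * (G y \<bullet> b)\<bar> + ?M * ((f y)^2 + (norm (G y))^2))"
     using m by (simp add: abs_mult)
   qed
  qed auto
  have iZ: "integrable lborel (\<lambda>y. mol ?h (x - y) * (Z y \<bullet> b))"
  proof (rule Bochner_Integration.integrable_bound[OF mol_G_integrable[OF hs(1)[of k], of x b]])
   show "AE y in lborel. norm (mol ?h (x - y) * (Z y \<bullet> b)) \<le> norm (mol ?h (x - y) * (G y \<bullet> b))"
    by (intro AE_I2) (simp add: Z_def)
  qed simp
  have "(LI y. dmol ?h b (x - y) * f y) = (LI y. mol ?h (x - y) * (G y \<bullet> b) - mol ?h (x - y) * (Z y \<bullet> b))"
   using l1 l2 unfolding chain_rule[OF hs(1) b q] by (rule LIMSEQ_unique)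
  moreover have "(LI y. dmol ?h b (x - y) * f y) = (LI y. mol ?h (x - y) * (G y \<bullet> b))"
   using wk b by (simp add: wk_grad_def)
  ultimately show ?thesis using iZ mol_G_integrable[OF hs(1)[of k], of x b] by simp
 qed
 \<comment> \<open>\<open>Z\<close> is only square integrable; cut off to a ball it becomes
   integrable, and kernels supported in the ball do not notice the cut.\<close>
 have "AE y in lborel. y \<in> ball 0 (real n) \<longrightarrow> indicator (ball 0 (real n)) y *\<^sub>R Z y = 0" for n :: nat
 proof (rule mol_zero_vec[OF hs])
  show "integrable lborel (\<lambda>y. indicator (ball 0 (real n)) y *\<^sub>R Z y)"
  proof (rule Bochner_Integration.integrable_bound)
   show "integrable lborel (\<lambda>y. indicator (ball 0 (real n)) y + (norm (G y))^2 :: real)"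
    using G_sq by (intro Bochner_Integration.integrable_add integrable_real_indicator)
     (use emeasure_bounded_finite[of "ball 0 (real n) :: 'a set"] in auto)
   show "AE y in lborel. norm (indicator (ball 0 (real n)) y *\<^sub>R Z y) \<le> norm (indicator (ball 0 (real n)) y + (norm (G y))^2 :: real)"
   proof (intro AE_I2)
    fix y
    have "norm (G y) \<le> 1 + (norm (G y))^2" using abs_mult_le_squares[of 1 "norm (G y)"] by simp
    then show "norm (indicator (ball 0 (real n)) y *\<^sub>R Z y) \<le> norm (indicator (ball 0 (real n)) y + (norm (G y))^2 :: real)"
     by (auto simp: Z_def indicator_def add_nonneg_nonneg)
   qed
  qed (auto intro!: borel_measurable_scaleR borel_measurable_indicator)
  fix k and x :: 'a assume sub: "cball x (real DIM('a) * hs k) \<subseteq> ball 0 (real n)"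
  show "cv (mol (hs k)) (\<lambda>y. indicator (ball 0 (real n)) y *\<^sub>R Z y) x = 0"
  proof (rule euclidean_eqI)
   fix b :: 'a assume b: "b \<in> Basis"
   have eq: "mol (hs k) (x - y) *\<^sub>R (indicator (ball 0 (real n)) y *\<^sub>R Z y) = mol (hs k) (x - y) *\<^sub>R Z y" for y
   proof (cases "mol (hs k) (x - y) = 0")
    case False
    then have "y \<in> ball 0 (real n)" using mol_supp[OF hs(1) False] sub by (auto simp: dist_norm subset_iff)
    then show ?thesis by simp
   qed simp
   have iZ: "integrable lborel (\<lambda>y. mol (hs k) (x - y) *\<^sub>R Z y)"
   proof (rule Bochner_Integration.integrable_bound)
    show "integrable lborel (\<lambda>y. mol (hs k) (x - y) * norm (G y))"
     by (rule mol_sq_mult_integrable[OF hs(1) _ G_sq]) simp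
    show "AE y in lborel. norm (mol (hs k) (x - y) *\<^sub>R Z y) \<le> norm (mol (hs k) (x - y) * norm (G y))"
     by (intro AE_I2) (simp add: Z_def abs_mult)
   qed (auto intro!: borel_measurable_scaleR)
   show "cv (mol (hs k)) (\<lambda>y. indicator (ball 0 (real n)) y *\<^sub>R Z y) x \<bullet> b = 0 \<bullet> b"
    unfolding cv_def eq using integral_inner_left[OF iZ, of b] key[OF b, of k x] by simp
  qed
 qed auto
 then have "AE y in lborel. \<forall>n::nat. y \<in> ball 0 (real n) \<longrightarrow> indicator (ball 0 (real n)) y *\<^sub>R Z y = 0"
  unfolding AE_all_countable by blast
 then show ?thesis
 proof eventually_elim
  case (elim y)
  obtain n :: nat where "norm y < n" using reals_Archimedean2 by blast
  then have "Z y = 0" using elim[rule_format, of n] by simp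
  then show ?case by (auto simp: Z_def)
 qed
qed

end

text \<open>The line formula comes from \<open>wk_grad_line\<close>, which needs integrable fields.
  The gradient is therefore cut off to balls; a given segment lies in all sufficiently large
  ones.\<close>

lemma sobolevI:
 fixes f :: "'a::euclidean_space \<Rightarrow> real"
 assumes f_nonneg: "\<And>x. 0 \<le> f x"
  and f_int: "integrable lborel f" and f_L1: "(LI x. f x) \<le> A"
  and f_sq: "integrable lborel (\<lambda>x. (f x)^2)" and f_L2: "(LI x. (f x)^2) \<le> A"
  and G_meas [measurable]: "G \<in> borel_measurable borel"
  and G_sq: "integrable lborel (\<lambda>x. (norm (G x))^2)" and G_L2: "(LI x. (norm (G x))^2) \<le> A"
  and hs: "\<And>k. 0 < hs k" "hs \<longlonglongrightarrow> (0::real)" and wk: "wk_grad UNIV hs f G"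
 shows "sobolev f G A"
proof
 fix v
 have "AE y in lborel. y \<in> ball 0 (real n) \<and> y + v \<in> ball 0 (real n) \<longrightarrow>
  indicator (ball 0 (real n)) (y + v) * f (y + v) - indicator (ball 0 (real n)) y * f y
   = (LI s. indicator {0..1} s * ((indicator (ball 0 (real n)) (y + s *\<^sub>R v) *\<^sub>R G (y + s *\<^sub>R v)) \<bullet> v))" for n :: nat
 proof (rule wk_grad_line[OF hs, where U = "ball 0 (real n)"])
  show "integrable lborel (\<lambda>y. indicator (ball 0 (real n)) y * f y)"
   using integrable_mult_indicator[OF _ f_int, of "ball 0 (real n)"] by simp
  show "integrable lborel (\<lambda>y. indicator (ball 0 (real n)) y *\<^sub>R G y)"
  proof (rule Bochner_Integration.integrable_bound)
   show "integrable lborel (\<lambda>y. indicator (ball 0 (real n)) y + (norm (G y))^2 :: real)"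
    using G_sq by (intro Bochner_Integration.integrable_add integrable_real_indicator)
     (use emeasure_bounded_finite[of "ball 0 (real n) :: 'a set"] in auto)
   show "AE y in lborel. norm (indicator (ball 0 (real n)) y *\<^sub>R G y) \<le> norm (indicator (ball 0 (real n)) y + (norm (G y))^2 :: real)"
   proof (intro AE_I2)
    fix y
    have "norm (G y) \<le> 1 + (norm (G y))^2" using abs_mult_le_squares[of 1 "norm (G y)"] by simp
    then show "norm (indicator (ball 0 (real n)) y *\<^sub>R G y) \<le> norm (indicator (ball 0 (real n)) y + (norm (G y))^2 :: real)"
     by (auto simp: indicator_def add_nonneg_nonneg)
   qed
  qed (auto intro!: borel_measurable_scaleR borel_measurable_indicator)
  show "wk_grad (ball 0 (real n)) hs (\<lambda>y. indicator (ball 0 (real n)) y * f y) (\<lambda>y. indicator (ball 0 (real n)) y *\<^sub>R G y)"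
   unfolding wk_grad_def
  proof (intro allI impI ballI)
   fix k and x b :: 'a assume sub: "cball x (real DIM('a) * hs k) \<subseteq> ball 0 (real n)" and b: "b \<in> Basis"
   have e1: "dmol (hs k) b (x - y) * (indicator (ball 0 (real n)) y * f y) = dmol (hs k) b (x - y) * f y" for y
   proof (cases "dmol (hs k) b (x - y) = 0")
    case False
    then have "y \<in> ball 0 (real n)" using dmol_supp[OF hs(1) False] sub by (auto simp: dist_norm subset_iff)
    then show ?thesis by simp
   qed simp
   have e2: "mol (hs k) (x - y) * ((indicator (ball 0 (real n)) y *\<^sub>R G y) \<bullet> b) = mol (hs k) (x - y) * (G y \<bullet> b)" for y
   proof (cases "mol (hs k) (x - y) = 0")
    case False
    then have "y \<in> ball 0 (real n)" using mol_supp[OF hs(1) False] sub by (auto simp: dist_norm subset_iff)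
    then show ?thesis by simp
   qed simp
   show "(LI y. dmol (hs k) b (x - y) * (indicator (ball 0 (real n)) y * f y))
    = (LI y. mol (hs k) (x - y) * ((indicator (ball 0 (real n)) y *\<^sub>R G y) \<bullet> b))"
    unfolding e1 e2 using wk b by (simp add: wk_grad_def)
  qed
 qed auto
 then have "AE y in lborel. \<forall>n::nat. y \<in> ball 0 (real n) \<and> y + v \<in> ball 0 (real n) \<longrightarrow>
  indicator (ball 0 (real n)) (y + v) * f (y + v) - indicator (ball 0 (real n)) y * f y
   = (LI s. indicator {0..1} s * ((indicator (ball 0 (real n)) (y + s *\<^sub>R v) *\<^sub>R G (y + s *\<^sub>R v)) \<bullet> v))"
  unfolding AE_all_countable by blast
 then show "AE y in lborel. f (y + v) - f y = (LI s. indicator {0..1} s * (G (y + s *\<^sub>R v) \<bullet> v))"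
 proof eventually_elim
  case (elim y)
  obtain n :: nat where n: "norm y + norm v < n" using reals_Archimedean2 by blast
  have y: "norm y < n" using n norm_ge_zero[of v] by linarith
  have yv: "norm (y + v) < n" using n norm_triangle_ineq[of y v] by linarith
  have s: "norm (y + s *\<^sub>R v) < n" if "0 \<le> s" "s \<le> 1" for s
  proof -
   have "norm (y + s *\<^sub>R v) \<le> norm y + \<bar>s\<bar> * norm v" using norm_triangle_ineq[of y "s *\<^sub>R v"] by simp
   also have "... \<le> norm y + 1 * norm v" using that by (intro add_left_mono mult_right_mono) auto
   finally show ?thesis using n by simp
  qed
  have "f (y + v) - f y = (LI s. indicator {0..1} s * ((indicator (ball 0 (real n)) (y + s *\<^sub>R v) *\<^sub>R G (y + s *\<^sub>R v)) \<bullet> v))"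
   using elim[rule_format, of n] y yv by simp
  also have "... = (LI s. indicator {0..1} s * (G (y + s *\<^sub>R v) \<bullet> v))"
   by (intro Bochner_Integration.integral_cong refl) (auto simp: indicator_def s)
  finally show ?case .
 qed
qed (use assms in auto)

section \<open>Mollification in L2 and between neighbouring dyadic scales\<close>

lemma nn_mol_jensen:
 fixes u :: "'a::euclidean_space \<Rightarrow> ennreal"
 assumes h: "0 < h" and [measurable]: "u \<in> borel_measurable borel"
 shows "(NI y. ennreal (mol h (x - y)) * u y) ^ 2 \<le> (NI y. ennreal (mol h (x - y)) * (u y) ^ 2)"
proof -
 have ms: "ennreal (mol h z) = ennreal (sqrt (mol h z)) ^ 2" for z :: 'a
  by (simp add: ennreal_power mol_nonneg h)
 have ms2: "ennreal (sqrt (mol h z)) * ennreal (sqrt (mol h z)) = ennreal (mol h z)" for z :: 'a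
  by (simp add: ennreal_mult[symmetric] mol_nonneg h)
 have "(NI y. ennreal (mol h (x - y)) * u y) ^ 2
   = (NI y. ennreal (sqrt (mol h (x - y))) * (ennreal (sqrt (mol h (x - y))) * u y)) ^ 2"
  by (simp add: mult.assoc[symmetric] ms2)
 also have "... \<le> (NI y. ennreal (sqrt (mol h (x - y))) ^ 2) *
   (NI y. (ennreal (sqrt (mol h (x - y))) * u y) ^ 2)"
  by (intro Cauchy_Schwarz_nn_integral) auto
 also have "(NI y. ennreal (sqrt (mol h (x - y))) ^ 2) = 1"
  using nn_integral_reflect[of "\<lambda>z. ennreal (mol h z)" x] nn_integral_mol[OF h, where 'a='a]
  by (simp add: ms[symmetric])
 finally show ?thesis by (simp add: power_mult_distrib ms[symmetric])
qed

lemma cv_mol_L2: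
 fixes f :: "'a::euclidean_space \<Rightarrow> 'b::{banach, second_countable_topology}"
 assumes h: "0 < h" and [measurable]: "f \<in> borel_measurable borel"
 shows "(NI x. ennreal ((norm (cv (mol h) f x))^2)) \<le> (NI x. ennreal ((norm (f x))^2))"
proof -
 have "ennreal ((norm (cv (mol h) f x))^2) \<le> (NI y. ennreal (mol h (x - y)) * ennreal ((norm (f y))^2))" for x
 proof -
  have "ennreal (norm (cv (mol h) f x)) \<le> (NI y. ennreal (norm (mol h (x - y) *\<^sub>R f y)))"
   unfolding cv_def by (rule norm_integral_le_nn_integral)
  also have "... = (NI y. ennreal (mol h (x - y)) * ennreal (norm (f y)))"
   by (intro nn_integral_cong) (simp add: ennreal_mult abs_mol[OF h] mol_nonneg[OF h])
  finally have "ennreal (norm (cv (mol h) f x)) ^ 2 \<le> (...) ^ 2" by (rule power_mono) simp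
  also have "... \<le> (NI y. ennreal (mol h (x - y)) * ennreal (norm (f y)) ^ 2)"
   by (intro nn_mol_jensen h) simp
  finally show ?thesis by (simp add: ennreal_power)
 qed
 then have "(NI x. ennreal ((norm (cv (mol h) f x))^2))
   \<le> (NI x. (NI y. ennreal (mol h (x - y)) * ennreal ((norm (f y))^2)))"
  by (intro nn_integral_mono)
 also have "... = (NI y. (NI x. ennreal (mol h (x - y)) * ennreal ((norm (f y))^2)))"
  using nn_integral_swap[of "\<lambda>p. ennreal (mol h (fst p - snd p)) * ennreal ((norm (f (snd p)))^2)"] by simp
 also have "... = (NI y. ennreal ((norm (f y))^2))"
 proof (rule nn_integral_cong)
  fix y
  have "(NI x. ennreal (mol h (x - y)) * ennreal ((norm (f y))^2))
    = (NI x. ennreal (mol h (x + - y))) * ennreal ((norm (f y))^2)"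
   by (subst nn_integral_multc) auto
  also have "... = ennreal ((norm (f y))^2)"
   using nn_integral_shift[of "\<lambda>x. ennreal (mol h x)" "- y"] nn_integral_mol[OF h, where 'a='a] by simp
  finally show "(NI x. ennreal (mol h (x - y)) * ennreal ((norm (f y))^2)) = ennreal ((norm (f y))^2)" .
 qed
 finally show ?thesis .
qed

lemma cv_mol_minus_const:
 fixes f :: "'a::euclidean_space \<Rightarrow> real"
 assumes h: "0 < h" and f: "integrable lborel f"
 shows "ennreal \<bar>cv (mol h) f x - c\<bar> \<le> (NI y. ennreal (mol h (x - y)) * ennreal \<bar>f y - c\<bar>)"
proof -
 have m: "integrable lborel (\<lambda>y. mol h (x - y))" "(LI y. mol h (x - y)) = 1"
  using mol_integrable[OF h, where 'a='a] integral_reflect[of "mol h" x] mol_integral[OF h, where 'a='a]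
  by (auto simp: integrable_reflect)
 have i: "integrable lborel (\<lambda>y. mol h (x - y) * f y)" using integrable_mol_kernel[OF f h, of x] by simp
 have "cv (mol h) f x - c = (LI y. mol h (x - y) * f y - mol h (x - y) * c)"
  using i m by (simp add: cv_def)
 also have "... = (LI y. mol h (x - y) * (f y - c))"
  by (intro Bochner_Integration.integral_cong refl) (simp add: algebra_simps)
 finally have "ennreal \<bar>cv (mol h) f x - c\<bar> \<le> (NI y. ennreal (norm (mol h (x - y) * (f y - c))))"
  using norm_integral_le_nn_integral[of lborel "\<lambda>y. mol h (x - y) * (f y - c)"] by simp
 also have "... = (NI y. ennreal (mol h (x - y)) * ennreal \<bar>f y - c\<bar>)"
  by (intro nn_integral_cong) (simp add: abs_mult abs_mol[OF h] ennreal_mult mol_nonneg[OF h])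
 finally show ?thesis .
qed

context sobolev
begin

text \<open>The square of \<open>molB\<close> stems from the two kernels, the unit ball with the
  power \<open>DIM('a)\<close> from the volume of a ball of radius
  \<open>3 * real DIM('a) * h\<close>, and the two further factors from the squared length of a
  translation in that ball.\<close>

definition step_const :: real where
 "step_const = (molB TYPE('a))^2 * unit_ball_vol DIM('a) * (3 * real DIM('a)) ^ (DIM('a) + 2)"

text \<open>Jensen moves the square inside the average, and on the support of the kernel the
  translations have length at most \<open>real DIM('a) * h\<close>.\<close>

lemma mol_error:
 assumes h: "0 < h"
 shows "(NI x. ennreal ((f x - cv (mol h) f x)^2)) \<le> ennreal ((real DIM('a) * h)^2 * A)"
proof -
 have "ennreal ((f x - cv (mol h) f x)^2) \<le> (NI v. ennreal (mol h v) * ennreal ((f (x + - v) - f x)^2))" for x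
 proof -
  have "ennreal ((f x - cv (mol h) f x)^2) = ennreal \<bar>cv (mol h) f x - f x\<bar> ^ 2"
   by (simp add: ennreal_power power2_commute)
  also have "... \<le> (NI y. ennreal (mol h (x - y)) * ennreal \<bar>f y - f x\<bar>) ^ 2"
   by (intro power_mono cv_mol_minus_const h f_int) simp
  also have "... \<le> (NI y. ennreal (mol h (x - y)) * (ennreal \<bar>f y - f x\<bar>) ^ 2)"
   by (intro nn_mol_jensen h) simp
  also have "... = (NI v. ennreal (mol h (x - (x - v))) * (ennreal \<bar>f (x - v) - f x\<bar>) ^ 2)"
   using nn_integral_reflect[of "\<lambda>y. ennreal (mol h (x - y)) * (ennreal \<bar>f y - f x\<bar>) ^ 2" x] by simp
  finally show ?thesis by (simp add: ennreal_power)
 qed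
 then have "(NI x. ennreal ((f x - cv (mol h) f x)^2))
   \<le> (NI x. (NI v. ennreal (mol h v) * ennreal ((f (x + - v) - f x)^2)))"
  by (intro nn_integral_mono)
 also have "... = (NI v. (NI x. ennreal (mol h v) * ennreal ((f (x + - v) - f x)^2)))"
  using nn_integral_swap[of "\<lambda>p. ennreal (mol h (snd p)) * ennreal ((f (fst p + - snd p) - f (fst p))^2)"] by simp
 also have "... \<le> (NI v. ennreal (mol h (v::'a)) * ennreal ((real DIM('a) * h)^2 * A))"
 proof (intro nn_integral_mono)
  fix v :: 'a
  have "(NI x. ennreal (mol h v) * ennreal ((f (x + - v) - f x)^2))
   = ennreal (mol h v) * (NI x. ennreal ((f (x + - v) - f x)^2))"
   by (rule nn_integral_cmult) simp
  also have "(NI x. ennreal ((f (x + - v) - f x)^2)) = ennreal (LI x. (f (x + - v) - f x)^2)"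
   by (intro nn_integral_eq_integral translation) simp
  also have "ennreal (mol h v) * ... \<le> ennreal (mol h v) * ennreal ((real DIM('a) * h)^2 * A)"
  proof (cases "mol h v = 0")
   case False
   have "(LI x. (f (x + - v) - f x)^2) \<le> (norm (- v))^2 * A" by (rule translation)
   also have "... \<le> (real DIM('a) * h)^2 * A"
    using mol_supp[OF h False] A_nonneg by (intro mult_right_mono power_mono) auto
   finally show ?thesis by (intro mult_left_mono ennreal_leI) auto
  qed simp
  finally show "(NI x. ennreal (mol h v) * ennreal ((f (x + - v) - f x)^2))
   \<le> ennreal (mol h v) * ennreal ((real DIM('a) * h)^2 * A)" .
 qed
 also have "... = ennreal ((real DIM('a) * h)^2 * A)"
  by (simp add: nn_integral_multc nn_integral_mol[OF h])
 finally show ?thesis .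
qed

text \<open>The difference of the two averages is a double average of f(b) - f(a) over points with
  distance at most \<open>3 * real DIM('a) * h\<close>. The kernels cost h^(-2n), the ball of
  increments returns h^n, and the translation estimate h^2.\<close>

lemma mol_step:
 assumes h: "0 < h"
 shows "(cv (mol h) f x - cv (mol (2 * h)) f x)^2 \<le> step_const * A * (h\<^sup>2 / h ^ DIM('a))"
proof -
 let ?c = "cv (mol (2 * h)) f x" and ?R = "3 * real DIM('a) * h"
 let ?M = "(molB TYPE('a))^2 / (h ^ DIM('a) * h ^ DIM('a))"
 have h2: "0 < 2 * h" using h by simp
 have MB: "0 < molB TYPE('a)" by (rule molB_pos)
 have [measurable]: "cball (0::'a) ?R \<in> sets borel" by (rule borel_closed) simp
 have "ennreal ((cv (mol h) f x - ?c)^2) = ennreal \<bar>cv (mol h) f x - ?c\<bar> ^ 2" by (simp add: ennreal_power)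
 also have "... \<le> (NI a. ennreal (mol h (x - a)) * ennreal \<bar>f a - ?c\<bar>) ^ 2"
  by (intro power_mono cv_mol_minus_const h f_int) simp
 also have "... \<le> (NI a. ennreal (mol h (x - a)) * ennreal \<bar>f a - ?c\<bar> ^ 2)"
  by (intro nn_mol_jensen h) simp
 also have "... \<le> (NI a. ennreal (mol h (x - a)) * (NI b. ennreal (mol (2 * h) (x - b)) * ennreal \<bar>f b - f a\<bar> ^ 2))"
 proof (intro nn_integral_mono mult_left_mono)
  fix a
  have "ennreal \<bar>f a - ?c\<bar> ^ 2 = ennreal \<bar>?c - f a\<bar> ^ 2" by (simp add: abs_minus_commute)
  also have "... \<le> (NI b. ennreal (mol (2 * h) (x - b)) * ennreal \<bar>f b - f a\<bar>) ^ 2"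
   by (intro power_mono cv_mol_minus_const h2 f_int) simp
  also have "... \<le> (NI b. ennreal (mol (2 * h) (x - b)) * ennreal \<bar>f b - f a\<bar> ^ 2)"
   by (intro nn_mol_jensen h2) simp
  finally show "ennreal \<bar>f a - ?c\<bar> ^ 2 \<le> ..." .
 qed simp
 also have "... = (NI a. (NI b. ennreal (mol h (x - a)) * (ennreal (mol (2 * h) (x - b)) * ennreal \<bar>f b - f a\<bar> ^ 2)))"
  by (intro nn_integral_cong nn_integral_cmult[symmetric]) simp
 also have "... \<le> (NI a. (NI b. ennreal ?M * (indicator (cball 0 ?R) (b - a) * ennreal ((f b - f a)^2))))"
 proof (intro nn_integral_mono)
  fix a b
  show "ennreal (mol h (x - a)) * (ennreal (mol (2 * h) (x - b)) * ennreal \<bar>f b - f a\<bar> ^ 2)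
   \<le> ennreal ?M * (indicator (cball 0 ?R) (b - a) * ennreal ((f b - f a)^2))"
  proof (cases "mol h (x - a) = 0 \<or> mol (2 * h) (x - b) = 0")
   case False
   have "norm (x - a) \<le> real DIM('a) * h" using False by (intro mol_supp h) auto
   moreover have "norm (x - b) \<le> real DIM('a) * (2 * h)" using False by (intro mol_supp h2) auto
   moreover have "norm (b - a) \<le> norm (x - a) + norm (x - b)"
    using norm_triangle_ineq4[of "x - a" "x - b"] by simp
   ultimately have ab: "b - a \<in> cball 0 ?R" by simp
   have "mol h (x - a) * mol (2 * h) (x - b) \<le> (molB TYPE('a) / h ^ DIM('a)) * (molB TYPE('a) / h ^ DIM('a))"
   proof (intro mult_mono mol_bound h)
    have "mol (2 * h) (x - b) \<le> molB TYPE('a) / (2 * h) ^ DIM('a)" by (rule mol_bound[OF h2])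
    also have "... \<le> molB TYPE('a) / h ^ DIM('a)"
     using h MB by (intro divide_left_mono power_mono) auto
    finally show "mol (2 * h) (x - b) \<le> molB TYPE('a) / h ^ DIM('a)" .
   qed (use h MB mol_nonneg[OF h2] in auto)
   then have "mol h (x - a) * mol (2 * h) (x - b) \<le> ?M" by (simp add: power2_eq_square)
   then have "ennreal (mol h (x - a) * mol (2 * h) (x - b)) * ennreal ((f b - f a)^2) \<le> ennreal ?M * ennreal ((f b - f a)^2)"
    by (intro mult_right_mono ennreal_leI) auto
   then show ?thesis using ab mol_nonneg[OF h, of "x - a"] mol_nonneg[OF h2, of "x - b"]
    by (simp add: ennreal_mult ennreal_power mult.assoc)
  qed auto
 qed
 also have "... = (NI a. (NI v. ennreal ?M * (indicator (cball 0 ?R) v * ennreal ((f (a + v) - f a)^2))))"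
 proof (rule nn_integral_cong)
  fix a :: 'a
  show "(NI b. ennreal ?M * (indicator (cball 0 ?R) (b - a) * ennreal ((f b - f a)^2)))
   = (NI v. ennreal ?M * (indicator (cball 0 ?R) v * ennreal ((f (a + v) - f a)^2)))"
   using nn_integral_shift[of "\<lambda>b. ennreal ?M * (indicator (cball 0 ?R) (b - a) * ennreal ((f b - f a)^2))" a]
   by (simp add: add.commute)
 qed
 also have "... = (NI v. (NI a. ennreal ?M * (indicator (cball 0 ?R) v * ennreal ((f (a + v) - f a)^2))))"
  using nn_integral_swap[of "\<lambda>p. ennreal ?M * (indicator (cball 0 ?R) (snd p) * ennreal ((f (fst p + snd p) - f (fst p))^2))"] by simp
 also have "... \<le> (NI v. ennreal (?M * (?R\<^sup>2 * A)) * indicator (cball 0 ?R) (v::'a))"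
 proof (intro nn_integral_mono)
  fix v :: 'a
  show "(NI a. ennreal ?M * (indicator (cball 0 ?R) v * ennreal ((f (a + v) - f a)^2)))
   \<le> ennreal (?M * (?R\<^sup>2 * A)) * indicator (cball 0 ?R) v"
  proof (cases "v \<in> cball 0 ?R")
   case True
   have "(NI a. ennreal ?M * (indicator (cball 0 ?R) v * ennreal ((f (a + v) - f a)^2)))
     = ennreal ?M * (NI a. ennreal ((f (a + v) - f a)^2))"
    using True by (simp add: nn_integral_cmult)
   also have "(NI a. ennreal ((f (a + v) - f a)^2)) = ennreal (LI a. (f (a + v) - f a)^2)"
    by (intro nn_integral_eq_integral translation) simp
   also have "ennreal ?M * ... \<le> ennreal ?M * ennreal (?R\<^sup>2 * A)"
   proof (intro mult_left_mono ennreal_leI)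
    have "(LI a. (f (a + v) - f a)^2) \<le> (norm v)^2 * A" by (rule translation)
    also have "... \<le> ?R\<^sup>2 * A" using True A_nonneg by (intro mult_right_mono power_mono) auto
    finally show "(LI a. (f (a + v) - f a)^2) \<le> ?R\<^sup>2 * A" .
   qed simp
   also have "... = ennreal (?M * (?R\<^sup>2 * A))" using A_nonneg h by (intro ennreal_mult[symmetric]) auto
   finally show ?thesis using True by simp
  qed simp
 qed
 also have "... = ennreal (?M * (?R\<^sup>2 * A)) * emeasure lborel (cball (0::'a) ?R)"
  by (rule nn_integral_cmult_indicator) simp
 also have "... = ennreal (?M * (?R\<^sup>2 * A)) * ennreal (unit_ball_vol DIM('a) * ?R ^ DIM('a))"
  using h by (subst emeasure_cball) auto
 also have "... = ennreal ((?M * (?R\<^sup>2 * A)) * (unit_ball_vol DIM('a) * ?R ^ DIM('a)))"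
  using A_nonneg h by (subst ennreal_mult[symmetric]) auto
 also have "(?M * (?R\<^sup>2 * A)) * (unit_ball_vol DIM('a) * ?R ^ DIM('a)) = step_const * A * (h\<^sup>2 / h ^ DIM('a))"
  using h by (simp add: step_const_def power_mult_distrib power_add power2_eq_square field_simps)
 finally show ?thesis
  using A_nonneg h unit_ball_vol_nonneg[of "real DIM('a)"] by (subst (asm) ennreal_le_iff) (auto simp: step_const_def)
qed

end

text \<open>Telescoping over dyadic scales: between 1 and 2 the L1 bound suffices, and each step
  from 2h to h costs at most a multiple of h^(1-n/2) \<le> h^(-s) by \<open>mol_step\<close>.
  Positivity of s makes the series geometric; in dimension three s = 1/2 is admissible, in dimension
  two every s > 0.\<close>

lemma sobolev_sup_bound:
 fixes A s :: real
 assumes s: "0 < s" "real DIM('a::euclidean_space) / 2 - 1 \<le> s"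
 shows "\<exists>C>0. \<forall>f (G :: 'a \<Rightarrow> 'a) h x. sobolev f G A \<longrightarrow> 0 < h \<longrightarrow> h \<le> 2 \<longrightarrow> \<bar>cv (mol h) f x\<bar> \<le> C * h powr (- s)"
proof -
 let ?S = "(molB TYPE('a))^2 * unit_ball_vol DIM('a) * (3 * real DIM('a)) ^ (DIM('a) + 2)"
 define D where "D = sqrt (?S * \<bar>A\<bar>)"
 \<comment> \<open>The first summand starts the induction at scales between 1 and 2, the second one
   gives C 2^(-s) + D \<le> C, which closes the induction step.\<close>
 define C where "C = molB TYPE('a) * \<bar>A\<bar> * 2 powr s + D / (1 - 2 powr (- s)) + 1"
 have r: "0 < 1 - 2 powr (- s)" using s(1) powr_less_mono[of "- s" 0 2] by simp
 have D: "0 \<le> D" by (simp add: D_def unit_ball_vol_nonneg)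
 have C: "0 < C" "molB TYPE('a) * \<bar>A\<bar> * 2 powr s \<le> C"
  using r D molB_pos[where 'a='a] by (auto simp: C_def add_nonneg_pos)
 have C2: "C * 2 powr (- s) + D \<le> C"
 proof -
  have "D / (1 - 2 powr (- s)) \<le> C" using molB_pos[where 'a='a] by (simp add: C_def)
  then have "D \<le> C * (1 - 2 powr (- s))" using r by (simp add: field_simps)
  then show ?thesis by (simp add: algebra_simps)
 qed
 have main: "\<bar>cv (mol h) f x\<bar> \<le> C * h powr (- s)"
  if sob: "sobolev f (G :: 'a \<Rightarrow> 'a) A" and h: "1 / 2 ^ n \<le> h" "h \<le> 2" for f G h x and n :: nat
  using h
 proof (induction n arbitrary: h)
  case 0
  interpret sobolev f G A by (rule sob)
  have h: "1 \<le> h" "0 < h" using 0 by auto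
  have "\<bar>cv (mol h) f x\<bar> \<le> molB TYPE('a) / h ^ DIM('a) * (LI y. norm (f y))"
   using cv_bound[OF f_int mol_measurable mol_abs_bound[OF h(2)], of x] by simp
  also have "... \<le> molB TYPE('a) * \<bar>A\<bar>"
  proof (intro mult_mono)
   show "molB TYPE('a) / h ^ DIM('a) \<le> molB TYPE('a)"
    using h molB_pos[where 'a='a] one_le_power[OF h(1), of "DIM('a)"] by (simp add: field_simps)
   show "(LI y. norm (f y)) \<le> \<bar>A\<bar>" using f_L1 f_nonneg by simp
  qed (use molB_pos[where 'a='a] in auto)
  also have "... = (molB TYPE('a) * \<bar>A\<bar> * 2 powr s) * 2 powr (- s)" by (simp add: powr_minus)
  also have "... \<le> C * h powr (- s)"
   using C s(1) h 0 by (intro mult_mono powr_mono2') auto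
  finally show ?case .
 next
  case (Suc n)
  interpret sobolev f G A by (rule sob)
  have h0: "0 < h" using Suc.prems(1) less_le_trans[of 0 "1 / 2 ^ Suc n" h] by simp
  show ?case
  proof (cases "h \<le> 1")
   case False
   moreover have "1 / 2 ^ n \<le> (1 :: real)" by simp
   ultimately have "1 / 2 ^ n \<le> h" by linarith
   then show ?thesis using Suc.IH[of h] Suc.prems by simp
  next
   case True
   have IH: "\<bar>cv (mol (2 * h)) f x\<bar> \<le> C * (2 * h) powr (- s)"
    using Suc.prems True by (intro Suc.IH) (auto simp: field_simps)
   have "(cv (mol h) f x - cv (mol (2 * h)) f x)^2 \<le> ?S * A * (h\<^sup>2 / h ^ DIM('a))"
    using mol_step[OF h0, of x] by (simp add: step_const_def)
   also have "h\<^sup>2 / h ^ DIM('a) = (h powr (1 - real DIM('a) / 2))^2"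
   proof -
    have "(h powr (1 - real DIM('a) / 2))^2 = h powr (2 - real DIM('a))"
     using h0 by (simp add: powr_power algebra_simps)
    also have "... = h powr 2 / h powr real DIM('a)" by (rule powr_diff)
    also have "... = h\<^sup>2 / h ^ DIM('a)" using h0 by (simp add: powr_realpow powr_numeral)
    finally show ?thesis by simp
   qed
   also have "... \<le> (h powr (- s))^2"
    using s h0 True by (intro power_mono powr_mono') auto
   finally have "(cv (mol h) f x - cv (mol (2 * h)) f x)^2 \<le> ?S * A * (h powr (- s))^2"
    using A_nonneg unit_ball_vol_nonneg[of "real DIM('a)"] by (auto simp: mult_left_mono)
   then have "sqrt ((cv (mol h) f x - cv (mol (2 * h)) f x)^2) \<le> sqrt (?S * A * (h powr (- s))^2)"
    by (rule real_sqrt_le_mono)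
   then have "\<bar>cv (mol h) f x - cv (mol (2 * h)) f x\<bar> \<le> D * h powr (- s)"
    using A_nonneg by (simp add: D_def real_sqrt_mult)
   then have "\<bar>cv (mol h) f x\<bar> \<le> C * (2 * h) powr (- s) + D * h powr (- s)" using IH by linarith
   also have "... = (C * 2 powr (- s) + D) * h powr (- s)" using h0 by (simp add: powr_mult algebra_simps)
   also have "... \<le> C * h powr (- s)" by (intro mult_right_mono C2) simp
   finally show ?thesis .
  qed
 qed
 show ?thesis
 proof (intro exI[of _ C] conjI C allI impI)
  fix f and G :: "'a \<Rightarrow> 'a" and h :: real and x assume a: "sobolev f G A" "0 < h" "h \<le> 2"
  obtain n where "(1 / 2) ^ n < h" using real_arch_pow_inv[OF a(2), of "1/2"] by auto
  then show "\<bar>cv (mol h) f x\<bar> \<le> C * h powr (- s)"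
   using main[OF a(1), of n h x] a(3) by (simp add: power_divide)
 qed
qed

text \<open>At a level above twice the bound on the mollified function, f > l forces f \<le> 2 (f -
  f_h), so the tail is controlled by the mollification error.\<close>

lemma sobolev_tail:
 fixes A s :: real
 assumes s: "0 < s" "real DIM('a::euclidean_space) / 2 - 1 \<le> s"
 shows "\<exists>C>0. \<forall>f (G :: 'a \<Rightarrow> 'a) h l. sobolev f G A \<longrightarrow> 0 < h \<longrightarrow> h \<le> 2 \<longrightarrow> C * h powr (- s) \<le> l \<longrightarrow>
   (LI x. indicator {x. l < f x} x * (f x)^2) \<le> C * h\<^sup>2"
proof -
 obtain C where C: "0 < C" "\<And>f (G :: 'a \<Rightarrow> 'a) h x. sobolev f G A \<Longrightarrow> 0 < h \<Longrightarrow> h \<le> 2 \<Longrightarrow> \<bar>cv (mol h) f x\<bar> \<le> C * h powr (- s)"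
  using sobolev_sup_bound[OF s, of A] by metis
 define K where "K = 2 * C + 4 * (real DIM('a))^2 * \<bar>A\<bar>"
 have K: "0 < K" "2 * C \<le> K" "4 * (real DIM('a))^2 * \<bar>A\<bar> \<le> K" using C(1) by (auto simp: K_def add_pos_nonneg)
 show ?thesis
 proof (intro exI[of _ K] conjI K allI impI)
  fix f and G :: "'a \<Rightarrow> 'a" and h l assume sob: "sobolev f G A" and h: "0 < h" "h \<le> 2" and l: "K * h powr (- s) \<le> l"
  interpret sobolev f G A by (rule sob)
  have pt: "indicator {x. l < f x} x * (f x)^2 \<le> 4 * (f x - cv (mol h) f x)^2" for x
  proof (cases "l < f x")
   case True
   have "2 * cv (mol h) f x \<le> 2 * \<bar>cv (mol h) f x\<bar>" by simp
   also have "... \<le> (2 * C) * h powr (- s)" using C(2)[OF sob h, of x] by simp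
   also have "... \<le> K * h powr (- s)" using K by (intro mult_right_mono) auto
   also have "... \<le> l" by (rule l)
   also have "l < f x" by (rule True)
   finally have "f x \<le> 2 * (f x - cv (mol h) f x)" by simp
   then have "(f x)^2 \<le> (2 * (f x - cv (mol h) f x))^2" using f_nonneg[of x] by (intro power_mono) auto
   also have "(2 * (f x - cv (mol h) f x))^2 = 4 * (f x - cv (mol h) f x)^2"
    by (simp add: power2_eq_square algebra_simps)
   finally show ?thesis using True by simp
  qed simp
  have [measurable]: "cv (mol h) f \<in> borel_measurable borel" by (intro cv_measurable) auto
  have "ennreal (LI x. indicator {x. l < f x} x * (f x)^2) = (NI x. ennreal (indicator {x. l < f x} x * (f x)^2))"
   using integrable_mult_indicator[OF _ f_sq, of "{x. l < f x}"]
   by (intro nn_integral_eq_integral[symmetric]) auto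
  also have "... \<le> (NI x. 4 * ennreal ((f x - cv (mol h) f x)^2))"
  proof (intro nn_integral_mono)
   fix x
   show "ennreal (indicator {x. l < f x} x * (f x)^2) \<le> 4 * ennreal ((f x - cv (mol h) f x)^2)"
    using ennreal_leI[OF pt[of x]] by (simp add: ennreal_mult)
  qed
  also have "... = 4 * (NI x. ennreal ((f x - cv (mol h) f x)^2))" by (rule nn_integral_cmult) simp
  also have "... \<le> 4 * ennreal ((real DIM('a) * h)^2 * A)" by (intro mult_left_mono mol_error h) simp
  also have "... = ennreal (4 * ((real DIM('a) * h)^2 * A))" using A_nonneg by (simp add: ennreal_mult)
  finally have "(LI x. indicator {x. l < f x} x * (f x)^2) \<le> 4 * ((real DIM('a) * h)^2 * A)"
   using A_nonneg by (subst (asm) ennreal_le_iff) auto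
  also have "... = (4 * (real DIM('a))^2 * \<bar>A\<bar>) * h\<^sup>2" using A_nonneg by (simp add: power_mult_distrib)
  also have "... \<le> K * h\<^sup>2" using K by (intro mult_right_mono) auto
  finally show "(LI x. indicator {x. l < f x} x * (f x)^2) \<le> K * h\<^sup>2" .
 qed
qed

text \<open>Choosing the scale as a function of the level l gives a tail of f^2 of order l^(-4). On
  a dyadic layer one has f^4 \<le> 4 l^2 f^2, so the layers sum to a geometric series.\<close>

lemma sobolev_L4:
 fixes A :: real
 assumes dim: "DIM('a::euclidean_space) \<le> 3"
 shows "\<exists>C>0. \<forall>f (G :: 'a \<Rightarrow> 'a). sobolev f G A \<longrightarrow>
  integrable lborel (\<lambda>x. f x ^ 4) \<and> (LI x. f x ^ 4) \<le> C"
proof -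
 have "0 < (1/2 :: real)" "real DIM('a) / 2 - 1 \<le> 1 / 2" using dim by auto
 from sobolev_tail[OF this, of A] obtain K where K: "0 < K"
  "\<And>f (G :: 'a \<Rightarrow> 'a) h l. sobolev f G A \<Longrightarrow> 0 < h \<Longrightarrow> h \<le> 2 \<Longrightarrow> K * h powr (- (1 / 2)) \<le> l \<Longrightarrow>
   (LI x. indicator {x. l < f x} x * (f x)^2) \<le> K * h\<^sup>2" by blast
 have tail: "(LI x. indicator {x. l < f x} x * (f x)^2) \<le> K * (K / l) ^ 4"
  if "sobolev f (G :: 'a \<Rightarrow> 'a) A" "K \<le> l" for f G l
 proof -
  have l: "0 < l" using that K by linarith
  \<comment> \<open>The scale h = (K / l)^2 solves K h^(-1/2) = l.\<close>
  have "(K / l)^2 \<le> 1" using that K l by (intro power_le_one) auto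
  moreover have "K * ((K / l)^2) powr (- (1 / 2)) \<le> l"
   using l K(1) by (simp add: powr_minus powr_half_sqrt)
  ultimately have "(LI x. indicator {x. l < f x} x * (f x)^2) \<le> K * ((K / l)^2)^2"
   using l K(1) by (intro K(2)[OF that(1)]) auto
  then show ?thesis by (simp flip: power_mult)
 qed
 \<comment> \<open>The first summand accounts for values up to \<open>K\<close>, the series for the
   layers between \<open>2 ^ k * K\<close> and twice that level, and 1 ensures positivity.\<close>
 define C where "C = K\<^sup>2 * \<bar>A\<bar> + (\<Sum>k. (2 ^ Suc k * K)^2 * (K * (K / (2 ^ k * K)) ^ 4)) + 1"
 have geo: "(2 ^ Suc k * K)^2 * (K * (K / (2 ^ k * K)) ^ 4) = (4 * K ^ 3) * (1 / 4) ^ k" for k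
 proof -
  have "((2::real) ^ k)^2 = (2\<^sup>2) ^ k" by (simp only: power_mult[symmetric] mult.commute)
  then have "(2 ^ Suc k * K)^2 = 4 * 4 ^ k * K\<^sup>2" by (simp add: power_mult_distrib)
  moreover have "K / (2 ^ k * K) = (1 / 2) ^ k" using K(1) by (simp add: power_divide)
  moreover have "((1 / 2 :: real) ^ k) ^ 4 = (1 / 16) ^ k" by (simp add: power_mult[symmetric] mult.commute[of k]) (simp add: power_mult power_divide)
  ultimately have "(2 ^ Suc k * K)^2 * (K * (K / (2 ^ k * K)) ^ 4) = 4 * K ^ 3 * (4 ^ k * (1 / 16) ^ k)"
   by (simp add: power2_eq_square power3_eq_cube)
  also have "(4::real) ^ k * (1 / 16) ^ k = (1 / 4) ^ k" by (simp flip: power_mult_distrib)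
  finally show ?thesis .
 qed
 have summ: "summable (\<lambda>k. (2 ^ Suc k * K)^2 * (K * (K / (2 ^ k * K)) ^ 4))"
  unfolding geo by (intro summable_mult summable_geometric) simp
 have sn: "0 \<le> (\<Sum>k. (2 ^ Suc k * K)^2 * (K * (K / (2 ^ k * K)) ^ 4))"
  using K(1) by (intro suminf_nonneg summ) auto
 have C: "0 < C" unfolding C_def using sn K by (simp add: add_nonneg_pos)
 show ?thesis
 proof (intro exI[of _ C] conjI[of "0 < C"] C allI impI)
  fix f and G :: "'a \<Rightarrow> 'a" assume sob: "sobolev f G A"
  interpret sobolev f G A by (rule sob)
  let ?u = "\<lambda>k::nat. \<lambda>x. ennreal ((2 ^ Suc k * K)^2 * (indicator {x. 2 ^ k * K < f x} x * (f x)^2))"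
  have pt: "ennreal (f x ^ 4) \<le> ennreal (K\<^sup>2 * (f x)^2) + (\<Sum>k. ?u k x)" for x
  proof (cases "f x \<le> K")
   case True
   have "f x ^ 4 = (f x)^2 * (f x)^2" by (simp flip: power_add)
   also have "... \<le> K\<^sup>2 * (f x)^2" using True f_nonneg[of x] by (intro mult_right_mono power_mono) auto
   finally show ?thesis by (simp add: ennreal_leI add_increasing2)
  next
   case False
   obtain n where n: "f x < 2 ^ n * K"
    using real_arch_pow[of 2 "f x / K"] K(1) by (auto simp: field_simps)
   \<comment> \<open>\<open>m\<close> is the first dyadic level above the value. It is positive
     since the value exceeds \<open>K\<close>, so the value lies in the layer with index m -
     1.\<close>
   define m where "m = (LEAST n. f x \<le> 2 ^ n * K)"
   have m: "f x \<le> 2 ^ m * K" unfolding m_def by (rule LeastI[of "\<lambda>n. f x \<le> 2 ^ n * K" n]) (use n in simp)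
   have "m \<noteq> 0" using m False by (auto intro: ccontr)
   then obtain k where k: "m = Suc k" by (cases m) auto
   have "\<not> f x \<le> 2 ^ k * K" using not_less_Least[of k "\<lambda>n. f x \<le> 2 ^ n * K"] k by (simp add: m_def)
   then have k1: "2 ^ k * K < f x" by simp
   have "f x ^ 4 = (f x)^2 * (f x)^2" by (simp flip: power_add)
   also have "... \<le> (2 ^ Suc k * K)^2 * (f x)^2" using m k f_nonneg[of x] by (intro mult_right_mono power_mono) auto
   finally have "ennreal (f x ^ 4) \<le> ?u k x" using k1 by (simp add: ennreal_leI)
   also have "... = sum (\<lambda>k. ?u k x) {k}" by simp
   also have "... \<le> (\<Sum>k. ?u k x)" by (rule sum_le_suminf) auto
   finally show ?thesis by (simp add: add_increasing)
  qed
  have "(NI x. ennreal (f x ^ 4)) \<le> (NI x. ennreal (K\<^sup>2 * (f x)^2) + (\<Sum>k. ?u k x))"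
   by (intro nn_integral_mono pt)
  also have "... = (NI x. ennreal (K\<^sup>2 * (f x)^2)) + (\<Sum>k. (NI x. ?u k x))"
   by (subst nn_integral_add) (auto intro!: nn_integral_suminf)
  also have "... \<le> ennreal (K\<^sup>2 * \<bar>A\<bar>) + (\<Sum>k. ennreal ((2 ^ Suc k * K)^2 * (K * (K / (2 ^ k * K)) ^ 4)))"
  proof (intro add_mono suminf_le)
   show "(NI x. ennreal (K\<^sup>2 * (f x)^2)) \<le> ennreal (K\<^sup>2 * \<bar>A\<bar>)"
   proof -
    have "(NI x. ennreal (K\<^sup>2 * (f x)^2)) = ennreal (LI x. K\<^sup>2 * (f x)^2)"
     using f_sq by (intro nn_integral_eq_integral) auto
    also have "... \<le> ennreal (K\<^sup>2 * \<bar>A\<bar>)" using f_L2 by (intro ennreal_leI) (auto intro!: mult_left_mono)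
    finally show ?thesis .
   qed
   fix k
   have "(NI x. ?u k x) = ennreal (LI x. (2 ^ Suc k * K)^2 * (indicator {x. 2 ^ k * K < f x} x * (f x)^2))"
    using integrable_mult_indicator[OF _ f_sq, of "{x. 2 ^ k * K < f x}"]
    by (intro nn_integral_eq_integral integrable_mult_right) auto
   also have "... = ennreal ((2 ^ Suc k * K)^2 * (LI x. indicator {x. 2 ^ k * K < f x} x * (f x)^2))" by simp
   also have "... \<le> ennreal ((2 ^ Suc k * K)^2 * (K * (K / (2 ^ k * K)) ^ 4))"
    using K(1) by (intro ennreal_leI mult_left_mono tail[OF sob]) auto
   finally show "(NI x. ?u k x) \<le> ennreal ((2 ^ Suc k * K)^2 * (K * (K / (2 ^ k * K)) ^ 4))" .
  qed auto
  also have "(\<Sum>k. ennreal ((2 ^ Suc k * K)^2 * (K * (K / (2 ^ k * K)) ^ 4))) = ennreal (\<Sum>k. (2 ^ Suc k * K)^2 * (K * (K / (2 ^ k * K)) ^ 4))"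
   using K(1) summ by (intro suminf_ennreal2) auto
  also have "ennreal (K\<^sup>2 * \<bar>A\<bar>) + ... = ennreal (C - 1)" using sn by (simp add: C_def ennreal_plus)
  finally have b: "(NI x. ennreal (f x ^ 4)) \<le> ennreal (C - 1)" .
  show i: "integrable lborel (\<lambda>x. f x ^ 4) \<and> (LI x. f x ^ 4) \<le> C"
  proof
   show i: "integrable lborel (\<lambda>x. f x ^ 4)"
    using b by (intro integrableI_bounded) (auto intro: le_less_trans simp: f_nonneg)
   have "ennreal (LI x. f x ^ 4) \<le> ennreal C"
    using nn_integral_eq_integral[OF i] b by (simp add: order_trans[OF _ ennreal_leI])
   then show "(LI x. f x ^ 4) \<le> C" using C by (subst (asm) ennreal_le_iff) auto
  qed
 qed
qed

section \<open>Comparison of two densities\<close>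

text \<open>Writing c = d^(1-p) makes the left side a product of powers with total exponent p + 1 +
  (1 - p) = 2, which is at most the square of the largest of u, v and d.\<close>

lemma young_three:
 fixes u v c p :: real
 assumes "0 \<le> u" "0 \<le> v" "0 \<le> c" "0 \<le> p" "p < 1"
 shows "u powr p * v * c \<le> u\<^sup>2 + v\<^sup>2 + c powr (2 / (1 - p))"
proof -
 define d where "d = c powr (1 / (1 - p))"
 have "1 / (1 - p) + 1 / (1 - p) = 2 / (1 - p)" by (simp flip: add_divide_distrib)
 then have "d\<^sup>2 = c powr (2 / (1 - p))" by (simp add: d_def power2_eq_square flip: powr_add)
 moreover have "0 \<le> d" "d powr (1 - p) = c" using assms by (auto simp: d_def powr_powr)
 ultimately have d: "0 \<le> d" "d powr (1 - p) = c" "d\<^sup>2 = c powr (2 / (1 - p))" by auto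
 define m where "m = max u (max v d)"
 have m: "0 \<le> m" "u \<le> m" "v \<le> m" "d \<le> m" using assms d by (auto simp: m_def)
 have "u powr p * v * c \<le> m powr p * m * m powr (1 - p)"
  unfolding d(2)[symmetric] using assms m d by (intro mult_mono powr_mono2) auto
 also have "... = m\<^sup>2"
  using m(1) assms by (cases "m = 0") (auto simp: powr_diff power2_eq_square)
 also have "... \<le> u\<^sup>2 + v\<^sup>2 + d\<^sup>2"
  unfolding m_def by (auto simp: max_def)
 finally show ?thesis by (simp add: d(3))
qed

lemma powr_root_diff:
 fixes a b r :: real
 assumes "0 \<le> a" "0 \<le> b" "1 \<le> r"
 shows "\<bar>a - b\<bar> \<le> \<bar>a powr r - b powr r\<bar> powr (1 / r)"
  and "\<bar>a - b\<bar> powr r \<le> \<bar>a powr r - b powr r\<bar>"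
proof -
 have "\<bar>(a powr r) powr (1 / r) - (b powr r) powr (1 / r)\<bar> \<le> \<bar>a powr r - b powr r\<bar> powr (1 / r)"
  using assms by (intro powr_diff_le) auto
 then show 1: "\<bar>a - b\<bar> \<le> \<bar>a powr r - b powr r\<bar> powr (1 / r)"
  using assms by (simp add: powr_powr)
 have "\<bar>a - b\<bar> powr r \<le> (\<bar>a powr r - b powr r\<bar> powr (1 / r)) powr r"
  using assms 1 by (intro powr_mono2) auto
 then show "\<bar>a - b\<bar> powr r \<le> \<bar>a powr r - b powr r\<bar>" using assms by (simp add: powr_powr)
qed

text \<open>As a function of a^r the left power has exponent 1 + 1/(2r), so its derivative is a
  multiple of a^(1/2).\<close>

lemma powr_half_more_diff:
 fixes a b r R :: real
 assumes "0 \<le> a" "0 \<le> b" "1 \<le> r" "a \<le> R" "b \<le> R"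
 shows "\<bar>a powr (r + 1 / 2) - b powr (r + 1 / 2)\<bar> \<le> 2 * R powr (1 / 2) * \<bar>a powr r - b powr r\<bar>"
proof -
 let ?q = "1 / (2 * r)"
 have q: "0 < ?q" "?q \<le> 1 / 2" "r * (1 + ?q) = r + 1 / 2" "r * ?q = 1 / 2" using assms by (auto simp: field_simps)
 obtain z where z: "0 \<le> z" "z \<le> max (b powr r) (a powr r)"
  "(a powr r) powr (1 + ?q) - (b powr r) powr (1 + ?q) = (1 + ?q) * z powr ?q * (a powr r - b powr r)"
  using powr_MVT[of "b powr r" "a powr r" ?q] q(1) by auto
 have "z \<le> R powr r" using z(2) assms powr_mono2[of r a R] powr_mono2[of r b R] by auto
 then have zR: "z powr ?q \<le> R powr (1 / 2)"
  using z(1) q powr_mono2[of ?q z "R powr r"] by (simp add: powr_powr)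
 have "\<bar>a powr (r + 1 / 2) - b powr (r + 1 / 2)\<bar> = (1 + ?q) * z powr ?q * \<bar>a powr r - b powr r\<bar>"
  using z(3) q by (simp only: powr_powr q(3)) (simp add: abs_mult)
 also have "... \<le> 2 * R powr (1 / 2) * \<bar>a powr r - b powr r\<bar>"
  using q zR by (intro mult_right_mono mult_mono) auto
 finally show ?thesis .
qed

text \<open>The kernel through which two mollified functions interact, see \<open>kk_eq\<close>:
  again even, nonnegative and of mass 1, with twice the support radius.\<close>

definition kk :: "real \<Rightarrow> 'a::euclidean_space \<Rightarrow> real" where
 "kk h = cv (mol h) (mol h)"

lemma kk_eq: "(LI x. mol h (x - y) * mol h (x - z)) = kk h (z - (y::'a::euclidean_space))"
proof -
 have "(LI x. mol h (x - y) * mol h (x - z)) = (LI x. mol h (x + y - y) * mol h (x + y - z))"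
  using integral_shift[of "\<lambda>x. mol h (x - y) * mol h (x - z)" y] by simp
 also have "... = (LI x. mol h (z - y - x) * mol h x)"
  by (intro Bochner_Integration.integral_cong refl) (metis (no_types, opaque_lifting) add_diff_cancel_right' diff_diff_eq2 mol_minus_commute mult.commute add.commute)
 finally show ?thesis by (simp add: kk_def cv_def)
qed

lemma kk_nonneg: "0 < h \<Longrightarrow> 0 \<le> kk h x"
 unfolding kk_def cv_def by (intro Bochner_Integration.integral_nonneg) (auto intro!: mult_nonneg_nonneg mol_nonneg)

lemma kk_measurable [measurable]: "kk h \<in> borel_measurable borel"
 unfolding kk_def by (intro cv_measurable) auto

lemma kk_even: "kk h (- x) = kk h (x :: 'a::euclidean_space)"
 using kk_eq[of h 0 x] kk_eq[of h x 0] by (simp add: mult.commute)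

lemma kk_supp:
 fixes x :: "'a::euclidean_space"
 assumes h: "0 < h" and k: "kk h x \<noteq> 0" shows "norm x \<le> 2 * real DIM('a) * h"
proof (rule ccontr)
 assume n: "\<not> ?thesis"
 have "mol h (x - y) * mol h y = 0" for y
 proof (rule ccontr)
  assume "mol h (x - y) * mol h y \<noteq> 0"
  then have "norm (x - y) \<le> real DIM('a) * h" "norm y \<le> real DIM('a) * h"
   using mol_supp[OF h] by auto
  then show False using norm_triangle_ineq[of "x - y" y] n by simp
 qed
 then have "(\<lambda>y. mol h (x - y) * mol h y) = (\<lambda>y. 0)" by (rule ext)
 then have "kk h x = 0" by (simp add: kk_def cv_def)
 then show False using k by simp
qed

lemma kk_nn_integral:
 assumes h: "0 < h" shows "(NI x. ennreal (kk h (x :: 'a::euclidean_space))) = 1"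
proof -
 have e: "ennreal (kk h x) = (NI y. ennreal (mol h (x - y)) * ennreal (mol h y))" for x :: 'a
 proof -
  have "integrable lborel (\<lambda>y. mol h (x - y) * mol h y)"
   using integrable_mol_kernel[OF mol_integrable[OF h] h, of x] by simp
  then have "ennreal (kk h x) = (NI y. ennreal (mol h (x - y) * mol h y))"
   unfolding kk_def cv_def by (subst nn_integral_eq_integral) (auto intro!: mult_nonneg_nonneg mol_nonneg[OF h])
  also have "... = (NI y. ennreal (mol h (x - y)) * ennreal (mol h y))"
   by (intro nn_integral_cong ennreal_mult mol_nonneg[OF h])
  finally show ?thesis .
 qed
 have "(NI x. ennreal (kk h (x :: 'a))) = (NI y. (NI x. ennreal (mol h (x - y)) * ennreal (mol h (y :: 'a))))"
  unfolding e using nn_integral_swap[of "\<lambda>p. ennreal (mol h (fst p - snd p)) * ennreal (mol h (snd p :: 'a))"] by simp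
 also have "... = (NI y. ennreal (mol h (y :: 'a)))"
 proof (rule nn_integral_cong)
  fix y :: 'a
  have "(NI x. ennreal (mol h (x - y)) * ennreal (mol h y)) = (NI x. ennreal (mol h (x + - y))) * ennreal (mol h y)"
   by (subst nn_integral_multc) auto
  also have "... = ennreal (mol h y)"
   using nn_integral_shift[of "\<lambda>x. ennreal (mol h x)" "- y"] nn_integral_mol[OF h, where 'a='a] by simp
  finally show "(NI x. ennreal (mol h (x - y)) * ennreal (mol h y)) = ennreal (mol h y)" .
 qed
 also have "... = 1" by (rule nn_integral_mol[OF h])
 finally show ?thesis .
qed

lemma kk_abs_bound: "0 < h \<Longrightarrow> \<bar>kk h (x::'a::euclidean_space)\<bar> \<le> molB TYPE('a) / h ^ DIM('a)"
 using cv_bound[OF mol_integrable mol_measurable mol_abs_bound, of h h x]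
 by (simp add: kk_def abs_mol mol_integral)

text \<open>Increments over distances of order h, divided by h, are bounded in L2 uniformly in
  h.\<close>

lemma (in sobolev) kk_difference:
 assumes h: "0 < h"
 shows "(NI y. (NI z. ennreal (kk h (z - y)) * ennreal (((f y - f z) / h)^2))) \<le> ennreal ((2 * real DIM('a))^2 * A)"
proof -
 have "(NI y. (NI z. ennreal (kk h (z - y)) * ennreal (((f y - f z) / h)^2)))
   = (NI y. (NI v. ennreal (kk h v) * ennreal (((f (y + v) - f y) / h)^2)))"
 proof (rule nn_integral_cong)
  fix y :: 'a
  show "(NI z. ennreal (kk h (z - y)) * ennreal (((f y - f z) / h)^2))
   = (NI v. ennreal (kk h v) * ennreal (((f (y + v) - f y) / h)^2))"
   using nn_integral_shift[of "\<lambda>z. ennreal (kk h (z - y)) * ennreal (((f y - f z) / h)^2)" y]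
   by (simp add: add.commute power_divide power2_commute)
 qed
 also have "... = (NI v. (NI y. ennreal (kk h v) * ennreal (((f (y + v) - f y) / h)^2)))"
  using nn_integral_swap[of "\<lambda>p. ennreal (kk h (snd p)) * ennreal (((f (fst p + snd p) - f (fst p)) / h)^2)"] by simp
 also have "... \<le> (NI v. ennreal (kk h (v::'a)) * ennreal ((2 * real DIM('a))^2 * A))"
 proof (rule nn_integral_mono)
  fix v :: 'a
  have "(NI y. ennreal (kk h v) * ennreal (((f (y + v) - f y) / h)^2))
   = ennreal (kk h v) * (NI y. ennreal (((f (y + v) - f y) / h)^2))" by (rule nn_integral_cmult) simp
  also have "(NI y. ennreal (((f (y + v) - f y) / h)^2)) = ennreal (LI y. ((f (y + v) - f y) / h)^2)"
   using translation[of v] by (intro nn_integral_eq_integral) (auto simp: power_divide)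
  also have "ennreal (kk h v) * ... \<le> ennreal (kk h v) * ennreal ((2 * real DIM('a))^2 * A)"
  proof (cases "kk h v = 0")
   case False
   have "(LI y. ((f (y + v) - f y) / h)^2) = (LI y. (f (y + v) - f y)^2) / h\<^sup>2"
    by (simp add: power_divide)
   also have "... \<le> ((norm v)^2 * A) / h\<^sup>2" by (intro divide_right_mono translation) simp
   also have "... \<le> ((2 * real DIM('a) * h)^2 * A) / h\<^sup>2"
    using kk_supp[OF h False] A_nonneg by (intro divide_right_mono mult_right_mono power_mono) auto
   also have "... = (2 * real DIM('a))^2 * A" using h by (simp add: power_mult_distrib)
   finally show ?thesis by (intro mult_left_mono ennreal_leI) auto
  qed simp
  finally show "(NI y. ennreal (kk h v) * ennreal (((f (y + v) - f y) / h)^2))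
   \<le> ennreal (kk h v) * ennreal ((2 * real DIM('a))^2 * A)" .
 qed
 also have "... = ennreal ((2 * real DIM('a))^2 * A)" by (simp add: nn_integral_multc kk_nn_integral[OF h])
 finally show ?thesis .
qed

lemma kk_average:
 fixes Q :: "'a::euclidean_space \<Rightarrow> real"
 assumes h: "0 < h" and [measurable]: "Q \<in> borel_measurable borel"
 shows "(NI y. (NI z. ennreal (kk h (z - y)) * ennreal (Q y))) = (NI y. ennreal (Q y))"
  and "(NI y. (NI z. ennreal (kk h (z - y)) * ennreal (Q z))) = (NI y. ennreal (Q y))"
proof -
 have s: "(NI z. ennreal (kk h (z - y)) * ennreal (Q y)) = ennreal (Q y)" for y
  using nn_integral_shift[of "\<lambda>z. ennreal (kk h z)" "- y"] kk_nn_integral[OF h, where 'a='a]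
  by (simp add: nn_integral_multc)
 then show "(NI y. (NI z. ennreal (kk h (z - y)) * ennreal (Q y))) = (NI y. ennreal (Q y))"
  by simp
 have "(NI y. (NI z. ennreal (kk h (z - y)) * ennreal (Q z)))
   = (NI z. (NI y. ennreal (kk h (z - y)) * ennreal (Q z)))"
  using nn_integral_swap[of "\<lambda>p. ennreal (kk h (snd p - fst p)) * ennreal (Q (snd p))"] by simp
 also have "... = (NI z. (NI y. ennreal (kk h (y - z)) * ennreal (Q z)))"
 proof -
  have "kk h (z - y) = kk h (y - z)" for y z :: 'a using kk_even[of h "y - z"] by simp
  then show ?thesis by simp
 qed
 finally show "(NI y. (NI z. ennreal (kk h (z - y)) * ennreal (Q z))) = (NI y. ennreal (Q y))"
  by (simp add: s)
qed

text \<open>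
  Mollifying both factors replaces \<open>\<integral> w g\<close> by \<open>\<integral> w g - 1/2 \<integral>\<integral> kk h (y - z) (w y - w z) (g y - g z)\<close>.
\<close>

lemma symmetrization:
 fixes w g Q f1 f2 :: "'a::euclidean_space \<Rightarrow> real"
 assumes h: "0 < h" and s1: "sobolev f1 G1 A" and s2: "sobolev f2 G2 A"
  and w: "integrable lborel w" and g: "integrable lborel g" and wg: "\<And>y. 0 \<le> w y * g y"
  and Q: "integrable lborel Q" "\<And>y. 0 \<le> Q y" "(LI y. Q y) \<le> B" and kap: "0 \<le> \<kappa>"
  and bound: "\<And>y z. \<bar>w y - w z\<bar> * \<bar>g y - g z\<bar> \<le> \<kappa> * (((f1 y - f1 z) / h)^2 + ((f2 y - f2 z) / h)^2 + Q y + Q z)"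
 defines "E \<equiv> \<kappa> * (2 * (2 * real DIM('a))^2 * A + 2 * B)"
 shows "0 \<le> 2 * (LI x. cv (mol h) w x * cv (mol h) g x) + E"
  and "2 * (NI x. ennreal (w x * g x)) \<le> ennreal (2 * (LI x. cv (mol h) w x * cv (mol h) g x) + E)"
proof -
 interpret S1: sobolev f1 G1 A by (rule s1)
 interpret S2: sobolev f2 G2 A by (rule s2)
 have [measurable]: "w \<in> borel_measurable borel" "g \<in> borel_measurable borel" "Q \<in> borel_measurable borel"
  using w g Q by auto
 note A0 = S1.A_nonneg
 have B0: "0 \<le> B" using Q(3) Bochner_Integration.integral_nonneg[of lborel Q] Q(2) by (meson order_trans)
 have E0: "0 \<le> E" using A0 B0 kap by (simp add: E_def)
 let ?K = "\<lambda>p :: 'a \<times> 'a. kk h (snd p - fst p)"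
 let ?I = "(LI x. cv (mol h) w x * cv (mol h) g x)"
 \<comment> \<open>\<open>P\<close> collects the cross terms, whose integral is twice that of the
   product of the mollified functions; \<open>D\<close> dominates the product of the
   increments.\<close>
 define D where "D p = ?K p * (\<bar>w (fst p) - w (snd p)\<bar> * \<bar>g (fst p) - g (snd p)\<bar>)" for p
 define P where "P p = ?K p * (w (fst p) * g (snd p) + w (snd p) * g (fst p))" for p
 have [measurable]: "D \<in> borel_measurable borel" "P \<in> borel_measurable borel"
  unfolding D_def[abs_def] P_def[abs_def] by measurable
 have K0: "0 \<le> ?K p" for p by (rule kk_nonneg[OF h])
 have D0: "0 \<le> D p" for p using K0[of p] by (simp add: D_def)
 have Db: "(\<integral>\<^sup>+p. ennreal (D p) \<partial>(lborel \<Otimes>\<^sub>M lborel)) \<le> ennreal E"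
 proof -
  have "(\<integral>\<^sup>+p. ennreal (D p) \<partial>(lborel \<Otimes>\<^sub>M lborel)) = (NI y. (NI z. ennreal (D (y, z))))"
   by (subst lborel.nn_integral_fst[symmetric]) (auto simp: lborel_prod)
  also have "... \<le> (NI y. (NI z. ennreal \<kappa> * (ennreal (kk h (z - y)) * ennreal (((f1 y - f1 z) / h)^2) + ennreal (kk h (z - y)) * ennreal (((f2 y - f2 z) / h)^2)
    + ennreal (kk h (z - y)) * ennreal (Q y) + ennreal (kk h (z - y)) * ennreal (Q z))))"
  proof (intro nn_integral_mono)
   fix y z
   have "D (y, z) \<le> kk h (z - y) * (\<kappa> * (((f1 y - f1 z) / h)^2 + ((f2 y - f2 z) / h)^2 + Q y + Q z))"
    unfolding D_def fst_conv snd_conv by (intro mult_left_mono bound kk_nonneg h)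
   then have "ennreal (D (y, z)) \<le> ennreal (\<kappa> * (kk h (z - y) * ((f1 y - f1 z) / h)^2 + kk h (z - y) * ((f2 y - f2 z) / h)^2 + kk h (z - y) * Q y + kk h (z - y) * Q z))"
    by (intro ennreal_leI) (simp add: algebra_simps)
   also have "... = ennreal \<kappa> * (ennreal (kk h (z - y)) * ennreal (((f1 y - f1 z) / h)^2) + ennreal (kk h (z - y)) * ennreal (((f2 y - f2 z) / h)^2)
    + ennreal (kk h (z - y)) * ennreal (Q y) + ennreal (kk h (z - y)) * ennreal (Q z))"
    using kap Q(2) kk_nonneg[OF h, of "z - y"] by (simp only: ennreal_mult ennreal_plus add_nonneg_nonneg mult_nonneg_nonneg zero_le_power2)
   finally show "ennreal (D (y, z)) \<le> ..." .
  qed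
  also have "... = ennreal \<kappa> * ((NI y. (NI z. ennreal (kk h (z - y)) * ennreal (((f1 y - f1 z) / h)^2)))
    + (NI y. (NI z. ennreal (kk h (z - y)) * ennreal (((f2 y - f2 z) / h)^2)))
    + (NI y. (NI z. ennreal (kk h (z - y)) * ennreal (Q y)))
    + (NI y. (NI z. ennreal (kk h (z - y)) * ennreal (Q z))))"
   by (simp add: nn_integral_cmult nn_integral_add)
  also have "... \<le> ennreal \<kappa> * (ennreal ((2 * real DIM('a))^2 * A) + ennreal ((2 * real DIM('a))^2 * A) + ennreal B + ennreal B)"
  proof -
   have "(NI y. ennreal (Q y)) \<le> ennreal B"
    using Q by (subst nn_integral_eq_integral) (auto intro: ennreal_leI)
   then show ?thesis
    by (intro mult_left_mono add_mono S1.kk_difference S2.kk_difference h) (auto simp: kk_average[OF h])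
  qed
  also have "... = ennreal E"
  proof -
   have "ennreal ((2 * real DIM('a))^2 * A) + ennreal ((2 * real DIM('a))^2 * A) + ennreal B + ennreal B
     = ennreal (2 * (2 * real DIM('a))^2 * A + 2 * B)"
    using A0 B0 by (simp flip: ennreal_plus)
   then show ?thesis using kap A0 B0 by (simp add: E_def ennreal_mult)
  qed
  finally show ?thesis .
 qed
 have D_int: "integrable (lborel \<Otimes>\<^sub>M lborel) D"
  using Db D0 by (intro integrableI_bounded) (auto simp: lborel_prod intro: le_less_trans)
 have DE: "integral\<^sup>L (lborel \<Otimes>\<^sub>M lborel) D \<le> E"
  using Db nn_integral_eq_integral[OF D_int] D0 E0 by simp
 have cvp: "?I = (\<integral>p. w (fst p) * g (snd p) * ?K p \<partial>(lborel \<Otimes>\<^sub>M lborel))"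
  by (subst cv_cv_product(2)[OF w g mol_integrable[OF h] mol_abs_bound[OF h] mol_integrable[OF h] mol_abs_bound[OF h]]) (simp add: kk_eq)
 have cvp': "?I = (\<integral>p. g (fst p) * w (snd p) * ?K p \<partial>(lborel \<Otimes>\<^sub>M lborel))"
  using cv_cv_product(2)[OF g w mol_integrable[OF h] mol_abs_bound[OF h] mol_integrable[OF h] mol_abs_bound[OF h]]
  by (simp add: kk_eq mult.commute)
 have ip: "integrable (lborel \<Otimes>\<^sub>M lborel) (\<lambda>p. a (fst p) * b (snd p) * ?K p)"
  if a: "integrable lborel a" and b: "integrable lborel b" for a b :: "'a \<Rightarrow> real"
 proof -
  have [measurable]: "a \<in> borel_measurable borel" "b \<in> borel_measurable borel" using a b by auto
  have "integrable (lborel \<Otimes>\<^sub>M lborel) (\<lambda>p. a (fst p) * b (snd p))"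
  proof (rule integrable_prodI)
   have "(NI x. (NI y. ennreal (norm (a (fst (x, y)) * b (snd (x, y))))))
     = (NI x. ennreal (norm (a x))) * (NI y. ennreal (norm (b y)))"
    by (simp add: abs_mult ennreal_mult nn_integral_cmult nn_integral_multc)
   also have "... < \<infinity>" using a b by (auto simp: integrable_iff_bounded ennreal_mult_less_top)
   finally show "(NI x. (NI y. ennreal (norm (a (fst (x, y)) * b (snd (x, y)))))) < \<infinity>" .
  qed simp
  from integrable_bounded_scale[OF this, of ?K, OF _ kk_abs_bound[OF h]]
  show ?thesis by (simp add: lborel_prod mult.commute)
 qed
 have Pe: "P = (\<lambda>p. w (fst p) * g (snd p) * ?K p + g (fst p) * w (snd p) * ?K p)"
  by (simp add: P_def fun_eq_iff algebra_simps)
 have P_int: "integrable (lborel \<Otimes>\<^sub>M lborel) P"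
  unfolding Pe by (intro Bochner_Integration.integrable_add ip w g)
 have PI: "integral\<^sup>L (lborel \<Otimes>\<^sub>M lborel) P = 2 * ?I"
  unfolding Pe using ip[OF w g] ip[OF g w] cvp cvp' by simp
 \<comment> \<open>The diagonal terms equal the cross terms plus the product of the increments.
   Because the diagonal terms are nonnegative, so is \<open>P p + D p\<close>.\<close>
 have pt: "?K p * (w (fst p) * g (fst p) + w (snd p) * g (snd p)) \<le> P p + D p" for p
 proof -
  have "w (fst p) * g (fst p) + w (snd p) * g (snd p) = (w (fst p) * g (snd p) + w (snd p) * g (fst p)) + (w (fst p) - w (snd p)) * (g (fst p) - g (snd p))"
   by (simp add: algebra_simps)
  also have "... \<le> (w (fst p) * g (snd p) + w (snd p) * g (fst p)) + \<bar>w (fst p) - w (snd p)\<bar> * \<bar>g (fst p) - g (snd p)\<bar>"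
   unfolding abs_mult[symmetric] by simp
  finally show ?thesis using mult_left_mono[OF _ K0[of p]] by (simp add: P_def D_def flip: distrib_left)
 qed
 have PD0: "0 \<le> P p + D p" for p
  using pt[of p] wg[of "fst p"] wg[of "snd p"] K0[of p] by (meson add_nonneg_nonneg mult_nonneg_nonneg order_trans)
 have PD: "integral\<^sup>L (lborel \<Otimes>\<^sub>M lborel) (\<lambda>p. P p + D p) \<le> 2 * ?I + E"
  using P_int D_int PI DE by simp
 have "0 \<le> integral\<^sup>L (lborel \<Otimes>\<^sub>M lborel) (\<lambda>p. P p + D p)"
  by (intro Bochner_Integration.integral_nonneg PD0)
 with PD show "0 \<le> 2 * ?I + E" by linarith
 have "2 * (NI x. ennreal (w x * g x))
   = (NI y. (NI z. ennreal (kk h (z - y)) * ennreal (w y * g y)))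
    + (NI y. (NI z. ennreal (kk h (z - y)) * ennreal (w z * g z)))"
  by (simp add: kk_average[OF h] mult_2)
 also have "... = (NI y. (NI z. ennreal (kk h (z - y)) * ennreal (w y * g y) + ennreal (kk h (z - y)) * ennreal (w z * g z)))"
  by (simp add: nn_integral_add)
 also have "... \<le> (NI y. (NI z. ennreal (P (y, z) + D (y, z))))"
 proof (intro nn_integral_mono)
  fix y z
  have "ennreal (kk h (z - y)) * ennreal (w y * g y) + ennreal (kk h (z - y)) * ennreal (w z * g z)
    = ennreal (kk h (z - y) * (w y * g y + w z * g z))"
   using wg kk_nonneg[OF h, of "z - y"] by (simp add: ennreal_mult ennreal_plus distrib_left)
  also have "... \<le> ennreal (P (y, z) + D (y, z))" using pt[of "(y, z)"] by (intro ennreal_leI) simp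
  finally show "ennreal (kk h (z - y)) * ennreal (w y * g y) + ennreal (kk h (z - y)) * ennreal (w z * g z) \<le> ..." .
 qed
 also have "... = (\<integral>\<^sup>+p. ennreal (P p + D p) \<partial>(lborel \<Otimes>\<^sub>M lborel))"
  by (subst lborel.nn_integral_fst[symmetric]) (auto simp: lborel_prod)
 also have "... = ennreal (integral\<^sup>L (lborel \<Otimes>\<^sub>M lborel) (\<lambda>p. P p + D p))"
  using P_int D_int PD0 by (intro nn_integral_eq_integral) auto
 also have "... \<le> ennreal (2 * ?I + E)" by (intro ennreal_leI PD)
 finally show "2 * (NI x. ennreal (w x * g x)) \<le> ennreal (2 * ?I + E)" .
qed

text \<open>It dominates every power of \<rho> with exponent between 1 and 4r, and each summand has
  a uniformly bounded integral: the mass, the L1 and L2 norms of f = \<rho>^r, and its L4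
  norm.\<close>

definition pot :: "real \<Rightarrow> real \<Rightarrow> real" where
 "pot r x = x + x powr r + (x powr r)^2 + (x powr r) ^ 4"

lemma pot_nonneg: "0 \<le> x \<Longrightarrow> 0 \<le> pot r x"
 by (simp add: pot_def)

lemma pot_ge:
 assumes "0 \<le> x" "1 \<le> r" "1 \<le> e" "e \<le> 4 * r" shows "x powr e \<le> pot r x"
proof (cases "x \<le> 1")
 case True
 have "x powr e \<le> x powr 1" using assms True by (intro powr_mono') auto
 moreover have "x \<le> pot r x" using assms by (simp add: pot_def)
 ultimately show ?thesis using assms by simp
next
 case False
 have "x powr e \<le> x powr (4 * r)" using assms False by (intro powr_mono) auto
 also have "... = (x powr r) ^ 4" using False by (simp add: powr_power mult.commute)
 also have "... \<le> pot r x" using assms by (simp add: pot_def)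
 finally show ?thesis .
qed

text \<open>The increment of the densities is interpolated: the portion of exponent p r is replaced
  by that of the r-th powers and gains h^p, the rest is bounded by R. The increment of the pressure
  gains a full h at the cost of R^(1/2). \<open>young_three\<close> then produces a power of R whose
  exponent the hypotheses place in the range of \<open>pot_ge\<close>.\<close>

lemma increment_product_bound:
 fixes a b c d r p h R :: real
 assumes nn: "0 \<le> a" "0 \<le> b" "0 \<le> c" "0 \<le> d" and R: "a \<le> R" "b \<le> R" "c \<le> R" "d \<le> R"
  and r: "1 \<le> r" and h: "0 < h" and p: "0 \<le> p" "p < 1" "p * r \<le> 1"
  and e: "1 \<le> (3 - 2 * p * r) / (1 - p)" "(3 - 2 * p * r) / (1 - p) \<le> 4 * r"
 shows "\<bar>a - b\<bar> * \<bar>c powr (r + 1 / 2) - d powr (r + 1 / 2)\<bar>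
  \<le> 2 * h powr (1 + p) * (((a powr r - b powr r) / h)^2 + ((c powr r - d powr r) / h)^2 + pot r R)"
proof (cases "a = b")
 case True
 then show ?thesis using nn R by (auto intro!: mult_nonneg_nonneg add_nonneg_nonneg pot_nonneg)
next
 case False
 define u where "u = \<bar>a powr r - b powr r\<bar> / h"
 define v where "v = \<bar>c powr r - d powr r\<bar> / h"
 have R0: "0 \<le> R" using nn R by linarith
 have ab: "0 < \<bar>a - b\<bar>" "\<bar>a - b\<bar> \<le> R" using False nn R by auto
 have "\<bar>a - b\<bar> powr r \<le> \<bar>a powr r - b powr r\<bar>" by (rule powr_root_diff[OF nn(1,2) r])
 then have 1: "\<bar>a - b\<bar> powr r \<le> h * u" using h by (simp add: u_def)
 have u0: "0 \<le> u" "0 \<le> v" using h by (auto simp: u_def v_def)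
 have "\<bar>a - b\<bar> = \<bar>a - b\<bar> powr (p * r) * \<bar>a - b\<bar> powr (1 - p * r)"
  using ab(1) by (simp flip: powr_add)
 also have "... = (\<bar>a - b\<bar> powr r) powr p * \<bar>a - b\<bar> powr (1 - p * r)"
  by (simp add: powr_powr mult.commute)
 also have "... \<le> (h * u) powr p * R powr (1 - p * r)"
  using 1 ab p by (intro mult_mono powr_mono2) auto
 finally have A: "\<bar>a - b\<bar> \<le> h powr p * u powr p * R powr (1 - p * r)"
  using h u0 by (simp add: powr_mult)
 have "\<bar>c powr (r + 1 / 2) - d powr (r + 1 / 2)\<bar> \<le> 2 * R powr (1 / 2) * \<bar>c powr r - d powr r\<bar>"
  by (rule powr_half_more_diff[OF nn(3,4) r R(3,4)])
 then have B: "\<bar>c powr (r + 1 / 2) - d powr (r + 1 / 2)\<bar> \<le> 2 * R powr (1 / 2) * (h * v)" using h by (simp add: v_def)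
 have "\<bar>a - b\<bar> * \<bar>c powr (r + 1 / 2) - d powr (r + 1 / 2)\<bar> \<le> (h powr p * u powr p * R powr (1 - p * r)) * (2 * R powr (1 / 2) * (h * v))"
  using A B by (intro mult_mono) auto
 also have "... = 2 * (h * h powr p) * (u powr p * v * (R powr (1 - p * r) * R powr (1 / 2)))" by (simp add: mult_ac)
 also have "R powr (1 - p * r) * R powr (1 / 2) = R powr (3 / 2 - p * r)" by (simp flip: powr_add)
 also have "h * h powr p = h powr (1 + p)" using h by (simp add: powr_add)
 also have "2 * h powr (1 + p) * (u powr p * v * R powr (3 / 2 - p * r)) \<le> 2 * h powr (1 + p) * (u\<^sup>2 + v\<^sup>2 + (R powr (3 / 2 - p * r)) powr (2 / (1 - p)))"
  using u0 p by (intro mult_left_mono young_three) auto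
 also have "(R powr (3 / 2 - p * r)) powr (2 / (1 - p)) = R powr ((3 - 2 * p * r) / (1 - p))"
 proof -
  have "(3 / 2 - p * r) * (2 / (1 - p)) = (3 - 2 * p * r) / (1 - p)"
   unfolding times_divide_eq_right by (simp add: left_diff_distrib)
  then show ?thesis by (simp only: powr_powr)
 qed
 also have "2 * h powr (1 + p) * (u\<^sup>2 + v\<^sup>2 + R powr ((3 - 2 * p * r) / (1 - p))) \<le> 2 * h powr (1 + p) * (u\<^sup>2 + v\<^sup>2 + pot r R)"
  using pot_ge[OF R0 r e] by (intro mult_left_mono add_left_mono) auto
 finally show ?thesis by (simp add: u_def v_def power_divide)
qed

lemma pot_max:
 fixes a1 a2 b1 b2 r :: real
 assumes "0 \<le> a1" "0 \<le> b1" "0 \<le> a2" "0 \<le> b2"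
 shows "pot r (max (max a1 b1) (max a2 b2)) \<le> pot r a1 + pot r b1 + pot r a2 + pot r b2"
proof -
 have "max (max a1 b1) (max a2 b2) \<in> {a1, b1, a2, b2}" by (simp add: max_def)
 then show ?thesis
  using assms pot_nonneg[of a1 r] pot_nonneg[of a2 r] pot_nonneg[of b1 r] pot_nonneg[of b2 r] by auto
qed

text \<open>Expanding the increments of both densities gives four products, each with the factor 2
  of \<open>increment_product_bound\<close>.\<close>

lemma increment_bound_pressure:
 fixes a1 a2 b1 b2 r p h :: real
 assumes nn: "0 \<le> a1" "0 \<le> b1" "0 \<le> a2" "0 \<le> b2"
  and r: "1 \<le> r" and h: "0 < h" and p: "0 \<le> p" "p < 1" "p * r \<le> 1"
  and e: "1 \<le> (3 - 2 * p * r) / (1 - p)" "(3 - 2 * p * r) / (1 - p) \<le> 4 * r"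
 shows "\<bar>(a1 - a2) - (b1 - b2)\<bar> * \<bar>(a1 powr (r + 1 / 2) - a2 powr (r + 1 / 2)) - (b1 powr (r + 1 / 2) - b2 powr (r + 1 / 2))\<bar>
  \<le> 8 * h powr (1 + p) * (((a1 powr r - b1 powr r) / h)^2 + ((a2 powr r - b2 powr r) / h)^2
    + (pot r a1 + pot r a2) + (pot r b1 + pot r b2))"
proof -
 define R where "R = max (max a1 b1) (max a2 b2)"
 have R: "a1 \<le> R" "b1 \<le> R" "a2 \<le> R" "b2 \<le> R" by (auto simp: R_def)
 define x1 where "x1 = \<bar>a1 - b1\<bar>"
 define x2 where "x2 = \<bar>a2 - b2\<bar>"
 define y1 where "y1 = \<bar>a1 powr (r + 1 / 2) - b1 powr (r + 1 / 2)\<bar>"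
 define y2 where "y2 = \<bar>a2 powr (r + 1 / 2) - b2 powr (r + 1 / 2)\<bar>"
 define D1 where "D1 = ((a1 powr r - b1 powr r) / h)^2"
 define D2 where "D2 = ((a2 powr r - b2 powr r) / h)^2"
 define H where "H = 2 * h powr (1 + p)"
 note ib = increment_product_bound[OF _ _ _ _ _ _ _ _ r h p e, of _ _ _ _ R]
 have 1: "x1 * y1 \<le> H * (D1 + D1 + pot r R)" "x1 * y2 \<le> H * (D1 + D2 + pot r R)"
  "x2 * y1 \<le> H * (D2 + D1 + pot r R)" "x2 * y2 \<le> H * (D2 + D2 + pot r R)"
  unfolding x1_def x2_def y1_def y2_def D1_def D2_def H_def
  by (intro ib nn R)+
 have "\<bar>(a1 - a2) - (b1 - b2)\<bar> * \<bar>(a1 powr (r + 1 / 2) - a2 powr (r + 1 / 2)) - (b1 powr (r + 1 / 2) - b2 powr (r + 1 / 2))\<bar>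
   \<le> (x1 + x2) * (y1 + y2)"
  unfolding x1_def x2_def y1_def y2_def by (intro mult_mono) auto
 also have "... = x1 * y1 + x1 * y2 + x2 * y1 + x2 * y2" by (simp add: algebra_simps)
 also have "... \<le> H * (D1 + D1 + pot r R) + H * (D1 + D2 + pot r R) + H * (D2 + D1 + pot r R) + H * (D2 + D2 + pot r R)"
  by (intro add_mono 1)
 also have "... = (4 * H) * (D1 + D2 + pot r R)" by (simp add: algebra_simps)
 also have "... \<le> (4 * H) * (D1 + D2 + (pot r a1 + pot r b1 + pot r a2 + pot r b2))"
  using pot_max[OF nn] by (intro mult_left_mono add_left_mono) (auto simp: R_def H_def)
 finally show ?thesis by (simp add: H_def D1_def D2_def algebra_simps)
qed

text \<open>Only the second factor is treated as small. The single power of h suffices, since this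
  error is compared with \<kappa> and not with its square.\<close>

lemma increment_bound_root:
 fixes a1 a2 b1 b2 r h :: real
 assumes nn: "0 \<le> a1" "0 \<le> b1" "0 \<le> a2" "0 \<le> b2" and r: "1 \<le> r" and h: "0 < h"
 shows "\<bar>(a1 - a2) - (b1 - b2)\<bar> * \<bar>(a1 powr r - a2 powr r) - (b1 powr r - b2 powr r)\<bar>
  \<le> 2 * h * (((a1 powr r - b1 powr r) / h)^2 + ((a2 powr r - b2 powr r) / h)^2
    + (pot r a1 + pot r a2) + (pot r b1 + pot r b2))"
proof -
 define R where "R = max (max a1 b1) (max a2 b2)"
 have R: "a1 \<le> R" "b1 \<le> R" "a2 \<le> R" "b2 \<le> R" "0 \<le> R" using nn by (auto simp: R_def)
 define d1 where "d1 = \<bar>a1 powr r - b1 powr r\<bar> / h"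
 define d2 where "d2 = \<bar>a2 powr r - b2 powr r\<bar> / h"
 have d: "0 \<le> d1" "0 \<le> d2" using h by (auto simp: d1_def d2_def)
 have dd: "\<bar>(a1 powr r - a2 powr r) - (b1 powr r - b2 powr r)\<bar> \<le> h * d1 + h * d2"
  using h by (simp add: d1_def d2_def)
 have "R\<^sup>2 \<le> pot r R" using pot_ge[OF R(5) r, of 2] r R(5) by (simp add: powr_numeral)
 also have "... \<le> pot r a1 + pot r b1 + pot r a2 + pot r b2" unfolding R_def by (rule pot_max[OF nn])
 finally have R2: "R\<^sup>2 \<le> pot r a1 + pot r b1 + pot r a2 + pot r b2" .
 have "\<bar>(a1 - a2) - (b1 - b2)\<bar> \<le> 2 * R" using nn R by (simp add: abs_le_iff)
 then have "\<bar>(a1 - a2) - (b1 - b2)\<bar> * \<bar>(a1 powr r - a2 powr r) - (b1 powr r - b2 powr r)\<bar> \<le> (2 * R) * (h * d1 + h * d2)"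
  using dd R by (intro mult_mono) auto
 also have "... = h * (2 * R * d1 + 2 * R * d2)" by (simp add: algebra_simps)
 also have "... \<le> h * ((R\<^sup>2 + d1\<^sup>2) + (R\<^sup>2 + d2\<^sup>2))"
  using h by (intro mult_left_mono add_mono sum_squares_bound) auto
 also have "... \<le> h * (2 * (d1\<^sup>2 + d2\<^sup>2 + R\<^sup>2))" using h by (intro mult_left_mono) auto
 also have "... \<le> h * (2 * (d1\<^sup>2 + d2\<^sup>2 + (pot r a1 + pot r b1 + pot r a2 + pot r b2)))"
  using h R2 by (intro mult_left_mono add_left_mono) auto
 finally show ?thesis by (simp add: d1_def d2_def power_divide algebra_simps)
qed

section \<open>Densities whose r-th power is a Sobolev function, alone and in pairs\<close>

locale dens = sobolev f G A for f :: "'a::euclidean_space \<Rightarrow> real" and G :: "'a \<Rightarrow> 'a" and A :: real +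
 fixes rho :: "'a \<Rightarrow> real" and r :: real
 assumes r: "1 \<le> r" and rho_nonneg: "\<And>x. 0 \<le> rho x" and rho_int: "integrable lborel rho"
  and rho_L1: "(LI x. rho x) \<le> A" and f_eq: "\<And>x. f x = rho x powr r"
  and f4: "integrable lborel (\<lambda>x. f x ^ 4)" "(LI x. f x ^ 4) \<le> A"
begin

lemma rho_meas [measurable]: "rho \<in> borel_measurable borel" using rho_int by auto

lemma rho_root: "f x powr (1 / r) = rho x"
 using r rho_nonneg[of x] by (simp add: f_eq powr_powr)

lemma pot_int: "integrable lborel (\<lambda>x. pot r (rho x))" and pot_le: "(LI x. pot r (rho x)) \<le> 4 * A"
proof -
 have e: "(\<lambda>x. pot r (rho x)) = (\<lambda>x. rho x + f x + (f x)^2 + f x ^ 4)" by (simp add: pot_def f_eq fun_eq_iff)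
 show "integrable lborel (\<lambda>x. pot r (rho x))" unfolding e using rho_int f_int f_sq f4(1) by auto
 show "(LI x. pot r (rho x)) \<le> 4 * A"
  unfolding e using rho_int f_int f_sq f4 rho_L1 f_L1 f_L2 by simp
qed

lemma pressure_int: "integrable lborel (\<lambda>x. rho x powr (r + 1 / 2))"
proof -
 have "(\<lambda>x. rho x powr (r + 1 / 2)) = (\<lambda>x. f x powr (1 + 1 / (2 * r)))"
  using r by (auto simp: f_eq powr_powr fun_eq_iff field_simps intro!: arg_cong[where f = "\<lambda>a. _ powr a"])
 then show ?thesis using powr_integrable[of "1 / (2 * r)"] r by simp
qed

lemma flux_int:
 fixes V :: "'a \<Rightarrow> 'a"
 assumes [measurable]: "V \<in> borel_measurable borel" and V: "integrable lborel (\<lambda>x. (norm (V x))^2)"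
 shows "integrable lborel (\<lambda>x. sqrt (rho x) *\<^sub>R V x)"
proof (rule Bochner_Integration.integrable_bound)
 show "integrable lborel (\<lambda>x. rho x + (norm (V x))^2)" using rho_int V by auto
 show "AE x in lborel. norm (sqrt (rho x) *\<^sub>R V x) \<le> norm (rho x + (norm (V x))^2)"
  using abs_mult_le_squares[of "sqrt (rho x)" "norm (V x)" for x] rho_nonneg by (intro AE_I2) (simp add: abs_mult)
qed (auto intro!: borel_measurable_scaleR)

end

lemma twice_ennreal_add: "0 \<le> a \<Longrightarrow> 0 \<le> b \<Longrightarrow> 2 * ennreal a + 2 * ennreal b = ennreal (2 * a + 2 * b)"
 by (simp add: ennreal_plus ennreal_mult)

text \<open>The flux is cut at the level l = K h^(-s) of f. Below it \<rho> \<le> l^(1/r), so the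
  flux is square integrable with factor h^(-s/r). Above it Cauchy-Schwarz bounds the L1 norm by the
  mass in the tail, and mollification turns L1 into L2 at the cost h^(-n). The condition n/2 - 1
  \<le> s makes the second part no worse than the first.\<close>

lemma flux_mollified:
 fixes A r s :: real
 assumes dim: "real DIM('a::euclidean_space) / 2 - 1 \<le> s" and s: "0 < s" and r: "1 \<le> r"
 shows "\<exists>C>0. \<forall>f (G :: 'a \<Rightarrow> 'a) rho (V :: 'a \<Rightarrow> 'a) e h. dens f G A rho r \<longrightarrow> V \<in> borel_measurable borel \<longrightarrow>
   integrable lborel (\<lambda>x. (norm (V x))^2) \<longrightarrow> (LI x. (norm (V x))^2) \<le> e \<longrightarrow> 0 < h \<longrightarrow> h \<le> 1 \<longrightarrow>
   (NI x. ennreal ((norm (cv (mol h) (\<lambda>y. sqrt (rho y) *\<^sub>R V y) x))^2)) \<le> ennreal (C * e * h powr (- (s / r)))"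
proof -
 obtain K where K: "0 < K" "\<And>f (G :: 'a \<Rightarrow> 'a) h l. sobolev f G A \<Longrightarrow> 0 < h \<Longrightarrow> h \<le> 2 \<Longrightarrow> K * h powr (- s) \<le> l \<Longrightarrow>
   (LI x. indicator {x. l < f x} x * (f x)^2) \<le> K * h\<^sup>2"
  using sobolev_tail[OF s dim, of A] by blast
 let ?B = "molB TYPE('a)"
 have B: "0 < ?B" by (rule molB_pos)
 define C where "C = 2 * K powr (1 / r) + 2 * ?B * (K powr (1 / r - 2) * K)"
 have C: "0 < C" using K(1) B by (auto simp: C_def intro!: add_pos_nonneg)
 show ?thesis
 proof (intro exI[of _ C] conjI C allI impI)
  fix f and G :: "'a \<Rightarrow> 'a" and rho and V :: "'a \<Rightarrow> 'a" and e h :: real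
  assume D: "dens f G A rho r" and Vm [measurable]: "V \<in> borel_measurable borel"
   and V: "integrable lborel (\<lambda>x. (norm (V x))^2)" "(LI x. (norm (V x))^2) \<le> e" and h: "0 < h" "h \<le> 1"
  interpret dens f G A rho r by (rule D)
  have e0: "0 \<le> e" using V(2) Bochner_Integration.integral_nonneg[of lborel "\<lambda>x. (norm (V x))^2"] by (meson order_trans zero_le_power2)
  define l where "l = K * h powr (- s)"
  have l: "0 < l" using K(1) h by (simp add: l_def)
  let ?J = "\<lambda>x. sqrt (rho x) *\<^sub>R V x"
  define J1 where "J1 x = indicator {x. f x \<le> l} x *\<^sub>R ?J x" for x
  define J2 where "J2 x = indicator {x. l < f x} x *\<^sub>R ?J x" for x
  have J: "integrable lborel ?J" by (rule flux_int[OF Vm V(1)])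
  have [measurable]: "J1 \<in> borel_measurable borel" "J2 \<in> borel_measurable borel"
   unfolding J1_def[abs_def] J2_def[abs_def] by (auto intro!: borel_measurable_scaleR)
  have J1: "integrable lborel J1" and J2: "integrable lborel J2"
   using integrable_mult_indicator[OF _ J, of "{x. f x \<le> l}"] integrable_mult_indicator[OF _ J, of "{x. l < f x}"]
   by (simp_all add: J1_def[abs_def] J2_def[abs_def])
  have split: "?J x = J1 x + J2 x" for x by (simp add: J1_def J2_def indicator_def)
  have cvs: "cv (mol h) ?J x = cv (mol h) J1 x + cv (mol h) J2 x" for x
  proof -
   have "cv (mol h) ?J x = (LI y. mol h (x - y) *\<^sub>R J1 y + mol h (x - y) *\<^sub>R J2 y)"
    unfolding cv_def by (intro Bochner_Integration.integral_cong refl) (simp only: split scaleR_add_right)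
   then show ?thesis using integrable_mol_kernel[OF J1 h(1), of x] integrable_mol_kernel[OF J2 h(1), of x]
    by (simp add: cv_def)
  qed
  have b1: "(NI x. ennreal ((norm (cv (mol h) J1 x))^2)) \<le> ennreal (l powr (1 / r) * e)"
  proof -
   have "(NI x. ennreal ((norm (cv (mol h) J1 x))^2)) \<le> (NI x. ennreal ((norm (J1 x))^2))"
    using J1 by (intro cv_mol_L2 h) auto
   also have "... \<le> (NI x. ennreal (l powr (1 / r) * (norm (V x))^2))"
   proof (intro nn_integral_mono ennreal_leI)
    fix x
    show "(norm (J1 x))^2 \<le> l powr (1 / r) * (norm (V x))^2"
    proof (cases "f x \<le> l")
     case True
     then have "rho x \<le> l powr (1 / r)" using powr_mono2[of "1 / r" "f x" l] f_nonneg[of x] r rho_root[of x] by simp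
     then show ?thesis using True rho_nonneg[of x] by (simp add: J1_def power_mult_distrib mult_right_mono)
    qed (simp add: J1_def)
   qed
   also have "... = ennreal (l powr (1 / r) * (LI x. (norm (V x))^2))"
    using V(1) by (subst nn_integral_eq_integral) auto
   also have "... \<le> ennreal (l powr (1 / r) * e)" using V(2) by (intro ennreal_leI mult_left_mono) auto
   finally show ?thesis .
  qed
  define T where "T = (LI x. indicator {x. l < f x} x * rho x)"
  have Ti: "integrable lborel (\<lambda>x. indicator {x. l < f x} x * rho x)"
   using integrable_mult_indicator[OF _ rho_int, of "{x. l < f x}"] by simp
  have Te: "T \<le> l powr (1 / r - 2) * (K * h\<^sup>2)"
  proof -
   have fi: "integrable lborel (\<lambda>x. indicator {x. l < f x} x * (f x)^2)"
    using integrable_mult_indicator[OF _ f_sq, of "{x. l < f x}"] by simp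
   have "T \<le> (LI x. l powr (1 / r - 2) * (indicator {x. l < f x} x * (f x)^2))"
    unfolding T_def
   proof (rule integral_mono[OF Ti])
    show "integrable lborel (\<lambda>x. l powr (1 / r - 2) * (indicator {x. l < f x} x * (f x)^2))" using fi by simp
    fix x
    show "indicator {x. l < f x} x * rho x \<le> l powr (1 / r - 2) * (indicator {x. l < f x} x * (f x)^2)"
    proof (cases "l < f x")
     case True
     \<comment> \<open>The exponent 1/r - 2 is negative, so on the tail this power of f is largest
       at the level l.\<close>
     have "rho x = f x powr (1 / r - 2) * (f x)^2"
      using True l by (simp add: rho_root[symmetric] powr_diff powr_numeral)
     also have "... \<le> l powr (1 / r - 2) * (f x)^2"
      using True l r by (intro mult_right_mono powr_mono2') (auto simp: field_simps)
     finally show ?thesis using True by simp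
    qed simp
   qed
   also have "... = l powr (1 / r - 2) * (LI x. indicator {x. l < f x} x * (f x)^2)" by simp
   also have "... \<le> l powr (1 / r - 2) * (K * h\<^sup>2)"
    using h by (intro mult_left_mono K(2)[OF sobolev_axioms h(1)]) (auto simp: l_def)
   finally show ?thesis .
  qed
  have T0: "0 \<le> T" unfolding T_def by (intro Bochner_Integration.integral_nonneg) (simp add: rho_nonneg)
  have J2n: "(NI x. ennreal (norm (J2 x))) ^ 2 \<le> ennreal (T * e)"
  proof -
   have "(NI x. ennreal (norm (J2 x))) = (NI x. ennreal (indicator {x. l < f x} x * sqrt (rho x)) * ennreal (norm (V x)))"
    using rho_nonneg by (intro nn_integral_cong) (auto simp: J2_def ennreal_mult indicator_def)
   also have "... ^ 2 \<le> (NI x. ennreal (indicator {x. l < f x} x * sqrt (rho x)) ^ 2) * (NI x. ennreal (norm (V x)) ^ 2)"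
    by (intro Cauchy_Schwarz_nn_integral) auto
   also have "(NI x. ennreal (indicator {x. l < f x} x * sqrt (rho x)) ^ 2) = (NI x. ennreal (indicator {x. l < f x} x * rho x))"
    using rho_nonneg by (intro nn_integral_cong) (auto simp: ennreal_power indicator_def)
   also have "... = ennreal T" unfolding T_def using Ti rho_nonneg by (intro nn_integral_eq_integral) auto
   also have "(NI x. ennreal (norm (V x)) ^ 2) = ennreal (LI x. (norm (V x))^2)"
    using V(1) by (simp add: ennreal_power nn_integral_eq_integral)
   also have "ennreal T * ... \<le> ennreal T * ennreal e" using V(2) by (intro mult_left_mono ennreal_leI) auto
   finally show ?thesis using T0 e0 by (simp add: ennreal_mult)
  qed
  have b2: "(NI x. ennreal ((norm (cv (mol h) J2 x))^2)) \<le> ennreal (?B / h ^ DIM('a) * (T * e))"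
  proof -
   define n2 where "n2 = (LI x. norm (J2 x))"
   have n2: "ennreal n2 = (NI x. ennreal (norm (J2 x)))" "0 \<le> n2"
    unfolding n2_def using J2 by (auto simp: nn_integral_eq_integral)
   have n2e: "n2\<^sup>2 \<le> T * e" using J2n T0 e0 n2(2) unfolding n2(1)[symmetric] by (simp add: ennreal_power)
   \<comment> \<open>The squared L2 norm is at most the supremum times the L1 norm; the former is
     h^(-n) times the L1 norm of \<open>J2\<close> up to a constant.\<close>
   have "(NI x. ennreal ((norm (cv (mol h) J2 x))^2))
    \<le> (NI x. ennreal (?B / h ^ DIM('a) * n2) * ennreal (norm (cv (mol h) J2 x)))"
   proof (intro nn_integral_mono)
    fix x
    have "norm (cv (mol h) J2 x) * norm (cv (mol h) J2 x) \<le> (?B / h ^ DIM('a) * n2) * norm (cv (mol h) J2 x)"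
     unfolding n2_def by (intro mult_right_mono cv_bound[OF J2 mol_measurable mol_abs_bound[OF h(1)]]) auto
    then show "ennreal ((norm (cv (mol h) J2 x))^2) \<le> ennreal (?B / h ^ DIM('a) * n2) * ennreal (norm (cv (mol h) J2 x))"
     using B h n2(2) by (subst ennreal_mult[symmetric]) (auto simp: power2_eq_square intro!: ennreal_leI)
   qed
   also have "... = ennreal (?B / h ^ DIM('a) * n2) * (NI x. ennreal (norm (cv (mol h) J2 x)))"
    by (intro nn_integral_cmult) (auto intro!: measurable_compose[OF cv_measurable])
   also have "... \<le> ennreal (?B / h ^ DIM('a) * n2) * ennreal n2"
   proof (intro mult_left_mono)
    have "(NI x. ennreal (norm (cv (mol h) J2 x)))
     \<le> (NI x. ennreal \<bar>mol h (x::'a)\<bar>) * (NI y. ennreal (norm (J2 y)))"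
     by (rule nn_integral_cv_le) auto
    then show "(NI x. ennreal (norm (cv (mol h) J2 x))) \<le> ennreal n2"
     by (simp add: abs_mol[OF h(1)] nn_integral_mol[OF h(1)] n2)
   qed simp
   also have "... = ennreal (?B / h ^ DIM('a) * n2\<^sup>2)"
    using B h n2(2) by (subst ennreal_mult[symmetric]) (auto simp: power2_eq_square)
   also have "... \<le> ennreal (?B / h ^ DIM('a) * (T * e))"
    using n2e B h by (intro ennreal_leI mult_left_mono) auto
   finally show ?thesis .
  qed
  have lp: "l powr (1 / r) = K powr (1 / r) * h powr (- (s / r))"
   using K(1) h by (simp add: l_def powr_mult powr_powr)
  have Th: "T / h ^ DIM('a) \<le> (K powr (1 / r - 2) * K) * h powr (- (s / r))"
  proof -
   have "T / h ^ DIM('a) \<le> l powr (1 / r - 2) * (K * h\<^sup>2) / h ^ DIM('a)"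
    using Te h by (intro divide_right_mono) auto
   also have "l powr (1 / r - 2) = K powr (1 / r - 2) * h powr (- s * (1 / r - 2))"
    using K(1) h by (simp add: l_def powr_mult powr_powr)
   also have "K powr (1 / r - 2) * h powr (- s * (1 / r - 2)) * (K * h\<^sup>2) / h ^ DIM('a)
    = (K powr (1 / r - 2) * K) * (h powr (- s * (1 / r - 2)) * h powr 2 / h powr real DIM('a))"
    using h by (simp add: powr_realpow powr_numeral)
   also have "h powr (- s * (1 / r - 2)) * h powr 2 / h powr real DIM('a) = h powr (- s * (1 / r - 2) + 2 - real DIM('a))"
    by (simp only: powr_add powr_diff)
   also have "... \<le> h powr (- (s / r))"
    using dim h by (intro powr_mono') (auto simp: algebra_simps)
   finally show ?thesis using K(1) by (simp add: mult_left_mono)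
  qed
  have "(NI x. ennreal ((norm (cv (mol h) ?J x))^2))
   \<le> (NI x. 2 * ennreal ((norm (cv (mol h) J1 x))^2) + 2 * ennreal ((norm (cv (mol h) J2 x))^2))"
  proof (intro nn_integral_mono)
   fix x
   have "(norm (cv (mol h) ?J x))^2 \<le> (norm (cv (mol h) J1 x) + norm (cv (mol h) J2 x))^2"
    unfolding cvs by (intro power_mono norm_triangle_ineq) auto
   also have "... \<le> 2 * (norm (cv (mol h) J1 x))^2 + 2 * (norm (cv (mol h) J2 x))^2"
    using sum_squares_bound[of "norm (cv (mol h) J1 x)" "norm (cv (mol h) J2 x)"] by (simp add: power2_sum)
   finally have "ennreal ((norm (cv (mol h) ?J x))^2) \<le> ennreal (2 * (norm (cv (mol h) J1 x))^2 + 2 * (norm (cv (mol h) J2 x))^2)"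
    by (rule ennreal_leI)
   then show "ennreal ((norm (cv (mol h) ?J x))^2) \<le> 2 * ennreal ((norm (cv (mol h) J1 x))^2) + 2 * ennreal ((norm (cv (mol h) J2 x))^2)"
    by (simp add: ennreal_mult ennreal_plus)
  qed
  also have "... = 2 * (NI x. ennreal ((norm (cv (mol h) J1 x))^2)) + 2 * (NI x. ennreal ((norm (cv (mol h) J2 x))^2))"
  proof -
   have [measurable]: "cv (mol h) J1 \<in> borel_measurable borel" "cv (mol h) J2 \<in> borel_measurable borel" by (auto intro!: cv_measurable)
   show ?thesis by (simp add: nn_integral_add nn_integral_cmult)
  qed
  also have "... \<le> 2 * ennreal (l powr (1 / r) * e) + 2 * ennreal (?B / h ^ DIM('a) * (T * e))"
   by (intro add_mono mult_left_mono b1 b2) auto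
  also have "... = ennreal (2 * (l powr (1 / r) * e) + 2 * (?B / h ^ DIM('a) * (T * e)))"
  proof -
   have "0 \<le> l powr (1 / r) * e" "0 \<le> ?B / h ^ DIM('a) * (T * e)" using B h T0 e0 by (auto intro!: mult_nonneg_nonneg divide_nonneg_nonneg)
   then show ?thesis by (rule twice_ennreal_add)
  qed
  also have "... \<le> ennreal (C * e * h powr (- (s / r)))"
  proof (intro ennreal_leI)
   have "2 * (l powr (1 / r) * e) + 2 * (?B / h ^ DIM('a) * (T * e)) = 2 * l powr (1 / r) * e + 2 * ?B * (T / h ^ DIM('a)) * e"
    by (simp add: field_simps)
   also have "... \<le> 2 * l powr (1 / r) * e + 2 * ?B * ((K powr (1 / r - 2) * K) * h powr (- (s / r))) * e"
    using Th B e0 by (intro add_left_mono mult_right_mono mult_left_mono) auto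
   also have "... = C * e * h powr (- (s / r))" unfolding lp C_def by (simp add: algebra_simps)
   finally show "2 * (l powr (1 / r) * e) + 2 * (?B / h ^ DIM('a) * (T * e)) \<le> ..." .
  qed
  finally show "(NI x. ennreal ((norm (cv (mol h) ?J x))^2)) \<le> ennreal (C * e * h powr (- (s / r)))" .
 qed
qed

locale dens_pair = d1: dens f1 G1 A rho1 r + d2: dens f2 G2 A rho2 r
 for f1 f2 :: "'a::euclidean_space \<Rightarrow> real" and G1 G2 A rho1 rho2 r
begin

abbreviation w where "w x \<equiv> rho1 x - rho2 x"
abbreviation z where "z x \<equiv> rho1 x powr (r + 1 / 2) - rho2 x powr (r + 1 / 2)"
abbreviation F where "F x \<equiv> f1 x - f2 x"

text \<open>The factor of \<kappa> in the error \<open>E\<close> of \<open>symmetrization\<close>,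
  where \<open>Q\<close> is the sum of the two potentials and has integral at most 8 A.\<close>

definition E0 :: real where "E0 = 8 * (real DIM('a))^2 * A + 16 * A"

lemma E0_nonneg: "0 \<le> E0"
 using d1.A_nonneg by (simp add: E0_def)

lemma w_int: "integrable lborel w" using d1.rho_int d2.rho_int by simp
lemma z_int: "integrable lborel z" using d1.pressure_int d2.pressure_int by simp
lemma F_int: "integrable lborel F" using d1.f_int d2.f_int by simp

lemma Q_int: "integrable lborel (\<lambda>x. pot r (rho1 x) + pot r (rho2 x))"
 and Q_le: "(LI x. pot r (rho1 x) + pot r (rho2 x)) \<le> 8 * A"
 using d1.pot_int d2.pot_int d1.pot_le d2.pot_le by auto

lemma Q_nonneg: "0 \<le> pot r (rho1 x) + pot r (rho2 x)"
 using pot_nonneg d1.rho_nonneg d2.rho_nonneg by (simp add: add_nonneg_nonneg)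

lemma diff_sign: "0 < q \<Longrightarrow> 0 \<le> w x * (rho1 x powr q - rho2 x powr q)"
proof (cases "rho1 x \<le> rho2 x")
 case True
 assume "0 < q"
 then have "rho1 x powr q \<le> rho2 x powr q" using True d1.rho_nonneg by (intro powr_mono2) auto
 then show ?thesis using True by (intro mult_nonpos_nonpos) auto
next
 case False
 assume "0 < q"
 then have "rho2 x powr q \<le> rho1 x powr q" using False d2.rho_nonneg by (intro powr_mono2) auto
 then show ?thesis using False by (intro mult_nonneg_nonneg) auto
qed

text \<open>\<open>w\<close> and \<open>z\<close> have the same sign because powers are monotone.
  Their mollifications need not, and \<open>symmetrization\<close> with the factor
  \<open>8 * h powr (1 + p)\<close> measures the defect.\<close>

lemma pressure_error:
 assumes h: "0 < h" and p: "0 \<le> p" "p < 1" "p * r \<le> 1"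
  and e: "1 \<le> (3 - 2 * p * r) / (1 - p)" "(3 - 2 * p * r) / (1 - p) \<le> 4 * r"
 shows "- (LI x. cv (mol h) w x * cv (mol h) z x) \<le> 4 * h powr (1 + p) * E0"
proof -
 have "0 \<le> 2 * (LI x. cv (mol h) w x * cv (mol h) z x)
   + 8 * h powr (1 + p) * (2 * (2 * real DIM('a))^2 * A + 2 * (8 * A))"
 proof (rule symmetrization(1)[OF h d1.sobolev_axioms d2.sobolev_axioms w_int z_int _ Q_int Q_nonneg Q_le])
  show "0 \<le> w y * z y" for y using d1.r by (intro diff_sign) simp
  show "\<bar>w y - w u\<bar> * \<bar>z y - z u\<bar> \<le> 8 * h powr (1 + p) * (((f1 y - f1 u) / h)^2 + ((f2 y - f2 u) / h)^2
    + (pot r (rho1 y) + pot r (rho2 y)) + (pot r (rho1 u) + pot r (rho2 u)))" for y u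
   unfolding d1.f_eq d2.f_eq
   by (rule increment_bound_pressure[OF d1.rho_nonneg d1.rho_nonneg d2.rho_nonneg d2.rho_nonneg d1.r h p e])
 qed simp
 then show ?thesis by (simp add: E0_def power_mult_distrib algebra_simps)
qed

text \<open>By \<open>symmetrization\<close> the integral of w F is at most Y, and |F| \<ge> |w|^r.
  The square of w is split at a threshold m: below it m |w| is controlled by the mass, above it
  m^(1-r) w F by Y.\<close>

lemma L2_of_mollified:
 assumes h: "0 < h" and Y: "(LI x. cv (mol h) w x * cv (mol h) F x) + 2 * h * E0 \<le> Y" "0 < Y"
 shows "(NI x. ennreal ((w x)^2)) \<le> ennreal ((2 * A + 1) * Y powr (1 / r))"
proof -
 let ?I = "(LI x. cv (mol h) w x * cv (mol h) F x)"
 have wF: "0 \<le> w x * F x" for x unfolding d1.f_eq d2.f_eq using d1.r by (intro diff_sign) simp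
 have "2 * (NI x. ennreal (w x * F x)) \<le> ennreal (2 * ?I + 2 * h * (2 * (2 * real DIM('a))^2 * A + 2 * (8 * A)))"
 proof (rule symmetrization(2)[OF h d1.sobolev_axioms d2.sobolev_axioms w_int F_int wF Q_int Q_nonneg Q_le])
  show "\<bar>w y - w u\<bar> * \<bar>F y - F u\<bar> \<le> 2 * h * (((f1 y - f1 u) / h)^2 + ((f2 y - f2 u) / h)^2
    + (pot r (rho1 y) + pot r (rho2 y)) + (pot r (rho1 u) + pot r (rho2 u)))" for y u
   unfolding d1.f_eq d2.f_eq
   by (rule increment_bound_root[OF d1.rho_nonneg d1.rho_nonneg d2.rho_nonneg d2.rho_nonneg d1.r h])
 qed (use h in simp)
 also have "2 * ?I + 2 * h * (2 * (2 * real DIM('a))^2 * A + 2 * (8 * A)) = 2 * (?I + h * E0)"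
  by (simp add: E0_def power_mult_distrib algebra_simps)
 also have "ennreal (2 * (?I + h * E0)) \<le> ennreal (2 * Y)"
 proof (intro ennreal_leI)
  have "0 \<le> h * E0" using h E0_nonneg by simp
  then show "2 * (?I + h * E0) \<le> 2 * Y" using Y(1) by simp
 qed
 also have "... = 2 * ennreal Y" using Y(2) by (simp add: ennreal_mult)
 finally have wFY: "(NI x. ennreal (w x * F x)) \<le> ennreal Y"
  by (simp add: ennreal_mult_le_mult_iff)
 \<comment> \<open>This threshold equates the order of both contributions, since m^(1-r) Y =
   m.\<close>
 define m where "m = Y powr (1 / r)"
 have m: "0 < m" "m powr r = Y" using Y(2) d1.r by (auto simp: m_def powr_powr)
 have pt: "(w x)^2 \<le> m * \<bar>w x\<bar> + m powr (1 - r) * (w x * F x)" for x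
 proof (cases "\<bar>w x\<bar> \<le> m")
  case True
  have "(w x)^2 = \<bar>w x\<bar> * \<bar>w x\<bar>" by (simp add: power2_eq_square)
  also have "... \<le> m * \<bar>w x\<bar>" using True by (intro mult_right_mono) auto
  finally show ?thesis using wF[of x] by (smt (verit) mult_nonneg_nonneg powr_ge_zero)
 next
  case False
  then have W: "0 < \<bar>w x\<bar>" "m \<le> \<bar>w x\<bar>" using m(1) by linarith+
  have "(w x)^2 = \<bar>w x\<bar> powr 2" using W by (simp add: powr_numeral)
  also have "... = \<bar>w x\<bar> powr (1 - r) * (\<bar>w x\<bar> * \<bar>w x\<bar> powr r)"
   using W(1) by (simp add: powr_mult_base flip: powr_add)
  also have "... \<le> m powr (1 - r) * (\<bar>w x\<bar> * \<bar>F x\<bar>)"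
  proof (intro mult_mono)
   show "\<bar>w x\<bar> powr (1 - r) \<le> m powr (1 - r)" using W m(1) d1.r by (intro powr_mono2') auto
   show "\<bar>w x\<bar> powr r \<le> \<bar>F x\<bar>"
    unfolding d1.f_eq d2.f_eq by (intro powr_root_diff d1.rho_nonneg d2.rho_nonneg d1.r)
  qed auto
  also have "\<bar>w x\<bar> * \<bar>F x\<bar> = w x * F x" using wF[of x] by (simp flip: abs_mult)
  finally show ?thesis using m(1) by (simp add: add_increasing)
 qed
 have "(NI x. ennreal ((w x)^2)) \<le> (NI x. ennreal m * ennreal \<bar>w x\<bar> + ennreal (m powr (1 - r)) * ennreal (w x * F x))"
 proof (intro nn_integral_mono)
  fix x
  have "ennreal ((w x)^2) \<le> ennreal (m * \<bar>w x\<bar> + m powr (1 - r) * (w x * F x))" by (intro ennreal_leI pt)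
  also have "... = ennreal m * ennreal \<bar>w x\<bar> + ennreal (m powr (1 - r)) * ennreal (w x * F x)"
   using m(1) wF[of x] by (subst ennreal_plus) (auto simp: ennreal_mult)
  finally show "ennreal ((w x)^2) \<le> ..." .
 qed
 also have "... = ennreal m * (NI x. ennreal \<bar>w x\<bar>) + ennreal (m powr (1 - r)) * (NI x. ennreal (w x * F x))"
  by (simp add: nn_integral_add nn_integral_cmult)
 also have "... \<le> ennreal m * ennreal (2 * A) + ennreal (m powr (1 - r)) * ennreal Y"
 proof (intro add_mono mult_left_mono wFY)
  have "(NI x. ennreal \<bar>w x\<bar>) = ennreal (LI x. \<bar>w x\<bar>)"
   using w_int by (intro nn_integral_eq_integral) auto
  also have "(LI x. \<bar>w x\<bar>) \<le> (LI x. rho1 x + rho2 x)"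
   using w_int d1.rho_int d2.rho_int d1.rho_nonneg d2.rho_nonneg
   by (intro integral_mono) (auto simp: abs_le_iff add_increasing add_increasing2)
  also have "... \<le> 2 * A" using d1.rho_int d2.rho_int d1.rho_L1 d2.rho_L1 by simp
  finally show "(NI x. ennreal \<bar>w x\<bar>) \<le> ennreal (2 * A)" by (simp add: ennreal_leI)
 qed auto
 also have "... = ennreal (m * (2 * A) + m powr (1 - r) * Y)"
  using m(1) d1.A_nonneg Y(2) by (subst ennreal_plus) (auto simp: ennreal_mult)
 also have "m * (2 * A) + m powr (1 - r) * Y = (2 * A + 1) * m"
  using m(1) by (simp add: m(2)[symmetric] algebra_simps flip: powr_add)
 finally show ?thesis by (simp add: m_def)
qed

end

section \<open>The potential of the momentum\<close>

text \<open>The integrated form of the product rule for the squared norm of a primitive, obtained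
  from Fubini: the square of the integral lives on the (t,s) plane, the two triangles contribute
  equally by symmetry, and the diagonal is a null set.\<close>

lemma norm_integral_square:
 fixes a :: "real \<Rightarrow> 'v::euclidean_space"
 assumes a: "integrable lborel a"
 shows "(norm (LI s. a s))^2 = 2 * (LI t. (LI s. indicator {..<t} s *\<^sub>R a s) \<bullet> a t)"
proof -
 have [measurable]: "a \<in> borel_measurable borel" using a by auto
 have ab: "integrable (lborel \<Otimes>\<^sub>M lborel) (\<lambda>p. a (fst p) \<bullet> a (snd p))"
 proof (rule integrable_prodI)
  have "(NI x. (NI y. ennreal (norm (a (fst (x, y)) \<bullet> a (snd (x, y))))))
    \<le> (NI x. (NI y. ennreal (norm (a x)) * ennreal (norm (a y))))"
   by (intro nn_integral_mono) (simp add: ennreal_mult[symmetric] ennreal_leI Cauchy_Schwarz_ineq2)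
  also have "... = (NI x. ennreal (norm (a x))) * (NI y. ennreal (norm (a y)))"
   by (simp add: nn_integral_cmult nn_integral_multc)
  also have "... < \<infinity>" using a by (auto simp: integrable_iff_bounded ennreal_mult_less_top)
  finally show "(NI x. (NI y. ennreal (norm (a (fst (x, y)) \<bullet> a (snd (x, y)))))) < \<infinity>" .
 qed (auto intro!: borel_measurable_inner)
 define L where "L p = indicator {p. snd p < fst p} p * (a (fst p) \<bullet> a (snd p))" for p :: "real \<times> real"
 define U where "U p = indicator {p. fst p < snd p} p * (a (fst p) \<bullet> a (snd p))" for p :: "real \<times> real"
 have meas: "{p. snd p < fst p} \<in> sets (borel :: (real \<times> real) measure)" "{p. fst p < snd p} \<in> sets (borel :: (real \<times> real) measure)"
  by (auto intro!: borel_open open_Collect_less continuous_intros)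
 have meas': "{p. snd p < fst p} \<in> sets (lborel \<Otimes>\<^sub>M (lborel :: real measure))" "{p. fst p < snd p} \<in> sets (lborel \<Otimes>\<^sub>M (lborel :: real measure))"
  unfolding lborel_prod using meas by auto
 have L: "integrable (lborel \<Otimes>\<^sub>M lborel) L"
  unfolding L_def using integrable_mult_indicator[OF meas'(1) ab] by simp
 have U: "integrable (lborel \<Otimes>\<^sub>M lborel) U"
  unfolding U_def using integrable_mult_indicator[OF meas'(2) ab] by simp
 have row: "integrable lborel (\<lambda>s. a t \<bullet> a s)" for t using a by simp
 have ind1: "integrable lborel (\<lambda>s. indicator {..<t} s *\<^sub>R a s)" for t
  using a by (intro integrable_mult_indicator) auto
 have L1: "(LI s. L (t, s)) = (LI s. indicator {..<t} s *\<^sub>R a s) \<bullet> a t" for t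
 proof -
  have "(LI s. L (t, s)) = (LI s. (indicator {..<t} s *\<^sub>R a s) \<bullet> a t)"
   by (intro Bochner_Integration.integral_cong refl) (auto simp: L_def indicator_def inner_commute)
  then show ?thesis using integral_inner_left[OF ind1, of t "a t"] by simp
 qed
 have U1: "(LI t. U (t, s)) = (LI t. L (s, t))" for s
  by (intro Bochner_Integration.integral_cong refl) (auto simp: L_def U_def indicator_def inner_commute)
 have Ui: "integrable lborel (\<lambda>t. (LI s. U (t, s)))" and Li: "integrable lborel (\<lambda>t. (LI s. L (t, s)))"
  using lborel_pair.integrable_fst'[OF U] lborel_pair.integrable_fst'[OF L] by auto
 have "(norm (LI s. a s))^2 = (LI t. a t \<bullet> (LI s. a s))"
  using a by (simp add: power2_norm_eq_inner)
 also have "... = (LI t. (LI s. L (t, s)) + (LI s. U (t, s)))"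
 proof (rule Bochner_Integration.integral_cong[OF refl])
  fix t
  have Ls: "integrable lborel (\<lambda>s. L (t, s))" "integrable lborel (\<lambda>s. U (t, s))"
   using integrable_mult_indicator[OF _ row[of t], of "{..<t}"] integrable_mult_indicator[OF _ row[of t], of "{t<..}"]
   by (simp_all add: L_def U_def indicator_def)
  have "a t \<bullet> (LI s. a s) = (LI s. a t \<bullet> a s)" using a by simp
  also have "... = (LI s. L (t, s) + U (t, s))"
  proof (rule integral_cong_AE)
   show "AE s in lborel. a t \<bullet> a s = L (t, s) + U (t, s)"
    using AE_lborel_singleton[of t] by eventually_elim (auto simp: L_def U_def indicator_def)
  qed (use Ls in auto)
  also have "... = (LI s. L (t, s)) + (LI s. U (t, s))" using Ls by simp
  finally show "a t \<bullet> (LI s. a s) = (LI s. L (t, s)) + (LI s. U (t, s))" .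
 qed
 also have "... = (LI t. (LI s. L (t, s))) + (LI t. (LI s. U (t, s)))"
  using Ui Li by simp
 also have "(LI t. (LI s. U (t, s))) = (LI t. (LI s. L (t, s)))"
  using integral_swap[OF U] by (simp add: U1)
 finally show ?thesis by (simp add: L1)
qed

text \<open>\<open>M\<close> is a momentum field or a difference of two, extended by 0 outside the
  time interval and bounded in L1 in space. Square integrability comes from the mollification at the
  fixed scale \<open>h\<close>; bounds such as \<open>C1\<close> degenerate as h tends to 0 and only
  serve to make integrals and suprema finite.\<close>

locale momentum =
 fixes T h K :: real and M :: "real \<times> 'a::euclidean_space \<Rightarrow> 'a"
 assumes T: "0 < T" and h: "0 < h" and K: "0 \<le> K"
  and M_meas [measurable]: "M \<in> borel_measurable borel"
  and M_cut: "\<And>t x. t \<notin> {0<..<T} \<Longrightarrow> M (t, x) = 0"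
  and M_L1: "AE t in lborel. integrable lborel (\<lambda>x. M (t, x)) \<and> (LI x. norm (M (t, x))) \<le> K"
begin

definition mh :: "real \<Rightarrow> 'a \<Rightarrow> 'a" where "mh t x = cv (mol h) (\<lambda>y. M (t, y)) x"
text \<open>The integral effectively starts at time 0, as \<open>M\<close> vanishes before.\<close>

definition U :: "real \<Rightarrow> 'a \<Rightarrow> 'a" where "U t y = (LI s. indicator {..<t} s *\<^sub>R M (s, y))"
definition Uh :: "real \<Rightarrow> 'a \<Rightarrow> 'a" where "Uh t x = cv (mol h) (U t) x"

lemma M_int: "integrable (lborel \<Otimes>\<^sub>M lborel) M"
proof (rule integrable_prodI)
 have "(NI t. (NI x. ennreal (norm (M (t, x))))) \<le> (NI t. ennreal K * indicator {0<..<T} t)"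
 proof (rule nn_integral_mono_AE)
  show "AE t in lborel. (NI x. ennreal (norm (M (t, x)))) \<le> ennreal K * indicator {0<..<T} t"
   using M_L1
  proof eventually_elim
   case (elim t)
   then show ?case
    by (cases "t \<in> {0<..<T}") (auto simp: nn_integral_eq_integral M_cut ennreal_leI)
  qed
 qed
 also have "... < \<infinity>" using T by (simp add: nn_integral_cmult ennreal_mult_less_top)
 finally show "(NI t. (NI x. ennreal (norm (M (t, x))))) < \<infinity>" .
qed simp

lemma M_ind_int: "integrable (lborel \<Otimes>\<^sub>M lborel) (\<lambda>p. indicator {..<t} (fst p) *\<^sub>R M p)"
 by (rule integrable_bounded_scale[OF M_int, where B = 1]) (auto simp: lborel_prod indicator_def)

lemma U_int: "integrable lborel (U t)"
 using lborel_pair.integrable_snd[of "\<lambda>s y. indicator {..<t} s *\<^sub>R M (s, y)"] M_ind_int[of t]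
 by (simp add: U_def[abs_def] case_prod_beta')

lemma cv_U:
 assumes k [measurable]: "k \<in> borel_measurable borel" and B: "\<And>y. \<bar>k y\<bar> \<le> B"
 shows "cv k (U t) x = (LI s. indicator {..<t} s *\<^sub>R cv k (\<lambda>y. M (s, y)) x)"
  and "integrable lborel (\<lambda>s. indicator {..<t} s *\<^sub>R cv k (\<lambda>y. M (s, y)) x)"
proof -
 define F where "F p = k (x - snd p) *\<^sub>R (indicator {..<t} (fst p) *\<^sub>R M p)" for p
 have F: "integrable (lborel \<Otimes>\<^sub>M lborel) F"
  unfolding F_def by (rule integrable_bounded_scale[OF M_ind_int, of "\<lambda>p. k (x - snd p)" B]) (use B in \<open>auto simp: lborel_prod\<close>)
 have in1: "(LI y. F (s, y)) = indicator {..<t} s *\<^sub>R cv k (\<lambda>y. M (s, y)) x" for s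
 proof -
  have "(LI y. F (s, y)) = (LI y. indicator {..<t} s *\<^sub>R (k (x - y) *\<^sub>R M (s, y)))"
   by (intro Bochner_Integration.integral_cong refl) (simp add: F_def mult.commute)
  also have "... = indicator {..<t} s *\<^sub>R (LI y. k (x - y) *\<^sub>R M (s, y))"
   by (cases "s < t") auto
  finally show ?thesis by (simp add: cv_def)
 qed
 have in2: "(LI s. F (s, y)) = k (x - y) *\<^sub>R U t y" for y
  by (simp add: F_def U_def del: scaleR_scaleR)
 show "cv k (U t) x = (LI s. indicator {..<t} s *\<^sub>R cv k (\<lambda>y. M (s, y)) x)"
  using integral_swap[OF F] by (simp only: in1 in2 cv_def[of k "U t"])
 show "integrable lborel (\<lambda>s. indicator {..<t} s *\<^sub>R cv k (\<lambda>y. M (s, y)) x)"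
  using lborel_pair.integrable_fst'[OF F] by (simp only: in1)
qed

lemma mh_joint [measurable]: "(\<lambda>p. mh (fst p) (snd p)) \<in> borel_measurable borel"
proof -
 have "(\<lambda>q::(real \<times> 'a) \<times> 'a. mol h (snd (fst q) - snd q) *\<^sub>R M (fst (fst q), snd q)) \<in> borel_measurable borel"
  by measurable
 from measurable_integral_snd(1)[OF this] show ?thesis by (simp add: mh_def cv_def)
qed

lemma Uh_eq: "Uh t x = (LI s. indicator {..<t} s *\<^sub>R mh s x)"
 unfolding Uh_def mh_def by (rule cv_U(1)[OF mol_measurable mol_abs_bound[OF h]])

lemma mh_ind_int: "integrable lborel (\<lambda>s. indicator {..<t} s *\<^sub>R mh s x)"
 unfolding mh_def by (rule cv_U(2)[OF mol_measurable mol_abs_bound[OF h]])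

lemma Uh_joint [measurable]: "(\<lambda>p. Uh (fst p) (snd p)) \<in> borel_measurable borel"
proof -
 have [measurable]: "{q :: (real \<times> 'a) \<times> real. snd q < fst (fst q)} \<in> sets borel"
  by (auto intro!: borel_open open_Collect_less continuous_intros)
 have "(\<lambda>q::(real \<times> 'a) \<times> real. indicator {q. snd q < fst (fst q)} q *\<^sub>R mh (snd q) (snd (fst q))) \<in> borel_measurable borel"
  using measurable_compose[OF _ mh_joint, of "\<lambda>q::(real \<times> 'a) \<times> real. (snd q, snd (fst q))" borel]
  by (intro borel_measurable_scaleR borel_measurable_indicator) auto
 from measurable_integral_snd(1)[OF this]
 show ?thesis by (simp add: Uh_eq indicator_def lessThan_def)
qed

lemma mh_cut: "t \<notin> {0<..<T} \<Longrightarrow> mh t x = 0"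
 by (simp add: mh_def cv_def M_cut)

definition C1 :: real where "C1 = molB TYPE('a) / h ^ DIM('a) * K"

lemma mh_bound: "AE t in lborel. (\<forall>x. norm (mh t x) \<le> C1) \<and> integrable lborel (mh t) \<and> (LI x. norm (mh t x)) \<le> K"
 using M_L1
proof eventually_elim
 case (elim t)
 then have Mt: "integrable lborel (\<lambda>x. M (t, x))" "(LI x. norm (M (t, x))) \<le> K" by auto
 have B: "0 \<le> molB TYPE('a) / h ^ DIM('a)" using molB_pos[where 'a='a] h by simp
 have "norm (mh t x) \<le> C1" for x
 proof -
  have "norm (mh t x) \<le> molB TYPE('a) / h ^ DIM('a) * (LI x. norm (M (t, x)))"
   unfolding mh_def by (rule cv_bound[OF Mt(1) mol_measurable mol_abs_bound[OF h]])
  also have "... \<le> C1" unfolding C1_def by (rule mult_left_mono[OF Mt(2) B])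
  finally show ?thesis .
 qed
 moreover have i: "integrable lborel (mh t)"
  unfolding mh_def[abs_def] by (rule cv_integrable[OF Mt(1) mol_integrable[OF h]])
 moreover have "(LI x. norm (mh t x)) \<le> K"
 proof -
  have "(NI x. ennreal (norm (mh t x))) \<le> (NI x. ennreal \<bar>mol h (x::'a)\<bar>) * (NI y. ennreal (norm (M (t, y))))"
   unfolding mh_def by (rule nn_integral_cv_le) (use Mt in auto)
  also have "... = ennreal (LI y. norm (M (t, y)))"
   using Mt by (simp add: abs_mol[OF h] nn_integral_mol[OF h] nn_integral_eq_integral)
  also have "... \<le> ennreal K" by (rule ennreal_leI[OF Mt(2)])
  finally show ?thesis using i K by (simp add: nn_integral_eq_integral)
 qed
 ultimately show ?case by blast
qed

lemma C1_nonneg: "0 \<le> C1" using molB_pos[where 'a='a] h K by (simp add: C1_def)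

lemma Uh_bound: "norm (Uh t x) \<le> T * C1"
proof -
 have "norm (Uh t x) \<le> (LI s. norm (indicator {..<t} s *\<^sub>R mh s x))"
  unfolding Uh_eq by (rule integral_norm_bound)
 also have "... \<le> (LI s. C1 * indicator {0<..<T} s)"
 proof (rule integral_mono_AE)
  show "AE s in lborel. norm (indicator {..<t} s *\<^sub>R mh s x) \<le> C1 * indicator {0<..<T} s"
   using mh_bound
  proof eventually_elim
   case (elim s)
   then show ?case using C1_nonneg mh_cut[of s x] by (auto simp: indicator_def)
  qed
  show "integrable lborel (\<lambda>s. norm (indicator {..<t} s *\<^sub>R mh s x))" by (rule integrable_norm[OF mh_ind_int])
  show "integrable lborel (\<lambda>s. C1 * indicator {0<..<T} s)"
   using T by (intro integrable_mult_right integrable_real_indicator) auto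
 qed
 also have "... = T * C1" using T by simp
 finally show ?thesis .
qed

lemma Uh_int: "integrable lborel (Uh t)"
 unfolding Uh_def[abs_def] by (rule cv_integrable[OF U_int mol_integrable[OF h]])

lemma Uh_sq_int: "integrable lborel (\<lambda>x. (norm (Uh t x))^2)"
proof (rule integrable_nonneg_bound)
 show "integrable lborel (\<lambda>x. T * C1 * norm (Uh t x))" using Uh_int by auto
 show "(norm (Uh t x))^2 \<le> T * C1 * norm (Uh t x)" for x
  unfolding power2_eq_square by (rule mult_right_mono[OF Uh_bound]) simp
 show "(\<lambda>x. (norm (Uh t x))^2) \<in> borel_measurable lborel" using Uh_int[of t] by auto
qed simp

lemma Uh_L1: "(LI x. norm (Uh t x)) \<le> T * K"
proof -
 have "(NI x. ennreal (norm (Uh t x))) \<le> (NI x. (NI s. ennreal (norm (mh s x))))"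
 proof (intro nn_integral_mono)
  fix x
  have "ennreal (norm (Uh t x)) \<le> (NI s. ennreal (norm (indicator {..<t} s *\<^sub>R mh s x)))"
   unfolding Uh_eq by (rule norm_integral_le_nn_integral)
  also have "... \<le> (NI s. ennreal (norm (mh s x)))"
   by (intro nn_integral_mono ennreal_leI) (auto simp: indicator_def)
  finally show "ennreal (norm (Uh t x)) \<le> ..." .
 qed
 also have "... = (NI s. (NI x. ennreal (norm (mh s x))))"
  using nn_integral_swap[of "\<lambda>p. ennreal (norm (mh (fst p) (snd p)))"] by simp
 also have "... \<le> (NI s. ennreal K * indicator {0<..<T} s)"
 proof (rule nn_integral_mono_AE)
  show "AE s in lborel. (NI x. ennreal (norm (mh s x))) \<le> ennreal K * indicator {0<..<T} s"
   using mh_bound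
  proof eventually_elim
   case (elim s)
   then show ?case
    by (cases "s \<in> {0<..<T}") (auto simp: nn_integral_eq_integral mh_cut ennreal_leI)
  qed
 qed
 also have "... = ennreal (T * K)" using T K by (simp add: nn_integral_cmult ennreal_mult mult.commute)
 finally show ?thesis using Uh_int[of t] T K by (simp add: nn_integral_eq_integral)
qed

text \<open>The field \<open>Uh\<close> is the time primitive of \<open>mh\<close>, so
  \<open>norm_integral_square\<close> applies at every point to \<open>mh\<close> cut off at
  \<open>tau\<close>; Fubini then integrates over space.\<close>

lemma energy_identity:
 shows "integrable lborel (\<lambda>t. indicator {..<tau} t * (LI x. Uh t x \<bullet> mh t x))"
  and "(LI x. (norm (Uh tau x))^2) = 2 * (LI t. indicator {..<tau} t * (LI x. Uh t x \<bullet> mh t x))"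
proof -
 define P where "P p = indicator {..<tau} (fst p) * (Uh (fst p) (snd p) \<bullet> mh (fst p) (snd p))" for p :: "real \<times> 'a"
 have Pm: "P \<in> borel_measurable borel"
  unfolding P_def[abs_def] by (intro borel_measurable_times borel_measurable_inner Uh_joint mh_joint) simp
 have P: "integrable (lborel \<Otimes>\<^sub>M lborel) P"
 proof (rule integrable_prodI[OF Pm])
  have "(NI t. (NI x. ennreal (norm (P (t, x))))) \<le> (NI t. ennreal (T * C1 * K) * indicator {0<..<T} t)"
  proof (rule nn_integral_mono_AE)
   show "AE t in lborel. (NI x. ennreal (norm (P (t, x)))) \<le> ennreal (T * C1 * K) * indicator {0<..<T} t"
    using mh_bound
   proof eventually_elim
    case (elim t)
    show ?case
    proof (cases "t \<in> {0<..<T}")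
     case True
     have "(NI x. ennreal (norm (P (t, x)))) \<le> (NI x. ennreal (T * C1 * norm (mh t x)))"
     proof (intro nn_integral_mono ennreal_leI)
      fix x
      have "norm (P (t, x)) \<le> \<bar>Uh t x \<bullet> mh t x\<bar>" by (auto simp: P_def indicator_def)
      also have "... \<le> norm (Uh t x) * norm (mh t x)" by (rule Cauchy_Schwarz_ineq2)
      also have "... \<le> T * C1 * norm (mh t x)" by (intro mult_right_mono Uh_bound) simp
      finally show "norm (P (t, x)) \<le> T * C1 * norm (mh t x)" .
     qed
     also have "... = ennreal (T * C1 * (LI x. norm (mh t x)))"
      using elim T C1_nonneg by (subst nn_integral_eq_integral) auto
     also have "... \<le> ennreal (T * C1 * K)"
      using elim T C1_nonneg by (intro ennreal_leI mult_left_mono) auto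
     finally show ?thesis using True by simp
    qed (simp add: P_def mh_cut)
   qed
  qed
  also have "... < \<infinity>" using T by (simp add: nn_integral_cmult ennreal_mult_less_top)
  finally show "(NI t. (NI x. ennreal (norm (P (t, x))))) < \<infinity>" .
 qed
 have P1: "(LI x. P (t, x)) = indicator {..<tau} t * (LI x. Uh t x \<bullet> mh t x)" for t
  by (simp add: P_def)
 show "integrable lborel (\<lambda>t. indicator {..<tau} t * (LI x. Uh t x \<bullet> mh t x))"
  using lborel_pair.integrable_fst'[OF P] by (simp only: P1)
 have "(norm (Uh tau x))^2 = 2 * (LI t. P (t, x))" for x
 proof -
  have "(norm (Uh tau x))^2 = 2 * (LI t. (LI s. indicator {..<t} s *\<^sub>R (indicator {..<tau} s *\<^sub>R mh s x)) \<bullet> (indicator {..<tau} t *\<^sub>R mh t x))"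
   unfolding Uh_eq by (rule norm_integral_square[OF mh_ind_int])
  also have "(\<lambda>t. (LI s. indicator {..<t} s *\<^sub>R (indicator {..<tau} s *\<^sub>R mh s x)) \<bullet> (indicator {..<tau} t *\<^sub>R mh t x)) = (\<lambda>t. P (t, x))"
  proof
   fix t
   show "(LI s. indicator {..<t} s *\<^sub>R (indicator {..<tau} s *\<^sub>R mh s x)) \<bullet> (indicator {..<tau} t *\<^sub>R mh t x) = P (t, x)"
   proof (cases "t < tau")
    case True
    then have "(\<lambda>s. indicator {..<t} s *\<^sub>R (indicator {..<tau} s *\<^sub>R mh s x)) = (\<lambda>s. indicator {..<t} s *\<^sub>R mh s x)"
     by (auto simp: indicator_def fun_eq_iff)
    then show ?thesis using True by (simp add: P_def Uh_eq)
   qed (simp add: P_def)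
  qed
  finally show ?thesis .
 qed
 then have "(LI x. (norm (Uh tau x))^2) = 2 * (LI x. (LI t. P (t, x)))" by simp
 also have "(LI x. (LI t. P (t, x))) = (LI t. (LI x. P (t, x)))"
  by (rule integral_swap[OF P, symmetric])
 finally show "(LI x. (norm (Uh tau x))^2) = 2 * (LI t. indicator {..<tau} t * (LI x. Uh t x \<bullet> mh t x))"
  by (simp only: P1)
qed

text \<open>\<open>v\<close> plays the role of the gradient of \<open>g\<close> and \<open>w\<close>
  that of - div U. Both relations are only required when tested with the mollifier of scale
  \<open>h\<close>, which is all that mollified quantities see.\<close>

lemma Uh_by_parts:
 fixes g :: "'a \<Rightarrow> real" and v :: "'a \<Rightarrow> 'a"
 assumes g: "integrable lborel g"
  and v: "\<And>x. integrable lborel (\<lambda>y. mol h (x - y) *\<^sub>R v y)"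
  and gv: "\<And>x b. b \<in> Basis \<Longrightarrow> (LI y. dmol h b (x - y) * g y) = (LI y. mol h (x - y) * (v y \<bullet> b))"
  and w: "\<And>x. cv (mol h) w x = - (\<Sum>b\<in>Basis. cv (dmol h b) (\<lambda>y. U t y \<bullet> b) x)"
 shows "integrable lborel (\<lambda>x. Uh t x \<bullet> cv (mol h) v x)"
  and "(LI x. Uh t x \<bullet> cv (mol h) v x) = (LI x. cv (mol h) w x * cv (mol h) g x)"
proof -
 have Ub: "integrable lborel (\<lambda>y. U t y \<bullet> b)" for b using U_int by auto
 have dB: "\<exists>B. \<forall>x::'a. \<bar>dmol h b x\<bar> \<le> B" if "b \<in> Basis" for b using dmol_bounded[OF h] that by blast
 have c1: "cv (mol h) v x \<bullet> b = cv (dmol h b) g x" if "b \<in> Basis" for x b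
  using integral_inner_left[OF v[of x], of b] gv[OF that, of x] by (simp add: cv_def)
 have c2: "Uh t x \<bullet> b = cv (mol h) (\<lambda>y. U t y \<bullet> b) x" for x b
  unfolding Uh_def by (rule cv_inner[OF U_int mol_measurable mol_abs_bound[OF h]])
 have e: "Uh t x \<bullet> cv (mol h) v x = (\<Sum>b\<in>Basis. cv (mol h) (\<lambda>y. U t y \<bullet> b) x * cv (dmol h b) g x)" for x
  by (subst euclidean_inner) (simp add: c1 c2)
 have i1: "integrable lborel (\<lambda>x. cv (mol h) (\<lambda>y. U t y \<bullet> b) x * cv (dmol h b) g x)" if b: "b \<in> Basis" for b
 proof -
  obtain B where B: "\<And>x::'a. \<bar>dmol h b x\<bar> \<le> B" using dB[OF b] by blast
  have "\<bar>dmol h b x\<bar> \<le> max B (molB TYPE('a) / h ^ DIM('a))" "\<bar>mol h x\<bar> \<le> max B (molB TYPE('a) / h ^ DIM('a))" for x :: 'a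
   using B[of x] mol_abs_bound[OF h, of x] by linarith+
  then show ?thesis
   by (intro cv_cv_product(1)[OF Ub g mol_integrable[OF h] _ dmol_integrable[OF h b]])
 qed
 have i2: "integrable lborel (\<lambda>x. cv (dmol h b) (\<lambda>y. U t y \<bullet> b) x * cv (mol h) g x)" if b: "b \<in> Basis" for b
 proof -
  obtain B where B: "\<And>x::'a. \<bar>dmol h b x\<bar> \<le> B" using dB[OF b] by blast
  have "\<bar>dmol h b x\<bar> \<le> max B (molB TYPE('a) / h ^ DIM('a))" "\<bar>mol h x\<bar> \<le> max B (molB TYPE('a) / h ^ DIM('a))" for x :: 'a
   using B[of x] mol_abs_bound[OF h, of x] by linarith+
  then show ?thesis
   by (intro cv_cv_product(1)[OF Ub g dmol_integrable[OF h b] _ mol_integrable[OF h]])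
 qed
 show "integrable lborel (\<lambda>x. Uh t x \<bullet> cv (mol h) v x)" unfolding e using i1 by auto
 have "(LI x. Uh t x \<bullet> cv (mol h) v x) = (\<Sum>b\<in>Basis. (LI x. cv (mol h) (\<lambda>y. U t y \<bullet> b) x * cv (dmol h b) g x))"
  unfolding e using i1 by (intro Bochner_Integration.integral_sum)
 also have "... = (\<Sum>b\<in>Basis. - (LI x. cv (dmol h b) (\<lambda>y. U t y \<bullet> b) x * cv (mol h) g x))"
  by (intro sum.cong refl cv_by_parts[OF h] Ub g)
 also have "... = - (LI x. (\<Sum>b\<in>Basis. cv (dmol h b) (\<lambda>y. U t y \<bullet> b) x * cv (mol h) g x))"
  using i2 by (subst Bochner_Integration.integral_sum) (auto simp: sum_negf)
 also have "... = (LI x. cv (mol h) w x * cv (mol h) g x)"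
  by (simp add: w sum_distrib_right flip: Bochner_Integration.integral_minus)
 finally show "(LI x. Uh t x \<bullet> cv (mol h) v x) = (LI x. cv (mol h) w x * cv (mol h) g x)" .
qed

text \<open>
  \<open>Uh\<close> satisfies \<open>\<partial>\<^sub>t Uh = J\<^sub>h - q\<^sub>h\<close>. As \<open>q = \<nabla>z\<close> and \<open>w = - div U\<close>, testing with \<open>Uh\<close> turns the second term
  into \<open>- \<integral> w\<^sub>h z\<^sub>h\<close>, which is almost nonpositive because \<open>w\<close> and \<open>z\<close> have the same sign.
\<close>

lemma energy_estimate:
 fixes J q :: "real \<Rightarrow> 'a \<Rightarrow> 'a" and w z :: "real \<Rightarrow> 'a \<Rightarrow> real"
 assumes e0: "0 \<le> e" and j0: "0 \<le> j"
  and J: "AE t\<in>{0<..<T} in lborel. integrable lborel (J t) \<and> integrable lborel (q t) \<and> (\<forall>x. M (t, x) = J t x - q t x)"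
  and z: "AE t\<in>{0<..<T} in lborel. integrable lborel (z t)"
  and zq: "AE t\<in>{0<..<T} in lborel. (\<forall>x. \<forall>b\<in>Basis. (LI y. dmol h b (x - y) * z t y) = (LI y. mol h (x - y) * (q t y \<bullet> b)))"
  and w: "AE t\<in>{0<..<T} in lborel. (\<forall>x. cv (mol h) (w t) x = - (\<Sum>b\<in>Basis. cv (dmol h b) (\<lambda>y. U t y \<bullet> b) x))"
  and wz: "AE t\<in>{0<..<T} in lborel. - (LI x. cv (mol h) (w t) x * cv (mol h) (z t) x) \<le> e"
  and Jh: "AE t\<in>{0<..<T} in lborel. (NI x. ennreal ((norm (cv (mol h) (J t) x))^2)) \<le> ennreal j"
 assumes tau: "tau \<in> {0<..<T}"
 shows "(LI x. (norm (Uh tau x))^2) \<le> 4 * T\<^sup>2 * j + 4 * T * e"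
proof -
 \<comment> \<open>The supremum of the energy over time is finite by the crude bound with
   \<open>C1\<close>. It can therefore be absorbed once it reappears with the factor 1/2.\<close>
 define S where "S = (\<lambda>t. (LI x. (norm (Uh t x))^2)) ` {0<..<T}"
 have bdd: "bdd_above S"
 proof -
  have "(LI x. (norm (Uh t x))^2) \<le> T * C1 * (T * K)" for t
  proof -
   have "(LI x. (norm (Uh t x))^2) \<le> (LI x. T * C1 * norm (Uh t x))"
   proof (rule integral_mono[OF Uh_sq_int])
    show "integrable lborel (\<lambda>x. T * C1 * norm (Uh t x))" using Uh_int by auto
    show "(norm (Uh t x))^2 \<le> T * C1 * norm (Uh t x)" for x
     unfolding power2_eq_square by (rule mult_right_mono[OF Uh_bound]) simp
   qed
   also have "... = T * C1 * (LI x. norm (Uh t x))" by simp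
   also have "... \<le> T * C1 * (T * K)" using T C1_nonneg by (intro mult_left_mono Uh_L1) auto
   finally show ?thesis .
  qed
  then show ?thesis unfolding S_def by (intro bdd_aboveI2)
 qed
 have S0: "S \<noteq> {}" using tau by (auto simp: S_def)
 have le_Sup: "(LI x. (norm (Uh t x))^2) \<le> Sup S" if "t \<in> {0<..<T}" for t
  using that bdd by (intro cSup_upper) (auto simp: S_def)
 have key: "(LI x. (norm (Uh r x))^2) \<le> Sup S / 2 + (2 * T\<^sup>2 * j + 2 * T * e)" if r: "r \<in> {0<..<T}" for r
 proof -
  \<comment> \<open>The weight 1/(4T) in the Young inequality is chosen so that integration over a
    time span T and the factor 2 of the energy identity leave exactly half of the supremum.\<close>
  let ?c = "Sup S / (4 * T) + T * j + e"
  have Sup0: "0 \<le> Sup S" using le_Sup[OF r] Bochner_Integration.integral_nonneg[of lborel "\<lambda>x. (norm (Uh r x))^2"]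
   by (meson order_trans zero_le_power2)
  have c0: "0 \<le> ?c" using Sup0 T j0 e0 by (intro add_nonneg_nonneg) auto
  have inner: "AE t\<in>{0<..<T} in lborel. (LI x. Uh t x \<bullet> mh t x) \<le> ?c"
   using J z zq w wz Jh
  proof eventually_elim
   case (elim t)
   show ?case
   proof
    assume t: "t \<in> {0<..<T}"
    have Jt: "integrable lborel (J t)" "integrable lborel (q t)" "\<And>x. M (t, x) = J t x - q t x" using elim(1) t by auto
    have mt: "mh t x = cv (mol h) (J t) x - cv (mol h) (q t) x" for x
     unfolding mh_def Jt(3) by (rule cv_diff[OF Jt(1,2) mol_measurable mol_abs_bound[OF h]])
    have bp: "integrable lborel (\<lambda>x. Uh t x \<bullet> cv (mol h) (q t) x)"
     "(LI x. Uh t x \<bullet> cv (mol h) (q t) x) = (LI x. cv (mol h) (w t) x * cv (mol h) (z t) x)"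
    proof -
     have zt: "integrable lborel (z t)" using elim(2) t by blast
     have zq: "\<And>x b. b \<in> Basis \<Longrightarrow> (LI y. dmol h b (x - y) * z t y) = (LI y. mol h (x - y) * (q t y \<bullet> b))"
      using elim(3) t by blast
     have wt: "\<And>x. cv (mol h) (w t) x = - (\<Sum>b\<in>Basis. cv (dmol h b) (\<lambda>y. U t y \<bullet> b) x)"
      using elim(4) t by blast
     show "integrable lborel (\<lambda>x. Uh t x \<bullet> cv (mol h) (q t) x)"
      "(LI x. Uh t x \<bullet> cv (mol h) (q t) x) = (LI x. cv (mol h) (w t) x * cv (mol h) (z t) x)"
      using Uh_by_parts[OF zt integrable_mol_kernel[OF Jt(2) h] zq wt] by blast+
    qed
    have Jm: "cv (mol h) (J t) \<in> borel_measurable borel" using Jt(1) by (intro cv_measurable) auto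
    have Jsq: "integrable lborel (\<lambda>x. (norm (cv (mol h) (J t) x))^2)"
     using elim(6) t Jm by (intro integrableI_bounded) (auto intro: le_less_trans)
    have Jle: "(LI x. (norm (cv (mol h) (J t) x))^2) \<le> j"
     using elim(6) t j0 Jsq by (simp add: nn_integral_eq_integral)
    have ub: "\<bar>Uh t x \<bullet> cv (mol h) (J t) x\<bar> \<le> (1 / (4 * T)) * (norm (Uh t x))^2 + T * (norm (cv (mol h) (J t) x))^2" for x
    proof -
     let ?a = "norm (Uh t x)" and ?b = "norm (cv (mol h) (J t) x)"
     have "\<bar>Uh t x \<bullet> cv (mol h) (J t) x\<bar> \<le> ?a * ?b" by (rule Cauchy_Schwarz_ineq2)
     also have "... \<le> (1 / (4 * T)) * ?a\<^sup>2 + T * ?b\<^sup>2"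
     proof -
      have "0 \<le> (?a - 2 * T * ?b)^2 / (4 * T)" using T by simp
      also have "(?a - 2 * T * ?b)^2 / (4 * T) = (1 / (4 * T)) * ?a\<^sup>2 + T * ?b\<^sup>2 - ?a * ?b"
       using T by (simp add: power2_eq_square field_simps)
      finally show ?thesis by simp
     qed
     finally show ?thesis .
    qed
    have Rint: "integrable lborel (\<lambda>x. (1 / (4 * T)) * (norm (Uh t x))^2 + T * (norm (cv (mol h) (J t) x))^2)"
     using Uh_sq_int[of t] Jsq by (intro Bochner_Integration.integrable_add integrable_mult_right) auto
    have UJ: "integrable lborel (\<lambda>x. Uh t x \<bullet> cv (mol h) (J t) x)"
    proof (rule Bochner_Integration.integrable_bound[OF Rint])
     show "AE x in lborel. norm (Uh t x \<bullet> cv (mol h) (J t) x) \<le> norm ((1 / (4 * T)) * (norm (Uh t x))^2 + T * (norm (cv (mol h) (J t) x))^2)"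
      using ub by (intro AE_I2) (simp add: order_trans[OF _ abs_ge_self])
    qed (use Uh_int[of t] Jm in \<open>auto intro!: borel_measurable_inner\<close>)
    have "(LI x. Uh t x \<bullet> mh t x) = (LI x. Uh t x \<bullet> cv (mol h) (J t) x) - (LI x. Uh t x \<bullet> cv (mol h) (q t) x)"
     using UJ bp(1) by (simp add: mt inner_diff_right)
    also have "(LI x. Uh t x \<bullet> cv (mol h) (J t) x)
      \<le> (LI x. (1 / (4 * T)) * (norm (Uh t x))^2 + T * (norm (cv (mol h) (J t) x))^2)"
     using ub by (intro integral_mono UJ Rint) (auto intro: order_trans[OF abs_ge_self])
    also have "... = (1 / (4 * T)) * (LI x. (norm (Uh t x))^2) + T * (LI x. (norm (cv (mol h) (J t) x))^2)"
     using Uh_sq_int[of t] Jsq by simp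
    also have "... \<le> (1 / (4 * T)) * Sup S + T * j"
     using T Jle le_Sup[OF t] by (intro add_mono mult_left_mono) auto
    finally have "(LI x. Uh t x \<bullet> mh t x) \<le> (1 / (4 * T)) * Sup S + T * j - (LI x. cv (mol h) (w t) x * cv (mol h) (z t) x)"
     using bp(2) by simp
    then show "(LI x. Uh t x \<bullet> mh t x) \<le> ?c" using elim(5) t by simp
   qed
  qed
  have "(LI x. (norm (Uh r x))^2) = 2 * (LI t. indicator {..<r} t * (LI x. Uh t x \<bullet> mh t x))"
   by (rule energy_identity(2))
  also have "(LI t. indicator {..<r} t * (LI x. Uh t x \<bullet> mh t x)) \<le> (LI t. ?c * indicator {0<..<T} t)"
  proof (rule integral_mono_AE[OF energy_identity(1)])
   show "AE t in lborel. indicator {..<r} t * (LI x. Uh t x \<bullet> mh t x) \<le> ?c * indicator {0<..<T} t"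
    using inner
   proof eventually_elim
    case (elim t)
    show ?case
    proof (cases "t \<in> {0<..<T}")
     case True
     then show ?thesis using elim c0 by (auto simp: indicator_def)
    next
     case False
     then show ?thesis by (simp add: mh_cut)
    qed
   qed
  qed (use T in simp)
  also have "... = T * ?c" using T by simp
  also have "2 * (T * ?c) = Sup S / 2 + (2 * T\<^sup>2 * j + 2 * T * e)"
   using T by (simp add: power2_eq_square field_simps)
  finally show ?thesis by simp
 qed
 have "Sup S \<le> Sup S / 2 + (2 * T\<^sup>2 * j + 2 * T * e)"
  using key by (intro cSup_least[OF S0]) (auto simp: S_def)
 then have "Sup S \<le> 4 * T\<^sup>2 * j + 4 * T * e" by simp
 with le_Sup[OF tau] show ?thesis by simp
qed

text \<open>After integration by parts the product is that of \<open>Uh\<close>, of norm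
  O(\<kappa>), with a bounded gradient. Young with weight \<kappa> makes both contributions
  O(\<kappa>), and mollification does not increase the norm of \<open>v\<close>.\<close>

lemma mollified_product_bound:
 fixes g :: "'a \<Rightarrow> real" and v :: "'a \<Rightarrow> 'a"
 assumes kap: "0 < \<kappa>" and g: "integrable lborel g" and vm [measurable]: "v \<in> borel_measurable borel"
  and v2: "integrable lborel (\<lambda>x. (norm (v x))^2)" "(LI x. (norm (v x))^2) \<le> B"
  and v: "\<And>x. integrable lborel (\<lambda>y. mol h (x - y) *\<^sub>R v y)"
  and gv: "\<And>x b. b \<in> Basis \<Longrightarrow> (LI y. dmol h b (x - y) * g y) = (LI y. mol h (x - y) * (v y \<bullet> b))"
  and w: "\<And>x. cv (mol h) w x = - (\<Sum>b\<in>Basis. cv (dmol h b) (\<lambda>y. U t y \<bullet> b) x)"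
  and U2: "(LI x. (norm (Uh t x))^2) \<le> C * \<kappa>\<^sup>2"
 shows "(LI x. cv (mol h) w x * cv (mol h) g x) \<le> (C + B) * \<kappa>"
proof -
 note bp = Uh_by_parts[OF g v gv w]
 have vmm [measurable]: "cv (mol h) v \<in> borel_measurable borel" by (intro cv_measurable) auto
 have vle: "(NI x. ennreal ((norm (cv (mol h) v x))^2)) \<le> ennreal B"
  using cv_mol_L2[OF h vm] v2 by (simp add: nn_integral_eq_integral order_trans[OF _ ennreal_leI])
 have B0: "0 \<le> B" using v2(2) Bochner_Integration.integral_nonneg[of lborel "\<lambda>x. (norm (v x))^2"]
  by (meson order_trans zero_le_power2)
 have vi: "integrable lborel (\<lambda>x. (norm (cv (mol h) v x))^2)"
  using vle by (intro integrableI_bounded) (auto intro: le_less_trans)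
 have vB: "(LI x. (norm (cv (mol h) v x))^2) \<le> B"
  using vle vi B0 by (simp add: nn_integral_eq_integral)
 have pt: "Uh t x \<bullet> cv (mol h) v x \<le> (1 / \<kappa>) * (norm (Uh t x))^2 + \<kappa> * (norm (cv (mol h) v x))^2" for x
 proof -
  let ?a = "norm (Uh t x)" and ?b = "norm (cv (mol h) v x)"
  have "Uh t x \<bullet> cv (mol h) v x \<le> ?a * ?b" by (rule norm_cauchy_schwarz)
  also have "... = \<kappa> * \<bar>(?a / \<kappa>) * ?b\<bar>" using kap by (simp add: abs_mult)
  also have "... \<le> \<kappa> * ((?a / \<kappa>)^2 + ?b\<^sup>2)" using kap by (intro mult_left_mono abs_mult_le_squares) auto
  also have "... = (1 / \<kappa>) * ?a\<^sup>2 + \<kappa> * ?b\<^sup>2" using kap by (simp add: power2_eq_square field_simps)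
  finally show ?thesis .
 qed
 have "(LI x. cv (mol h) w x * cv (mol h) g x) = (LI x. Uh t x \<bullet> cv (mol h) v x)" using bp(2) by simp
 also have "... \<le> (LI x. (1 / \<kappa>) * (norm (Uh t x))^2 + \<kappa> * (norm (cv (mol h) v x))^2)"
  using Uh_sq_int[of t] vi
  by (intro integral_mono bp(1) pt Bochner_Integration.integrable_add integrable_mult_right) auto
 also have "... = (1 / \<kappa>) * (LI x. (norm (Uh t x))^2) + \<kappa> * (LI x. (norm (cv (mol h) v x))^2)"
  using Uh_sq_int[of t] vi by simp
 also have "... \<le> (1 / \<kappa>) * (C * \<kappa>\<^sup>2) + \<kappa> * B"
  using U2 vB kap by (intro add_mono mult_left_mono) auto
 also have "... = (C + B) * \<kappa>" using kap by (simp add: power2_eq_square field_simps)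
 finally show ?thesis .
qed

end

section \<open>Slicing distributions in time\<close>

text \<open>The maximum is there because the real bound in \<open>Linf_Lq\<close> may be negative,
  in which case \<open>ennreal C\<close> is 0.\<close>

lemma Lq_norm_bound:
 assumes q: "0 < q" and C: "Lq_norm q A f \<le> ennreal C"
 shows "(\<integral>\<^sup>+x\<in>A. ennreal (norm (f x) powr q) \<partial>lborel) \<le> ennreal (max C 0 powr q)"
proof -
 define I where "I = (\<integral>\<^sup>+x\<in>A. ennreal (norm (f x) powr q) \<partial>lborel)"
 have fin: "I \<noteq> \<infinity>" using C by (auto simp: Lq_norm_def I_def[symmetric] Let_def top_unique split: if_splits)
 then have "ennreal (enn2real I powr (1 / q)) \<le> ennreal C"
  using C by (simp add: Lq_norm_def I_def[symmetric] Let_def)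
 also have "... \<le> ennreal (max C 0)" by (rule ennreal_leI) simp
 finally have "enn2real I powr (1 / q) \<le> max C 0" by (subst (asm) ennreal_le_iff) auto
 then have "(enn2real I powr (1 / q)) powr q \<le> max C 0 powr q" using q by (intro powr_mono2) auto
 then have "enn2real I \<le> max C 0 powr q" using q by (simp add: powr_powr)
 then have "ennreal (enn2real I) \<le> ennreal (max C 0 powr q)" by (rule ennreal_leI)
 moreover have "ennreal (enn2real I) = I" using fin by (simp add: less_top)
 ultimately show ?thesis by (simp add: I_def[symmetric])
qed

lemma in_Lq_finite: "in_Lq q A f \<Longrightarrow> (\<integral>\<^sup>+x\<in>A. ennreal (norm (f x) powr q) \<partial>lborel) < \<infinity>"
 by (auto simp: in_Lq_def Lq_norm_def Let_def less_top split: if_splits)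

lemma Lq_norm_leI:
 assumes q: "0 < q" and C: "0 \<le> C" and I: "(\<integral>\<^sup>+x\<in>A. ennreal (norm (f x) powr q) \<partial>lborel) \<le> ennreal (C powr q)"
 shows "Lq_norm q A f \<le> ennreal C"
proof -
 define I where "I = (\<integral>\<^sup>+x\<in>A. ennreal (norm (f x) powr q) \<partial>lborel)"
 have I: "I \<le> ennreal (C powr q)" using I by (simp add: I_def)
 then have fin: "I \<noteq> \<infinity>" by (auto simp: top_unique)
 have "enn2real I \<le> C powr q" using I by (intro enn2real_leI) auto
 then have "enn2real I powr (1 / q) \<le> (C powr q) powr (1 / q)" using q by (intro powr_mono2) auto
 then have "enn2real I powr (1 / q) \<le> C" using q C by (simp add: powr_powr)
 then show ?thesis using fin by (simp add: Lq_norm_def I_def[symmetric] Let_def ennreal_leI)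
qed

section \<open>Products of mollifiers in time and space as test functions\<close>

lemma Basis_axis: "(b :: real ^ 'n) \<in> Basis \<longleftrightarrow> (\<exists>i. b = axis i 1)"
 by (auto simp: Basis_vec_def)

lemma dmol_minus: "dmol h (- v) x = - dmol h v x"
 by (simp add: dmol_sum[of h "- v"] dmol_sum[of h v] sum_negf)

text \<open>The product structure turns a distributional identity on space-time into a time
  mollification of spatially mollified identities. In one dimension the support radius of
  \<open>mol k\<close> is \<open>k\<close>, so the ball condition keeps the support in the open time
  interval.\<close>

lemma test_product:
 fixes x0 :: "real ^ 'n"
 assumes k: "0 < k" and h: "0 < h" and t0: "cball t0 k \<subseteq> {0<..<T}"
 defines "\<phi> \<equiv> \<lambda>p. mol k (t0 - fst p) * mol h (x0 - snd p)"
 shows "test_fun ({0<..<T} \<times> UNIV) \<phi>"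
  and "dt \<phi> (t, x) = - (dmol k 1 (t0 - t) * mol h (x0 - x))"
  and "dx i \<phi> (t, x) = - (mol k (t0 - t) * dmol h (axis i 1) (x0 - x))"
proof -
 have "Ck j \<phi>" for j
  unfolding \<phi>_def
 proof (rule Ck_mult)
  show "Ck j (\<lambda>p :: real \<times> (real ^ 'n). mol k (t0 - fst p))"
   by (rule Ck_mol_comp[where a = "\<lambda>b. t0 * b" and v = "\<lambda>b. (- b, 0)"]) (simp add: algebra_simps inner_prod_def)
  show "Ck j (\<lambda>p :: real \<times> (real ^ 'n). mol h (x0 - snd p))"
   by (rule Ck_mol_comp[where a = "\<lambda>b. x0 \<bullet> b" and v = "\<lambda>b. (0, - b)"]) (simp add: inner_diff_left inner_prod_def)
 qed
 moreover have sup: "{p. \<phi> p \<noteq> 0} \<subseteq> cball t0 k \<times> cball x0 (real DIM(real ^ 'n) * h)"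
 proof
  fix p :: "real \<times> (real ^ 'n)" assume "p \<in> {p. \<phi> p \<noteq> 0}"
  then have "mol k (t0 - fst p) \<noteq> 0" "mol h (x0 - snd p) \<noteq> 0" by (auto simp: \<phi>_def)
  then have "norm (t0 - fst p) \<le> real DIM(real) * k" "norm (x0 - snd p) \<le> real DIM(real ^ 'n) * h"
   using mol_supp k h by blast+
  then show "p \<in> cball t0 k \<times> cball x0 (real DIM(real ^ 'n) * h)"
   by (cases p) (simp add: dist_norm)
 qed
 moreover have cp: "compact (cball t0 k \<times> cball x0 (real DIM(real ^ 'n) * h))" by (intro compact_Times compact_cball)
 ultimately show "test_fun ({0<..<T} \<times> UNIV) \<phi>"
 proof -
  have "bounded {p. \<phi> p \<noteq> 0}" using bounded_subset[OF compact_imp_bounded[OF cp] sup] .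
  moreover have "closure {p. \<phi> p \<noteq> 0} \<subseteq> {0<..<T} \<times> UNIV"
   using closure_minimal[OF sup compact_imp_closed[OF cp]] t0 by auto
  ultimately show ?thesis using \<open>\<And>j. Ck j \<phi>\<close> by (simp add: test_fun_def compact_closure)
 qed
 have d1: "((\<lambda>p :: real \<times> (real ^ 'n). mol k (t0 - fst p)) has_derivative (\<lambda>v. dmol k (- fst v) (t0 - t))) (at (t, x))"
 proof -
  have "((\<lambda>p :: real \<times> (real ^ 'n). t0 - fst p) has_derivative (\<lambda>v. - fst v)) (at (t, x))" by (auto intro!: derivative_eq_intros)
  from has_derivative_compose[OF this, of "mol k" "\<lambda>v. dmol k v (t0 - t)"] show ?thesis using mol_has_derivative[of k "t0 - t"] by simp
 qed
 have d2: "((\<lambda>p :: real \<times> (real ^ 'n). mol h (x0 - snd p)) has_derivative (\<lambda>v. dmol h (- snd v) (x0 - x))) (at (t, x))"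
 proof -
  have "((\<lambda>p :: real \<times> (real ^ 'n). x0 - snd p) has_derivative (\<lambda>v. - snd v)) (at (t, x))" by (auto intro!: derivative_eq_intros)
  from has_derivative_compose[OF this, of "mol h" "\<lambda>v. dmol h v (x0 - x)"] show ?thesis using mol_has_derivative[of h "x0 - x"] by simp
 qed
 have "frechet_derivative \<phi> (at (t, x)) = (\<lambda>v. mol k (t0 - t) * dmol h (- snd v) (x0 - x) + dmol k (- fst v) (t0 - t) * mol h (x0 - x))"
  unfolding \<phi>_def using frechet_derivative_at[OF has_derivative_mult[OF d1 d2]] by simp
 moreover have "dmol k (0::real) y = 0" "dmol h (0::real ^ 'n) z = 0" for y z by (simp_all add: dmol_sum[of _ 0])
 ultimately show "dt \<phi> (t, x) = - (dmol k 1 (t0 - t) * mol h (x0 - x))"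
  and "dx i \<phi> (t, x) = - (mol k (t0 - t) * dmol h (axis i 1) (x0 - x))"
  by (simp_all add: dt_def dx_def dmol_minus)
qed

text \<open>The one-dimensional case of \<open>mol_zero\<close>, applied to the difference.\<close>

lemma slice_eq:
 fixes a b :: "real \<Rightarrow> real"
 assumes h: "\<And>k. 0 < h k" "h \<longlonglongrightarrow> (0::real)" and a: "integrable lborel a" "integrable lborel b"
  and z: "\<And>k t0. cball t0 (h k) \<subseteq> {0<..<T} \<Longrightarrow>
   (LI t. mol (h k) (t0 - t) * a t) = (LI t. mol (h k) (t0 - t) * b t)"
 shows "AE t\<in>{0<..<T} in lborel. a t = b t"
proof -
 have "AE t\<in>{0<..<T} in lborel. a t - b t = 0"
 proof (rule mol_zero[OF h])
  fix k t0 assume "cball t0 (real DIM(real) * h k) \<subseteq> {0<..<T}"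
  then have "cv (mol (h k)) a t0 = cv (mol (h k)) b t0" using z[of t0 k] by (simp add: cv_def)
  then show "cv (mol (h k)) (\<lambda>t. a t - b t) t0 = 0"
   by (simp add: cv_diff[OF a mol_measurable mol_abs_bound[OF h(1)[of k]]])
 qed (use a in auto)
 then show ?thesis by eventually_elim auto
qed

lemma integrable_time:
 fixes a :: "real \<Rightarrow> real"
 assumes [measurable]: "a \<in> borel_measurable borel" and B: "AE t in lborel. \<bar>a t\<bar> \<le> B"
  and z: "\<And>t. t \<notin> {0<..<T} \<Longrightarrow> a t = 0"
 shows "integrable lborel a"
proof (rule Bochner_Integration.integrable_bound)
 show "integrable lborel (\<lambda>t. B * indicator {0<..<T} t)" by (cases "T > 0") auto
 show "AE t in lborel. norm (a t) \<le> norm (B * indicator {0<..<T} t)"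
  using B by eventually_elim (use z in \<open>auto simp: indicator_def\<close>)
qed simp

text \<open>Continuity in the centre serves to pass from countably many centres to all of them;
  local integrability suffices because the kernel has bounded support.\<close>

lemma cv_continuous:
 fixes g :: "'a::euclidean_space \<Rightarrow> real"
 assumes k: "continuous_on UNIV k" "\<And>x. \<bar>k x\<bar> \<le> B" "\<And>x. k x \<noteq> 0 \<Longrightarrow> norm x \<le> d"
  and [measurable]: "g \<in> borel_measurable borel" and g: "\<And>S. bounded S \<Longrightarrow> S \<in> sets borel \<Longrightarrow> integrable lborel (\<lambda>y. indicator S y * g y)"
 shows "continuous_on UNIV (cv k g)"
proof -
 have [measurable]: "k \<in> borel_measurable borel" by (rule borel_measurable_continuous_onI[OF k(1)])
 have "cv k g \<midarrow>x\<rightarrow> cv k g x" for x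
 proof (rule tendsto_at_iff_sequentially[THEN iffD2], intro allI impI)
  fix X assume X: "\<forall>i. X i \<in> UNIV - {x}" "X \<longlonglongrightarrow> x"
  obtain e where e: "\<And>i. norm (X i) \<le> e"
   using convergent_imp_bounded[OF X(2)] by (auto simp: bounded_iff)
  show "(cv k g \<circ> X) \<longlonglongrightarrow> cv k g x"
   unfolding cv_def comp_def
  proof (rule integral_dominated_convergence[where w = "\<lambda>y. B * \<bar>indicator (cball 0 (e + d)) y * g y\<bar>"])
   show "integrable lborel (\<lambda>y. B * \<bar>indicator (cball 0 (e + d)) y * g y\<bar>)"
    using g[of "cball 0 (e + d)"] by (auto intro!: integrable_abs)
   show "AE y in lborel. (\<lambda>i. k (X i - y) *\<^sub>R g y) \<longlonglongrightarrow> k (x - y) *\<^sub>R g y"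
   proof (rule AE_I2)
    fix y
    have "isCont k (x - y)" using k(1) by (simp add: continuous_on_eq_continuous_at)
    then have "(\<lambda>i. k (X i - y)) \<longlonglongrightarrow> k (x - y)"
     using X(2) by (intro isCont_tendsto_compose[of _ k] tendsto_intros)
    then show "(\<lambda>i. k (X i - y) *\<^sub>R g y) \<longlonglongrightarrow> k (x - y) *\<^sub>R g y" by (intro tendsto_intros)
   qed
   show "AE y in lborel. norm (k (X i - y) *\<^sub>R g y) \<le> B * \<bar>indicator (cball 0 (e + d)) y * g y\<bar>" for i
   proof (rule AE_I2)
    fix y
    show "norm (k (X i - y) *\<^sub>R g y) \<le> B * \<bar>indicator (cball 0 (e + d)) y * g y\<bar>"
    proof (cases "k (X i - y) = 0")
     case True
     have "0 \<le> B" using k(2)[of 0] by linarith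
     then show ?thesis using True by simp
    next
     case False
     then have "norm (X i - y) \<le> d" by (rule k(3))
     then have "y \<in> cball 0 (e + d)" using e[of i] norm_triangle_ineq2[of y "X i"] by (simp add: norm_minus_commute)
     then show ?thesis using k(2)[of "X i - y"] by (simp add: abs_mult mult_right_mono)
    qed
   qed
  qed simp_all
 qed
 then show ?thesis by (simp add: continuous_on_eq_continuous_at isCont_def)
qed

lemma equal_on_dense:
 fixes f g :: "'a::euclidean_space \<Rightarrow> real"
 assumes "continuous_on UNIV f" "continuous_on UNIV g" "closure D = UNIV" "\<And>x. x \<in> D \<Longrightarrow> f x = g x"
 shows "f x = g x"
proof -
 have "f x - g x = 0"
  by (rule continuous_constant_on_closure[of D "\<lambda>x. f x - g x" 0 x]) (use assms in \<open>auto intro!: continuous_intros\<close>)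
 then show ?thesis by simp
qed

lemma countable_dense: "\<exists>D::'a::euclidean_space set. countable D \<and> closure D = UNIV"
proof -
 obtain D :: "'a set" where D: "countable D" "\<And>X. open X \<Longrightarrow> X \<noteq> {} \<Longrightarrow> \<exists>d\<in>D. d \<in> X"
  using countable_dense_setE by blast
 have "closure D = UNIV"
  using D(2)[of "- closure D"] closure_subset[of D] by auto
 then show ?thesis using D(1) by blast
qed

text \<open>For a fixed centre x, \<open>slice_eq\<close> removes the time mollification, but the
  exceptional null set of times depends on x. Centres in a countable dense set share one null set,
  and both sides are continuous in x.\<close>

lemma wk_grad_slices:
 fixes H :: "real \<times> 'a::euclidean_space \<Rightarrow> real" and G :: "real \<times> 'a \<Rightarrow> 'a"
 assumes h: "0 < h" and [measurable]: "H \<in> borel_measurable borel" "G \<in> borel_measurable borel"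
  and cut: "\<And>t x. t \<notin> {0<..<T} \<Longrightarrow> H (t, x) = 0" "\<And>t x. t \<notin> {0<..<T} \<Longrightarrow> G (t, x) = 0"
  and HB: "AE t in lborel. integrable lborel (\<lambda>x. H (t, x)) \<and> (LI x. \<bar>H (t, x)\<bar>) \<le> B"
  and GB: "AE t in lborel. integrable lborel (\<lambda>x. (norm (G (t, x)))^2) \<and> (LI x. (norm (G (t, x)))^2) \<le> B"
  and test: "\<And>k t0 x b. 0 < k \<Longrightarrow> cball t0 k \<subseteq> {0<..<T} \<Longrightarrow> b \<in> Basis \<Longrightarrow>
   (LI t. mol k (t0 - t) * (LI y. dmol h b (x - y) * H (t, y)))
   = (LI t. mol k (t0 - t) * (LI y. mol h (x - y) * (G (t, y) \<bullet> b)))"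
 shows "AE t\<in>{0<..<T} in lborel. (\<forall>x. \<forall>b\<in>Basis.
   (LI y. dmol h b (x - y) * H (t, y)) = (LI y. mol h (x - y) * (G (t, y) \<bullet> b)))"
proof -
 obtain C where C: "0 < C" "\<And>b x. b \<in> Basis \<Longrightarrow> \<bar>dmol h b (x::'a)\<bar> \<le> C" using dmol_bounded[OF h, where 'a='a] by blast
 have pt: "AE t\<in>{0<..<T} in lborel.
   (LI y. dmol h b (x - y) * H (t, y)) = (LI y. mol h (x - y) * (G (t, y) \<bullet> b))"
  if b: "b \<in> Basis" for x b
 proof (rule slice_eq[where h = "\<lambda>k. 1 / real (Suc k)"])
  have [measurable]: "dmol h b \<in> borel_measurable borel" using b by measurable
  show "integrable lborel (\<lambda>t. (LI y. dmol h b (x - y) * H (t, y)))"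
  proof (rule integrable_time[where T = T and B = "C * B"])
   show "(\<lambda>t. (LI y. dmol h b (x - y) * H (t, y))) \<in> borel_measurable borel"
    using measurable_integral_snd(1)[of "\<lambda>p. dmol h b (x - snd p) * H p"] by simp
   show "AE t in lborel. \<bar>(LI y. dmol h b (x - y) * H (t, y))\<bar> \<le> C * B"
    using HB
   proof eventually_elim
    case (elim t)
    have "\<bar>cv (dmol h b) (\<lambda>y. H (t, y)) x\<bar> \<le> C * (LI y. norm (H (t, y)))"
     using cv_bound[OF conjunct1[OF elim], of "dmol h b" C x] C(2)[OF b] by simp
    also have "C * (LI y. norm (H (t, y))) \<le> C * B" using elim C(1) by simp
    finally show ?case by (simp add: cv_def)
   qed
  qed (simp add: cut)
  show "integrable lborel (\<lambda>t. (LI y. mol h (x - y) * (G (t, y) \<bullet> b)))"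
  proof (rule integrable_time[where T = T and B = "(LI y. (mol h (x - y))^2) + B"])
   show "(\<lambda>t. (LI y. mol h (x - y) * (G (t, y) \<bullet> b))) \<in> borel_measurable borel"
    using measurable_integral_snd(1)[of "\<lambda>p. mol h (x - snd p) * (G p \<bullet> b)"] by simp
   have m2: "integrable lborel (\<lambda>y. (mol h (x - y))^2)"
   proof -
    have "integrable lborel (\<lambda>y::'a. (mol h y)^2)"
     using mol_supp[OF h, where 'a='a] by (intro integrable_continuous_compact_supp[where r = "real DIM('a) * h"] continuous_intros continuous_mol) auto
    then show ?thesis using integrable_reflect[of "\<lambda>y. (mol h y)^2" x] by simp
   qed
   show "AE t in lborel. \<bar>(LI y. mol h (x - y) * (G (t, y) \<bullet> b))\<bar> \<le> (LI y. (mol h (x - y))^2) + B"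
    using GB
   proof eventually_elim
    case (elim t)
    have i: "integrable lborel (\<lambda>y. (mol h (x - y))^2 + (norm (G (t, y)))^2)" using m2 elim by auto
    have "\<bar>(LI y. mol h (x - y) * (G (t, y) \<bullet> b))\<bar> \<le> (LI y. (mol h (x - y))^2 + (norm (G (t, y)))^2)"
    proof (rule integral_abs_bound_integral[OF _ i])
     show "integrable lborel (\<lambda>y. mol h (x - y) * (G (t, y) \<bullet> b))"
     proof (rule integrable_mult_of_squares[OF _ _ m2])
      show "integrable lborel (\<lambda>y. (G (t, y) \<bullet> b)^2)"
      proof (rule integrable_nonneg_bound[OF conjunct1[OF elim]])
       fix y
       show "(G (t, y) \<bullet> b)^2 \<le> (norm (G (t, y)))^2" using Basis_le_norm[OF b, of "G (t, y)"] by (simp add: abs_le_square_iff[symmetric])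
      qed simp_all
     qed simp_all
     fix y
     have "\<bar>mol h (x - y) * (G (t, y) \<bullet> b)\<bar> \<le> (mol h (x - y))^2 + (G (t, y) \<bullet> b)^2" by (rule abs_mult_le_squares)
     also have "(G (t, y) \<bullet> b)^2 \<le> (norm (G (t, y)))^2" using Basis_le_norm[OF b, of "G (t, y)"] by (simp add: abs_le_square_iff[symmetric])
     finally show "\<bar>mol h (x - y) * (G (t, y) \<bullet> b)\<bar> \<le> (mol h (x - y))^2 + (norm (G (t, y)))^2" by simp
    qed
    then show ?case using elim m2 by simp
   qed
  qed (simp add: cut)
  show "(\<lambda>k. 1 / real (Suc k)) \<longlonglongrightarrow> 0" by (rule LIMSEQ_Suc[OF lim_inverse_n'])
  show "(LI t. mol (1 / real (Suc k)) (t0 - t) * (LI y. dmol h b (x - y) * H (t, y)))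
   = (LI t. mol (1 / real (Suc k)) (t0 - t) * (LI y. mol h (x - y) * (G (t, y) \<bullet> b)))"
   if "cball t0 (1 / real (Suc k)) \<subseteq> {0<..<T}" for t0 k
   by (rule test) (use that b in auto)
 qed simp
 obtain D :: "'a set" where D: "countable D" "closure D = UNIV" using countable_dense by blast
 have "AE t in lborel. \<forall>x\<in>D. \<forall>b\<in>Basis. t \<in> {0<..<T} \<longrightarrow>
   (LI y. dmol h b (x - y) * H (t, y)) = (LI y. mol h (x - y) * (G (t, y) \<bullet> b))"
  by (intro AE_ball_countable' pt D countable_finite[OF finite_Basis])
 then show ?thesis using HB GB
 proof eventually_elim
  case (elim t)
  show ?case
  proof (intro impI allI ballI)
   fix x b :: 'a assume t: "t \<in> {0<..<T}" and b: "b \<in> Basis"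
   have "cv (dmol h b) (\<lambda>y. H (t, y)) x = cv (mol h) (\<lambda>y. G (t, y) \<bullet> b) x"
   proof (rule equal_on_dense[OF _ _ D(2)])
    show "continuous_on UNIV (cv (dmol h b) (\<lambda>y. H (t, y)))"
    proof (rule cv_continuous[OF dmol_continuous[OF b] C(2)[OF b] dmol_supp[OF h]])
     show "integrable lborel (\<lambda>y. indicator S y * H (t, y))" if "S \<in> sets borel" for S
      using integrable_mult_indicator[of S lborel "\<lambda>y. H (t, y)"] that elim by simp
    qed simp_all
    show "continuous_on UNIV (cv (mol h) (\<lambda>y. G (t, y) \<bullet> b))"
    proof (rule cv_continuous[OF continuous_mol mol_abs_bound[OF h] mol_supp[OF h]])
     show "integrable lborel (\<lambda>y. indicator S y * (G (t, y) \<bullet> b))" if S: "bounded S" "S \<in> sets borel" for S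
     proof (rule integrable_mult_of_squares)
      show "indicator S \<in> borel_measurable lborel" using S by simp
      have "emeasure lborel S < \<infinity>" using S(1) by (rule emeasure_bounded_finite)
      then have "integrable lborel (indicator S :: 'a \<Rightarrow> real)" using S by simp
      moreover have "(\<lambda>y. (indicator S y)^2 :: real) = indicator S" by (auto simp: indicator_def)
      ultimately show "integrable lborel (\<lambda>y. (indicator S y)^2 :: real)" by simp
      show "integrable lborel (\<lambda>x. (G (t, x) \<bullet> b)^2)"
      proof (rule integrable_nonneg_bound[OF conjunct1[OF elim(3)]])
       fix y
       show "(G (t, y) \<bullet> b)^2 \<le> (norm (G (t, y)))^2" using Basis_le_norm[OF b, of "G (t, y)"] by (simp add: abs_le_square_iff[symmetric])
      qed simp_all
     qed simp
    qed simp_all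
    show "cv (dmol h b) (\<lambda>y. H (t, y)) x = cv (mol h) (\<lambda>y. G (t, y) \<bullet> b) x" if "x \<in> D" for x
     using elim(1) that b t by (simp add: cv_def)
   qed
   then show "(LI y. dmol h b (x - y) * H (t, y)) = (LI y. mol h (x - y) * (G (t, y) \<bullet> b))"
    by (simp add: cv_def)
  qed
 qed
qed

lemma Lq_norm_1: "Lq_norm 1 A f = (\<integral>\<^sup>+x\<in>A. ennreal (norm (f x)) \<partial>lborel)"
 by (auto simp: Lq_norm_def Let_def less_top)

lemma sum_Basis_vec: "(\<Sum>b\<in>(Basis :: (real ^ 'n) set). g b) = (\<Sum>i\<in>UNIV. g (axis i 1))"
proof -
 have "(Basis :: (real ^ 'n) set) = range (\<lambda>i :: 'n. axis i (1::real))" using Basis_axis by auto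
 moreover have "inj (\<lambda>i :: 'n. axis i (1::real))" by (auto simp: inj_on_def axis_eq_axis)
 from sum.reindex[OF this, of g] have "sum g (range (\<lambda>i :: 'n. axis i (1::real))) = (\<Sum>i\<in>UNIV. g (axis i 1))"
  by (simp only: comp_def)
 ultimately show ?thesis by simp
qed

lemma AE_zero_continuous:
 fixes g :: "'a::euclidean_space \<Rightarrow> real"
 assumes W: "open W" "continuous_on W g" and g: "AE s in lborel. s \<in> W \<longrightarrow> g s = 0" and s: "s \<in> W"
 shows "g s = 0"
proof (rule ccontr)
 assume n: "g s \<noteq> 0"
 define S where "S = W \<inter> g -` (- {0})"
 have S: "open S" unfolding S_def by (intro continuous_open_preimage W) auto
 have "S \<in> null_sets lborel"
 proof (rule AE_iff_null_sets[THEN iffD2])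
  show "S \<in> sets lborel" using S by simp
  show "AE x in lborel. x \<notin> S" using g by eventually_elim (auto simp: S_def)
 qed
 then have "negligible S" by (simp add: negligible_iff_null_sets null_sets_completionI)
 moreover have "S \<noteq> {}" using n s by (auto simp: S_def)
 ultimately show False using open_not_negligible[OF S] by blast
qed

section \<open>Integrating a weak time derivative and the continuity equation\<close>

lemma continuous_primitive:
 fixes b :: "real \<Rightarrow> real"
 assumes b: "integrable lborel b"
 shows "continuous_on UNIV (\<lambda>t. (LI s. indicator {..<t} s * b s))"
proof -
 have [measurable]: "b \<in> borel_measurable borel" using b by auto
 have "(\<lambda>t. (LI s. indicator {..<t} s * b s)) \<midarrow>t\<rightarrow> (LI s. indicator {..<t} s * b s)" for t
 proof (rule tendsto_at_iff_sequentially[THEN iffD2], intro allI impI)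
  fix X assume X: "\<forall>i. X i \<in> UNIV - {t}" "X \<longlonglongrightarrow> t"
  show "((\<lambda>t. (LI s. indicator {..<t} s * b s)) \<circ> X) \<longlonglongrightarrow> (LI s. indicator {..<t} s * b s)"
   unfolding comp_def
  proof (rule integral_dominated_convergence[where w = "\<lambda>s. \<bar>b s\<bar>"])
   show "AE s in lborel. (\<lambda>i. indicator {..<X i} s * b s) \<longlonglongrightarrow> indicator {..<t} s * b s"
    using AE_lborel_singleton[of t]
   proof eventually_elim
    case (elim s)
    have "\<forall>\<^sub>F i in sequentially. indicator {..<X i} s * b s = indicator {..<t} s * b s"
    proof (cases "s < t")
     case True
     then have "\<forall>\<^sub>F i in sequentially. s < X i" using X(2) by (auto dest: order_tendstoD)
     then show ?thesis by eventually_elim (use True in simp)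
    next
     case False
     then have "t < s" using elim by simp
     then have "\<forall>\<^sub>F i in sequentially. X i < s" using X(2) by (auto dest: order_tendstoD)
     then show ?thesis by eventually_elim (use False in simp)
    qed
    then show ?case by (rule tendsto_eventually)
   qed
   show "AE s in lborel. norm (indicator {..<X i} s * b s) \<le> \<bar>b s\<bar>" for i
    by (auto simp: indicator_def)
  qed (use b in auto)
 qed
 then show ?thesis by (simp add: continuous_on_eq_continuous_at isCont_def)
qed

lemma primitive_difference:
 fixes b :: "real \<Rightarrow> real"
 assumes b: "integrable lborel b" and v: "0 < v"
 shows "(LI s. indicator {..<t + v} s * b s) - (LI s. indicator {..<t} s * b s)
  = (LI s. indicator {0..1::real} s * (b (t + s * v) * v))"
proof -
 have [measurable]: "b \<in> borel_measurable borel" using b by auto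
 have i: "integrable lborel (\<lambda>s. indicator {..<a} s * b s)" for a
  using integrable_mult_indicator[of "{..<a}" lborel b] b by simp
 have "(LI s. indicator {..<t + v} s * b s) - (LI s. indicator {..<t} s * b s)
   = (LI s. indicator {..<t + v} s * b s - indicator {..<t} s * b s)" using i by simp
 also have "... = (LI s. indicator {t..t + v} s * b s)"
 proof (rule integral_cong_AE)
  show "AE s in lborel. indicator {..<t + v} s * b s - indicator {..<t} s * b s = indicator {t..t + v} s * b s"
   using AE_lborel_singleton[of "t + v"] by eventually_elim (use v in \<open>auto simp: indicator_def\<close>)
 qed simp_all
 also have "... = \<bar>v\<bar> *\<^sub>R (LI s. indicator {t..t + v} (t + v * s) * b (t + v * s))"
  using v by (intro lborel_integral_real_affine) auto
 also have "... = (LI s. v * (indicator {t..t + v} (t + v * s) * b (t + v * s)))"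
  using v by simp
 also have "... = (LI s. indicator {0..1::real} s * (b (t + s * v) * v))"
 proof (rule Bochner_Integration.integral_cong[OF refl])
  fix s
  have "v * s \<le> v \<longleftrightarrow> s \<le> 1" "0 \<le> v * s \<longleftrightarrow> 0 \<le> s" using v by (auto simp: zero_le_mult_iff mult_le_cancel_left1)
  then show "v * (indicator {t..t + v} (t + v * s) * b (t + v * s)) = indicator {0..1::real} s * (b (t + s * v) * v)"
   by (auto simp: indicator_def mult_ac)
 qed
 finally show ?thesis .
qed

text \<open>The weak derivative of \<open>a\<close> is - b, so \<open>D\<close>, which is
  \<open>a\<close> plus the primitive of \<open>b\<close>, should be constant.
  \<open>wk_grad_line\<close> gives this for almost every starting time; continuity removes the
  exceptions and carries the identity to the end point 0.\<close>

lemma constant_of_weak_derivative: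
 fixes a b :: "real \<Rightarrow> real"
 assumes T: "0 < T" and a: "continuous_on {0..T} a" and b: "integrable lborel b" "\<And>s. s \<notin> {0<..<T} \<Longrightarrow> b s = 0"
  and h: "\<And>k. 0 < h k" "h \<longlonglongrightarrow> (0::real)"
  and test: "\<And>k t0. cball t0 (h k) \<subseteq> {0<..<T} \<Longrightarrow>
   (LI t. dmol (h k) 1 (t0 - t) * (indicator {0<..<T} t * a t)) = - (LI t. mol (h k) (t0 - t) * b t)"
  and t: "t \<in> {0<..<T}"
 shows "a t - a 0 = - (LI s. indicator {..<t} s * b s)"
proof -
 define a' where "a' t = indicator {0<..<T} t * a t" for t
 define B where "B t = (LI s. indicator {..<t} s * b s)" for t
 define D where "D t = a t + B t" for t
 have Bc: "continuous_on S B" for S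
  unfolding B_def using continuous_on_subset[OF continuous_primitive[OF b(1)]] by auto
 have Dc: "continuous_on {0..T} D" unfolding D_def by (intro continuous_intros a Bc)
 obtain e where e: "\<And>t. t \<in> {0..T} \<Longrightarrow> norm (a t) \<le> e"
  using compact_imp_bounded[OF compact_continuous_image[OF a compact_Icc]] unfolding bounded_iff by blast
 have ai: "integrable lborel a'"
 proof (rule integrable_time[where T = T and B = "\<bar>e\<bar>"])
  have "continuous_on {0<..<T} a" using a by (rule continuous_on_subset) auto
  from borel_measurable_continuous_on_indicator[OF _ this]
  show "a' \<in> borel_measurable borel" by (simp add: a'_def[abs_def])
  have "\<bar>a' t\<bar> \<le> \<bar>e\<bar>" for t using e[of t] by (auto simp: a'_def indicator_def)
  then show "AE t in lborel. \<bar>a' t\<bar> \<le> \<bar>e\<bar>" by simp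
 qed (simp add: a'_def)
 have wk: "wk_grad {0<..<T} h a' (\<lambda>t. - b t)"
  using test by (auto simp: wk_grad_def a'_def)
 have step: "D s = D t" if st: "0 < s" "s < t" "t < T" for s t
 proof -
  define v where "v = t - s"
  have v: "0 < v" using st by (simp add: v_def)
  have AE: "AE y in lborel. y \<in> {0<..<T - v} \<longrightarrow> D (y + v) - D y = 0"
   using wk_grad_line[OF h ai Bochner_Integration.integrable_minus[OF b(1)] open_greaterThanLessThan convex_real_interval(8) wk, of v]
  proof eventually_elim
   case (elim y)
   show ?case
   proof
    assume y: "y \<in> {0<..<T - v}"
    then have "y \<in> {0<..<T}" "y + v \<in> {0<..<T}" using v by auto
    then have "a (y + v) - a y = (LI s. indicator {0..1::real} s * (- b (y + s *\<^sub>R v) \<bullet> v))"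
     using elim by (simp add: a'_def)
    also have "... = (LI s. - (indicator {0..1::real} s * (b (y + s * v) * v)))"
     by (rule Bochner_Integration.integral_cong[OF refl]) simp
    also have "... = - (B (y + v) - B y)"
     using primitive_difference[OF b(1) v, of y] by (simp add: B_def)
    finally show "D (y + v) - D y = 0" by (simp add: D_def)
   qed
  qed
  have "D (s + v) - D s = 0"
  proof (rule AE_zero_continuous[OF _ _ AE, where s = s])
   have "continuous_on {0<..<T - v} D" using Dc by (rule continuous_on_subset) (use v in auto)
   moreover have "continuous_on {0<..<T - v} (\<lambda>y. D (y + v))"
    by (rule continuous_on_compose2[OF Dc]) (use v in \<open>auto intro!: continuous_intros\<close>)
   ultimately show "continuous_on {0<..<T - v} (\<lambda>y. D (y + v) - D y)" by (rule continuous_on_diff[rotated])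
  qed (use st in \<open>auto simp: v_def\<close>)
  then show ?thesis by (simp add: v_def)
 qed
 have cl: "closure {0<..<T} = {0..T}" using T by (simp add: closure_greaterThanLessThan)
 have "D 0 = D t"
 proof (rule continuous_constant_on_closure[of "{0<..<T}" D "D t" 0])
  show "continuous_on (closure {0<..<T}) D" using Dc cl by simp
  show "D x = D t" if "x \<in> {0<..<T}" for x
   using step[of x t] step[of t x] that t by (cases x t rule: linorder_cases) auto
  show "0 \<in> closure {0<..<T}" using cl T by simp
 qed
 moreover have "B 0 = 0"
 proof -
  have "B 0 = (\<integral>s. 0 \<partial>(lborel :: real measure))" unfolding B_def
   by (rule Bochner_Integration.integral_cong[OF refl]) (use b(2) in \<open>auto simp: indicator_def\<close>)
  then show ?thesis by simp
 qed
 ultimately show ?thesis by (simp add: D_def B_def)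
qed

lemma (in momentum) sum_cv_U:
 shows "(\<Sum>b\<in>Basis. cv (dmol h b) (\<lambda>y. U t y \<bullet> b) x)
   = (LI s. indicator {..<t} s * (\<Sum>b\<in>Basis. cv (dmol h b) (\<lambda>y. M (s, y)) x \<bullet> b))"
  and "integrable lborel (\<lambda>s. \<Sum>b\<in>Basis. cv (dmol h b) (\<lambda>y. M (s, y)) x \<bullet> b)"
proof -
 obtain C where C: "0 < C" "\<And>b x. b \<in> Basis \<Longrightarrow> \<bar>dmol h b (x::'a)\<bar> \<le> C" using dmol_bounded[OF h, where 'a='a] by blast
 have i: "integrable lborel (\<lambda>s. indicator {..<t} s *\<^sub>R cv (dmol h b) (\<lambda>y. M (s, y)) x)" if "b \<in> Basis" for b t
  using cv_U(2)[OF dmol_measurable[OF that] C(2)[OF that]] .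
 have "(\<Sum>b\<in>Basis. cv (dmol h b) (\<lambda>y. U t y \<bullet> b) x)
   = (\<Sum>b\<in>Basis. (LI s. indicator {..<t} s *\<^sub>R cv (dmol h b) (\<lambda>y. M (s, y)) x) \<bullet> b)"
  by (intro sum.cong refl) (simp add: cv_inner[OF U_int dmol_measurable C(2), symmetric] cv_U(1)[OF dmol_measurable C(2)])
 also have "... = (\<Sum>b\<in>Basis. (LI s. (indicator {..<t} s *\<^sub>R cv (dmol h b) (\<lambda>y. M (s, y)) x) \<bullet> b))"
  by (intro sum.cong refl integral_inner_left[symmetric]) (use i in auto)
 also have "... = (LI s. (\<Sum>b\<in>Basis. (indicator {..<t} s *\<^sub>R cv (dmol h b) (\<lambda>y. M (s, y)) x) \<bullet> b))"
  by (intro Bochner_Integration.integral_sum[symmetric] integrable_inner_left) (use i in auto)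
 finally show "(\<Sum>b\<in>Basis. cv (dmol h b) (\<lambda>y. U t y \<bullet> b) x)
   = (LI s. indicator {..<t} s * (\<Sum>b\<in>Basis. cv (dmol h b) (\<lambda>y. M (s, y)) x \<bullet> b))"
  by (simp add: sum_distrib_left)
 show "integrable lborel (\<lambda>s. \<Sum>b\<in>Basis. cv (dmol h b) (\<lambda>y. M (s, y)) x \<bullet> b)"
 proof (intro Bochner_Integration.integrable_sum integrable_inner_left)
  fix b :: 'a assume b: "b \<in> Basis"
  have "indicator {..<T} s *\<^sub>R cv (dmol h b) (\<lambda>y. M (s, y)) x = cv (dmol h b) (\<lambda>y. M (s, y)) x" for s
   by (auto simp: indicator_def cv_def M_cut)
  then show "integrable lborel (\<lambda>s. cv (dmol h b) (\<lambda>y. M (s, y)) x)" using i[OF b, of T] by simp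
 qed
qed

text \<open>The kernel is bounded with compact support, so continuity of the density in local L1 is
  enough.\<close>

lemma cv_time_continuous:
 fixes \<rho> :: "real \<Rightarrow> 'a::euclidean_space \<Rightarrow> real"
 assumes h: "0 < h" and C: "C_Lq_loc T 1 \<rho>" and int: "\<And>t. t \<in> {0..T} \<Longrightarrow> integrable lborel (\<rho> t)"
 shows "continuous_on {0..T} (\<lambda>t. cv (mol h) (\<rho> t) x)"
 unfolding continuous_on_def
proof
 fix t assume t: "t \<in> {0..T}"
 define A where "A = cball x (real DIM('a) * h)"
 define B where "B = molB TYPE('a) / h ^ DIM('a)"
 have B: "\<bar>mol h y\<bar> \<le> B" for y :: 'a using mol_abs_bound[OF h] by (simp add: B_def)
 have bound: "ennreal \<bar>cv (mol h) (\<rho> s) x - cv (mol h) (\<rho> t) x\<bar> \<le> ennreal B * Lq_norm 1 A (\<lambda>y. \<rho> s y - \<rho> t y)"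
  if s: "s \<in> {0..T}" for s
 proof -
  have "cv (mol h) (\<rho> s) x - cv (mol h) (\<rho> t) x = (LI y. mol h (x - y) *\<^sub>R (\<rho> s y - \<rho> t y))"
   using cv_diff[OF int[OF s] int[OF t] mol_measurable B] by (simp add: cv_def)
  then have "ennreal \<bar>cv (mol h) (\<rho> s) x - cv (mol h) (\<rho> t) x\<bar> \<le> (NI y. ennreal (norm (mol h (x - y) *\<^sub>R (\<rho> s y - \<rho> t y))))"
   using norm_integral_le_nn_integral[of lborel "\<lambda>y. mol h (x - y) *\<^sub>R (\<rho> s y - \<rho> t y)"] by simp
  also have "... \<le> (NI y. ennreal B * (ennreal (norm (\<rho> s y - \<rho> t y)) * indicator A y))"
  proof (rule nn_integral_mono)
   fix y
   show "ennreal (norm (mol h (x - y) *\<^sub>R (\<rho> s y - \<rho> t y))) \<le> ennreal B * (ennreal (norm (\<rho> s y - \<rho> t y)) * indicator A y)"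
   proof (cases "mol h (x - y) = 0")
    case False
    then have "y \<in> A" using mol_supp[OF h] by (auto simp: A_def dist_norm)
    moreover have "0 \<le> B" using B[of 0] by linarith
    ultimately show ?thesis using B[of "x - y"]
     by (auto simp: abs_mult ennreal_mult[symmetric] intro!: ennreal_leI mult_right_mono)
   qed simp
  qed
  also have "... = ennreal B * Lq_norm 1 A (\<lambda>y. \<rho> s y - \<rho> t y)"
   unfolding Lq_norm_1
  proof (rule nn_integral_cmult)
   have [measurable]: "\<rho> s \<in> borel_measurable borel" "\<rho> t \<in> borel_measurable borel" using int[OF s] int[OF t] by auto
   have [measurable]: "A \<in> sets borel" by (simp add: A_def)
   show "(\<lambda>y. ennreal (norm (\<rho> s y - \<rho> t y)) * indicator A y) \<in> borel_measurable lborel" by simp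
  qed
  finally show ?thesis .
 qed
 have "((\<lambda>s. Lq_norm 1 A (\<lambda>y. \<rho> s y - \<rho> t y)) \<longlongrightarrow> 0) (at t within {0..T})"
  using C t by (auto simp: C_Lq_loc_def A_def)
 then have "((\<lambda>s. ennreal B * Lq_norm 1 A (\<lambda>y. \<rho> s y - \<rho> t y)) \<longlongrightarrow> ennreal B * 0) (at t within {0..T})"
  by (intro ennreal_tendsto_cmult) auto
 then have lim: "((\<lambda>s. ennreal B * Lq_norm 1 A (\<lambda>y. \<rho> s y - \<rho> t y)) \<longlongrightarrow> 0) (at t within {0..T})" by simp
 have "((\<lambda>s. ennreal \<bar>cv (mol h) (\<rho> s) x - cv (mol h) (\<rho> t) x\<bar>) \<longlongrightarrow> 0) (at t within {0..T})"
 proof (rule tendsto_sandwich[OF _ _ tendsto_const lim])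
  show "\<forall>\<^sub>F s in at t within {0..T}. ennreal \<bar>cv (mol h) (\<rho> s) x - cv (mol h) (\<rho> t) x\<bar> \<le> ennreal B * Lq_norm 1 A (\<lambda>y. \<rho> s y - \<rho> t y)"
   unfolding eventually_at_filter by (rule always_eventually) (use bound in blast)
 qed simp
 then have "((\<lambda>s. \<bar>cv (mol h) (\<rho> s) x - cv (mol h) (\<rho> t) x\<bar>) \<longlongrightarrow> 0) (at t within {0..T})"
  by (intro tendsto_ennrealD) simp_all
 then show "((\<lambda>s. cv (mol h) (\<rho> s) x) \<longlongrightarrow> cv (mol h) (\<rho> t) x) (at t within {0..T})"
  by (simp add: tendsto_rabs_zero_iff LIM_zero_iff)
qed

text \<open>Tested with a product of kernels, the continuity equation states that the time
  derivative of the mollified density is minus the mollified divergence of the momentum. Integrating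
  from 0 is possible because the chosen density is continuous in time, which also identifies the
  initial value.\<close>

lemma continuity_mollified:
 fixes \<rho> :: "real \<Rightarrow> real ^ 'n \<Rightarrow> real" and u :: "real \<Rightarrow> real ^ 'n \<Rightarrow> real ^ 'n"
 assumes mom: "momentum T h K M" and eq: "continuity_eq T \<rho> u"
  and m\<rho>: "(\<lambda>p. indicator {0<..<T} (fst p) *\<^sub>R \<rho> (fst p) (snd p)) \<in> borel_measurable borel"
  and mu: "(\<lambda>p. indicator {0<..<T} (fst p) *\<^sub>R (\<rho> (fst p) (snd p) *\<^sub>R u (fst p) (snd p))) \<in> borel_measurable borel"
  and M: "AE t\<in>{0<..<T} in lborel. (AE x in lborel. \<rho> t x *\<^sub>R u t x = M (t, x))"
  and C: "C_Lq_loc T 1 \<rho>" and int: "\<And>t. t \<in> {0..T} \<Longrightarrow> integrable lborel (\<rho> t)"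
  and \<rho>0: "AE x in lborel. \<rho> 0 x = \<rho>0 x" "\<rho>0 \<in> borel_measurable borel"
  and t: "t \<in> {0<..<T}"
 shows "cv (mol h) (\<rho> t) x - cv (mol h) \<rho>0 x = - (\<Sum>b\<in>Basis. cv (dmol h b) (\<lambda>y. momentum.U M t y \<bullet> b) x)"
proof -
 interpret momentum T h K M by (rule mom)
 have meas: "(\<lambda>x. \<rho> t x *\<^sub>R u t x) \<in> borel_measurable borel" if "t \<in> {0<..<T}" for t
 proof -
  have "(\<lambda>x. (t, x)) \<in> borel \<rightarrow>\<^sub>M (borel :: (real \<times> (real ^ 'n)) measure)" by (intro borel_measurable_Pair) simp_all
  from measurable_compose[OF this mu] show ?thesis using that by (simp del: scaleR_scaleR)
 qed
 define a where "a t = cv (mol h) (\<rho> t) x" for t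
 define b where "b s = (\<Sum>b\<in>Basis. cv (dmol h b) (\<lambda>y. M (s, y)) x \<bullet> b)" for s
 have bcut: "b s = 0" if "s \<notin> {0<..<T}" for s using that by (simp add: b_def cv_def M_cut)
 have b_int: "integrable lborel b" unfolding b_def by (rule sum_cv_U(2))
 have ac: "continuous_on {0..T} a" unfolding a_def by (rule cv_time_continuous[OF h C int])
 obtain e where e: "\<And>t. t \<in> {0..T} \<Longrightarrow> norm (a t) \<le> e"
  using compact_imp_bounded[OF compact_continuous_image[OF ac compact_Icc]] unfolding bounded_iff by blast
 have ai: "integrable lborel (\<lambda>t. indicator {0<..<T} t * a t)"
 proof (rule integrable_time[where T = T and B = "\<bar>e\<bar>"])
  have "continuous_on {0<..<T} a" using ac by (rule continuous_on_subset) auto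
  from borel_measurable_continuous_on_indicator[OF _ this]
  show "(\<lambda>t. indicator {0<..<T} t * a t) \<in> borel_measurable borel" by simp
  have "\<bar>indicator {0<..<T} t * a t\<bar> \<le> \<bar>e\<bar>" for t using e[of t] by (auto simp: indicator_def)
  then show "AE t in lborel. \<bar>indicator {0<..<T} t * a t\<bar> \<le> \<bar>e\<bar>" by simp
 qed simp
 have test: "(LI t. dmol k 1 (t0 - t) * (indicator {0<..<T} t * a t)) = - (LI t. mol k (t0 - t) * b t)"
  if k: "0 < k" and t0: "cball t0 k \<subseteq> {0<..<T}" for k t0
 proof -
  define \<phi> where "\<phi> = (\<lambda>p. mol k (t0 - fst p) * mol h (x - snd p))"
  let ?I = "\<lambda>t y. \<rho> t y * dt \<phi> (t, y) + (\<rho> t y *\<^sub>R u t y) \<bullet> grad_scalar \<phi> (t, y)"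
  have tf: "test_fun ({0<..<T} \<times> UNIV) \<phi>" unfolding \<phi>_def by (rule test_product(1)[OF k h t0])
  have dm: "dmol h (axis i (1::real)) \<in> borel_measurable borel" for i :: 'n
   by (rule dmol_measurable) simp
  have gr: "z \<bullet> grad_scalar \<phi> (t, y) = - (mol k (t0 - t) * (\<Sum>b\<in>Basis. dmol h b (x - y) * (z \<bullet> b)))" for z t y
  proof -
   have "z \<bullet> grad_scalar \<phi> (t, y) = (\<Sum>i\<in>UNIV. z $ i * - (mol k (t0 - t) * dmol h (axis i 1) (x - y)))"
    by (simp add: inner_vec_def grad_scalar_def \<phi>_def test_product(3)[OF k h t0])
   then show ?thesis unfolding sum_Basis_vec by (simp add: inner_axis sum_distrib_left sum_negf mult_ac)
  qed
  have dt\<phi>: "dt \<phi> (t, y) = - (dmol k 1 (t0 - t) * mol h (x - y))" for t y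
   by (simp add: \<phi>_def test_product(2)[OF k h t0])
  have inner: "AE t\<in>{0<..<T} in lborel.
   (LI y. ?I t y)
    = - (dmol k 1 (t0 - t) * a t + mol k (t0 - t) * b t)"
   using M M_L1
  proof eventually_elim
   case (elim t)
   show ?case
   proof
    assume t: "t \<in> {0<..<T}"
    then have AEM: "AE y in lborel. \<rho> t y *\<^sub>R u t y = M (t, y)" and Mi: "integrable lborel (\<lambda>y. M (t, y))" using elim by auto
    have rhoi: "integrable lborel (\<rho> t)" using int[of t] t by auto
    have [measurable]: "(\<lambda>y. \<rho> t y *\<^sub>R u t y) \<in> borel_measurable borel" "\<rho> t \<in> borel_measurable borel" using meas[OF t] rhoi by auto
    have gm: "(\<lambda>y. Z y \<bullet> grad_scalar \<phi> (t, y)) \<in> borel_measurable borel"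
     if [measurable]: "Z \<in> borel_measurable borel" for Z :: "real ^ 'n \<Rightarrow> real ^ 'n"
     unfolding gr by measurable
    have gms: "(\<lambda>y. (\<rho> t y *\<^sub>R u t y) \<bullet> grad_scalar \<phi> (t, y)) \<in> borel_measurable borel"
     "(\<lambda>y. M (t, y) \<bullet> grad_scalar \<phi> (t, y)) \<in> borel_measurable borel"
     using Mi by (auto intro!: gm meas[OF t] simp del: inner_scaleR_left)
    have i1: "integrable lborel (\<lambda>y. mol h (x - y) * \<rho> t y)" using integrable_mol_kernel[OF rhoi h] by simp
    have i2: "integrable lborel (\<lambda>y. dmol h b (x - y) * (M (t, y) \<bullet> b))" if "b \<in> Basis" for b
     using integrable_dmol_kernel[OF _ h that, of "\<lambda>y. M (t, y) \<bullet> b" x] Mi by simp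
    have "(LI y. ?I t y)
     = (LI y. \<rho> t y * dt \<phi> (t, y) + M (t, y) \<bullet> grad_scalar \<phi> (t, y))"
    proof (rule integral_cong_AE)
     show "AE y in lborel. ?I t y = \<rho> t y * dt \<phi> (t, y) + M (t, y) \<bullet> grad_scalar \<phi> (t, y)"
      using AEM by eventually_elim simp
     have "(\<lambda>y. \<rho> t y * dt \<phi> (t, y)) \<in> borel_measurable lborel" unfolding dt\<phi> by measurable
     then show "(\<lambda>y. ?I t y) \<in> borel_measurable lborel"
      "(\<lambda>y. \<rho> t y * dt \<phi> (t, y) + M (t, y) \<bullet> grad_scalar \<phi> (t, y)) \<in> borel_measurable lborel"
      using gms by (simp_all del: inner_scaleR_left)
    qed
    also have "... = (LI y. - (dmol k 1 (t0 - t) * (mol h (x - y) * \<rho> t y)) - mol k (t0 - t) * (\<Sum>b\<in>Basis. dmol h b (x - y) * (M (t, y) \<bullet> b)))"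
     unfolding gr dt\<phi> by (rule Bochner_Integration.integral_cong[OF refl]) simp
    also have "... = - (dmol k 1 (t0 - t) * (LI y. mol h (x - y) * \<rho> t y)) - mol k (t0 - t) * (\<Sum>b\<in>Basis. (LI y. dmol h b (x - y) * (M (t, y) \<bullet> b)))"
     using i1 i2 by (subst Bochner_Integration.integral_diff) (auto simp: Bochner_Integration.integral_sum)
    also have "(\<Sum>b\<in>Basis. (LI y. dmol h b (x - y) * (M (t, y) \<bullet> b))) = b t"
     unfolding b_def
    proof (rule sum.cong[OF refl])
     fix b' :: "real ^ 'n" assume b': "b' \<in> Basis"
     obtain C where "\<And>x::real ^ 'n. \<bar>dmol h b' x\<bar> \<le> C" using dmol_bounded[OF h, where 'a="real ^ 'n"] b' by blast
     from cv_inner[OF Mi dmol_measurable[OF b'] this, of x b']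
     show "(LI y. dmol h b' (x - y) * (M (t, y) \<bullet> b')) = cv (dmol h b') (\<lambda>y. M (t, y)) x \<bullet> b'" by (simp add: cv_def)
    qed
    finally show "(LI y. ?I t y)
     = - (dmol k 1 (t0 - t) * a t + mol k (t0 - t) * b t)" by (simp add: a_def cv_def)
   qed
  qed
  have ia: "integrable lborel (\<lambda>t. dmol k 1 (t0 - t) * (indicator {0<..<T} t * a t))"
   using integrable_dmol_kernel[OF ai k, of 1 t0] by simp
  have ib: "integrable lborel (\<lambda>t. mol k (t0 - t) * b t)" using integrable_mol_kernel[OF b_int k, of t0] by simp
  have "0 = (LINT t:{0<..<T}|lborel. LINT y|lborel. ?I t y)"
   using eq tf by (simp add: continuity_eq_def)
  also have "... = (LI t. - (dmol k 1 (t0 - t) * (indicator {0<..<T} t * a t) + mol k (t0 - t) * b t))"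
   unfolding set_lebesgue_integral_def
  proof (rule integral_cong_AE)
   \<comment> \<open>Joint measurability is only available after the cutoff in time, so the
     indicator is first moved inside the spatial integral.\<close>
   have "(\<lambda>t. indicator {0<..<T} t *\<^sub>R (LI y. ?I t y))
    = (\<lambda>t. (LI y. (indicator {0<..<T} t *\<^sub>R \<rho> t y) * dt \<phi> (t, y) + (indicator {0<..<T} t *\<^sub>R (\<rho> t y *\<^sub>R u t y)) \<bullet> grad_scalar \<phi> (t, y)))"
    by (rule ext) (auto simp: indicator_def)
   also have "... \<in> borel_measurable borel"
   proof -
    have [measurable]: "(\<lambda>p. dt \<phi> (fst p, snd p)) \<in> borel_measurable borel"
    proof -
     have [measurable]: "dmol k (1::real) \<in> borel_measurable borel" by (rule dmol_measurable) simp
     show ?thesis unfolding dt\<phi> by measurable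
    qed
    have "(\<lambda>p. (indicator {0<..<T} (fst p) *\<^sub>R (\<rho> (fst p) (snd p) *\<^sub>R u (fst p) (snd p))) \<bullet> grad_scalar \<phi> (fst p, snd p)) \<in> borel_measurable borel"
    proof -
     define Z where "Z p = indicator {0<..<T} (fst p) *\<^sub>R (\<rho> (fst p) (snd p) *\<^sub>R u (fst p) (snd p))" for p
     have [measurable]: "Z \<in> borel_measurable borel" using mu by (simp add: Z_def[abs_def])
     have "(\<lambda>p. Z p \<bullet> grad_scalar \<phi> (fst p, snd p)) \<in> borel_measurable borel" unfolding gr by measurable
     then show ?thesis by (simp only: Z_def)
    qed
    moreover have "(\<lambda>p. (indicator {0<..<T} (fst p) *\<^sub>R \<rho> (fst p) (snd p)) * dt \<phi> (fst p, snd p)) \<in> borel_measurable borel"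
     by (intro borel_measurable_times m\<rho>) measurable
    ultimately have "(\<lambda>p. (indicator {0<..<T} (fst p) *\<^sub>R \<rho> (fst p) (snd p)) * dt \<phi> (fst p, snd p)
      + (indicator {0<..<T} (fst p) *\<^sub>R (\<rho> (fst p) (snd p) *\<^sub>R u (fst p) (snd p))) \<bullet> grad_scalar \<phi> (fst p, snd p)) \<in> borel_measurable borel"
     by (rule borel_measurable_add[rotated])
    from measurable_integral_snd(1)[OF this] show ?thesis by (simp only: fst_conv snd_conv)
   qed
   finally show "(\<lambda>t. indicator {0<..<T} t *\<^sub>R (LI y. ?I t y)) \<in> borel_measurable lborel"
    by simp
   show "(\<lambda>t. - (dmol k 1 (t0 - t) * (indicator {0<..<T} t * a t) + mol k (t0 - t) * b t)) \<in> borel_measurable lborel"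
    using ia ib by auto
   show "AE t in lborel. indicator {0<..<T} t *\<^sub>R (LI y. ?I t y)
     = - (dmol k 1 (t0 - t) * (indicator {0<..<T} t * a t) + mol k (t0 - t) * b t)"
    using inner
   proof eventually_elim
    case (elim t)
    then show ?case by (cases "t \<in> {0<..<T}") (simp_all add: bcut)
   qed
  qed
  also have "... = - ((LI t. dmol k 1 (t0 - t) * (indicator {0<..<T} t * a t)) + (LI t. mol k (t0 - t) * b t))"
   using ia ib by simp
  finally show ?thesis by simp
 qed
 have "a t - a 0 = - (LI s. indicator {..<t} s * b s)"
 proof (rule constant_of_weak_derivative[OF T ac b_int bcut, where h = "\<lambda>k. 1 / real (Suc k)"])
  show "(\<lambda>k. 1 / real (Suc k)) \<longlonglongrightarrow> 0" by (rule LIMSEQ_Suc[OF lim_inverse_n'])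
  show "(LI t. dmol (1 / real (Suc k)) 1 (t0 - t) * (indicator {0<..<T} t * a t)) = - (LI t. mol (1 / real (Suc k)) (t0 - t) * b t)"
   if "cball t0 (1 / real (Suc k)) \<subseteq> {0<..<T}" for k t0
   by (rule test) (use that in auto)
 qed (use t in auto)
 moreover have "a 0 = cv (mol h) \<rho>0 x"
  unfolding a_def cv_def
 proof (rule integral_cong_AE)
  have [measurable]: "\<rho> 0 \<in> borel_measurable borel" "\<rho>0 \<in> borel_measurable borel" using int[of 0] T \<rho>0 by auto
  show "(\<lambda>y. mol h (x - y) *\<^sub>R \<rho> 0 y) \<in> borel_measurable lborel" "(\<lambda>y. mol h (x - y) *\<^sub>R \<rho>0 y) \<in> borel_measurable lborel"
   by measurable
  show "AE y in lborel. mol h (x - y) *\<^sub>R \<rho> 0 y = mol h (x - y) *\<^sub>R \<rho>0 y" using \<rho>0(1) by eventually_elim simp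
 qed
 ultimately have "cv (mol h) (\<rho> t) x - cv (mol h) \<rho>0 x = - (LI s. indicator {..<t} s * b s)" by (simp only: a_def)
 also have "... = - (\<Sum>b\<in>Basis. cv (dmol h b) (\<lambda>y. U t y \<bullet> b) x)" unfolding sum_cv_U(1) b_def ..
 finally show ?thesis .
qed

section \<open>Energy and entropy of a weak solution\<close>

lemma set_borel_measurable_time:
 fixes f :: "real \<Rightarrow> 'a::euclidean_space \<Rightarrow> 'b::real_normed_vector"
 assumes "set_borel_measurable lborel ({0<..<T} \<times> UNIV) (\<lambda>p. f (fst p) (snd p))"
 shows "(\<lambda>p. indicator {0<..<T} (fst p) *\<^sub>R f (fst p) (snd p)) \<in> borel_measurable borel"
proof -
 have "(\<lambda>p. indicator {0<..<T} (fst p) *\<^sub>R f (fst p) (snd p)) = (\<lambda>p. indicator ({0<..<T} \<times> UNIV) p *\<^sub>R f (fst p) (snd p))"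
  by (rule ext) (auto simp: indicator_def)
 then show ?thesis using assms by (simp add: set_borel_measurable_def)
qed

lemma measurable_of_compact:
 fixes f :: "'a::euclidean_space \<Rightarrow> 'b::euclidean_space"
 assumes "\<And>A. compact A \<Longrightarrow> set_borel_measurable lborel A f"
 shows "f \<in> borel_measurable borel"
proof (rule borel_measurable_LIMSEQ_metric)
 show "(\<lambda>x. indicator (cball 0 (real n)) x *\<^sub>R f x) \<in> borel_measurable borel" for n
  using assms[of "cball 0 (real n)"] by (simp add: set_borel_measurable_def)
 show "(\<lambda>n. indicator (cball 0 (real n)) x *\<^sub>R f x) \<longlonglongrightarrow> f x" for x
 proof (rule tendsto_eventually)
  obtain n where "norm x \<le> real n" using real_arch_simple by blast
  then have "indicator (cball 0 (real m)) x *\<^sub>R f x = f x" if "n \<le> m" for m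
   using that by (auto simp: indicator_def)
  then show "\<forall>\<^sub>F n in sequentially. indicator (cball 0 (real n)) x *\<^sub>R f x = f x"
   unfolding eventually_sequentially by blast
 qed
qed

lemma integrable_of_nn_bound:
 fixes f :: "'a \<Rightarrow> real"
 assumes "f \<in> borel_measurable M" "\<And>x. 0 \<le> f x" "(\<integral>\<^sup>+x. ennreal (f x) \<partial>M) \<le> ennreal B" "0 \<le> B"
 shows "integrable M f" "(\<integral>x. f x \<partial>M) \<le> B"
proof -
 show i: "integrable M f"
  using assms by (intro integrableI_bounded) (auto intro: le_less_trans)
 show "(\<integral>x. f x \<partial>M) \<le> B"
  using nn_integral_eq_integral[OF i] assms by (simp add: ennreal_le_iff)
qed

lemma sobolev_mono:
 assumes "sobolev f G A" "A \<le> B" shows "sobolev f G B"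
proof -
 interpret sobolev f G A by (rule assms(1))
 have "(LI x. f x) \<le> B" "(LI x. (f x)^2) \<le> B" "(LI x. (norm (G x))^2) \<le> B"
  using f_L1 f_L2 G_L2 assms(2) by linarith+
 then show ?thesis by (intro sobolev.intro f_nonneg f_int f_sq G_meas G_sq line)
qed

lemma powr_between:
 fixes x :: real
 assumes "0 \<le> x" "1 \<le> a" "a \<le> b"
 shows "x powr a \<le> x + x powr b"
proof (cases "x \<le> 1")
 case True
 then have "x powr a \<le> x" using powr_mono'[of 1 a x] assms by (cases "x = 0") auto
 then show ?thesis by (simp add: add_increasing2)
next
 case False
 then have "x powr a \<le> x powr b" using assms by (intro powr_mono) auto
 then show ?thesis using assms by linarith
qed

text \<open>
  \<open>S\<close> stands for \<open>\<surd>\<rho> u\<close>, \<open>G\<close> for \<open>\<nabla>\<rho>\<^sup>r\<close> with \<open>r = \<alpha> - 1/2\<close>, and \<open>S + (1 + 1/(2r)) G\<close> for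
  \<open>\<surd>\<rho> (u + \<alpha>\<rho>\<^sup>\<alpha>\<^sup>-\<^sup>2\<nabla>\<rho>)\<close>, whose square is controlled by the entropy.
\<close>

definition flow :: "real \<Rightarrow> real \<Rightarrow> real \<Rightarrow> real \<Rightarrow> ('a::euclidean_space \<Rightarrow> real) \<Rightarrow> (real \<Rightarrow> 'a \<Rightarrow> real) \<Rightarrow>
  (real \<times> 'a \<Rightarrow> real) \<Rightarrow> (real \<times> 'a \<Rightarrow> 'a) \<Rightarrow> (real \<times> 'a \<Rightarrow> 'a) \<Rightarrow> bool" where
 "flow T r A \<epsilon> \<rho>0 \<rho> R G S \<longleftrightarrow>
   R \<in> borel_measurable borel \<and> G \<in> borel_measurable borel \<and> S \<in> borel_measurable borel \<and>
   (\<forall>t x. t \<notin> {0<..<T} \<longrightarrow> S (t, x) = 0) \<and>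
   (AE t\<in>{0<..<T} in lborel. (AE x in lborel. \<rho> t x = R (t, x)) \<and>
    dens (\<lambda>x. R (t, x) powr r) (\<lambda>x. G (t, x)) A (\<lambda>x. R (t, x)) r \<and>
    integrable lborel (\<lambda>x. (norm (S (t, x)))^2) \<and> (LI x. (norm (S (t, x)))^2) \<le> A \<and>
    integrable lborel (\<lambda>x. (norm (S (t, x) + (1 + 1 / (2 * r)) *\<^sub>R G (t, x)))^2) \<and>
    (LI x. (norm (S (t, x) + (1 + 1 / (2 * r)) *\<^sub>R G (t, x)))^2) \<le> A * \<epsilon>) \<and>
   (\<forall>h>0. AE t\<in>{0<..<T} in lborel. (\<forall>x. \<forall>b\<in>Basis.
    (LI y. dmol h b (x - y) * R (t, y) powr r) = (LI y. mol h (x - y) * (G (t, y) \<bullet> b)))) \<and>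
   (\<forall>h>0. AE t\<in>{0<..<T} in lborel. (\<forall>x. cv (mol h) (\<lambda>y. R (t, y)) x - cv (mol h) \<rho>0 x
    = - (LI s. indicator {..<t} s * (\<Sum>b\<in>Basis. cv (dmol h b) (\<lambda>y. sqrt (R (s, y)) *\<^sub>R S (s, y)) x \<bullet> b))))"

lemma sqrt_mult_norm_bound:
 fixes S :: "'a \<Rightarrow> 'v::euclidean_space"
 assumes R: "integrable M R" "\<And>x. 0 \<le> R x" "(\<integral>x. R x \<partial>M) \<le> A"
  and Sm [measurable]: "S \<in> borel_measurable M" and S: "integrable M (\<lambda>x. (norm (S x))^2)" "(\<integral>x. (norm (S x))^2 \<partial>M) \<le> A"
 shows "integrable M (\<lambda>x. sqrt (R x) *\<^sub>R S x)" "(\<integral>x. norm (sqrt (R x) *\<^sub>R S x) \<partial>M) \<le> A"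
proof -
 have [measurable]: "R \<in> borel_measurable M" using R by auto
 have b: "norm (sqrt (R x) *\<^sub>R S x) \<le> R x / 2 + (norm (S x))^2 / 2" for x
 proof -
  have "0 \<le> (sqrt (R x) - norm (S x))^2" by simp
  then show ?thesis using R(2)[of x] by (simp add: power2_diff)
 qed
 have i: "integrable M (\<lambda>x. R x / 2 + (norm (S x))^2 / 2)" using R S by auto
 show j: "integrable M (\<lambda>x. sqrt (R x) *\<^sub>R S x)"
 proof (rule Bochner_Integration.integrable_bound[OF i])
  show "AE x in M. norm (sqrt (R x) *\<^sub>R S x) \<le> norm (R x / 2 + (norm (S x))^2 / 2)"
   using order_trans[OF b abs_ge_self] by simp
 qed simp
 have "(\<integral>x. norm (sqrt (R x) *\<^sub>R S x) \<partial>M) \<le> (\<integral>x. R x / 2 + (norm (S x))^2 / 2 \<partial>M)"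
  by (rule integral_mono[OF integrable_norm[OF j] i b])
 also have "... = (\<integral>x. R x \<partial>M) / 2 + (\<integral>x. (norm (S x))^2 \<partial>M) / 2" using R S by simp
 finally show "(\<integral>x. norm (sqrt (R x) *\<^sub>R S x) \<partial>M) \<le> A" using R(3) S(2) by linarith
qed

text \<open>With r = \<alpha> - 1/2 the powers of p combine to p^(-1/2), which the weight sqrt p
  cancels, and \<alpha>/r = 1 + 1/(2r). Here \<xi> stands for the gradient of the r-th power of the
  density.\<close>

lemma wgrad_dens_identity:
 fixes u \<xi> :: "'v::real_inner"
 assumes p: "0 < p" and a: "3 / 2 \<le> \<alpha>"
 shows "p * (norm (u + (\<alpha> * p powr (\<alpha> - 2)) *\<^sub>R ((1 / (\<alpha> - 1/2) * p powr (1 - (\<alpha> - 1/2))) *\<^sub>R \<xi>)))^2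
  = (norm (sqrt p *\<^sub>R u + (1 + 1 / (2 * (\<alpha> - 1/2))) *\<^sub>R \<xi>))^2"
proof -
 have "p powr (\<alpha> - 2) * p powr (1 - (\<alpha> - 1/2)) = p powr (- (1/2))" by (simp add: powr_add[symmetric])
 moreover have "sqrt p * p powr (- (1/2)) = 1" using p by (simp add: powr_half_sqrt[symmetric] powr_add[symmetric])
 ultimately have e: "sqrt p * (p powr (\<alpha> - 2) * p powr (1 - (\<alpha> - 1/2))) = 1" by simp
 have c: "\<alpha> * (1 / (\<alpha> - 1/2)) = 1 + 1 / (2 * (\<alpha> - 1/2))" using a by (simp add: field_simps)
 have "sqrt p * ((\<alpha> * p powr (\<alpha> - 2)) * (1 / (\<alpha> - 1/2) * p powr (1 - (\<alpha> - 1/2))))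
   = (\<alpha> * (1 / (\<alpha> - 1/2))) * (sqrt p * (p powr (\<alpha> - 2) * p powr (1 - (\<alpha> - 1/2))))" by (simp only: mult_ac)
 then have "sqrt p *\<^sub>R (u + (\<alpha> * p powr (\<alpha> - 2)) *\<^sub>R ((1 / (\<alpha> - 1/2) * p powr (1 - (\<alpha> - 1/2))) *\<^sub>R \<xi>))
   = sqrt p *\<^sub>R u + (1 + 1 / (2 * (\<alpha> - 1/2))) *\<^sub>R \<xi>"
  unfolding scaleR_add_right scaleR_scaleR e c by simp
 then have "(norm (sqrt p *\<^sub>R u + (1 + 1 / (2 * (\<alpha> - 1/2))) *\<^sub>R \<xi>))^2
   = (norm (sqrt p *\<^sub>R (u + (\<alpha> * p powr (\<alpha> - 2)) *\<^sub>R ((1 / (\<alpha> - 1/2) * p powr (1 - (\<alpha> - 1/2))) *\<^sub>R \<xi>))))^2" by simp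
 also have "... = p * (norm (u + (\<alpha> * p powr (\<alpha> - 2)) *\<^sub>R ((1 / (\<alpha> - 1/2) * p powr (1 - (\<alpha> - 1/2))) *\<^sub>R \<xi>)))^2"
  using p by (simp only: norm_scaleR power_mult_distrib power2_abs real_sqrt_pow2[OF less_imp_le])
 finally show ?thesis ..
qed

text \<open>One approximate solution at fixed \<epsilon>, with bounds \<open>P1\<close> on the mass,
  \<open>Q\<close> on the kinetic energy and \<open>P * \<epsilon>\<close> on the entropy. The
  factor \<epsilon> in the last one reflects that the initial entropy reduces to the pressure
  term.\<close>

locale solution =
 fixes T \<alpha> \<gamma> \<epsilon> P1 P Q :: real and \<rho>0 :: "real ^ 'n \<Rightarrow> real" and m0 :: "real ^ 'n \<Rightarrow> real ^ 'n"
  and \<rho> :: "real \<Rightarrow> real ^ 'n \<Rightarrow> real" and u :: "real \<Rightarrow> real ^ 'n \<Rightarrow> real ^ 'n"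
 assumes T: "0 < T" and eps: "0 < \<epsilon>" "\<epsilon> < 1" and alpha: "3 / 2 \<le> \<alpha>" and gam: "2 * \<alpha> - 1 \<le> \<gamma>"
  and const: "0 \<le> P1" "0 \<le> P" "0 \<le> Q"
  and ws: "weak_solution T \<alpha> \<gamma> \<epsilon> m0 \<rho> u" and Cl: "C_Lq_loc T 1 \<rho>"
  and init: "AE x in lborel. \<rho> 0 x = \<rho>0 x" "\<rho>0 \<in> borel_measurable borel"
  and mass: "\<And>t. t \<in> {0..T} \<Longrightarrow> Lq_norm 1 UNIV (\<rho> t) \<le> ennreal P1"
  and energy: "AE t\<in>{0<..<T} in lborel.
    (NI x. ennreal (\<rho> t x * (norm (u t x))^2)) \<le> ennreal Q"
  and entropy: "AE t\<in>{0<..<T} in lborel.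
    (NI x. ennreal (\<rho> t x * (norm (u t x + (\<alpha> * \<rho> t x powr (\<alpha> - 2)) *\<^sub>R dens_xgrad T (\<alpha> - 1/2) \<rho> t x))^2
       + \<epsilon> * \<rho> t x powr \<gamma>)) \<le> ennreal (P * \<epsilon>)"
begin

abbreviation D where "D \<equiv> xgrad T (\<lambda>s y. \<rho> s y powr (\<alpha> - 1/2))"

definition R0 where "R0 p = indicator {0<..<T} (fst p) *\<^sub>R \<rho> (fst p) (snd p)"
text \<open>A version of the density that is Borel on space-time and nonnegative everywhere, whereas
  the density itself is nonnegative only almost everywhere.\<close>

definition R where "R p = max 0 (R0 p)"
definition G where "G p = indicator {0<..<T} (fst p) *\<^sub>R D (fst p) (snd p)"
definition S where "S p = indicator {0<..<T} (fst p) *\<^sub>R (sqrt (\<rho> (fst p) (snd p)) *\<^sub>R u (fst p) (snd p))"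

lemma weak_facts:
 shows rho_nonneg_AE: "AE p in lborel. fst p \<in> {0<..<T} \<longrightarrow> 0 \<le> \<rho> (fst p) (snd p)"
  and rho_Linf: "Linf_Lq T 1 UNIV \<rho>" and D_Linf: "Linf_Lq T 2 UNIV D"
  and mom_Linf: "Linf_Lq T 2 UNIV (\<lambda>t x. sqrt (\<rho> t x) *\<^sub>R u t x)"
  and Ex_grad: "Ex (is_xgrad T (\<lambda>t x. \<rho> t x powr (\<alpha> - 1/2)))" and cont_eq: "continuity_eq T \<rho> u"
 using ws unfolding weak_solution_def by blast+

lemma R0_meas [measurable]: "R0 \<in> borel_measurable borel"
 unfolding R0_def[abs_def] by (rule set_borel_measurable_time[OF conjunct1[OF rho_Linf[unfolded Linf_Lq_def]]])

lemma R_meas [measurable]: "R \<in> borel_measurable borel"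
 unfolding R_def[abs_def] by measurable

lemma G_meas [measurable]: "G \<in> borel_measurable borel"
 unfolding G_def[abs_def] by (rule set_borel_measurable_time[OF conjunct1[OF D_Linf[unfolded Linf_Lq_def]]])

lemma S_meas [measurable]: "S \<in> borel_measurable borel"
 unfolding S_def[abs_def] by (rule set_borel_measurable_time[OF conjunct1[OF mom_Linf[unfolded Linf_Lq_def]]])

lemma rho_meas: "t \<in> {0..T} \<Longrightarrow> \<rho> t \<in> borel_measurable borel"
 using Cl by (intro measurable_of_compact) (auto simp: C_Lq_loc_def in_Lq_def)

lemma rho_nn: "t \<in> {0..T} \<Longrightarrow> (NI x. ennreal \<bar>\<rho> t x\<bar>) \<le> ennreal P1"
 using mass[of t] by (simp add: Lq_norm_1)

lemma rho_integrable: "t \<in> {0..T} \<Longrightarrow> integrable lborel (\<rho> t)"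
 using rho_nn[of t] rho_meas[of t] by (intro integrableI_bounded) (auto intro: le_less_trans)

lemma rho_eq: "AE t\<in>{0<..<T} in lborel. (AE x in lborel. 0 \<le> \<rho> t x \<and> \<rho> t x = R (t, x))"
proof -
 have "AE p in lborel \<Otimes>\<^sub>M lborel. fst p \<in> {0<..<T} \<longrightarrow> 0 \<le> \<rho> (fst p) (snd p)"
  using rho_nonneg_AE by (simp only: lborel_prod)
 from lborel_pair.AE_pair[OF this] show ?thesis
 proof eventually_elim
  case (elim t)
  show ?case
  proof
   assume t: "t \<in> {0<..<T}"
   show "AE x in lborel. 0 \<le> \<rho> t x \<and> \<rho> t x = R (t, x)"
    using elim by eventually_elim (use t in \<open>simp add: R_def R0_def max_def\<close>)
  qed
 qed
qed

text \<open>The entropy bound is proportional to \<epsilon> and contains \<epsilon> times the power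
  \<gamma>; dividing by \<epsilon> leaves a bound that does not depend on it.\<close>

lemma pressure_nn: "AE t\<in>{0<..<T} in lborel. (NI x. ennreal (R (t, x) powr \<gamma>)) \<le> ennreal P"
 using entropy rho_eq
proof eventually_elim
 case (elim t)
 show ?case
 proof
  assume t: "t \<in> {0<..<T}"
  have "ennreal \<epsilon> * (NI x. ennreal (R (t, x) powr \<gamma>)) = (NI x. ennreal (\<epsilon> * R (t, x) powr \<gamma>))"
   using eps by (simp add: nn_integral_cmult[symmetric] ennreal_mult)
  also have "... \<le> (NI x. ennreal (\<rho> t x * (norm (u t x + (\<alpha> * \<rho> t x powr (\<alpha> - 2)) *\<^sub>R dens_xgrad T (\<alpha> - 1/2) \<rho> t x))^2
       + \<epsilon> * \<rho> t x powr \<gamma>))"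
  proof (rule nn_integral_mono_AE)
   show "AE x in lborel. ennreal (\<epsilon> * R (t, x) powr \<gamma>) \<le> ennreal (\<rho> t x * (norm (u t x + (\<alpha> * \<rho> t x powr (\<alpha> - 2)) *\<^sub>R dens_xgrad T (\<alpha> - 1/2) \<rho> t x))^2
       + \<epsilon> * \<rho> t x powr \<gamma>)"
    using elim(2)[THEN mp, OF t] by eventually_elim (auto intro!: ennreal_leI)
  qed
  also have "... \<le> ennreal (P * \<epsilon>)" using elim t by blast
  also have "... = ennreal \<epsilon> * ennreal P" using eps const by (simp add: ennreal_mult mult.commute)
  finally show "(NI x. ennreal (R (t, x) powr \<gamma>)) \<le> ennreal P"
   using eps by (simp add: ennreal_mult_le_mult_iff)
 qed
qed

text \<open>Exponents between 1 and \<gamma> follow by interpolation with the mass. Since 2 \<alpha>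
  - 1 \<le> \<gamma>, this covers \<alpha> - 1/2 and 2 \<alpha> - 1, that is, the L1 and L2 norms of
  \<rho>^r.\<close>

lemma R_bounds:
 "AE t\<in>{0<..<T} in lborel. (NI x. ennreal (R (t, x))) \<le> ennreal P1 \<and>
   (\<forall>a. 1 \<le> a \<longrightarrow> a \<le> \<gamma> \<longrightarrow> (NI x. ennreal (R (t, x) powr a)) \<le> ennreal (P1 + P))"
 using pressure_nn
proof eventually_elim
 case (elim t)
 show ?case
 proof (intro impI conjI allI)
  assume t: "t \<in> {0<..<T}"
  have "(NI x. ennreal (R (t, x))) \<le> (NI x. ennreal \<bar>\<rho> t x\<bar>)"
   using t by (intro nn_integral_mono ennreal_leI) (simp add: R_def R0_def)
  also have "... \<le> ennreal P1" using t by (intro rho_nn) auto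
  finally show R1: "(NI x. ennreal (R (t, x))) \<le> ennreal P1" .
  fix a assume a: "1 \<le> a" "a \<le> \<gamma>"
  have "(NI x. ennreal (R (t, x) powr a)) \<le> (NI x. ennreal (R (t, x)) + ennreal (R (t, x) powr \<gamma>))"
   using a by (intro nn_integral_mono) (simp add: ennreal_plus[symmetric] ennreal_leI powr_between R_def del: ennreal_plus)
  also have "... = (NI x. ennreal (R (t, x))) + (NI x. ennreal (R (t, x) powr \<gamma>))"
   by (intro nn_integral_add) auto
  also have "... \<le> ennreal P1 + ennreal P" using R1 elim t by (intro add_mono) auto
  finally show "(NI x. ennreal (R (t, x) powr a)) \<le> ennreal (P1 + P)" using const by simp
 qed
qed

lemma S_bound: "AE t\<in>{0<..<T} in lborel. (NI x. ennreal ((norm (S (t, x)))^2)) \<le> ennreal Q"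
 using energy rho_eq
proof eventually_elim
 case (elim t)
 show ?case
 proof
  assume t: "t \<in> {0<..<T}"
  have "(NI x. ennreal ((norm (S (t, x)))^2)) \<le> (NI x. ennreal (\<rho> t x * (norm (u t x))^2))"
  proof (rule nn_integral_mono_AE)
   show "AE x in lborel. ennreal ((norm (S (t, x)))^2) \<le> ennreal (\<rho> t x * (norm (u t x))^2)"
    using elim(2)[THEN mp, OF t] by eventually_elim (use t in \<open>simp add: S_def power_mult_distrib\<close>)
  qed
  also have "... \<le> ennreal Q" using elim t by blast
  finally show "(NI x. ennreal ((norm (S (t, x)))^2)) \<le> ennreal Q" .
 qed
qed

text \<open>A qualitative bound taken from the definition of a weak solution, possibly depending on
  \<epsilon>. It is only used until the uniform one is available.\<close>

lemma G_bound: "\<exists>B\<ge>0. AE t\<in>{0<..<T} in lborel. (NI x. ennreal ((norm (G (t, x)))^2)) \<le> ennreal B"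
proof -
 obtain C where C: "AE t\<in>{0<..<T} in lborel. Lq_norm 2 UNIV (D t) \<le> ennreal C"
  using D_Linf unfolding Linf_Lq_def by blast
 have "AE t\<in>{0<..<T} in lborel. (NI x. ennreal ((norm (G (t, x)))^2)) \<le> ennreal (max C 0 powr 2)"
  using C
 proof eventually_elim
  case (elim t)
  show ?case
  proof
   assume t: "t \<in> {0<..<T}"
   then have "(NI x. ennreal (norm (D t x) powr 2)) \<le> ennreal (max C 0 powr 2)"
    using Lq_norm_bound[of 2 UNIV "D t" C] elim by simp
   then show "(NI x. ennreal ((norm (G (t, x)))^2)) \<le> ennreal (max C 0 powr 2)"
    using t by (simp add: G_def)
  qed
 qed
 then show ?thesis by (intro exI[of _ "max C 0 powr 2"]) simp
qed

lemma mollified_grad: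
 assumes h: "0 < h"
 shows "AE t\<in>{0<..<T} in lborel. (\<forall>x. \<forall>b\<in>Basis.
   (LI y. dmol h b (x - y) * R (t, y) powr (\<alpha> - 1/2)) = (LI y. mol h (x - y) * (G (t, y) \<bullet> b)))"
proof -
 obtain B where B: "0 \<le> B" "AE t\<in>{0<..<T} in lborel. (NI x. ennreal ((norm (G (t, x)))^2)) \<le> ennreal B"
  using G_bound by blast
 \<comment> \<open>On the time interval this is exactly the power of \<rho> to which
   \<open>is_xgrad\<close> refers; with the power of \<open>R\<close> it agrees only almost
   everywhere.\<close>
 define H where "H p = indicator {0<..<T} (fst p) * R0 p powr (\<alpha> - 1/2)" for p
 have Hm [measurable]: "H \<in> borel_measurable borel" unfolding H_def[abs_def] by measurable
 have cutH: "H (t, x) = 0" and cutG: "G (t, x) = 0" if "t \<notin> {0<..<T}" for t x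
  using that by (auto simp: H_def G_def)
 have HR: "AE t\<in>{0<..<T} in lborel. (AE x in lborel. H (t, x) = R (t, x) powr (\<alpha> - 1/2))"
  using rho_eq
 proof eventually_elim
  case (elim t)
  show ?case
  proof
   assume t: "t \<in> {0<..<T}"
   show "AE x in lborel. H (t, x) = R (t, x) powr (\<alpha> - 1/2)"
    using elim[THEN mp, OF t] by eventually_elim (use t in \<open>auto simp: H_def R_def R0_def\<close>)
  qed
 qed
 have HB: "AE t in lborel. integrable lborel (\<lambda>x. H (t, x)) \<and> (LI x. \<bar>H (t, x)\<bar>) \<le> P1 + P + B"
  using R_bounds HR
 proof eventually_elim
  case (elim t)
  show ?case
  proof (cases "t \<in> {0<..<T}")
   case True
   have eq: "(NI x. ennreal (H (t, x))) = (NI x. ennreal (R (t, x) powr (\<alpha> - 1/2)))"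
    by (rule nn_integral_cong_AE) (use elim(2)[THEN mp, OF True] in \<open>eventually_elim, simp\<close>)
   have H0: "0 \<le> H (t, x)" for x by (simp add: H_def)
   have "(NI x. ennreal (H (t, x))) \<le> ennreal (P1 + P)"
    unfolding eq using elim(1) True alpha gam by auto
   from integrable_of_nn_bound[OF _ H0 this] H0 show ?thesis using const B by (auto intro: order_trans)
  next
   case False
   then show ?thesis using const B by (simp add: H_def)
  qed
 qed
 have GB: "AE t in lborel. integrable lborel (\<lambda>x. (norm (G (t, x)))^2) \<and> (LI x. (norm (G (t, x)))^2) \<le> P1 + P + B"
  using B(2)
 proof eventually_elim
  case (elim t)
  show ?case
  proof (cases "t \<in> {0<..<T}")
   case True
   with elim have g: "(NI x. ennreal ((norm (G (t, x)))^2)) \<le> ennreal B" by blast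
   have m: "(\<lambda>x. (norm (G (t, x)))^2) \<in> borel_measurable lborel" by measurable
   show ?thesis using integrable_of_nn_bound[OF m _ g B(1)] const by auto
  next
   case False
   then show ?thesis using const B by (simp add: G_def)
  qed
 qed
 have xg: "is_xgrad T (\<lambda>t x. \<rho> t x powr (\<alpha> - 1/2)) D"
  unfolding xgrad_def by (rule someI_ex[OF Ex_grad])
 have test: "(LI t. mol k (t0 - t) * (LI y. dmol h b (x - y) * H (t, y)))
   = (LI t. mol k (t0 - t) * (LI y. mol h (x - y) * (G (t, y) \<bullet> b)))"
  if k: "0 < k" and t0: "cball t0 k \<subseteq> {0<..<T}" and b: "b \<in> Basis" for k t0 x b
 proof -
  obtain i where i: "b = axis i 1" using b Basis_axis by blast
  define \<phi> where "\<phi> = (\<lambda>p. mol k (t0 - fst p) * mol h (x - snd p))"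
  have tf: "test_fun ({0<..<T} \<times> UNIV) \<phi>" unfolding \<phi>_def by (rule test_product(1)[OF k h t0])
  have dx: "dx i \<phi> (t, y) = - (mol k (t0 - t) * dmol h b (x - y))" for t y
   unfolding \<phi>_def i by (rule test_product(3)[OF k h t0])
  have 1: "indicator {0<..<T} t *\<^sub>R (LI y. \<rho> t y powr (\<alpha> - 1/2) * dx i \<phi> (t, y))
    = - (mol k (t0 - t) * (LI y. dmol h b (x - y) * H (t, y)))" for t
  proof -
   have "indicator {0<..<T} t *\<^sub>R (LI y. \<rho> t y powr (\<alpha> - 1/2) * dx i \<phi> (t, y))
     = (LI y. (- mol k (t0 - t)) * (dmol h b (x - y) * H (t, y)))"
    unfolding dx integral_scaleR_right[symmetric] by (rule Bochner_Integration.integral_cong[OF refl]) (simp add: H_def R0_def indicator_def)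
   also have "... = - mol k (t0 - t) * (LI y. dmol h b (x - y) * H (t, y))" by (rule integral_mult_right_zero)
   finally show ?thesis by simp
  qed
  have 2: "indicator {0<..<T} t *\<^sub>R (LI y. D t y $ i * \<phi> (t, y))
    = mol k (t0 - t) * (LI y. mol h (x - y) * (G (t, y) \<bullet> b))" for t
  proof -
   have "indicator {0<..<T} t *\<^sub>R (LI y. D t y $ i * \<phi> (t, y))
     = (LI y. mol k (t0 - t) * (mol h (x - y) * (G (t, y) \<bullet> b)))"
    unfolding integral_scaleR_right[symmetric] by (rule Bochner_Integration.integral_cong[OF refl]) (simp add: G_def \<phi>_def i inner_axis)
   then show ?thesis by simp
  qed
  have "(LINT t:{0<..<T}|lborel. LINT x|lborel. \<rho> t x powr (\<alpha> - 1/2) * dx i \<phi> (t, x))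
    = - (LINT t:{0<..<T}|lborel. LINT x|lborel. D t x $ i * \<phi> (t, x))"
   using xg tf unfolding is_xgrad_def by blast
  then show ?thesis unfolding set_lebesgue_integral_def 1 2 by simp
 qed
 have "AE t\<in>{0<..<T} in lborel. (\<forall>x. \<forall>b\<in>Basis.
   (LI y. dmol h b (x - y) * H (t, y)) = (LI y. mol h (x - y) * (G (t, y) \<bullet> b)))"
  by (rule wk_grad_slices[OF h Hm G_meas cutH cutG HB GB test]) simp_all
 then show ?thesis using HR
 proof eventually_elim
  case (elim t)
  show ?case
  proof (intro impI allI ballI)
   fix x and b :: "real ^ 'n" assume t: "t \<in> {0<..<T}" and b: "b \<in> Basis"
   have [measurable]: "dmol h b \<in> borel_measurable borel" using b by measurable
   have "(LI y. dmol h b (x - y) * R (t, y) powr (\<alpha> - 1/2)) = (LI y. dmol h b (x - y) * H (t, y))"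
   proof (rule integral_cong_AE)
    show "AE y in lborel. dmol h b (x - y) * R (t, y) powr (\<alpha> - 1/2) = dmol h b (x - y) * H (t, y)"
     using elim(2)[THEN mp, OF t] by eventually_elim simp
   qed measurable
   then show "(LI y. dmol h b (x - y) * R (t, y) powr (\<alpha> - 1/2)) = (LI y. mol h (x - y) * (G (t, y) \<bullet> b))"
    using elim(1) t b by auto
  qed
 qed
qed

lemma wk: "AE t\<in>{0<..<T} in lborel.
  wk_grad UNIV (\<lambda>k. 1 / real (Suc k)) (\<lambda>x. R (t, x) powr (\<alpha> - 1/2)) (\<lambda>x. G (t, x))"
proof -
 have "AE t in lborel. \<forall>k. t \<in> {0<..<T} \<longrightarrow> (\<forall>x. \<forall>b\<in>Basis.
   (LI y. dmol (1 / real (Suc k)) b (x - y) * R (t, y) powr (\<alpha> - 1/2)) = (LI y. mol (1 / real (Suc k)) (x - y) * (G (t, y) \<bullet> b)))"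
  unfolding AE_all_countable
 proof
  fix k
  have "0 < 1 / real (Suc k)" by simp
  then show "AE t\<in>{0<..<T} in lborel. (\<forall>x. \<forall>b\<in>Basis.
   (LI y. dmol (1 / real (Suc k)) b (x - y) * R (t, y) powr (\<alpha> - 1/2)) = (LI y. mol (1 / real (Suc k)) (x - y) * (G (t, y) \<bullet> b)))"
   by (rule mollified_grad)
 qed
 then show ?thesis by eventually_elim (simp only: wk_grad_def, blast)
qed

text \<open>The gradient is recovered from the entropy and the energy: c G is the difference of the
  small field S + c G and of S. Identifying S + c G with the integrand of the entropy requires that
  G vanish on the vacuum.\<close>

lemma sobolev_slices:
 "AE t\<in>{0<..<T} in lborel.
   sobolev (\<lambda>x. R (t, x) powr (\<alpha> - 1/2)) (\<lambda>x. G (t, x)) (P1 + 3 * P + 2 * Q) \<and>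
   integrable lborel (\<lambda>x. (norm (S (t, x)))^2) \<and> (LI x. (norm (S (t, x)))^2) \<le> Q \<and>
   integrable lborel (\<lambda>x. (norm (S (t, x) + (1 + 1 / (2 * (\<alpha> - 1/2))) *\<^sub>R G (t, x)))^2) \<and>
   (LI x. (norm (S (t, x) + (1 + 1 / (2 * (\<alpha> - 1/2))) *\<^sub>R G (t, x)))^2) \<le> P * \<epsilon>"
proof -
 define c where "c = 1 + 1 / (2 * (\<alpha> - 1/2))"
 have c1: "1 \<le> c" using alpha by (simp add: c_def)
 obtain B where B: "0 \<le> B" "AE t\<in>{0<..<T} in lborel. (NI x. ennreal ((norm (G (t, x)))^2)) \<le> ennreal B"
  using G_bound by blast
 have "AE t\<in>{0<..<T} in lborel.
   sobolev (\<lambda>x. R (t, x) powr (\<alpha> - 1/2)) (\<lambda>x. G (t, x)) (P1 + 3 * P + 2 * Q) \<and>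
   integrable lborel (\<lambda>x. (norm (S (t, x)))^2) \<and> (LI x. (norm (S (t, x)))^2) \<le> Q \<and>
   integrable lborel (\<lambda>x. (norm (S (t, x) + c *\<^sub>R G (t, x)))^2) \<and>
   (LI x. (norm (S (t, x) + c *\<^sub>R G (t, x)))^2) \<le> P * \<epsilon>"
  using B(2) R_bounds S_bound wk entropy rho_eq
 proof eventually_elim
  case (elim t)
  show ?case
  proof
   assume t: "t \<in> {0<..<T}"
   note el = elim(1)[THEN mp, OF t] elim(2)[THEN mp, OF t] elim(3)[THEN mp, OF t] elim(4)[THEN mp, OF t] elim(5)[THEN mp, OF t] elim(6)[THEN mp, OF t]
   define f where "f x = R (t, x) powr (\<alpha> - 1/2)" for x
   have f0: "0 \<le> f x" for x by (simp add: f_def)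
   have fm [measurable]: "f \<in> borel_measurable borel" unfolding f_def[abs_def] by measurable
   have f1nn: "(NI x. ennreal (f x)) \<le> ennreal (P1 + P)"
    unfolding f_def using el(2) alpha gam by auto
   have f2: "(f x)^2 = R (t, x) powr (2 * \<alpha> - 1)" for x
    by (simp add: f_def power2_eq_square powr_add[symmetric])
   have f2nn: "(NI x. ennreal ((f x)^2)) \<le> ennreal (P1 + P)"
    unfolding f2 using el(2) alpha gam by auto
   have PP: "0 \<le> P1 + P" using const by simp
   note fi = integrable_of_nn_bound[OF _ f0 f1nn PP] and f2i = integrable_of_nn_bound[OF _ _ f2nn PP]
   have Gm: "(\<lambda>x. G (t, x)) \<in> borel_measurable borel" and Sm: "(\<lambda>x. S (t, x)) \<in> borel_measurable borel" by measurable
   have Gi: "integrable lborel (\<lambda>x. (norm (G (t, x)))^2)" "(LI x. (norm (G (t, x)))^2) \<le> B"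
    by (rule integrable_of_nn_bound[OF _ _ el(1) B(1)]; simp)+
   have Si: "integrable lborel (\<lambda>x. (norm (S (t, x)))^2)" "(LI x. (norm (S (t, x)))^2) \<le> Q"
    by (rule integrable_of_nn_bound[OF _ _ el(3) const(3)]; simp)+
   have wkf: "wk_grad UNIV (\<lambda>k. 1 / real (Suc k)) f (\<lambda>x. G (t, x))" using el(4) by (simp add: f_def[abs_def])
   have hs: "0 < 1 / real (Suc k)" for k by simp
   have hs0: "(\<lambda>k. 1 / real (Suc k)) \<longlonglongrightarrow> 0" by (rule LIMSEQ_Suc[OF lim_inverse_n'])
   have fi': "integrable lborel f" "(LI x. f x) \<le> P1 + P" using fi by auto
   have f2i': "integrable lborel (\<lambda>x. (f x)^2)" "(LI x. (f x)^2) \<le> P1 + P" using f2i by auto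
   \<comment> \<open>A first pass with the possibly \<epsilon>-dependent bound \<open>B\<close>,
     only to make \<open>grad_zero\<close> available.\<close>
   have "sobolev f (\<lambda>x. G (t, x)) (P1 + P + B)"
    by (rule sobolevI[OF f0 fi'(1) _ f2i'(1) _ Gm Gi(1) _ hs hs0 wkf]) (use fi'(2) f2i'(2) Gi(2) B(1) PP in linarith)+
   \<comment> \<open>On the vacuum the entropy integrand is 0 by convention, so S + c G has to be
     shown to vanish there as well.\<close>
   from sobolev.grad_zero[OF this hs hs0 wkf] have gz: "AE x in lborel. f x = 0 \<longrightarrow> G (t, x) = 0" .
   have "(NI x. ennreal ((norm (S (t, x) + c *\<^sub>R G (t, x)))^2))
     \<le> (NI x. ennreal (\<rho> t x * (norm (u t x + (\<alpha> * \<rho> t x powr (\<alpha> - 2)) *\<^sub>R dens_xgrad T (\<alpha> - 1/2) \<rho> t x))^2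
       + \<epsilon> * \<rho> t x powr \<gamma>))"
   proof (rule nn_integral_mono_AE)
    show "AE x in lborel. ennreal ((norm (S (t, x) + c *\<^sub>R G (t, x)))^2)
     \<le> ennreal (\<rho> t x * (norm (u t x + (\<alpha> * \<rho> t x powr (\<alpha> - 2)) *\<^sub>R dens_xgrad T (\<alpha> - 1/2) \<rho> t x))^2 + \<epsilon> * \<rho> t x powr \<gamma>)"
     using gz el(6)
    proof eventually_elim
     case (elim x)
     show ?case
     proof (cases "\<rho> t x = 0")
      case True
      then have "S (t, x) + c *\<^sub>R G (t, x) = 0" using elim by (simp add: S_def f_def)
      then show ?thesis by simp
     next
      case False
      then have "0 < \<rho> t x" using elim by simp
      from wgrad_dens_identity[OF this alpha, of "u t x" "D t x"]
      have "\<rho> t x * (norm (u t x + (\<alpha> * \<rho> t x powr (\<alpha> - 2)) *\<^sub>R dens_xgrad T (\<alpha> - 1/2) \<rho> t x))^2 = (norm (S (t, x) + c *\<^sub>R G (t, x)))^2"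
       using t by (simp only: dens_xgrad_def c_def S_def G_def fst_conv snd_conv indicator_simps scaleR_one)
      moreover have "0 \<le> \<epsilon> * \<rho> t x powr \<gamma>" using eps by simp
      ultimately show ?thesis by (intro ennreal_leI) linarith
     qed
    qed
   qed
   also have "... \<le> ennreal (P * \<epsilon>)" by (rule el(5))
   finally have Vnn: "(NI x. ennreal ((norm (S (t, x) + c *\<^sub>R G (t, x)))^2)) \<le> ennreal (P * \<epsilon>)" .
   have Pe: "0 \<le> P * \<epsilon>" using const eps by simp
   have Vi: "integrable lborel (\<lambda>x. (norm (S (t, x) + c *\<^sub>R G (t, x)))^2)" "(LI x. (norm (S (t, x) + c *\<^sub>R G (t, x)))^2) \<le> P * \<epsilon>"
    by (rule integrable_of_nn_bound[OF _ _ Vnn Pe]; simp)+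
   \<comment> \<open>As c \<ge> 1, the norm of G is at most that of c G, which is the difference of
     S + c G and S.\<close>
   have Gle: "(norm (G (t, x)))^2 \<le> 2 * (norm (S (t, x) + c *\<^sub>R G (t, x)))^2 + 2 * (norm (S (t, x)))^2" for x
   proof -
    define g s v where "g = norm (c *\<^sub>R G (t, x))" and "s = norm (S (t, x))" and "v = norm (S (t, x) + c *\<^sub>R G (t, x))"
    have g: "g \<le> v + s" using norm_triangle_ineq4[of "S (t, x) + c *\<^sub>R G (t, x)" "S (t, x)"] by (simp add: g_def s_def v_def)
    have "norm (G (t, x)) \<le> g" using c1 mult_right_mono[of 1 c "norm (G (t, x))"] by (simp add: g_def)
    then have "(norm (G (t, x)))^2 \<le> (v + s)^2" using g by (intro power_mono) auto
    also have "... \<le> 2 * v\<^sup>2 + 2 * s\<^sup>2" using zero_le_power2[of "v - s"] by (simp add: power2_sum power2_diff)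
    finally show ?thesis by (simp add: v_def s_def)
   qed
   have "(LI x. (norm (G (t, x)))^2) \<le> (LI x. 2 * (norm (S (t, x) + c *\<^sub>R G (t, x)))^2 + 2 * (norm (S (t, x)))^2)"
    using Gi(1) Vi(1) Si(1) Gle by (intro integral_mono) auto
   also have "... = 2 * (LI x. (norm (S (t, x) + c *\<^sub>R G (t, x)))^2) + 2 * (LI x. (norm (S (t, x)))^2)"
    using Vi(1) Si(1) by simp
   also have "... \<le> 2 * P + 2 * Q"
   proof -
    have "P * \<epsilon> \<le> P" using const eps by (simp add: mult_left_le)
    then show ?thesis using Vi(2) Si(2) by linarith
   qed
   finally have G2: "(LI x. (norm (G (t, x)))^2) \<le> 2 * P + 2 * Q" .
   have "sobolev f (\<lambda>x. G (t, x)) (P1 + 3 * P + 2 * Q)"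
    by (rule sobolevI[OF f0 fi'(1) _ f2i'(1) _ Gm Gi(1) _ hs hs0 wkf]) (use fi'(2) f2i'(2) G2 const in linarith)+
   then show "sobolev (\<lambda>x. R (t, x) powr (\<alpha> - 1/2)) (\<lambda>x. G (t, x)) (P1 + 3 * P + 2 * Q) \<and>
   integrable lborel (\<lambda>x. (norm (S (t, x)))^2) \<and> (LI x. (norm (S (t, x)))^2) \<le> Q \<and>
   integrable lborel (\<lambda>x. (norm (S (t, x) + c *\<^sub>R G (t, x)))^2) \<and>
   (LI x. (norm (S (t, x) + c *\<^sub>R G (t, x)))^2) \<le> P * \<epsilon>"
    using Si Vi by (simp add: f_def[abs_def])
  qed
 qed
 then show ?thesis by (simp only: c_def)
qed

text \<open>The L4 bound is an assumption so that its constant can be fixed once in terms of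
  \<open>P1\<close>, \<open>P\<close> and \<open>Q\<close>, and then serves every
  \<epsilon>.\<close>

lemma flow:
 assumes A: "P1 + 3 * P + 2 * Q \<le> A"
  and L4: "\<And>f (G :: real ^ 'n \<Rightarrow> real ^ 'n). sobolev f G (P1 + 3 * P + 2 * Q) \<Longrightarrow>
   integrable lborel (\<lambda>x. f x ^ 4) \<and> (LI x. f x ^ 4) \<le> A"
 shows "flow T (\<alpha> - 1/2) A \<epsilon> \<rho>0 \<rho> R G S"
proof -
 have bounds: "P1 \<le> A" "Q \<le> A" "P \<le> A" "0 \<le> A" using A const by auto
 have R0: "0 \<le> R p" for p by (simp add: R_def)
 have cut: "S (t, x) = 0" if "t \<notin> {0<..<T}" for t x using that by (simp add: S_def)
 define M where "M p = sqrt (R p) *\<^sub>R S p" for p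
 have Mm [measurable]: "M \<in> borel_measurable borel" unfolding M_def[abs_def] by measurable
 have main: "AE t\<in>{0<..<T} in lborel. (AE x in lborel. \<rho> t x = R (t, x)) \<and>
    dens (\<lambda>x. R (t, x) powr (\<alpha> - 1/2)) (\<lambda>x. G (t, x)) A (\<lambda>x. R (t, x)) (\<alpha> - 1/2) \<and>
    integrable lborel (\<lambda>x. (norm (S (t, x)))^2) \<and> (LI x. (norm (S (t, x)))^2) \<le> A \<and>
    integrable lborel (\<lambda>x. (norm (S (t, x) + (1 + 1 / (2 * (\<alpha> - 1/2))) *\<^sub>R G (t, x)))^2) \<and>
    (LI x. (norm (S (t, x) + (1 + 1 / (2 * (\<alpha> - 1/2))) *\<^sub>R G (t, x)))^2) \<le> A * \<epsilon>"
  using sobolev_slices rho_eq R_bounds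
 proof eventually_elim
  case (elim t)
  show ?case
  proof
   assume t: "t \<in> {0<..<T}"
   note sl = elim(1)[THEN mp, OF t] and re = elim(2)[THEN mp, OF t] and rb = elim(3)[THEN mp, OF t]
   have Rm: "(\<lambda>x. R (t, x)) \<in> borel_measurable lborel" by simp
   note Ri = integrable_of_nn_bound[OF Rm R0 conjunct1[OF rb] const(1)]
   have "dens (\<lambda>x. R (t, x) powr (\<alpha> - 1/2)) (\<lambda>x. G (t, x)) A (\<lambda>x. R (t, x)) (\<alpha> - 1/2)"
   proof (intro dens.intro dens_axioms.intro)
    show "sobolev (\<lambda>x. R (t, x) powr (\<alpha> - 1/2)) (\<lambda>x. G (t, x)) A"
     using sobolev_mono[OF conjunct1[OF sl] A] .
    show "1 \<le> \<alpha> - 1/2" using alpha by simp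
    show "(LI x. R (t, x)) \<le> A" using Ri(2) bounds by linarith
   qed (use Ri(1) R0 L4[OF conjunct1[OF sl]] in auto)
   moreover have "P * \<epsilon> \<le> A * \<epsilon>" using bounds eps by (intro mult_right_mono) auto
   moreover have "AE x in lborel. \<rho> t x = R (t, x)" using re by eventually_elim simp
   ultimately show "(AE x in lborel. \<rho> t x = R (t, x)) \<and>
    dens (\<lambda>x. R (t, x) powr (\<alpha> - 1/2)) (\<lambda>x. G (t, x)) A (\<lambda>x. R (t, x)) (\<alpha> - 1/2) \<and>
    integrable lborel (\<lambda>x. (norm (S (t, x)))^2) \<and> (LI x. (norm (S (t, x)))^2) \<le> A \<and>
    integrable lborel (\<lambda>x. (norm (S (t, x) + (1 + 1 / (2 * (\<alpha> - 1/2))) *\<^sub>R G (t, x)))^2) \<and>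
    (LI x. (norm (S (t, x) + (1 + 1 / (2 * (\<alpha> - 1/2))) *\<^sub>R G (t, x)))^2) \<le> A * \<epsilon>"
    using sl bounds(2) order_trans by blast
  qed
 qed
 have mom: "momentum T h A M" if h: "0 < h" for h
 proof
  show "AE t in lborel. integrable lborel (\<lambda>x. M (t, x)) \<and> (LI x. norm (M (t, x))) \<le> A"
   using main
  proof eventually_elim
   case (elim t)
   show ?case
   proof (cases "t \<in> {0<..<T}")
    case True
    with elim have d: "dens (\<lambda>x. R (t, x) powr (\<alpha> - 1/2)) (\<lambda>x. G (t, x)) A (\<lambda>x. R (t, x)) (\<alpha> - 1/2)"
     and S2: "integrable lborel (\<lambda>x. (norm (S (t, x)))^2)" "(LI x. (norm (S (t, x)))^2) \<le> A" by auto
    have Sm: "(\<lambda>x. S (t, x)) \<in> borel_measurable lborel" by simp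
    show ?thesis using sqrt_mult_norm_bound[OF dens.rho_int[OF d] R0 dens.rho_L1[OF d] Sm S2] by (simp add: M_def)
   next
    case False
    then show ?thesis using bounds by (simp add: M_def cut)
   qed
  qed
  show "M (t, x) = 0" if "t \<notin> {0<..<T}" for t x using cut[OF that] by (simp add: M_def)
 qed (use T h bounds Mm in auto)
 have mu: "(\<lambda>p. indicator {0<..<T} (fst p) *\<^sub>R (\<rho> (fst p) (snd p) *\<^sub>R u (fst p) (snd p))) \<in> borel_measurable borel"
 proof -
  \<comment> \<open>The square root of a negative number is minus that of its absolute value. Thus
    the momentum is recovered from \<open>S\<close> also on the null set of negative densities,
    which gives Borel measurability everywhere.\<close>
  have sq: "sqrt \<bar>a\<bar> * sqrt a = a" for a :: real
  proof (cases "0 \<le> a")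
   case False
   have "sqrt a = - sqrt (- a)" using real_sqrt_minus[of "- a"] by simp
   then show ?thesis using False real_sqrt_mult_self[of "- a"] by simp
  qed simp
  have "indicator {0<..<T} (fst p) *\<^sub>R (\<rho> (fst p) (snd p) *\<^sub>R u (fst p) (snd p)) = sqrt \<bar>R0 p\<bar> *\<^sub>R S p" for p
   using sq[of "\<rho> (fst p) (snd p)"] by (cases "fst p \<in> {0<..<T}") (simp_all add: R0_def S_def)
  then show ?thesis by simp
 qed
 have M_eq: "AE t\<in>{0<..<T} in lborel. (AE x in lborel. \<rho> t x *\<^sub>R u t x = M (t, x))"
  using rho_eq
 proof eventually_elim
  case (elim t)
  show ?case
  proof
   assume t: "t \<in> {0<..<T}"
   show "AE x in lborel. \<rho> t x *\<^sub>R u t x = M (t, x)"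
    using elim[THEN mp, OF t]
   proof eventually_elim
    case (elim x)
    then have "R (t, x) = \<rho> t x" "0 \<le> \<rho> t x" by simp_all
    then show ?case using t by (simp add: M_def S_def)
   qed
  qed
 qed
 have repr: "AE t\<in>{0<..<T} in lborel. (\<forall>x. cv (mol h) (\<lambda>y. R (t, y)) x - cv (mol h) \<rho>0 x
    = - (LI s. indicator {..<t} s * (\<Sum>b\<in>Basis. cv (dmol h b) (\<lambda>y. M (s, y)) x \<bullet> b)))" if h: "0 < h" for h
  using rho_eq
 proof eventually_elim
  case (elim t)
  show ?case
  proof (intro impI allI)
   fix x assume t: "t \<in> {0<..<T}"
   have "cv (mol h) (\<lambda>y. R (t, y)) x = cv (mol h) (\<rho> t) x"
    unfolding cv_def
   proof (rule integral_cong_AE)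
    have [measurable]: "\<rho> t \<in> borel_measurable borel" using t by (intro rho_meas) auto
    show "(\<lambda>y. mol h (x - y) *\<^sub>R \<rho> t y) \<in> borel_measurable lborel" by measurable
    show "AE y in lborel. mol h (x - y) *\<^sub>R R (t, y) = mol h (x - y) *\<^sub>R \<rho> t y"
     using elim[THEN mp, OF t] by eventually_elim simp
   qed simp
   moreover have "cv (mol h) (\<rho> t) x - cv (mol h) \<rho>0 x = - (\<Sum>b\<in>Basis. cv (dmol h b) (\<lambda>y. momentum.U M t y \<bullet> b) x)"
    by (rule continuity_mollified[OF mom[OF h] cont_eq R0_meas[unfolded R0_def[abs_def]] mu M_eq Cl rho_integrable init t])
   ultimately show "cv (mol h) (\<lambda>y. R (t, y)) x - cv (mol h) \<rho>0 x
    = - (LI s. indicator {..<t} s * (\<Sum>b\<in>Basis. cv (dmol h b) (\<lambda>y. M (s, y)) x \<bullet> b))"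
    by (simp only: momentum.sum_cv_U(1)[OF mom[OF h]])
  qed
 qed
 show ?thesis
  unfolding flow_def
 proof (intro conjI allI impI)
  show "R \<in> borel_measurable borel" "G \<in> borel_measurable borel" "S \<in> borel_measurable borel" by measurable
  show "S (t, x) = 0" if "t \<notin> {0<..<T}" for t x by (rule cut[OF that])
  show "AE t\<in>{0<..<T} in lborel. (\<forall>x. cv (mol h) (\<lambda>y. R (t, y)) x - cv (mol h) \<rho>0 x
    = - (LI s. indicator {..<t} s * (\<Sum>b\<in>Basis. cv (dmol h b) (\<lambda>y. sqrt (R (s, y)) *\<^sub>R S (s, y)) x \<bullet> b)))"
   if "0 < h" for h using repr[OF that] by (simp only: M_def)
  show "AE t\<in>{0<..<T} in lborel. (\<forall>x. \<forall>b\<in>Basis.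
    (LI y. dmol h b (x - y) * R (t, y) powr (\<alpha> - 1/2)) = (LI y. mol h (x - y) * (G (t, y) \<bullet> b)))"
   if "0 < h" for h by (rule mollified_grad[OF that])
 qed (rule main)
qed

end

section \<open>Stability and convergence\<close>

lemma integrable_mol_square_integrable:
 fixes v :: "'a::euclidean_space \<Rightarrow> 'b::euclidean_space"
 assumes h: "0 < h" and [measurable]: "v \<in> borel_measurable borel" and v: "integrable lborel (\<lambda>y. (norm (v y))^2)"
 shows "integrable lborel (\<lambda>y. mol h (x - y) *\<^sub>R v y)"
proof (rule Bochner_Integration.integrable_bound)
 have "integrable lborel (\<lambda>y::'a. (mol h y)^2)"
  using mol_supp[OF h, where 'a='a] by (intro integrable_continuous_compact_supp[where r = "real DIM('a) * h"] continuous_intros continuous_mol) auto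
 then have m2: "integrable lborel (\<lambda>y. (mol h (x - y))^2)" using integrable_reflect[of "\<lambda>y. (mol h y)^2" x] by simp
 then show "integrable lborel (\<lambda>y. (mol h (x - y))^2 + (norm (v y))^2)" using v by auto
 show "AE y in lborel. norm (mol h (x - y) *\<^sub>R v y) \<le> norm ((mol h (x - y))^2 + (norm (v y))^2)"
 proof (rule AE_I2)
  fix y
  show "norm (mol h (x - y) *\<^sub>R v y) \<le> norm ((mol h (x - y))^2 + (norm (v y))^2)"
   using abs_mult_le_squares[of "mol h (x - y)" "norm (v y)"] by (simp add: abs_mult)
 qed
qed simp

lemma norm_diff_square_le: "(norm (a - b))^2 \<le> 2 * (norm a)^2 + 2 * (norm (b::'v::real_inner))^2"
proof -
 have "(norm (a - b))^2 \<le> (norm a + norm b)^2" by (intro power_mono norm_triangle_ineq4) simp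
 also have "... \<le> 2 * (norm a)^2 + 2 * (norm b)^2" using zero_le_power2[of "norm a - norm b"] by (simp add: power2_sum power2_diff)
 finally show ?thesis .
qed

lemma flow_momentum:
 assumes F: "flow T r A \<epsilon> \<rho>0 \<rho> R G S" and T: "0 < T" and h: "0 < h" and A: "0 \<le> A"
 shows "momentum T h A (\<lambda>p. sqrt (R p) *\<^sub>R S p)"
proof
 have [measurable]: "R \<in> borel_measurable borel" "S \<in> borel_measurable borel" using F by (auto simp: flow_def)
 show "(\<lambda>p. sqrt (R p) *\<^sub>R S p) \<in> borel_measurable borel" by measurable
 have cut: "S (t, x) = 0" if "t \<notin> {0<..<T}" for t x using F that unfolding flow_def by blast
 then show "sqrt (R (t, x)) *\<^sub>R S (t, x) = 0" if "t \<notin> {0<..<T}" for t x using that by simp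
 have "AE t\<in>{0<..<T} in lborel. (AE x in lborel. \<rho> t x = R (t, x)) \<and>
    dens (\<lambda>x. R (t, x) powr r) (\<lambda>x. G (t, x)) A (\<lambda>x. R (t, x)) r \<and>
    integrable lborel (\<lambda>x. (norm (S (t, x)))^2) \<and> (LI x. (norm (S (t, x)))^2) \<le> A \<and>
    integrable lborel (\<lambda>x. (norm (S (t, x) + (1 + 1 / (2 * r)) *\<^sub>R G (t, x)))^2) \<and>
    (LI x. (norm (S (t, x) + (1 + 1 / (2 * r)) *\<^sub>R G (t, x)))^2) \<le> A * \<epsilon>"
  using F unfolding flow_def by blast
 then show "AE t in lborel. integrable lborel (\<lambda>x. sqrt (R (t, x)) *\<^sub>R S (t, x)) \<and> (LI x. norm (sqrt (R (t, x)) *\<^sub>R S (t, x))) \<le> A"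
 proof eventually_elim
  case (elim t)
  show ?case
  proof (cases "t \<in> {0<..<T}")
   case True
   with elim have d: "dens (\<lambda>x. R (t, x) powr r) (\<lambda>x. G (t, x)) A (\<lambda>x. R (t, x)) r"
    and S2: "integrable lborel (\<lambda>x. (norm (S (t, x)))^2)" "(LI x. (norm (S (t, x)))^2) \<le> A" by auto
   have Sm: "(\<lambda>x. S (t, x)) \<in> borel_measurable lborel" by simp
   show ?thesis using sqrt_mult_norm_bound[OF dens.rho_int[OF d] dens.rho_nonneg[OF d] dens.rho_L1[OF d] Sm S2] by simp
  next
   case False
   then show ?thesis using A by (simp add: cut)
  qed
 qed
qed (use T h A in auto)

text \<open>The chain rule with q = 1/(2r), for which f^(1+q) is the power r + 1/2 of the density
  and f^q its square root. As r + 1/2 = \<alpha>, the right side represents the gradient of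
  \<rho>^\<alpha>.\<close>

lemma dens_flux_gradient:
 assumes d: "dens f G A \<rho> r" and h: "0 < h" and b: "b \<in> Basis"
 shows "(LI y. dmol h b (x - y) * \<rho> y powr (r + 1 / 2))
   = (LI y. mol h (x - y) * ((((1 + 1 / (2 * r)) * sqrt (\<rho> y)) *\<^sub>R G y) \<bullet> b))"
proof -
 interpret dens f G A \<rho> r by (rule d)
 have q: "0 < 1 / (2 * r)" "1 / (2 * r) \<le> 1 / 2" using r by (auto simp: field_simps)
 have 1: "f y powr (1 + 1 / (2 * r)) = \<rho> y powr (r + 1 / 2)" for y
  using r by (simp add: f_eq powr_powr distrib_left)
 have 2: "f y powr (1 / (2 * r)) = sqrt (\<rho> y)" for y
  using r rho_nonneg[of y] by (simp add: f_eq powr_powr powr_half_sqrt)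
 show ?thesis using chain_rule[OF h b q, of x] by (simp only: 1 2 inner_scaleR_left)
qed

text \<open>The three conditions on \<kappa> dominate, in this order, the mollified forcing, the
  commutator of the diffusion, and the error of symmetrizing the product of w with the difference of
  the r-th powers. The constant is chosen before \<epsilon>, \<delta>, h and \<kappa>, which is what
  allows \<delta> to tend to 0 afterwards.\<close>

lemma pair_estimate:
 fixes A T r s p :: real
 assumes dim: "real DIM('a::euclidean_space) / 2 - 1 \<le> s" and s: "0 < s" and r: "1 \<le> r" and T: "0 < T" and A: "0 \<le> A"
  and p: "0 \<le> p" "p < 1" "p * r \<le> 1" "1 \<le> (3 - 2 * p * r) / (1 - p)" "(3 - 2 * p * r) / (1 - p) \<le> 4 * r"
 shows "\<exists>C>0. \<forall>\<epsilon> \<delta> h \<kappa> (\<rho>0 :: 'a \<Rightarrow> real) \<rho>1 \<rho>2 R1 G1 S1 R2 G2 S2.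
  flow T r A \<epsilon> \<rho>0 \<rho>1 R1 G1 S1 \<longrightarrow> flow T r A \<delta> \<rho>0 \<rho>2 R2 G2 S2 \<longrightarrow> 0 < \<delta> \<longrightarrow> \<delta> \<le> \<epsilon> \<longrightarrow> 0 < h \<longrightarrow> h \<le> 1 \<longrightarrow> 0 < \<kappa> \<longrightarrow>
  \<epsilon> * h powr (- (s / r)) \<le> \<kappa>\<^sup>2 \<longrightarrow> h powr (1 + p) \<le> \<kappa>\<^sup>2 \<longrightarrow> h \<le> \<kappa> \<longrightarrow>
  (AE t\<in>{0<..<T} in lborel. (NI x. ennreal ((\<rho>1 t x - \<rho>2 t x)^2)) \<le> ennreal (C * \<kappa> powr (1 / r)))"
proof -
 obtain C1 where C1: "0 < C1" and flux: "\<And>f (G :: 'a \<Rightarrow> 'a) rho (V :: 'a \<Rightarrow> 'a) e h. dens f G A rho r \<Longrightarrow> V \<in> borel_measurable borel \<Longrightarrow>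
   integrable lborel (\<lambda>x. (norm (V x))^2) \<Longrightarrow> (LI x. (norm (V x))^2) \<le> e \<Longrightarrow> 0 < h \<Longrightarrow> h \<le> 1 \<Longrightarrow>
   (NI x. ennreal ((norm (cv (mol h) (\<lambda>y. sqrt (rho y) *\<^sub>R V y) x))^2)) \<le> ennreal (C1 * e * h powr (- (s / r)))"
  using flux_mollified[OF dim s r, of A] by blast
 define E where "E = 8 * (real DIM('a))^2 * A + 16 * A"
 have E: "0 \<le> E" using A by (simp add: E_def)
 \<comment> \<open>This is \<open>4 * T\<^sup>2 * j + 4 * T * e\<close> from
   \<open>energy_estimate\<close> with the forcing bound \<open>j\<close> and the commutator bound
   \<open>4 * h powr (1 + p) * E\<close>, both expressed through the square of \<kappa>.\<close>
 define C2 where "C2 = 16 * T\<^sup>2 * C1 * A + 16 * T * E"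
 \<comment> \<open>Here 4 A bounds the square of the difference of the gradients, 2 E the
   symmetrization error, and 1 leaves room for strict positivity.\<close>
 define C3 where "C3 = C2 + 4 * A + 2 * E + 1"
 have C2: "0 \<le> C2" using C1 A T E by (simp add: C2_def)
 have C3: "0 < C3" using C2 A E by (simp add: C3_def)
 have key: "AE t\<in>{0<..<T} in lborel. (NI x. ennreal ((\<rho>1 t x - \<rho>2 t x)^2)) \<le> ennreal ((2 * A + 1) * C3 powr (1 / r) * \<kappa> powr (1 / r))"
  if F1: "flow T r A \<epsilon> \<rho>0 \<rho>1 R1 G1 S1" and F2: "flow T r A \<delta> \<rho>0 \<rho>2 R2 G2 S2"
   and del: "0 < \<delta>" "\<delta> \<le> \<epsilon>" and h: "0 < h" "h \<le> 1" and \<kappa>: "0 < \<kappa>"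
   and small: "\<epsilon> * h powr (- (s / r)) \<le> \<kappa>\<^sup>2" "h powr (1 + p) \<le> \<kappa>\<^sup>2" "h \<le> \<kappa>"
  for \<epsilon> \<delta> h \<kappa> and \<rho>0 :: "'a \<Rightarrow> real" and \<rho>1 \<rho>2 R1 G1 S1 R2 G2 S2
 proof -
  define c where "c = 1 + 1 / (2 * r)"
  have [measurable]: "R1 \<in> borel_measurable borel" "G1 \<in> borel_measurable borel" "S1 \<in> borel_measurable borel"
   "R2 \<in> borel_measurable borel" "G2 \<in> borel_measurable borel" "S2 \<in> borel_measurable borel"
   using F1 F2 by (auto simp: flow_def)
  define M1 where "M1 q = sqrt (R1 q) *\<^sub>R S1 q" for q
  define M2 where "M2 q = sqrt (R2 q) *\<^sub>R S2 q" for q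
  define M where "M q = M1 q - M2 q" for q
  interpret m1: momentum T h A M1 using flow_momentum[OF F1 T h(1) A] by (simp add: M1_def[abs_def])
  interpret m2: momentum T h A M2 using flow_momentum[OF F2 T h(1) A] by (simp add: M2_def[abs_def])
  interpret m: momentum T h "2 * A" M
  proof
   show "M \<in> borel_measurable borel" unfolding M_def[abs_def] by simp
   show "AE t in lborel. integrable lborel (\<lambda>x. M (t, x)) \<and> (LI x. norm (M (t, x))) \<le> 2 * A"
    using m1.M_L1 m2.M_L1
   proof eventually_elim
    case (elim t)
    have "(LI x. norm (M (t, x))) \<le> (LI x. norm (M1 (t, x)) + norm (M2 (t, x)))"
     unfolding M_def using elim by (intro integral_mono) (auto intro: norm_triangle_ineq4)
    also have "... = (LI x. norm (M1 (t, x))) + (LI x. norm (M2 (t, x)))" using elim by simp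
    finally show ?case using elim by (auto simp: M_def)
   qed
  qed (use T h A m1.M_cut m2.M_cut in \<open>auto simp: M_def\<close>)
  define J1 where "J1 t x = sqrt (R1 (t, x)) *\<^sub>R (S1 (t, x) + c *\<^sub>R G1 (t, x))" for t x
  define J2 where "J2 t x = sqrt (R2 (t, x)) *\<^sub>R (S2 (t, x) + c *\<^sub>R G2 (t, x))" for t x
  define q1 where "q1 t x = (c * sqrt (R1 (t, x))) *\<^sub>R G1 (t, x)" for t x
  define q2 where "q2 t x = (c * sqrt (R2 (t, x))) *\<^sub>R G2 (t, x)" for t x
  define J where "J t x = J1 t x - J2 t x" for t x
  define q where "q t x = q1 t x - q2 t x" for t x
  define w where "w t x = R1 (t, x) - R2 (t, x)" for t x
  define z where "z t x = R1 (t, x) powr (r + 1 / 2) - R2 (t, x) powr (r + 1 / 2)" for t x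
  \<comment> \<open>The momentum is the small flux minus the gradient of the pressure, the latter in
    the form given by \<open>dens_flux_gradient\<close>.\<close>
  have MJ: "M (t, x) = J t x - q t x" for t x
   by (simp add: M_def M1_def M2_def J_def J1_def J2_def q_def q1_def q2_def scaleR_add_right mult.commute)
  have D1: "AE t\<in>{0<..<T} in lborel. (AE x in lborel. \<rho>1 t x = R1 (t, x)) \<and>
    dens (\<lambda>x. R1 (t, x) powr r) (\<lambda>x. G1 (t, x)) A (\<lambda>x. R1 (t, x)) r \<and>
    integrable lborel (\<lambda>x. (norm (S1 (t, x)))^2) \<and> (LI x. (norm (S1 (t, x)))^2) \<le> A \<and>
    integrable lborel (\<lambda>x. (norm (S1 (t, x) + c *\<^sub>R G1 (t, x)))^2) \<and>
    (LI x. (norm (S1 (t, x) + c *\<^sub>R G1 (t, x)))^2) \<le> A * \<epsilon>"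
   using F1 unfolding flow_def c_def by blast
  have D2: "AE t\<in>{0<..<T} in lborel. (AE x in lborel. \<rho>2 t x = R2 (t, x)) \<and>
    dens (\<lambda>x. R2 (t, x) powr r) (\<lambda>x. G2 (t, x)) A (\<lambda>x. R2 (t, x)) r \<and>
    integrable lborel (\<lambda>x. (norm (S2 (t, x)))^2) \<and> (LI x. (norm (S2 (t, x)))^2) \<le> A \<and>
    integrable lborel (\<lambda>x. (norm (S2 (t, x) + c *\<^sub>R G2 (t, x)))^2) \<and>
    (LI x. (norm (S2 (t, x) + c *\<^sub>R G2 (t, x)))^2) \<le> A * \<delta>"
   using F2 unfolding flow_def c_def by blast
  have pair: "AE t\<in>{0<..<T} in lborel. (AE x in lborel. \<rho>1 t x = R1 (t, x) \<and> \<rho>2 t x = R2 (t, x)) \<and>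
    dens_pair (\<lambda>x. R1 (t, x) powr r) (\<lambda>x. R2 (t, x) powr r) (\<lambda>x. G1 (t, x)) (\<lambda>x. G2 (t, x)) A (\<lambda>x. R1 (t, x)) (\<lambda>x. R2 (t, x)) r"
   using D1 D2
  proof eventually_elim
   case (elim t)
   then show ?case by (auto intro!: dens_pair.intro)
  qed
  have parts: "AE t\<in>{0<..<T} in lborel. integrable lborel (J1 t) \<and> integrable lborel (J2 t) \<and> integrable lborel (q1 t) \<and> integrable lborel (q2 t) \<and>
    (NI x. ennreal ((norm (cv (mol h) (J1 t) x))^2)) \<le> ennreal (C1 * (A * \<epsilon>) * h powr (- (s / r))) \<and>
    (NI x. ennreal ((norm (cv (mol h) (J2 t) x))^2)) \<le> ennreal (C1 * (A * \<delta>) * h powr (- (s / r)))"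
   using D1 D2
  proof eventually_elim
   case (elim t)
   show ?case
   proof
    assume t: "t \<in> {0<..<T}"
    note e1 = elim(1)[THEN mp, OF t] and e2 = elim(2)[THEN mp, OF t]
    have d1: "dens (\<lambda>x. R1 (t, x) powr r) (\<lambda>x. G1 (t, x)) A (\<lambda>x. R1 (t, x)) r"
     and d2: "dens (\<lambda>x. R2 (t, x) powr r) (\<lambda>x. G2 (t, x)) A (\<lambda>x. R2 (t, x)) r" using e1 e2 by blast+
    interpret d1: dens "\<lambda>x. R1 (t, x) powr r" "\<lambda>x. G1 (t, x)" A "\<lambda>x. R1 (t, x)" r by (rule d1)
    interpret d2: dens "\<lambda>x. R2 (t, x) powr r" "\<lambda>x. G2 (t, x)" A "\<lambda>x. R2 (t, x)" r by (rule d2)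
    have V1: "(\<lambda>x. S1 (t, x) + c *\<^sub>R G1 (t, x)) \<in> borel_measurable borel" and V2: "(\<lambda>x. S2 (t, x) + c *\<^sub>R G2 (t, x)) \<in> borel_measurable borel"
     by measurable
    have v1: "integrable lborel (\<lambda>x. (norm (S1 (t, x) + c *\<^sub>R G1 (t, x)))^2)" "(LI x. (norm (S1 (t, x) + c *\<^sub>R G1 (t, x)))^2) \<le> A * \<epsilon>"
     and v2: "integrable lborel (\<lambda>x. (norm (S2 (t, x) + c *\<^sub>R G2 (t, x)))^2)" "(LI x. (norm (S2 (t, x) + c *\<^sub>R G2 (t, x)))^2) \<le> A * \<delta>"
     using e1 e2 by blast+
    have "integrable lborel (q1 t)"
     using integrable_scaleR_right[OF d1.flux_int[OF d1.G_meas d1.G_sq], of c] by (simp add: q1_def[abs_def])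
    moreover have "integrable lborel (q2 t)"
     using integrable_scaleR_right[OF d2.flux_int[OF d2.G_meas d2.G_sq], of c] by (simp add: q2_def[abs_def])
    ultimately show "integrable lborel (J1 t) \<and> integrable lborel (J2 t) \<and> integrable lborel (q1 t) \<and> integrable lborel (q2 t) \<and>
     (NI x. ennreal ((norm (cv (mol h) (J1 t) x))^2)) \<le> ennreal (C1 * (A * \<epsilon>) * h powr (- (s / r))) \<and>
     (NI x. ennreal ((norm (cv (mol h) (J2 t) x))^2)) \<le> ennreal (C1 * (A * \<delta>) * h powr (- (s / r)))"
     unfolding J1_def[abs_def] J2_def[abs_def]
     by (intro conjI d1.flux_int[OF V1 v1(1)] d2.flux_int[OF V2 v2(1)] flux[OF d1 V1 v1 h] flux[OF d2 V2 v2 h])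
   qed
  qed
  \<comment> \<open>Both flows start from the same density, whose mollification cancels in the
    difference.\<close>
  have repr: "AE t\<in>{0<..<T} in lborel. (\<forall>x. cv (mol h) (w t) x = - (\<Sum>b\<in>Basis. cv (dmol h b) (\<lambda>y. m.U t y \<bullet> b) x))"
  proof -
   have r1: "AE t\<in>{0<..<T} in lborel. (\<forall>x. cv (mol h) (\<lambda>y. R1 (t, y)) x - cv (mol h) \<rho>0 x
    = - (LI s. indicator {..<t} s * (\<Sum>b\<in>Basis. cv (dmol h b) (\<lambda>y. M1 (s, y)) x \<bullet> b)))"
    using F1 h(1) unfolding flow_def M1_def by blast
   have r2: "AE t\<in>{0<..<T} in lborel. (\<forall>x. cv (mol h) (\<lambda>y. R2 (t, y)) x - cv (mol h) \<rho>0 x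
    = - (LI s. indicator {..<t} s * (\<Sum>b\<in>Basis. cv (dmol h b) (\<lambda>y. M2 (s, y)) x \<bullet> b)))"
    using F2 h(1) unfolding flow_def M2_def by blast
   show ?thesis
    using r1 r2 pair
   proof eventually_elim
    case (elim t)
    show ?case
    proof (intro impI allI)
     fix x assume t: "t \<in> {0<..<T}"
     note el = elim(1)[THEN mp, OF t, THEN spec, of x] elim(2)[THEN mp, OF t, THEN spec, of x] conjunct2[OF elim(3)[THEN mp, OF t]]
     interpret dens_pair "\<lambda>x. R1 (t, x) powr r" "\<lambda>x. R2 (t, x) powr r" "\<lambda>x. G1 (t, x)" "\<lambda>x. G2 (t, x)" A "\<lambda>x. R1 (t, x)" "\<lambda>x. R2 (t, x)" r
      by (rule el(3))
     define b1 where "b1 s = (\<Sum>b\<in>Basis. cv (dmol h b) (\<lambda>y. M1 (s, y)) x \<bullet> b)" for s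
     define b2 where "b2 s = (\<Sum>b\<in>Basis. cv (dmol h b) (\<lambda>y. M2 (s, y)) x \<bullet> b)" for s
     define b0 where "b0 s = (\<Sum>b\<in>Basis. cv (dmol h b) (\<lambda>y. M (s, y)) x \<bullet> b)" for s
     have bi: "integrable lborel b1" "integrable lborel b2" "integrable lborel b0"
      unfolding b1_def b2_def b0_def by (rule m1.sum_cv_U(2) m2.sum_cv_U(2) m.sum_cv_U(2))+
     have ii: "integrable lborel (\<lambda>s. indicator {..<t} s * b1 s)" "integrable lborel (\<lambda>s. indicator {..<t} s * b2 s)"
      using integrable_mult_indicator[OF _ bi(1), of "{..<t}"] integrable_mult_indicator[OF _ bi(2), of "{..<t}"] by simp_all
     have "cv (mol h) (w t) x = cv (mol h) (\<lambda>y. R1 (t, y)) x - cv (mol h) (\<lambda>y. R2 (t, y)) x"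
      unfolding w_def using cv_diff[OF d1.rho_int d2.rho_int mol_measurable mol_abs_bound[OF h(1)]] .
     also have "... = - ((LI s. indicator {..<t} s * b1 s) - (LI s. indicator {..<t} s * b2 s))"
      using el(1,2) unfolding b1_def b2_def by linarith
     also have "... = - (LI s. indicator {..<t} s * b1 s - indicator {..<t} s * b2 s)" using ii by simp
     also have "(LI s. indicator {..<t} s * b1 s - indicator {..<t} s * b2 s) = (LI s. indicator {..<t} s * b0 s)"
     proof (rule integral_cong_AE)
      show "AE s in lborel. indicator {..<t} s * b1 s - indicator {..<t} s * b2 s = indicator {..<t} s * b0 s"
       using m1.M_L1 m2.M_L1
      proof eventually_elim
       case (elim s)
       have "cv (dmol h b) (\<lambda>y. M (s, y)) x = cv (dmol h b) (\<lambda>y. M1 (s, y)) x - cv (dmol h b) (\<lambda>y. M2 (s, y)) x" if b: "b \<in> Basis" for b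
       proof -
        obtain C where "\<And>y::'a. \<bar>dmol h b y\<bar> \<le> C" using dmol_bounded[OF h(1), where 'a='a] b by blast
        from cv_diff[OF conjunct1[OF elim(1)] conjunct1[OF elim(2)] dmol_measurable[OF b] this] show ?thesis by (simp add: M_def)
       qed
       then have "b0 s = b1 s - b2 s" by (simp add: b0_def b1_def b2_def inner_diff_left sum_subtractf)
       then show ?case by (simp add: right_diff_distrib)
      qed
     qed (use bi in auto)
     also have "- (LI s. indicator {..<t} s * b0 s) = - (\<Sum>b\<in>Basis. cv (dmol h b) (\<lambda>y. m.U t y \<bullet> b) x)"
      unfolding m.sum_cv_U(1) b0_def ..
     finally show "cv (mol h) (w t) x = - (\<Sum>b\<in>Basis. cv (dmol h b) (\<lambda>y. m.U t y \<bullet> b) x)" .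
    qed
   qed
  qed
  \<comment> \<open>The factor 4 comes from splitting the square of a difference and from \<delta>
    \<le> \<epsilon>, which makes the second flux no larger than the bound for the first.\<close>
  define j where "j = 4 * C1 * A * \<epsilon> * h powr (- (s / r))"
  have j0: "0 \<le> j" using C1 A del by (simp add: j_def)
  have Uh2: "(LI x. (norm (m.Uh tau x))^2) \<le> C2 * \<kappa>\<^sup>2" if tau: "tau \<in> {0<..<T}" for tau
  proof -
   have "(LI x. (norm (m.Uh tau x))^2) \<le> 4 * T\<^sup>2 * j + 4 * T * (4 * h powr (1 + p) * E)"
   proof (rule m.energy_estimate[where J = J and q = q and w = w and z = z, OF _ j0 _ _ _ repr _ _ tau])
    show "0 \<le> 4 * h powr (1 + p) * E" using E by simp
    show "AE t\<in>{0<..<T} in lborel. integrable lborel (J t) \<and> integrable lborel (q t) \<and> (\<forall>x. M (t, x) = J t x - q t x)"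
     using parts
    proof eventually_elim
     case (elim t)
     then show ?case by (auto simp: MJ J_def[abs_def] q_def[abs_def])
    qed
    show "AE t\<in>{0<..<T} in lborel. integrable lborel (z t)"
     using pair
    proof eventually_elim
     case (elim t)
     then show ?case unfolding z_def using dens_pair.z_int by blast
    qed
    show "AE t\<in>{0<..<T} in lborel. (\<forall>x. \<forall>b\<in>Basis. (LI y. dmol h b (x - y) * z t y) = (LI y. mol h (x - y) * (q t y \<bullet> b)))"
     using pair parts
    proof eventually_elim
     case (elim t)
     show ?case
     proof (intro impI allI ballI)
      fix x b :: 'a assume t: "t \<in> {0<..<T}" and b: "b \<in> Basis"
      interpret dens_pair "\<lambda>x. R1 (t, x) powr r" "\<lambda>x. R2 (t, x) powr r" "\<lambda>x. G1 (t, x)" "\<lambda>x. G2 (t, x)" A "\<lambda>x. R1 (t, x)" "\<lambda>x. R2 (t, x)" r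
       using elim(1) t by blast
      have qi: "integrable lborel (\<lambda>y. mol h (x - y) * (q1 t y \<bullet> b))" "integrable lborel (\<lambda>y. mol h (x - y) * (q2 t y \<bullet> b))"
      proof -
       have "integrable lborel (\<lambda>y. q1 t y \<bullet> b)" "integrable lborel (\<lambda>y. q2 t y \<bullet> b)" using elim(2) t by auto
       from integrable_mol_kernel[OF this(1) h(1), of x] integrable_mol_kernel[OF this(2) h(1), of x]
       show "integrable lborel (\<lambda>y. mol h (x - y) * (q1 t y \<bullet> b))" "integrable lborel (\<lambda>y. mol h (x - y) * (q2 t y \<bullet> b))" by simp_all
      qed
      have zi: "integrable lborel (\<lambda>y. dmol h b (x - y) * R1 (t, y) powr (r + 1 / 2))" "integrable lborel (\<lambda>y. dmol h b (x - y) * R2 (t, y) powr (r + 1 / 2))"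
       using integrable_dmol_kernel[OF d1.pressure_int h(1) b, of x] integrable_dmol_kernel[OF d2.pressure_int h(1) b, of x] by simp_all
      have "(LI y. dmol h b (x - y) * z t y) = (LI y. dmol h b (x - y) * R1 (t, y) powr (r + 1 / 2)) - (LI y. dmol h b (x - y) * R2 (t, y) powr (r + 1 / 2))"
       using zi by (simp add: z_def right_diff_distrib)
      also have "... = (LI y. mol h (x - y) * (q1 t y \<bullet> b)) - (LI y. mol h (x - y) * (q2 t y \<bullet> b))"
       unfolding q1_def q2_def c_def dens_flux_gradient[OF d1.dens_axioms h(1) b] dens_flux_gradient[OF d2.dens_axioms h(1) b] ..
      also have "... = (LI y. mol h (x - y) * (q t y \<bullet> b))"
       using qi by (simp add: q_def right_diff_distrib inner_diff_left)
      finally show "(LI y. dmol h b (x - y) * z t y) = (LI y. mol h (x - y) * (q t y \<bullet> b))" .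
     qed
    qed
    show "AE t\<in>{0<..<T} in lborel. - (LI x. cv (mol h) (w t) x * cv (mol h) (z t) x) \<le> 4 * h powr (1 + p) * E"
     using pair
    proof eventually_elim
     case (elim t)
     show ?case
     proof
      assume t: "t \<in> {0<..<T}"
      interpret dens_pair "\<lambda>x. R1 (t, x) powr r" "\<lambda>x. R2 (t, x) powr r" "\<lambda>x. G1 (t, x)" "\<lambda>x. G2 (t, x)" A "\<lambda>x. R1 (t, x)" "\<lambda>x. R2 (t, x)" r
       using elim t by blast
      show "- (LI x. cv (mol h) (w t) x * cv (mol h) (z t) x) \<le> 4 * h powr (1 + p) * E"
       using pressure_error[OF h(1) p] unfolding w_def z_def E0_def E_def .
     qed
    qed
    show "AE t\<in>{0<..<T} in lborel. (NI x. ennreal ((norm (cv (mol h) (J t) x))^2)) \<le> ennreal j"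
     using parts
    proof eventually_elim
     case (elim t)
     show ?case
     proof
      assume t: "t \<in> {0<..<T}"
      note el = elim[THEN mp, OF t]
      have Ji: "integrable lborel (J1 t)" "integrable lborel (J2 t)" using el by auto
      have [measurable]: "cv (mol h) (J1 t) \<in> borel_measurable borel" "cv (mol h) (J2 t) \<in> borel_measurable borel"
       using Ji by (auto intro!: cv_measurable)
      have "(NI x. ennreal ((norm (cv (mol h) (J t) x))^2))
        \<le> (NI x. 2 * ennreal ((norm (cv (mol h) (J1 t) x))^2) + 2 * ennreal ((norm (cv (mol h) (J2 t) x))^2))"
      proof (rule nn_integral_mono)
       fix x
       have "cv (mol h) (J t) x = cv (mol h) (J1 t) x - cv (mol h) (J2 t) x"
        unfolding J_def using cv_diff[OF Ji mol_measurable mol_abs_bound[OF h(1)]] .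
       then have "(norm (cv (mol h) (J t) x))^2 \<le> 2 * (norm (cv (mol h) (J1 t) x))^2 + 2 * (norm (cv (mol h) (J2 t) x))^2"
        using norm_diff_square_le by metis
       then show "ennreal ((norm (cv (mol h) (J t) x))^2) \<le> 2 * ennreal ((norm (cv (mol h) (J1 t) x))^2) + 2 * ennreal ((norm (cv (mol h) (J2 t) x))^2)"
        by (subst twice_ennreal_add) (simp_all add: ennreal_leI del: ennreal_plus)
      qed
      also have "... = 2 * (NI x. ennreal ((norm (cv (mol h) (J1 t) x))^2)) + 2 * (NI x. ennreal ((norm (cv (mol h) (J2 t) x))^2))"
       by (simp add: nn_integral_add nn_integral_cmult)
      also have "... \<le> 2 * ennreal (C1 * (A * \<epsilon>) * h powr (- (s / r))) + 2 * ennreal (C1 * (A * \<delta>) * h powr (- (s / r)))"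
       using el by (intro add_mono mult_left_mono) auto
      also have "... = ennreal (2 * (C1 * (A * \<epsilon>) * h powr (- (s / r))) + 2 * (C1 * (A * \<delta>) * h powr (- (s / r))))"
       using C1 A del by (intro twice_ennreal_add) auto
      also have "... \<le> ennreal j"
      proof (rule ennreal_leI)
       have "C1 * (A * \<delta>) * h powr (- (s / r)) \<le> C1 * (A * \<epsilon>) * h powr (- (s / r))"
        using C1 A del by (intro mult_right_mono mult_left_mono) auto
       moreover have "j = 4 * (C1 * (A * \<epsilon>) * h powr (- (s / r)))" by (simp add: j_def)
       ultimately show "2 * (C1 * (A * \<epsilon>) * h powr (- (s / r))) + 2 * (C1 * (A * \<delta>) * h powr (- (s / r))) \<le> j" by linarith
      qed
      finally show "(NI x. ennreal ((norm (cv (mol h) (J t) x))^2)) \<le> ennreal j" .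
     qed
    qed
   qed
   also have "... = 16 * T\<^sup>2 * C1 * A * (\<epsilon> * h powr (- (s / r))) + 16 * T * E * h powr (1 + p)" by (simp add: j_def)
   also have "... \<le> 16 * T\<^sup>2 * C1 * A * \<kappa>\<^sup>2 + 16 * T * E * \<kappa>\<^sup>2"
    using C1 A T E small by (intro add_mono mult_left_mono) auto
   also have "... = C2 * \<kappa>\<^sup>2" by (simp add: C2_def distrib_right)
   finally show ?thesis .
  qed
  have g1: "AE t\<in>{0<..<T} in lborel. (\<forall>x. \<forall>b\<in>Basis.
    (LI y. dmol h b (x - y) * R1 (t, y) powr r) = (LI y. mol h (x - y) * (G1 (t, y) \<bullet> b)))"
   using F1 h(1) unfolding flow_def by blast
  have g2: "AE t\<in>{0<..<T} in lborel. (\<forall>x. \<forall>b\<in>Basis.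
    (LI y. dmol h b (x - y) * R2 (t, y) powr r) = (LI y. mol h (x - y) * (G2 (t, y) \<bullet> b)))"
   using F2 h(1) unfolding flow_def by blast
  show ?thesis
   using pair repr g1 g2
  proof eventually_elim
   case (elim t)
   show ?case
   proof
    assume t: "t \<in> {0<..<T}"
    note el = elim(1)[THEN mp, OF t] elim(2)[THEN mp, OF t] elim(3)[THEN mp, OF t] elim(4)[THEN mp, OF t]
    interpret dp: dens_pair "\<lambda>x. R1 (t, x) powr r" "\<lambda>x. R2 (t, x) powr r" "\<lambda>x. G1 (t, x)" "\<lambda>x. G2 (t, x)" A "\<lambda>x. R1 (t, x)" "\<lambda>x. R2 (t, x)" r
     using el(1) by blast
    \<comment> \<open>Now the gradient of the difference of the r-th powers is tested with U: it is
      bounded but not small, and the smallness comes from \<open>Uh2\<close> alone.\<close>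
    define v where "v x = G1 (t, x) - G2 (t, x)" for x
    have vm [measurable]: "v \<in> borel_measurable borel" unfolding v_def[abs_def] by measurable
    have vle: "(norm (v x))^2 \<le> 2 * (norm (G1 (t, x)))^2 + 2 * (norm (G2 (t, x)))^2" for x
     unfolding v_def by (rule norm_diff_square_le)
    have gi: "integrable lborel (\<lambda>x. 2 * (norm (G1 (t, x)))^2 + 2 * (norm (G2 (t, x)))^2)" using dp.d1.G_sq dp.d2.G_sq by auto
    have v2: "integrable lborel (\<lambda>x. (norm (v x))^2)"
     by (rule integrable_nonneg_bound[OF gi _ _ vle]) auto
    have "(LI x. (norm (v x))^2) \<le> (LI x. 2 * (norm (G1 (t, x)))^2 + 2 * (norm (G2 (t, x)))^2)"
     by (rule integral_mono[OF v2 gi vle])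
    also have "... = 2 * (LI x. (norm (G1 (t, x)))^2) + 2 * (LI x. (norm (G2 (t, x)))^2)" using dp.d1.G_sq dp.d2.G_sq by simp
    also have "... \<le> 4 * A" using dp.d1.G_L2 dp.d2.G_L2 by linarith
    finally have v2A: "(LI x. (norm (v x))^2) \<le> 4 * A" .
    have grad: "(LI y. dmol h b (x - y) * (R1 (t, y) powr r - R2 (t, y) powr r)) = (LI y. mol h (x - y) * (v y \<bullet> b))"
     if b: "b \<in> Basis" for x b
    proof -
     have "integrable lborel (\<lambda>y. dmol h b (x - y) * R1 (t, y) powr r)" "integrable lborel (\<lambda>y. dmol h b (x - y) * R2 (t, y) powr r)"
      using integrable_dmol_kernel[OF dp.d1.f_int h(1) b, of x] integrable_dmol_kernel[OF dp.d2.f_int h(1) b, of x] by simp_all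
     moreover have "integrable lborel (\<lambda>y. mol h (x - y) * (G1 (t, y) \<bullet> b))" "integrable lborel (\<lambda>y. mol h (x - y) * (G2 (t, y) \<bullet> b))"
      by (rule dp.d1.mol_G_integrable[OF h(1)] dp.d2.mol_G_integrable[OF h(1)])+
     ultimately show ?thesis using el(3,4) b by (simp add: v_def right_diff_distrib inner_diff_left)
    qed
    have "(LI x. cv (mol h) (w t) x * cv (mol h) (\<lambda>y. R1 (t, y) powr r - R2 (t, y) powr r) x) \<le> (C2 + 4 * A) * \<kappa>"
     using el(2) by (intro m.mollified_product_bound[OF \<kappa> dp.F_int vm v2 v2A _ grad _ Uh2[OF t]] integrable_mol_square_integrable[OF h(1) vm v2]) auto
    moreover have "2 * h * E \<le> 2 * E * \<kappa>" using small(3) E mult_left_mono[of h \<kappa> "2 * E"] by (simp add: mult_ac)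
    moreover have "C3 * \<kappa> = (C2 + 4 * A) * \<kappa> + 2 * E * \<kappa> + \<kappa>" by (simp add: C3_def distrib_right)
    ultimately have Y: "(LI x. cv (mol h) (\<lambda>y. R1 (t, y) - R2 (t, y)) x * cv (mol h) (\<lambda>y. R1 (t, y) powr r - R2 (t, y) powr r) x) + 2 * h * dp.E0 \<le> C3 * \<kappa>"
     using \<kappa> unfolding w_def dp.E0_def E_def[symmetric] by linarith
    have "(NI x. ennreal ((\<rho>1 t x - \<rho>2 t x)^2)) = (NI x. ennreal ((R1 (t, x) - R2 (t, x))^2))"
    proof (rule nn_integral_cong_AE)
     show "AE x in lborel. ennreal ((\<rho>1 t x - \<rho>2 t x)^2) = ennreal ((R1 (t, x) - R2 (t, x))^2)"
      using conjunct1[OF el(1)] by eventually_elim simp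
    qed
    also have "... \<le> ennreal ((2 * A + 1) * (C3 * \<kappa>) powr (1 / r))"
     using C3 \<kappa> by (intro dp.L2_of_mollified[OF h(1) Y]) simp
    also have "(C3 * \<kappa>) powr (1 / r) = C3 powr (1 / r) * \<kappa> powr (1 / r)" using C3 \<kappa> by (simp add: powr_mult)
    finally show "(NI x. ennreal ((\<rho>1 t x - \<rho>2 t x)^2)) \<le> ennreal ((2 * A + 1) * C3 powr (1 / r) * \<kappa> powr (1 / r))"
     by (simp add: mult.assoc)
   qed
  qed
 qed
 have "0 < (2 * A + 1) * C3 powr (1 / r)" using A C3 by simp
 with key show ?thesis by blast
qed

text \<open>Lower semicontinuity of the L2 norm under local L1 convergence: on each ball a
  subsequence converges almost everywhere and Fatou applies, then the balls exhaust the
  space.\<close>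

lemma L2_limit:
 fixes g :: "nat \<Rightarrow> 'a::euclidean_space \<Rightarrow> real"
 assumes gm [measurable]: "\<And>n. g n \<in> borel_measurable borel" and fm [measurable]: "f \<in> borel_measurable borel"
  and lim: "\<And>A. compact A \<Longrightarrow> (\<lambda>n. Lq_norm 1 A (\<lambda>x. g n x - f x)) \<longlonglongrightarrow> 0"
  and L: "\<And>n. (NI x. ennreal ((g n x)^2)) \<le> L"
 shows "(NI x. ennreal ((f x)^2)) \<le> L"
proof -
 have loc: "(NI x. ennreal ((f x)^2) * indicator (cball 0 (real m)) x) \<le> L" for m
 proof -
  define A where "A = cball (0::'a) (real m)"
  have [measurable]: "A \<in> sets borel" by (simp add: A_def)
  have t0: "(\<lambda>n. Lq_norm 1 A (\<lambda>x. g n x - f x)) \<longlonglongrightarrow> 0" by (rule lim) (simp add: A_def)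
  \<comment> \<open>The first terms may have infinite norm; the sequence is shifted by
    \<open>N\<close> so that all differences are integrable on the ball.\<close>
  then have "\<forall>\<^sub>F n in sequentially. Lq_norm 1 A (\<lambda>x. g n x - f x) < 1" by (rule order_tendstoD) simp
  then obtain N where N: "\<And>n. N \<le> n \<Longrightarrow> Lq_norm 1 A (\<lambda>x. g n x - f x) < 1" by (auto simp: eventually_sequentially)
  define v where "v n x = indicator A x * (g (n + N) x - f x)" for n x
  have [measurable]: "v n \<in> borel_measurable borel" for n unfolding v_def[abs_def] by measurable
  have nn: "(NI x. ennreal (norm (v n x))) = Lq_norm 1 A (\<lambda>x. g (n + N) x - f x)" for n
   unfolding Lq_norm_1 by (rule nn_integral_cong) (auto simp: v_def indicator_def)
  have vi: "integrable lborel (v n)" for n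
  proof (rule integrableI_bounded)
   show "(NI x. ennreal (norm (v n x))) < \<infinity>"
    unfolding nn using N[of "n + N"] by (auto intro: less_trans)
  qed simp
  have "(\<lambda>n. ennreal (LI x. norm (v n x))) = (\<lambda>n. Lq_norm 1 A (\<lambda>x. g (n + N) x - f x))"
   by (rule ext) (simp only: nn[symmetric] nn_integral_eq_integral[OF integrable_norm[OF vi]] norm_ge_zero AE_I2)
  then have "(\<lambda>n. ennreal (LI x. norm (v n x))) \<longlonglongrightarrow> ennreal 0"
   using LIMSEQ_ignore_initial_segment[OF t0, of N] by simp
  then have "(\<lambda>n. (LI x. norm (v n x))) \<longlonglongrightarrow> 0"
   by (rule tendsto_ennrealD) (simp_all add: integral_nonneg_AE)
  from tendsto_L1_AE_subseq[OF vi this] obtain r where r: "strict_mono r" "AE x in lborel. (\<lambda>n. v (r n) x) \<longlonglongrightarrow> 0" by blast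
  have "(NI x. ennreal ((f x)^2) * indicator A x)
    \<le> (NI x. liminf (\<lambda>n. ennreal ((g (r n + N) x)^2) * indicator A x))"
  proof (rule nn_integral_mono_AE)
   show "AE x in lborel. ennreal ((f x)^2) * indicator A x \<le> liminf (\<lambda>n. ennreal ((g (r n + N) x)^2) * indicator A x)"
    using r(2)
   proof eventually_elim
    case (elim x)
    show ?case
    proof (cases "x \<in> A")
     case True
     then have "(\<lambda>n. g (r n + N) x - f x) \<longlonglongrightarrow> 0" using elim by (simp add: v_def)
     then have "(\<lambda>n. g (r n + N) x) \<longlonglongrightarrow> f x" by (simp add: LIM_zero_iff)
     then have "(\<lambda>n. ennreal ((g (r n + N) x)^2)) \<longlonglongrightarrow> ennreal ((f x)^2)" by (intro tendsto_ennrealI tendsto_power)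
     then have "liminf (\<lambda>n. ennreal ((g (r n + N) x)^2)) = ennreal ((f x)^2)" by (intro lim_imp_Liminf) simp_all
     then show ?thesis using True by simp
    qed simp
   qed
  qed
  also have "... \<le> liminf (\<lambda>n. (NI x. ennreal ((g (r n + N) x)^2) * indicator A x))"
   by (rule nn_integral_liminf) measurable
  also have "... \<le> liminf (\<lambda>n::nat. L)"
  proof (rule Liminf_mono, rule always_eventually, rule allI)
   fix n
   have "(NI x. ennreal ((g (r n + N) x)^2) * indicator A x) \<le> (NI x. ennreal ((g (r n + N) x)^2))"
    by (rule nn_integral_mono) (simp add: indicator_def)
   then show "(NI x. ennreal ((g (r n + N) x)^2) * indicator A x) \<le> L" using L order_trans by blast
  qed
  finally show ?thesis by (simp add: A_def Liminf_const)
 qed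
 have "(NI x. ennreal ((f x)^2)) = (NI x. (SUP m. ennreal ((f x)^2) * indicator (cball 0 (real m)) x))"
 proof (rule nn_integral_cong, rule antisym)
  fix x :: 'a
  obtain m where "norm x \<le> real m" using real_arch_simple by blast
  then have "ennreal ((f x)^2) = ennreal ((f x)^2) * indicator (cball 0 (real m)) x" by simp
  also have "... \<le> (SUP m. ennreal ((f x)^2) * indicator (cball 0 (real m)) x)" by (rule SUP_upper) simp
  finally show "ennreal ((f x)^2) \<le> (SUP m. ennreal ((f x)^2) * indicator (cball 0 (real m)) x)" .
  show "(SUP m. ennreal ((f x)^2) * indicator (cball 0 (real m)) x) \<le> ennreal ((f x)^2)"
   by (rule SUP_least) (simp add: indicator_def)
 qed
 also have "... = (SUP m. (NI x. ennreal ((f x)^2) * indicator (cball 0 (real m)) x))"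
 proof (rule nn_integral_monotone_convergence_SUP)
  show "incseq (\<lambda>m x. ennreal ((f x)^2) * indicator (cball (0::'a) (real m)) x)"
   by (auto simp: incseq_def le_fun_def indicator_def)
  have [measurable]: "cball (0::'a) (real m) \<in> sets borel" for m by simp
  show "(\<lambda>x. ennreal ((f x)^2) * indicator (cball 0 (real m)) x) \<in> borel_measurable lborel" for m by measurable
 qed
 also have "... \<le> L" by (rule SUP_least) (rule loc)
 finally show ?thesis .
qed

text \<open>Times of full measure accumulate at every point of the closed interval, end points
  included. The chosen time differs from \<open>t\<close> because the filter
  \<open>at t within {0..T}\<close> is punctured.\<close>

lemma AE_pick:
 fixes T t d :: real
 assumes P: "AE s\<in>{0<..<T} in lborel. P s" and T: "0 < T" and t: "t \<in> {0..T}" and d: "0 < d"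
 shows "\<exists>s\<in>{0<..<T}. s \<noteq> t \<and> \<bar>s - t\<bar> < d \<and> P s"
proof (rule ccontr)
 assume n: "\<not> ?thesis"
 define lo where "lo = max 0 (t - d)"
 define hi where "hi = min T (t + d)"
 define I where "I = {lo<..<hi}"
 have "AE s in lborel. s \<notin> I"
  using P AE_lborel_singleton[of t]
 proof eventually_elim
  case (elim s)
  show ?case
  proof
   assume "s \<in> I"
   then have "s \<in> {0<..<T}" "\<bar>s - t\<bar> < d" by (auto simp: I_def lo_def hi_def)
   then show False using n elim by auto
  qed
 qed
 then have "I \<in> null_sets lborel" by (subst AE_iff_null_sets) (auto simp: I_def)
 then have "emeasure lborel I = 0" by auto
 moreover have "lo < hi" using T t d by (auto simp: lo_def hi_def)
 ultimately show False by (simp add: I_def)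
qed

lemma Lq_norm_1_diff:
 fixes a b :: "'a::euclidean_space \<Rightarrow> real"
 assumes [measurable]: "a \<in> borel_measurable borel" "b \<in> borel_measurable borel" "A \<in> sets borel"
 shows "Lq_norm 1 A (\<lambda>x. a x - b x) \<le> Lq_norm 1 A a + Lq_norm 1 A b"
proof -
 have "Lq_norm 1 A (\<lambda>x. a x - b x) \<le> (NI x. ennreal (norm (a x)) * indicator A x + ennreal (norm (b x)) * indicator A x)"
  unfolding Lq_norm_1
 proof (rule nn_integral_mono)
  fix x
  have "ennreal (norm (a x - b x)) \<le> ennreal (norm (a x) + norm (b x))" by (intro ennreal_leI norm_triangle_ineq4)
  then show "ennreal (norm (a x - b x)) * indicator A x \<le> ennreal (norm (a x)) * indicator A x + ennreal (norm (b x)) * indicator A x"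
   by (cases "x \<in> A") simp_all
 qed
 also have "... = Lq_norm 1 A a + Lq_norm 1 A b"
  unfolding Lq_norm_1 by (rule nn_integral_add) measurable
 finally show ?thesis .
qed

lemma C_Lq_loc_measurable: "C_Lq_loc T q f \<Longrightarrow> t \<in> {0..T} \<Longrightarrow> (f t :: 'a::euclidean_space \<Rightarrow> real) \<in> borel_measurable borel"
 by (intro measurable_of_compact) (auto simp: C_Lq_loc_def in_Lq_def)

text \<open>The bound holds along times converging to \<open>t\<close>, and continuity in local L1
  together with lower semicontinuity of the L2 norm carries it to \<open>t\<close> itself.\<close>

lemma L2_all_times:
 fixes \<rho>1 \<rho>2 :: "real \<Rightarrow> 'a::euclidean_space \<Rightarrow> real"
 assumes T: "0 < T" and C1: "C_Lq_loc T 1 \<rho>1" and C2: "C_Lq_loc T 1 \<rho>2"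
  and L: "AE t\<in>{0<..<T} in lborel. (NI x. ennreal ((\<rho>1 t x - \<rho>2 t x)^2)) \<le> L"
  and t: "t \<in> {0..T}"
 shows "(NI x. ennreal ((\<rho>1 t x - \<rho>2 t x)^2)) \<le> L"
proof -
 have "\<forall>n. \<exists>s\<in>{0<..<T}. s \<noteq> t \<and> \<bar>s - t\<bar> < 1 / real (Suc n) \<and> (NI x. ennreal ((\<rho>1 s x - \<rho>2 s x)^2)) \<le> L"
  by (intro allI AE_pick[OF L T t]) simp
 then obtain s where s: "\<And>n. s n \<in> {0<..<T}" "\<And>n. s n \<noteq> t" "\<And>n. \<bar>s n - t\<bar> < 1 / real (Suc n)"
  "\<And>n. (NI x. ennreal ((\<rho>1 (s n) x - \<rho>2 (s n) x)^2)) \<le> L" by metis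
 have "(\<lambda>n. s n - t) \<longlonglongrightarrow> 0"
 proof (rule Lim_null_comparison)
  show "\<forall>\<^sub>F n in sequentially. norm (s n - t) \<le> 1 / real (Suc n)"
   using s(3) by (intro always_eventually) (auto intro: less_imp_le)
  show "(\<lambda>k. 1 / real (Suc k)) \<longlonglongrightarrow> 0" by (rule LIMSEQ_Suc[OF lim_inverse_n'])
 qed
 then have "s \<longlonglongrightarrow> t" by (simp add: LIM_zero_iff)
 then have fl: "filterlim s (at t within {0..T}) sequentially"
  using s(1,2) by (auto simp: filterlim_at intro!: always_eventually less_imp_le)
 have sin: "s n \<in> {0..T}" for n using s(1)[of n] by auto
 have m: "\<rho>1 a \<in> borel_measurable borel" "\<rho>2 a \<in> borel_measurable borel" if "a \<in> {0..T}" for a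
  using C_Lq_loc_measurable C1 C2 that by blast+
 show ?thesis
 proof (rule L2_limit[where g = "\<lambda>n x. \<rho>1 (s n) x - \<rho>2 (s n) x"])
  show "(\<lambda>x. \<rho>1 (s n) x - \<rho>2 (s n) x) \<in> borel_measurable borel" for n
   using m[OF sin[of n]] by (rule borel_measurable_diff)
  show "(\<lambda>x. \<rho>1 t x - \<rho>2 t x) \<in> borel_measurable borel"
   using m[OF t] by (rule borel_measurable_diff)
  show "(\<lambda>n. Lq_norm 1 A (\<lambda>x. (\<rho>1 (s n) x - \<rho>2 (s n) x) - (\<rho>1 t x - \<rho>2 t x))) \<longlonglongrightarrow> 0" if A: "compact A" for A
  proof (rule tendsto_sandwich[OF _ _ tendsto_const])
   have As: "A \<in> sets borel" using A by (simp add: compact_imp_closed borel_closed)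
   have "((\<lambda>a. Lq_norm 1 A (\<lambda>x. \<rho>1 a x - \<rho>1 t x)) \<longlongrightarrow> 0) (at t within {0..T})"
    "((\<lambda>a. Lq_norm 1 A (\<lambda>x. \<rho>2 a x - \<rho>2 t x)) \<longlongrightarrow> 0) (at t within {0..T})"
    using C1 C2 A t unfolding C_Lq_loc_def by blast+
   then have "(\<lambda>n. Lq_norm 1 A (\<lambda>x. \<rho>1 (s n) x - \<rho>1 t x)) \<longlonglongrightarrow> 0" "(\<lambda>n. Lq_norm 1 A (\<lambda>x. \<rho>2 (s n) x - \<rho>2 t x)) \<longlonglongrightarrow> 0"
    by (auto intro: filterlim_compose[OF _ fl])
   from tendsto_add[OF this]
   show "(\<lambda>n. Lq_norm 1 A (\<lambda>x. \<rho>1 (s n) x - \<rho>1 t x) + Lq_norm 1 A (\<lambda>x. \<rho>2 (s n) x - \<rho>2 t x)) \<longlonglongrightarrow> 0" by simp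
   show "\<forall>\<^sub>F n in sequentially. Lq_norm 1 A (\<lambda>x. (\<rho>1 (s n) x - \<rho>2 (s n) x) - (\<rho>1 t x - \<rho>2 t x))
     \<le> Lq_norm 1 A (\<lambda>x. \<rho>1 (s n) x - \<rho>1 t x) + Lq_norm 1 A (\<lambda>x. \<rho>2 (s n) x - \<rho>2 t x)"
   proof (rule always_eventually, rule allI)
    fix n
    have "(\<lambda>x. (\<rho>1 (s n) x - \<rho>2 (s n) x) - (\<rho>1 t x - \<rho>2 t x)) = (\<lambda>x. (\<rho>1 (s n) x - \<rho>1 t x) - (\<rho>2 (s n) x - \<rho>2 t x))"
     by (rule ext) simp
    then show "Lq_norm 1 A (\<lambda>x. (\<rho>1 (s n) x - \<rho>2 (s n) x) - (\<rho>1 t x - \<rho>2 t x))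
     \<le> Lq_norm 1 A (\<lambda>x. \<rho>1 (s n) x - \<rho>1 t x) + Lq_norm 1 A (\<lambda>x. \<rho>2 (s n) x - \<rho>2 t x)"
     using Lq_norm_1_diff[OF borel_measurable_diff[OF m(1)[OF sin[of n]] m(1)[OF t]] borel_measurable_diff[OF m(2)[OF sin[of n]] m(2)[OF t]] As] by simp
   qed
  qed simp
  show "(NI x. ennreal ((\<rho>1 (s n) x - \<rho>2 (s n) x)^2)) \<le> L" for n by (rule s(4))
 qed
qed

text \<open>With h = \<epsilon>^a and \<kappa> = \<epsilon>^b the conditions of
  \<open>pair_estimate\<close> become linear inequalities between exponents, since \<epsilon> < 1.
  The squared norm is of order \<kappa>^(1/r), hence the rate b/(2r).\<close>

lemma convergence_rate:
 fixes \<rho>e :: "real \<Rightarrow> real \<Rightarrow> 'a::euclidean_space \<Rightarrow> real" and \<rho> :: "real \<Rightarrow> 'a \<Rightarrow> real" and A T r s p a b :: real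
 assumes dim: "real DIM('a::euclidean_space) / 2 - 1 \<le> s" and s: "0 < s" and r: "1 \<le> r" and T: "0 < T" and A: "0 \<le> A"
  and p: "0 \<le> p" "p < 1" "p * r \<le> 1" "1 \<le> (3 - 2 * p * r) / (1 - p)" "(3 - 2 * p * r) / (1 - p) \<le> 4 * r"
  and ab: "0 \<le> a" "b \<le> a" "2 * b \<le> 1 - a * (s / r)" "2 * b \<le> a * (1 + p)"
  and flows: "\<And>\<epsilon>. \<epsilon> \<in> {0<..<1} \<Longrightarrow> \<exists>R G S. flow T r A \<epsilon> \<rho>0 (\<rho>e \<epsilon>) R G S"
  and C: "\<And>\<epsilon>. \<epsilon> \<in> {0<..<1} \<Longrightarrow> C_Lq_loc T 1 (\<rho>e \<epsilon>)"
  and e: "\<And>k. e k \<in> {0<..<1}" "e \<longlonglongrightarrow> (0::real)" and conv: "conv_C_Lq_loc T 1 (\<lambda>k. \<rho>e (e k)) \<rho>"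
 shows "\<exists>C>0. \<forall>\<epsilon>\<in>{0<..<1}. (SUP t\<in>{0..T}. Lq_norm 2 UNIV (\<lambda>x. \<rho>e \<epsilon> t x - \<rho> t x)) \<le> ennreal (C * \<epsilon> powr (b / (2 * r)))"
proof -
 obtain K where K: "0 < K" and pair: "\<And>\<epsilon> \<delta> h \<kappa> (\<rho>0 :: 'a \<Rightarrow> real) \<rho>1 \<rho>2 R1 G1 S1 R2 G2 S2.
  flow T r A \<epsilon> \<rho>0 \<rho>1 R1 G1 S1 \<Longrightarrow> flow T r A \<delta> \<rho>0 \<rho>2 R2 G2 S2 \<Longrightarrow> 0 < \<delta> \<Longrightarrow> \<delta> \<le> \<epsilon> \<Longrightarrow> 0 < h \<Longrightarrow> h \<le> 1 \<Longrightarrow> 0 < \<kappa> \<Longrightarrow>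
  \<epsilon> * h powr (- (s / r)) \<le> \<kappa>\<^sup>2 \<Longrightarrow> h powr (1 + p) \<le> \<kappa>\<^sup>2 \<Longrightarrow> h \<le> \<kappa> \<Longrightarrow>
  (AE t\<in>{0<..<T} in lborel. (NI x. ennreal ((\<rho>1 t x - \<rho>2 t x)^2)) \<le> ennreal (K * \<kappa> powr (1 / r)))"
  using pair_estimate[OF dim s r T A p] by blast
 have main: "Lq_norm 2 UNIV (\<lambda>x. \<rho>e \<epsilon> t x - \<rho> t x) \<le> ennreal (sqrt K * \<epsilon> powr (b / (2 * r)))"
  if eps: "\<epsilon> \<in> {0<..<1}" and t: "t \<in> {0..T}" for \<epsilon> t
 proof -
  have e0: "0 < \<epsilon>" "\<epsilon> < 1" using eps by auto
  define h where "h = \<epsilon> powr a"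
  define \<kappa> where "\<kappa> = \<epsilon> powr b"
  have anti: "\<epsilon> powr y \<le> \<epsilon> powr x" if "x \<le> y" for x y using powr_mono'[OF that, of \<epsilon>] e0 by simp
  have h: "0 < h" "h \<le> 1" using e0 anti[of 0 a] ab(1) by (simp_all add: h_def)
  have \<kappa>: "0 < \<kappa>" using e0 by (simp add: \<kappa>_def)
  have \<kappa>2: "\<kappa>\<^sup>2 = \<epsilon> powr (2 * b)" by (simp add: \<kappa>_def power2_eq_square powr_add[symmetric])
  have "\<epsilon> * h powr (- (s / r)) = \<epsilon> powr 1 * \<epsilon> powr (a * (- (s / r)))" using e0 by (simp add: h_def powr_powr)
  also have "... = \<epsilon> powr (1 - a * (s / r))" by (subst powr_add[symmetric]) simp
  also have "... \<le> \<kappa>\<^sup>2" unfolding \<kappa>2 by (rule anti[OF ab(3)])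
  finally have 1: "\<epsilon> * h powr (- (s / r)) \<le> \<kappa>\<^sup>2" .
  have 2: "h powr (1 + p) \<le> \<kappa>\<^sup>2" unfolding \<kappa>2 h_def powr_powr by (rule anti[OF ab(4)])
  have 3: "h \<le> \<kappa>" unfolding h_def \<kappa>_def by (rule anti[OF ab(2)])
  define L where "L = K * \<kappa> powr (1 / r)"
  obtain R1 G1 S1 where F1: "flow T r A \<epsilon> \<rho>0 (\<rho>e \<epsilon>) R1 G1 S1" using flows[OF eps] by blast
  have pairL: "(NI x. ennreal ((\<rho>e \<epsilon> t x - \<rho>e \<delta> t x)^2)) \<le> ennreal L" if del: "\<delta> \<in> {0<..<1}" "\<delta> \<le> \<epsilon>" for \<delta>
  proof -
   obtain R2 G2 S2 where F2: "flow T r A \<delta> \<rho>0 (\<rho>e \<delta>) R2 G2 S2" using flows[OF del(1)] by blast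
   have "0 < \<delta>" using del by simp
   from pair[OF F1 F2 this del(2) h \<kappa> 1 2 3] show ?thesis
    unfolding L_def[symmetric] by (rule L2_all_times[OF T C[OF eps] C[OF del(1)] _ t])
  qed
  \<comment> \<open>Only members of the subsequence below \<epsilon> are compared with it, so
    \<epsilon> need not belong to the subsequence.\<close>
  have "\<forall>\<^sub>F k in sequentially. e k < \<epsilon>" using e(2) e0 by (auto dest: order_tendstoD)
  then obtain N where N: "\<And>k. N \<le> k \<Longrightarrow> e k < \<epsilon>" by (auto simp: eventually_sequentially)
  have C\<rho>: "C_Lq_loc T 1 \<rho>" using conv by (simp add: conv_C_Lq_loc_def)
  have m: "\<rho>e \<epsilon> t \<in> borel_measurable borel" "\<rho> t \<in> borel_measurable borel" "\<And>k. \<rho>e (e k) t \<in> borel_measurable borel"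
   using C_Lq_loc_measurable[OF C[OF eps] t] C_Lq_loc_measurable[OF C\<rho> t] C_Lq_loc_measurable[OF C[OF e(1)] t] by blast+
  have "(NI x. ennreal ((\<rho>e \<epsilon> t x - \<rho> t x)^2)) \<le> ennreal L"
  proof (rule L2_limit[where g = "\<lambda>k x. \<rho>e \<epsilon> t x - \<rho>e (e (k + N)) t x"])
   show "(\<lambda>x. \<rho>e \<epsilon> t x - \<rho>e (e (k + N)) t x) \<in> borel_measurable borel" for k
    using m(1) m(3) by (rule borel_measurable_diff)
   show "(\<lambda>x. \<rho>e \<epsilon> t x - \<rho> t x) \<in> borel_measurable borel" using m(1,2) by (rule borel_measurable_diff)
   show "(NI x. ennreal ((\<rho>e \<epsilon> t x - \<rho>e (e (k + N)) t x)^2)) \<le> ennreal L" for k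
    using N[of "k + N"] by (intro pairL e(1)) auto
   show "(\<lambda>k. Lq_norm 1 B (\<lambda>x. (\<rho>e \<epsilon> t x - \<rho>e (e (k + N)) t x) - (\<rho>e \<epsilon> t x - \<rho> t x))) \<longlonglongrightarrow> 0" if B: "compact B" for B
   proof (rule tendsto_sandwich[OF _ _ tendsto_const])
    have "(\<lambda>k. SUP t\<in>{0..T}. Lq_norm 1 B (\<lambda>x. \<rho>e (e k) t x - \<rho> t x)) \<longlonglongrightarrow> 0"
     using conv B unfolding conv_C_Lq_loc_def by blast
    from LIMSEQ_ignore_initial_segment[OF this, of N]
    show "(\<lambda>k. SUP t\<in>{0..T}. Lq_norm 1 B (\<lambda>x. \<rho>e (e (k + N)) t x - \<rho> t x)) \<longlonglongrightarrow> 0" .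
    show "\<forall>\<^sub>F k in sequentially. Lq_norm 1 B (\<lambda>x. (\<rho>e \<epsilon> t x - \<rho>e (e (k + N)) t x) - (\<rho>e \<epsilon> t x - \<rho> t x))
      \<le> (SUP t\<in>{0..T}. Lq_norm 1 B (\<lambda>x. \<rho>e (e (k + N)) t x - \<rho> t x))"
    proof (rule always_eventually, rule allI)
     fix k
     have "Lq_norm 1 B (\<lambda>x. (\<rho>e \<epsilon> t x - \<rho>e (e (k + N)) t x) - (\<rho>e \<epsilon> t x - \<rho> t x)) = Lq_norm 1 B (\<lambda>x. \<rho>e (e (k + N)) t x - \<rho> t x)"
      unfolding Lq_norm_1 by (rule nn_integral_cong) (simp add: abs_minus_commute)
     also have "... \<le> (SUP t\<in>{0..T}. Lq_norm 1 B (\<lambda>x. \<rho>e (e (k + N)) t x - \<rho> t x))" using t by (rule SUP_upper)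
     finally show "Lq_norm 1 B (\<lambda>x. (\<rho>e \<epsilon> t x - \<rho>e (e (k + N)) t x) - (\<rho>e \<epsilon> t x - \<rho> t x))
      \<le> (SUP t\<in>{0..T}. Lq_norm 1 B (\<lambda>x. \<rho>e (e (k + N)) t x - \<rho> t x))" .
    qed
   qed simp
  qed
  moreover have "(sqrt K * \<epsilon> powr (b / (2 * r))) powr 2 = L"
  proof -
   have "\<epsilon> powr (b / (2 * r)) * \<epsilon> powr (b / (2 * r)) = \<epsilon> powr (b / r)" by (simp add: powr_add[symmetric] field_simps)
   moreover have "(sqrt K * \<epsilon> powr (b / (2 * r))) powr 2 = (sqrt K)^2 * (\<epsilon> powr (b / (2 * r)) * \<epsilon> powr (b / (2 * r)))"
    using K by (simp add: power_mult_distrib power2_eq_square)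
   moreover have "L = K * \<epsilon> powr (b / r)" by (simp add: L_def \<kappa>_def powr_powr)
   ultimately show ?thesis using K by simp
  qed
  ultimately show ?thesis using K by (intro Lq_norm_leI) simp_all
 qed
 show ?thesis
 proof (intro exI[of _ "sqrt K"] conjI ballI)
  show "0 < sqrt K" using K by simp
  show "(SUP t\<in>{0..T}. Lq_norm 2 UNIV (\<lambda>x. \<rho>e \<epsilon> t x - \<rho> t x)) \<le> ennreal (sqrt K * \<epsilon> powr (b / (2 * r)))"
   if "\<epsilon> \<in> {0<..<1}" for \<epsilon> by (rule SUP_least) (rule main[OF that])
 qed
qed

text \<open>All bounds are expressed through the data: the initial entropy vanishes because of the
  relation between velocity and density gradient, and the same relation makes the initial kinetic
  energy finite. The dimension enters through \<open>sobolev_L4\<close>.\<close>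

lemma family_flows:
 fixes \<rho>0 :: "real ^ 'n \<Rightarrow> real" and m0 u0 :: "real ^ 'n \<Rightarrow> real ^ 'n"
  and \<rho>e :: "real \<Rightarrow> real \<Rightarrow> real ^ 'n \<Rightarrow> real" and ue :: "real \<Rightarrow> real \<Rightarrow> real ^ 'n \<Rightarrow> real ^ 'n"
 assumes dim: "CARD('n) \<le> 3" and alpha: "3 / 2 \<le> \<alpha>" and gam: "2 * \<alpha> - 1 \<le> \<gamma>" and T: "0 < T"
  and m0: "AE x in lborel. m0 x = \<rho>0 x *\<^sub>R u0 x" and \<rho>0: "AE x in lborel. 0 \<le> \<rho>0 x"
  and L1: "in_Lq 1 UNIV \<rho>0" and L\<gamma>: "in_Lq \<gamma> UNIV \<rho>0" and W: "in_Lq 2 UNIV (wgrad (\<lambda>x. \<rho>0 x powr (\<alpha> - 1/2)))"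
  and u0: "AE x in lborel. \<rho>0 x > 0 \<longrightarrow> u0 x + (\<alpha> * \<rho>0 x powr (\<alpha> - 2)) *\<^sub>R dens_grad (\<alpha> - 1/2) \<rho>0 x = 0"
  and fam: "solution_family \<alpha> \<gamma> \<rho>0 m0 u0 \<rho>e ue"
 shows "\<exists>A\<ge>0. \<forall>\<epsilon>\<in>{0<..<1}. \<exists>R G S. flow T (\<alpha> - 1/2) A \<epsilon> \<rho>0 (\<rho>e \<epsilon>) R G S"
proof -
 obtain K where K': "0 < K \<and> (\<forall>\<epsilon>\<in>{0<..<1}. \<forall>T>0.
    weak_solution T \<alpha> \<gamma> \<epsilon> m0 (\<rho>e \<epsilon>) (ue \<epsilon>) \<and>
    C_Lq_loc T 1 (\<rho>e \<epsilon>) \<and> (AE x in lborel. \<rho>e \<epsilon> 0 x = \<rho>0 x) \<and>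
    (\<forall>t\<in>{0..T}. Lq_norm 1 UNIV (\<rho>e \<epsilon> t) = Lq_norm 1 UNIV \<rho>0) \<and>
    energy_bound K T \<alpha> \<gamma> \<epsilon> \<rho>0 m0 (\<rho>e \<epsilon>) (ue \<epsilon>) \<and>
    entropy_bound K T \<alpha> \<gamma> \<epsilon> \<rho>0 u0 (\<rho>e \<epsilon>) (ue \<epsilon>))"
  using conjunct1[OF fam[unfolded solution_family_def]] by (rule exE)
 have K: "0 < K" by (rule conjunct1[OF K'])
 have sol: "weak_solution T \<alpha> \<gamma> \<epsilon> m0 (\<rho>e \<epsilon>) (ue \<epsilon>) \<and>
    C_Lq_loc T 1 (\<rho>e \<epsilon>) \<and> (AE x in lborel. \<rho>e \<epsilon> 0 x = \<rho>0 x) \<and>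
    (\<forall>t\<in>{0..T}. Lq_norm 1 UNIV (\<rho>e \<epsilon> t) = Lq_norm 1 UNIV \<rho>0) \<and>
    energy_bound K T \<alpha> \<gamma> \<epsilon> \<rho>0 m0 (\<rho>e \<epsilon>) (ue \<epsilon>) \<and>
    entropy_bound K T \<alpha> \<gamma> \<epsilon> \<rho>0 u0 (\<rho>e \<epsilon>) (ue \<epsilon>)" if "\<epsilon> \<in> {0<..<1}" for \<epsilon>
  using bspec[OF conjunct2[OF K'] that, THEN spec, THEN mp, OF T] .
 have \<rho>0m: "\<rho>0 \<in> borel_measurable borel" using L1 by (simp add: in_Lq_def set_borel_measurable_def)
 obtain P1 where P1: "0 \<le> P1" "Lq_norm 1 UNIV \<rho>0 = ennreal P1"
  using L1 by (cases "Lq_norm 1 UNIV \<rho>0") (auto simp: in_Lq_def)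
 have "(NI x. ennreal (\<rho>0 x powr \<gamma>)) = (NI x. ennreal (norm (\<rho>0 x) powr \<gamma>))"
 proof (rule nn_integral_cong_AE)
  show "AE x in lborel. ennreal (\<rho>0 x powr \<gamma>) = ennreal (norm (\<rho>0 x) powr \<gamma>)" using \<rho>0 by eventually_elim simp
 qed
 also have "... < \<infinity>" using in_Lq_finite[OF L\<gamma>] by simp
 finally obtain P' where P': "0 \<le> P'" "(NI x. ennreal (\<rho>0 x powr \<gamma>)) = ennreal P'"
  by (cases "(NI x. ennreal (\<rho>0 x powr \<gamma>))") auto
 define c where "c = 1 + 1 / (2 * (\<alpha> - 1/2))"
 define W where "W = wgrad (\<lambda>x. \<rho>0 x powr (\<alpha> - 1/2))"
 have [measurable]: "W \<in> borel_measurable borel" using W by (simp add: in_Lq_def set_borel_measurable_def W_def)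
 have Wfin: "(NI x. ennreal ((norm (W x))^2)) < \<infinity>"
  using in_Lq_finite[OF W] by (simp add: W_def)
 \<comment> \<open>Where the density is positive, u0 is minus the density gradient term, so by
   \<open>wgrad_dens_identity\<close> with velocity 0 the energy density is a multiple of the
   squared gradient of \<rho>0^r.\<close>
 have "(NI x. ennreal ((norm (m0 x))^2 / \<rho>0 x)) \<le> (NI x. ennreal (c\<^sup>2) * ennreal ((norm (W x))^2))"
 proof (rule nn_integral_mono_AE)
  show "AE x in lborel. ennreal ((norm (m0 x))^2 / \<rho>0 x) \<le> ennreal (c\<^sup>2) * ennreal ((norm (W x))^2)"
   using m0 \<rho>0 u0
  proof eventually_elim
   case (elim x)
   show ?case
   proof (cases "\<rho>0 x = 0")
    case False
    then have pos: "0 < \<rho>0 x" using elim by simp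
    define y where "y = (\<alpha> * \<rho>0 x powr (\<alpha> - 2)) *\<^sub>R ((1 / (\<alpha> - 1/2) * \<rho>0 x powr (1 - (\<alpha> - 1/2))) *\<^sub>R W x)"
    have "u0 x + y = 0" using elim pos by (simp add: y_def dens_grad_def W_def)
    then have "u0 x = - y" by (simp add: eq_neg_iff_add_eq_0)
    then have "norm (u0 x) = norm y" by simp
    then have "(norm (m0 x))^2 / \<rho>0 x = \<rho>0 x * (norm (0 + y))^2"
     using pos elim by (simp add: power_mult_distrib power2_eq_square)
    also have "... = (norm (sqrt (\<rho>0 x) *\<^sub>R 0 + c *\<^sub>R W x))^2"
     unfolding y_def c_def by (rule wgrad_dens_identity[OF pos alpha])
    also have "... = c\<^sup>2 * (norm (W x))^2" by (simp add: power_mult_distrib)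
    finally show ?thesis by (simp add: ennreal_mult)
   qed simp
  qed
 qed
 also have "... = ennreal (c\<^sup>2) * (NI x. ennreal ((norm (W x))^2))" by (rule nn_integral_cmult) simp
 also have "... < \<infinity>" using Wfin by (simp add: ennreal_mult_less_top)
 finally obtain Q' where Q': "0 \<le> Q'" "(NI x. ennreal ((norm (m0 x))^2 / \<rho>0 x)) = ennreal Q'"
  by (cases "(NI x. ennreal ((norm (m0 x))^2 / \<rho>0 x))") auto
 have zero: "(NI x. ennreal (\<rho>0 x * (norm (u0 x + (\<alpha> * \<rho>0 x powr (\<alpha> - 2)) *\<^sub>R dens_grad (\<alpha> - 1/2) \<rho>0 x))^2)) = 0"
 proof -
  have "(NI x. ennreal (\<rho>0 x * (norm (u0 x + (\<alpha> * \<rho>0 x powr (\<alpha> - 2)) *\<^sub>R dens_grad (\<alpha> - 1/2) \<rho>0 x))^2)) = (NI (x :: real ^ 'n). 0)"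
  proof (rule nn_integral_cong_AE)
   show "AE x in lborel. ennreal (\<rho>0 x * (norm (u0 x + (\<alpha> * \<rho>0 x powr (\<alpha> - 2)) *\<^sub>R dens_grad (\<alpha> - 1/2) \<rho>0 x))^2) = 0"
    using \<rho>0 u0
   proof eventually_elim
    case (elim x)
    then show ?case by (cases "\<rho>0 x = 0") auto
   qed
  qed
  then show ?thesis by simp
 qed
 define P where "P = K * P'"
 define Q where "Q = K * (Q' + P')"
 have PQ: "0 \<le> P" "0 \<le> Q" using K P' Q' by (auto simp: P_def Q_def)
 have dim': "DIM(real ^ 'n) \<le> 3" using dim by simp
 obtain C4 where L4: "\<And>f (G :: real ^ 'n \<Rightarrow> real ^ 'n). sobolev f G (P1 + 3 * P + 2 * Q) \<Longrightarrow>
   integrable lborel (\<lambda>x. f x ^ 4) \<and> (LI x. f x ^ 4) \<le> C4"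
  using sobolev_L4[OF dim'] by blast
 \<comment> \<open>One constant has to serve for the Sobolev norms and for the fourth power of the
   same functions.\<close>
 define A where "A = max (P1 + 3 * P + 2 * Q) C4"
 have "\<exists>R G S. flow T (\<alpha> - 1/2) A \<epsilon> \<rho>0 (\<rho>e \<epsilon>) R G S" if eps: "\<epsilon> \<in> {0<..<1}" for \<epsilon>
 proof -
  have eps': "0 < \<epsilon>" "\<epsilon> < 1" using eps by auto
  note s = sol[OF eps]
  have "solution T \<alpha> \<gamma> \<epsilon> P1 P Q \<rho>0 m0 (\<rho>e \<epsilon>) (ue \<epsilon>)"
  proof
   show "weak_solution T \<alpha> \<gamma> \<epsilon> m0 (\<rho>e \<epsilon>) (ue \<epsilon>)" "C_Lq_loc T 1 (\<rho>e \<epsilon>)" "AE x in lborel. \<rho>e \<epsilon> 0 x = \<rho>0 x"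
    using s by blast+
   show "Lq_norm 1 UNIV (\<rho>e \<epsilon> t) \<le> ennreal P1" if "t \<in> {0..T}" for t using s that P1(2) by simp
   have eb: "energy_bound K T \<alpha> \<gamma> \<epsilon> \<rho>0 m0 (\<rho>e \<epsilon>) (ue \<epsilon>)" using s by blast
   obtain V where V: "is_velocity_grad T \<alpha> (\<rho>e \<epsilon>) (ue \<epsilon>) V \<and> (AE t\<in>{0<..<T} in lborel.
    (NI x. ennreal (\<rho>e \<epsilon> t x * (norm (ue \<epsilon> t x))^2 + \<epsilon> * \<rho>e \<epsilon> t x powr \<gamma>)) +
    (\<integral>\<^sup>+s\<in>{0<..<T}. (NI x. ennreal (\<rho>e \<epsilon> s x powr \<alpha> * (norm (V s x))^2
       + (\<alpha> - 1) * \<rho>e \<epsilon> s x powr \<alpha> * (trace (V s x))^2)) \<partial>lborel)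
    \<le> ennreal K * (ennreal Q' + ennreal \<epsilon> * ennreal P'))"
    using eb[unfolded energy_bound_def P'(2) Q'(2)] by (rule exE)
   have Qle: "ennreal K * (ennreal Q' + ennreal \<epsilon> * ennreal P') \<le> ennreal Q"
   proof -
    have "0 \<le> K" "0 \<le> \<epsilon>" "0 \<le> \<epsilon> * P'" "0 \<le> Q' + \<epsilon> * P'" using K P'(1) Q'(1) eps' by auto
    then have "ennreal K * (ennreal Q' + ennreal \<epsilon> * ennreal P') = ennreal (K * (Q' + \<epsilon> * P'))"
     using P'(1) Q'(1) by (simp only: ennreal_mult ennreal_plus)
    also have "... \<le> ennreal Q"
    proof (rule ennreal_leI)
     have "\<epsilon> * P' \<le> P'" using mult_right_mono[of \<epsilon> 1 P'] P' eps' by simp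
     then show "K * (Q' + \<epsilon> * P') \<le> Q" unfolding Q_def using K by (intro mult_left_mono) auto
    qed
    finally show ?thesis .
   qed
   show "AE t\<in>{0<..<T} in lborel. (NI x. ennreal (\<rho>e \<epsilon> t x * (norm (ue \<epsilon> t x))^2)) \<le> ennreal Q"
    using conjunct2[OF V]
   proof eventually_elim
    case (elim t)
    show ?case
    proof
     assume t: "t \<in> {0<..<T}"
     have "(NI x. ennreal (\<rho>e \<epsilon> t x * (norm (ue \<epsilon> t x))^2)) \<le> (NI x. ennreal (\<rho>e \<epsilon> t x * (norm (ue \<epsilon> t x))^2 + \<epsilon> * \<rho>e \<epsilon> t x powr \<gamma>))"
      using eps' by (intro nn_integral_mono ennreal_leI) simp
     also have "... \<le> ennreal K * (ennreal Q' + ennreal \<epsilon> * ennreal P')"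
      using order_trans[OF add_increasing2[OF zero_le order_refl] elim[THEN mp, OF t]] .
     also note Qle
     finally show "(NI x. ennreal (\<rho>e \<epsilon> t x * (norm (ue \<epsilon> t x))^2)) \<le> ennreal Q" .
    qed
   qed
   have Ple: "ennreal K * (0 + ennreal \<epsilon> * ennreal P') = ennreal (P * \<epsilon>)"
   proof -
    have "0 \<le> K" "0 \<le> \<epsilon>" "0 \<le> \<epsilon> * P'" "P * \<epsilon> = K * (\<epsilon> * P')" using K P'(1) eps' by (auto simp: P_def)
    then show ?thesis using P'(1) by (simp only: ennreal_mult add_0)
   qed
   have ent: "AE t\<in>{0<..<T} in lborel.
    (NI x. ennreal (\<rho>e \<epsilon> t x * (norm (ue \<epsilon> t x + (\<alpha> * \<rho>e \<epsilon> t x powr (\<alpha> - 2)) *\<^sub>R dens_xgrad T (\<alpha> - 1/2) (\<rho>e \<epsilon>) t x))^2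
       + \<epsilon> * \<rho>e \<epsilon> t x powr \<gamma>)) +
    ennreal (\<alpha> * \<gamma> * \<epsilon>) * (\<integral>\<^sup>+s\<in>{0<..<T}. (NI x. ennreal (\<rho>e \<epsilon> s x powr (\<alpha> + \<gamma> - 3)
       * (norm (dens_xgrad T (\<alpha> - 1/2) (\<rho>e \<epsilon>) s x))^2)) \<partial>lborel) \<le> ennreal (P * \<epsilon>)"
    using s unfolding entropy_bound_def zero P'(2) Ple by blast
   show "AE t\<in>{0<..<T} in lborel.
    (NI x. ennreal (\<rho>e \<epsilon> t x * (norm (ue \<epsilon> t x + (\<alpha> * \<rho>e \<epsilon> t x powr (\<alpha> - 2)) *\<^sub>R dens_xgrad T (\<alpha> - 1/2) (\<rho>e \<epsilon>) t x))^2
       + \<epsilon> * \<rho>e \<epsilon> t x powr \<gamma>)) \<le> ennreal (P * \<epsilon>)"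
    using ent
   proof eventually_elim
    case (elim t)
    show ?case using order_trans[OF add_increasing2[OF zero_le order_refl]] elim by blast
   qed
  qed (fact T eps' alpha gam P1(1) PQ \<rho>0m)+
  moreover have "P1 + 3 * P + 2 * Q \<le> A" by (simp add: A_def)
  moreover have "integrable lborel (\<lambda>x. f x ^ 4) \<and> (LI x. f x ^ 4) \<le> A"
   if "sobolev f G (P1 + 3 * P + 2 * Q)" for f and G :: "real ^ 'n \<Rightarrow> real ^ 'n"
   using L4[OF that] by (auto simp: A_def le_max_iff_disj)
  ultimately show ?thesis using solution.flow by blast
 qed
 moreover have "0 \<le> A" using P1 PQ by (simp add: A_def max_def)
 ultimately show ?thesis by blast
qed

theorem theorem1p2:
  fixes \<rho>0 :: "real ^ 'n \<Rightarrow> real" and m0 u0 :: "real ^ 'n \<Rightarrow> real ^ 'n"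
    and \<rho>e :: "real \<Rightarrow> real \<Rightarrow> real ^ 'n \<Rightarrow> real" and ue :: "real \<Rightarrow> real \<Rightarrow> real ^ 'n \<Rightarrow> real ^ 'n"
    and \<rho> :: "real \<Rightarrow> real ^ 'n \<Rightarrow> real" and u :: "real \<Rightarrow> real ^ 'n \<Rightarrow> real ^ 'n"
    and \<alpha> \<gamma> T :: real
  assumes "CARD('n) = 2 \<or> CARD('n) = 3" and "\<alpha> \<ge> 3/2" and "\<gamma> > 1"
    and "AE x in lborel. m0 x = \<rho>0 x *\<^sub>R u0 x"
    and "AE x in lborel. 0 \<le> \<rho>0 x"
    and "in_Lq 1 UNIV \<rho>0" and "in_Lq \<gamma> UNIV \<rho>0"
    and "Ex (is_wgrad (\<lambda>x. \<rho>0 x powr (\<alpha> - 1/2)))"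
    and "in_Lq 2 UNIV (wgrad (\<lambda>x. \<rho>0 x powr (\<alpha> - 1/2)))"
    and "in_Lq (2 * \<gamma> / (\<gamma> + 1)) UNIV m0"
    and "\<not> (AE x in lborel. \<rho>0 x = 0)"
    and "AE x in lborel. \<rho>0 x = 0 \<longrightarrow> m0 x = 0"
    and "\<exists>\<eta>0>0. in_Lq 1 UNIV (\<lambda>x. \<rho>0 x powr (- (1 + \<eta>0)) * norm (m0 x) powr (2 + \<eta>0))"
    and "CARD('n) = 2 \<Longrightarrow> \<gamma> > 1 \<and> \<gamma> \<ge> 2 * \<alpha> - 1"
    and "CARD('n) = 3 \<Longrightarrow> \<gamma> \<in> {1<..<3} \<and> \<alpha> \<in> {1<..<2} \<and> \<gamma> \<in> {2 * \<alpha> - 1..3 * \<alpha> - 1} \<and>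
           in_Lq 1 UNIV (\<lambda>x. \<rho>0 x powr (-3) * norm (m0 x) ^ 4)"
    and "AE x in lborel. \<rho>0 x > 0 \<longrightarrow>
           u0 x + (\<alpha> * \<rho>0 x powr (\<alpha> - 2)) *\<^sub>R dens_grad (\<alpha> - 1/2) \<rho>0 x = 0"
    and "T > 0"
    and "solution_family \<alpha> \<gamma> \<rho>0 m0 u0 \<rho>e ue"
    and "quasi_solution_limit T \<alpha> m0 \<rho>e ue \<rho> u"
  shows "(CARD('n) = 2 \<longrightarrow> (\<forall>\<sigma> < 1 / (2 * (2 * \<alpha> - 1)). \<exists>C>0. \<forall>\<epsilon>\<in>{0<..<1}.
            (SUP t\<in>{0..T}. Lq_norm 2 UNIV (\<lambda>x. \<rho>e \<epsilon> t x - \<rho> t x)) \<le> ennreal (C * \<epsilon> powr \<sigma>))) \<and>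
         (CARD('n) = 3 \<longrightarrow> (\<exists>C>0. \<forall>\<epsilon>\<in>{0<..<1}.
            (SUP t\<in>{0..T}. Lq_norm 2 UNIV (\<lambda>x. \<rho>e \<epsilon> t x - \<rho> t x))
              \<le> ennreal (C * \<epsilon> powr ((4 * \<alpha> - 3) / (4 * (2 * \<alpha> - 1)\<^sup>2)))))"
proof -
 define r where "r = \<alpha> - 1/2"
 have r: "1 \<le> r" using assms(2) by (simp add: r_def)
 have card: "CARD('n) \<le> 3" using assms(1) by auto
 have gam: "2 * \<alpha> - 1 \<le> \<gamma>" using assms(1,14,15) by auto
 obtain A where A: "0 \<le> A" and flows: "\<And>\<epsilon>. \<epsilon> \<in> {0<..<1} \<Longrightarrow> \<exists>R G S. flow T r A \<epsilon> \<rho>0 (\<rho>e \<epsilon>) R G S"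
  using family_flows[OF card assms(2) gam assms(17,4,5,6,7,9,16,18)] unfolding r_def by blast
 have C: "C_Lq_loc T 1 (\<rho>e \<epsilon>)" if "\<epsilon> \<in> {0<..<1}" for \<epsilon>
  using assms(17,18) that unfolding solution_family_def by blast
 obtain e where e: "\<And>k::nat. e k \<in> {0<..<1}" "e \<longlonglongrightarrow> 0" and conv_q: "\<And>q. q \<ge> 1 \<Longrightarrow> (CARD('n) = 3 \<longrightarrow> q < 6 * \<alpha> - 3) \<Longrightarrow>
      conv_C_Lq_loc T q (\<lambda>k. \<rho>e (e k)) \<rho>"
  using assms(19) unfolding quasi_solution_limit_def by blast
 have conv: "conv_C_Lq_loc T 1 (\<lambda>k. \<rho>e (e k)) \<rho>" by (rule conv_q) (use assms(2) in auto)
 show ?thesis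
 proof (intro conjI impI allI)
  assume two: "CARD('n) = 2"
  fix \<sigma> :: real assume \<sigma>: "\<sigma> < 1 / (2 * (2 * \<alpha> - 1))"
  have \<sigma>': "\<sigma> < 1 / (4 * r)" using \<sigma> by (simp add: r_def algebra_simps)
  \<comment> \<open>A positive s lowers the rate 1/(4r) by s/(4 r^2); it is chosen so small that
    this loss fits into the gap to \<sigma>. The cap 1 keeps s/r in the unit interval.\<close>
  define s where "s = min 1 (4 * r\<^sup>2 * (1 / (4 * r) - \<sigma>))"
  define b where "b = (1 - s / r) / 2"
  have s: "0 < s" "s \<le> 1" "s \<le> 4 * r\<^sup>2 * (1 / (4 * r) - \<sigma>)" using r \<sigma>' by (auto simp: s_def)
  have sr: "0 \<le> s / r" "s / r \<le> 1" using s r by (auto simp: field_simps)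
  obtain C where C0: "C > 0" and Cb: "\<And>\<epsilon>. \<epsilon> \<in> {0<..<1} \<Longrightarrow> (SUP t\<in>{0..T}. Lq_norm 2 UNIV (\<lambda>x. \<rho>e \<epsilon> t x - \<rho> t x)) \<le> ennreal (C * \<epsilon> powr (b / (2 * r)))"
  proof -
   have "\<exists>C>0. \<forall>\<epsilon>\<in>{0<..<1}. (SUP t\<in>{0..T}. Lq_norm 2 UNIV (\<lambda>x. \<rho>e \<epsilon> t x - \<rho> t x)) \<le> ennreal (C * \<epsilon> powr (b / (2 * r)))"
   \<comment> \<open>With p = 0 the exponent in the Young inequality is 3, which lies between 1 and
     4r. The scale is h = \<epsilon>, and in two dimensions n/2 - 1 = 0 < s.\<close>
   proof (rule convergence_rate[where p = 0 and a = 1, OF _ s(1) r assms(17) A _ _ _ _ _ _ _ _ _ flows C e conv])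
    show "b \<le> 1" "2 * b \<le> 1 - 1 * (s / r)" "2 * b \<le> 1 * (1 + 0)" using sr by (simp_all add: b_def add_divide_distrib diff_divide_distrib)
    show "real DIM(real ^ 'n) / 2 - 1 \<le> s" using two s(1) by simp
   qed (use r in auto)
   then show ?thesis using that by blast
  qed
  have \<sigma>b: "\<sigma> \<le> b / (2 * r)"
  proof -
   have "s / (4 * r\<^sup>2) \<le> 1 / (4 * r) - \<sigma>" using s(3) r by (subst pos_divide_le_eq) (simp_all add: mult.commute)
   moreover have "b / (2 * r) = 1 / (4 * r) - s / (4 * r\<^sup>2)" using r by (simp add: b_def field_simps power2_eq_square)
   ultimately show ?thesis by linarith
  qed
  show "\<exists>C>0. \<forall>\<epsilon>\<in>{0<..<1}. (SUP t\<in>{0..T}. Lq_norm 2 UNIV (\<lambda>x. \<rho>e \<epsilon> t x - \<rho> t x)) \<le> ennreal (C * \<epsilon> powr \<sigma>)"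
  proof (intro exI[of _ C] conjI ballI)
   fix \<epsilon> :: real assume \<epsilon>: "\<epsilon> \<in> {0<..<1}"
   have "C * \<epsilon> powr (b / (2 * r)) \<le> C * \<epsilon> powr \<sigma>"
    using C0 \<epsilon> powr_mono'[OF \<sigma>b, of \<epsilon>] by simp
   then show "(SUP t\<in>{0..T}. Lq_norm 2 UNIV (\<lambda>x. \<rho>e \<epsilon> t x - \<rho> t x)) \<le> ennreal (C * \<epsilon> powr \<sigma>)"
    using Cb[OF \<epsilon>] ennreal_leI order_trans by blast
  qed (rule C0)
 next
  assume three: "CARD('n) = 3"
  then have r2: "r < 3 / 2" using assms(15) by (simp add: r_def)
  \<comment> \<open>With a = s = 1/2 this p equates both constraints on 2 b, namely to 1 - 1/(4r).
    As \<alpha> < 2 means r < 3/2, the product p r = r - 1/2 stays below 1.\<close>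
  define p where "p = 1 - 1 / (2 * r)"
  define b where "b = (1 - 1 / (4 * r)) / 2"
  have p: "0 \<le> p" "p < 1" "p * r \<le> 1" using r r2 by (auto simp: p_def field_simps)
  have pe: "(3 - 2 * p * r) / (1 - p) = 4 * r * (2 - r)" using r by (simp add: p_def field_simps)
  \<comment> \<open>The exponent 4r (2 - r) stays in the range of \<open>pot_ge\<close>: the bound r
    < 3/2 keeps it above 1, and r \<ge> 1 keeps it at most 4r.\<close>
  have pe1: "1 \<le> 4 * r * (2 - r)"
   using mult_mono[of 1 r "1 / 2" "2 - r"] r r2 by simp
  have pe2: "4 * r * (2 - r) \<le> 4 * r" using r by (intro mult_left_le) auto
  have "\<exists>C>0. \<forall>\<epsilon>\<in>{0<..<1}. (SUP t\<in>{0..T}. Lq_norm 2 UNIV (\<lambda>x. \<rho>e \<epsilon> t x - \<rho> t x)) \<le> ennreal (C * \<epsilon> powr (b / (2 * r)))"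
  proof (rule convergence_rate[where s = "1/2" and a = "1/2", OF _ _ r assms(17) A p _ _ _ _ _ _ flows C e conv])
   show "1 \<le> (3 - 2 * p * r) / (1 - p)" "(3 - 2 * p * r) / (1 - p) \<le> 4 * r" unfolding pe by (rule pe1 pe2)+
   show "b \<le> 1 / 2" "2 * b \<le> 1 - 1 / 2 * (1 / 2 / r)" "2 * b \<le> 1 / 2 * (1 + p)"
    using r by (simp_all add: b_def p_def field_simps)
  qed (use three in auto)
  moreover have "b / (2 * r) = (4 * \<alpha> - 3) / (4 * (2 * \<alpha> - 1)^2)"
  proof -
   have "4 * \<alpha> - 3 = 4 * r - 1" "2 * \<alpha> - 1 = 2 * r" by (simp_all add: r_def)
   then show ?thesis using r by (simp add: b_def field_simps power2_eq_square)
  qed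
  ultimately show "\<exists>C>0. \<forall>\<epsilon>\<in>{0<..<1}. (SUP t\<in>{0..T}. Lq_norm 2 UNIV (\<lambda>x. \<rho>e \<epsilon> t x - \<rho> t x))
       \<le> ennreal (C * \<epsilon> powr ((4 * \<alpha> - 3) / (4 * (2 * \<alpha> - 1)^2)))" by simp
 qed
qed

end
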